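(* Let $(G,X)$ be a second-countable transformation group with $G$ abelian. Let $k$ be a positive integer and $z\in X$. Let $(x_n)_n$ be a sequence in $X$ such that $S_{x_n}\to S_z$ in $\Sigma$. Suppose that there exist a compact, symmetric neighbourhood $W$ of the identity in $G$ and $k$ sequences $(t_n^{(1)})_n,(t_n^{(2)})_n,\dots,(t_n^{(k)})_n$ in $G$ such that (1) $t_n^{(j)}\cdot x_n\to z$ as $n\to\infty$ for $1\leq j\leq k$; (2) there exists $N$ such that $n\geq N$ implies $Wt_n^{(j)}S_{x_n}\cap Wt_n^{(i)}S_{x_n}=\emptyset$ for $1\leq i<j\leq k$; (3) $\mu\big(WS_z\setminus(\operatorname{Int}W)S_z\big)=0$. Let $\tau_n,\tau\in\hat G$. If $\operatorname{Ind}(x_n,\tau_n)\to\operatorname{Ind}(z,\tau)$ as $n\to\infty$ then $M_L(\operatorname{Ind}(z,\tau),(\operatorname{Ind}(x_n,\tau_n)))\geq k$.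
   Context: Transformation group: a second-countable transformation group $(G,X)$ is a second-countable locally compact Hausdorff group $G$ with a (jointly) continuous action $(s,x)\mapsto s\cdot x$ on a second-countable locally compact Hausdorff space $X$. For $x\in X$, $S_x=\{s\in G: s\cdot x=x\}$ and $\dot s=sS_x$. $\operatorname{Int}W$ is the interior of $W$. Fell topology: $\Sigma$ is the set of closed subgroups of $G$ with the topology having as a basis the sets $U(C,F)=\{H\in\Sigma: C\cap H=\emptyset,\ H\cap A\neq\emptyset \text{ for each } A\in F\}$, $C\subset G$ compact and $F$ a finite family of non-empty open subsets of $G$. Measures: $\mu$ is a fixed Haar measure on $G$. Fix $f_0\in C_c(G)$ with $f_0(e)=1$, $0\leq f_0\leq 1$; for $H\in\Sigma$, $\alpha_H$ is the Haar measure on $H$ with $\int_H f_0\,d\alpha_H=1$. $\nu_H$ is the unique Haar measure on $G/H$ with $\int_G f(s)\,d\mu(s)=\int_{G/H}\int_H f(st)\,d\alpha_H(t)\,d\nu_H(\dot s)$ for all $f\in C_c(G)$. Write $\nu_x=\nu_{S_x}$. Induced representations: $\hat G$ is the character group of $G$. $C_0(X)\rtimes G$ is the crossed product for the action $(s\cdot f)(x)=f(s^{-1}\cdot x)$. For $x\in X$, $\tau\in\hat G$, $\operatorname{Ind}(x,\tau)=M_x\rtimes V_\tau$ is the irreducible representation of $C_0(X)\rtimes G$ on $L^2(G/S_x,\nu_x)$ that is the integrated form of the covariant pair $(M_x(f)\xi)(\dot s)=f(s\cdot x)\xi(\dot s)$, $(V_\tau(t)\xi)(\dot s)=\tau(t)\xi(t^{-1}\cdot\dot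 s)$; the same symbol denotes its class in the spectrum of $C_0(X)\rtimes G$, and convergence of such representations is in the spectrum. Relative lower multiplicity: let $A$ be a $C^*$-algebra, $\pi\in\hat A$, and $\varphi$ a pure state of $A$ associated with $\pi$. Let $\mathcal N$ be the base of weak$^*$-neighbourhoods of $0$ in $A^*$ consisting of the sets $N=\{\psi\in A^*:|\psi(a_i)|<\epsilon,\ 1\leq i\leq m\}$ ($\epsilon>0$, $a_1,\dots,a_m\in A$). For $\sigma\in\hat A$ and $N\in\mathcal N$ let $d(\sigma,\varphi,N)\in\{0,1,2,\dots,\infty\}$ be the supremum of the cardinalities of finite orthonormal subsets of $\{\eta\in H_\sigma:\|\eta\|=1,\ \langle\sigma(\cdot)\eta,\eta\rangle\in\varphi+N\}$ (it is $0$ if this set is empty). For a net $\Omega=(\pi_\lambda)$ in $\hat A$, $M_L(\pi,\Omega)=\inf_{N\in\mathcal N}\liminf_\lambda d(\pi_\lambda,\varphi,N)$; this does not depend on the choice of $\varphi$. *)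

theory Defs
  imports "HOL-Analysis.Analysis"
begin

text \<open>
  The abelian group is written additively: it is a type of class
  \<^class>\<open>topological_ab_group_add\<close>, so that the product of two subsets reads
  \<open>A + B\<close> and the coset of \<open>s\<close> modulo \<open>H\<close> reads \<open>s +o H\<close>.
\<close>

section \<open>Transformation groups, cosets and the Fell topology\<close>

definition continuous_action ::
    "('g::topological_ab_group_add \<Rightarrow> 'x::topological_space \<Rightarrow> 'x) \<Rightarrow> bool" where
  "continuous_action act \<longleftrightarrow>
     (\<forall>x. act 0 x = x) \<and> (\<forall>s t x. act (s + t) x = act s (act t x)) \<and>
     continuous_on UNIV (\<lambda>(s, x). act s x)"

definition stabilizer :: "('g \<Rightarrow> 'x \<Rightarrow> 'x) \<Rightarrow> 'x \<Rightarrow> 'g set" where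
  "stabilizer act x = {s. act s x = x}"

definition closed_subgroups :: "'g::topological_ab_group_add set set" where
  "closed_subgroups =
     {H. closed H \<and> 0 \<in> H \<and> (\<forall>s\<in>H. \<forall>t\<in>H. s + t \<in> H) \<and> (\<forall>s\<in>H. - s \<in> H)}"

definition fell_topology :: "'g::topological_ab_group_add set topology" where
  "fell_topology = topology_generated_by
     {{H \<in> closed_subgroups. C \<inter> H = {} \<and> (\<forall>A\<in>F. H \<inter> A \<noteq> {})} | C F.
        compact C \<and> finite F \<and> (\<forall>A\<in>F. open A \<and> A \<noteq> {})}"

definition cosets :: "'g::topological_ab_group_add set \<Rightarrow> 'g set set" where
  "cosets H = range (\<lambda>s. s +o H)"

definition coset_topology :: "'g::topological_ab_group_add set \<Rightarrow> 'g set topology" where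
  "coset_topology H = topology (\<lambda>U. U \<subseteq> cosets H \<and> open {s. s +o H \<in> U})"

lemma openin_coset_topology:
  "openin (coset_topology H) U \<longleftrightarrow> U \<subseteq> cosets H \<and> open {s. s +o H \<in> U}"
proof -
  let ?P = "\<lambda>U. U \<subseteq> cosets H \<and> open {s. s +o H \<in> U}"
  have eqs: "{s. s +o H \<in> S \<inter> T} = {s. s +o H \<in> S} \<inter> {s. s +o H \<in> T}"
    "{s. s +o H \<in> \<Union>K} = (\<Union>U\<in>K. {s. s +o H \<in> U})" for S T K
    by auto
  have "istopology ?P"
    unfolding istopology_def eqs by (auto intro!: open_Int open_UN)
  then show ?thesis
    by (simp add: coset_topology_def topology_inverse')
qed

section \<open>Haar measures\<close>

text \<open>
  \<open>m\<close> is a nonzero Borel measure for the topology \<open>T\<close>, finite on compact sets and invariant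
  under the maps \<open>L s\<close>, \<open>s \<in> S\<close>.  All spaces considered are second-countable, locally compact
  and Hausdorff, so that such measures are automatically regular.
\<close>

definition haar_measure ::
    "'a topology \<Rightarrow> ('s \<Rightarrow> 'a \<Rightarrow> 'a) \<Rightarrow> 's set \<Rightarrow> 'a measure \<Rightarrow> bool" where
  "haar_measure T L S m \<longleftrightarrow>
     space m = topspace T \<and> sets m = sigma_sets (topspace T) {U. openin T U} \<and>
     emeasure m (topspace T) \<noteq> 0 \<and>
     (\<forall>K. compactin T K \<longrightarrow> emeasure m K < \<infinity>) \<and>
     (\<forall>s\<in>S. \<forall>A\<in>sets m. emeasure m (L s ` A) = emeasure m A)"

definition Cc :: "('a::topological_space \<Rightarrow> 'b::real_normed_vector) set" where
  "Cc = {f. continuous_on UNIV f \<and> compact (closure {x. f x \<noteq> 0})}"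

text \<open>
  Weil's formula.  The inner integral depends only on the coset \<open>c\<close> and not on its
  chosen representative, since \<open>\<alpha>\<close> is invariant.
\<close>

definition weil_formula ::
    "'g::topological_ab_group_add measure \<Rightarrow> 'g measure \<Rightarrow> 'g set measure \<Rightarrow> bool" where
  "weil_formula \<mu> \<alpha> \<nu> \<longleftrightarrow>
     (\<forall>f::'g \<Rightarrow> complex. f \<in> Cc \<longrightarrow>
        (LINT s|\<mu>. f s) = (LINT c|\<nu>. LINT t|\<alpha>. f ((SOME s. s \<in> c) + t)))"

section \<open>Hilbert spaces with explicit carrier\<close>

record 'h hilbert =
  vectors :: "'h set"
  vadd :: "'h \<Rightarrow> 'h \<Rightarrow> 'h"
  vscale :: "complex \<Rightarrow> 'h \<Rightarrow> 'h"
  vzero :: 'h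
  vinner :: "'h \<Rightarrow> 'h \<Rightarrow> complex"

definition vnorm :: "'h hilbert \<Rightarrow> 'h \<Rightarrow> real" where
  "vnorm H \<xi> = sqrt (Re (vinner H \<xi> \<xi>))"

definition vdiff :: "'h hilbert \<Rightarrow> 'h \<Rightarrow> 'h \<Rightarrow> 'h" where
  "vdiff H \<xi> \<eta> = vadd H \<xi> (vscale H (- 1) \<eta>)"

locale hilbert_space =
  fixes H :: "'h hilbert"
  assumes zero_closed: "vzero H \<in> vectors H"
    and add_closed: "\<And>\<xi> \<eta>. \<xi> \<in> vectors H \<Longrightarrow> \<eta> \<in> vectors H \<Longrightarrow> vadd H \<xi> \<eta> \<in> vectors H"
    and scale_closed: "\<And>c \<xi>. \<xi> \<in> vectors H \<Longrightarrow> vscale H c \<xi> \<in> vectors H"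
    and add_assoc: "\<And>\<xi> \<eta> \<zeta>. \<xi> \<in> vectors H \<Longrightarrow> \<eta> \<in> vectors H \<Longrightarrow> \<zeta> \<in> vectors H \<Longrightarrow>
          vadd H (vadd H \<xi> \<eta>) \<zeta> = vadd H \<xi> (vadd H \<eta> \<zeta>)"
    and add_commute: "\<And>\<xi> \<eta>. \<xi> \<in> vectors H \<Longrightarrow> \<eta> \<in> vectors H \<Longrightarrow> vadd H \<xi> \<eta> = vadd H \<eta> \<xi>"
    and add_zero: "\<And>\<xi>. \<xi> \<in> vectors H \<Longrightarrow> vadd H \<xi> (vzero H) = \<xi>"
    and scale_zero: "\<And>\<xi>. \<xi> \<in> vectors H \<Longrightarrow> vscale H 0 \<xi> = vzero H"
    and scale_one: "\<And>\<xi>. \<xi> \<in> vectors H \<Longrightarrow> vscale H 1 \<xi> = \<xi>"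
    and scale_scale: "\<And>c d \<xi>. \<xi> \<in> vectors H \<Longrightarrow> vscale H c (vscale H d \<xi>) = vscale H (c * d) \<xi>"
    and scale_add_left: "\<And>c d \<xi>. \<xi> \<in> vectors H \<Longrightarrow>
          vscale H (c + d) \<xi> = vadd H (vscale H c \<xi>) (vscale H d \<xi>)"
    and scale_add_right: "\<And>c \<xi> \<eta>. \<xi> \<in> vectors H \<Longrightarrow> \<eta> \<in> vectors H \<Longrightarrow>
          vscale H c (vadd H \<xi> \<eta>) = vadd H (vscale H c \<xi>) (vscale H c \<eta>)"
    and inner_add: "\<And>\<xi> \<eta> \<zeta>. \<xi> \<in> vectors H \<Longrightarrow> \<eta> \<in> vectors H \<Longrightarrow> \<zeta> \<in> vectors H \<Longrightarrow>
          vinner H (vadd H \<xi> \<eta>) \<zeta> = vinner H \<xi> \<zeta> + vinner H \<eta> \<zeta>"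
    and inner_scale: "\<And>c \<xi> \<eta>. \<xi> \<in> vectors H \<Longrightarrow> \<eta> \<in> vectors H \<Longrightarrow>
          vinner H (vscale H c \<xi>) \<eta> = c * vinner H \<xi> \<eta>"
    and inner_cnj: "\<And>\<xi> \<eta>. \<xi> \<in> vectors H \<Longrightarrow> \<eta> \<in> vectors H \<Longrightarrow>
          vinner H \<eta> \<xi> = cnj (vinner H \<xi> \<eta>)"
    and inner_nonneg: "\<And>\<xi>. \<xi> \<in> vectors H \<Longrightarrow> 0 \<le> Re (vinner H \<xi> \<xi>)"
    and inner_definite: "\<And>\<xi>. \<xi> \<in> vectors H \<Longrightarrow> vinner H \<xi> \<xi> = 0 \<Longrightarrow> \<xi> = vzero H"
    and complete: "\<And>u::nat \<Rightarrow> 'h. range u \<subseteq> vectors H \<Longrightarrow>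
          (\<forall>\<epsilon>>0. \<exists>N. \<forall>m\<ge>N. \<forall>n\<ge>N. vnorm H (vdiff H (u m) (u n)) < \<epsilon>) \<Longrightarrow>
          \<exists>\<xi>\<in>vectors H. (\<lambda>n. vnorm H (vdiff H (u n) \<xi>)) \<longlonglongrightarrow> 0"

definition closed_subspace :: "'h hilbert \<Rightarrow> 'h set \<Rightarrow> bool" where
  "closed_subspace H V \<longleftrightarrow>
     V \<subseteq> vectors H \<and> vzero H \<in> V \<and> (\<forall>\<xi>\<in>V. \<forall>\<eta>\<in>V. vadd H \<xi> \<eta> \<in> V) \<and> (\<forall>c. \<forall>\<xi>\<in>V. vscale H c \<xi> \<in> V) \<and>
     (\<forall>\<xi>\<in>vectors H. (\<forall>\<epsilon>>0. \<exists>\<eta>\<in>V. vnorm H (vdiff H \<xi> \<eta>) < \<epsilon>) \<longrightarrow> \<xi> \<in> V)"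

definition linear_map :: "'h hilbert \<Rightarrow> 'k hilbert \<Rightarrow> ('h \<Rightarrow> 'k) \<Rightarrow> bool" where
  "linear_map H K T \<longleftrightarrow>
     T \<in> vectors H \<rightarrow> vectors K \<and>
     (\<forall>\<xi>\<in>vectors H. \<forall>\<eta>\<in>vectors H. T (vadd H \<xi> \<eta>) = vadd K (T \<xi>) (T \<eta>)) \<and>
     (\<forall>c. \<forall>\<xi>\<in>vectors H. T (vscale H c \<xi>) = vscale K c (T \<xi>))"

definition bounded_operator :: "'h hilbert \<Rightarrow> ('h \<Rightarrow> 'h) \<Rightarrow> bool" where
  "bounded_operator H T \<longleftrightarrow>
     linear_map H H T \<and> (\<exists>c. \<forall>\<xi>\<in>vectors H. vnorm H (T \<xi>) \<le> c * vnorm H \<xi>)"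

definition unitary_map :: "'h hilbert \<Rightarrow> 'k hilbert \<Rightarrow> ('h \<Rightarrow> 'k) \<Rightarrow> bool" where
  "unitary_map H K T \<longleftrightarrow>
     linear_map H K T \<and> bij_betw T (vectors H) (vectors K) \<and>
     (\<forall>\<xi>\<in>vectors H. \<forall>\<eta>\<in>vectors H. vinner K (T \<xi>) (T \<eta>) = vinner H \<xi> \<eta>)"

definition op_norm :: "'h hilbert \<Rightarrow> ('h \<Rightarrow> 'h) \<Rightarrow> real" where
  "op_norm H T = (SUP \<xi>\<in>{\<xi>\<in>vectors H. vnorm H \<xi> \<le> 1}. vnorm H (T \<xi>))"

definition adjoint_op :: "'h hilbert \<Rightarrow> ('h \<Rightarrow> 'h) \<Rightarrow> 'h \<Rightarrow> 'h" where
  "adjoint_op H T = (\<lambda>\<eta>\<in>vectors H.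
     THE \<zeta>. \<zeta> \<in> vectors H \<and> (\<forall>\<xi>\<in>vectors H. vinner H (T \<xi>) \<eta> = vinner H \<xi> \<zeta>))"

subsection \<open>The space of square-integrable functions\<close>

definition square_integrable :: "'a measure \<Rightarrow> ('a \<Rightarrow> complex) set" where
  "square_integrable M = {f \<in> borel_measurable M. integrable M (\<lambda>x. (cmod (f x))\<^sup>2)}"

definition l2_class :: "'a measure \<Rightarrow> ('a \<Rightarrow> complex) \<Rightarrow> ('a \<Rightarrow> complex) set" where
  "l2_class M f = {g \<in> square_integrable M. AE x in M. g x = f x}"

definition l2_rep :: "('a \<Rightarrow> complex) set \<Rightarrow> 'a \<Rightarrow> complex" where
  "l2_rep C = (SOME f. f \<in> C)"

definition L2 :: "'a measure \<Rightarrow> ('a \<Rightarrow> complex) set hilbert" where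
  "L2 M =
     \<lparr>vectors = l2_class M ` square_integrable M,
      vadd = (\<lambda>C D. l2_class M (\<lambda>x. l2_rep C x + l2_rep D x)),
      vscale = (\<lambda>c C. l2_class M (\<lambda>x. c * l2_rep C x)),
      vzero = l2_class M (\<lambda>_. 0),
      vinner = (\<lambda>C D. LINT x|M. l2_rep C x * cnj (l2_rep D x))\<rparr>"

section \<open>Spectrum and relative lower multiplicity for C*-algebras with explicit carrier\<close>

record 'a cstar =
  elems :: "'a set"
  cadd :: "'a \<Rightarrow> 'a \<Rightarrow> 'a"
  cscale :: "complex \<Rightarrow> 'a \<Rightarrow> 'a"
  cmult :: "'a \<Rightarrow> 'a \<Rightarrow> 'a"
  cadj :: "'a \<Rightarrow> 'a"
  cnorm :: "'a \<Rightarrow> real"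

type_synonym ('a, 'h) rep = "'h hilbert \<times> ('a \<Rightarrow> 'h \<Rightarrow> 'h)"

definition star_representation :: "'a cstar \<Rightarrow> ('a, 'h) rep \<Rightarrow> bool" where
  "star_representation A \<pi> \<longleftrightarrow> (case \<pi> of (H, p) \<Rightarrow>
     hilbert_space H \<and>
     (\<forall>a\<in>elems A. bounded_operator H (p a)) \<and>
     (\<forall>\<xi>\<in>vectors H. \<forall>a\<in>elems A.
        (\<forall>b\<in>elems A. p (cadd A a b) \<xi> = vadd H (p a \<xi>) (p b \<xi>) \<and> p (cmult A a b) \<xi> = p a (p b \<xi>)) \<and>
        (\<forall>c. p (cscale A c a) \<xi> = vscale H c (p a \<xi>)) \<and>
        (\<forall>\<eta>\<in>vectors H. vinner H (p (cadj A a) \<xi>) \<eta> = vinner H \<xi> (p a \<eta>))))"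

definition irreducible_rep :: "'a cstar \<Rightarrow> ('a, 'h) rep \<Rightarrow> bool" where
  "irreducible_rep A \<pi> \<longleftrightarrow> star_representation A \<pi> \<and> (case \<pi> of (H, p) \<Rightarrow>
     (\<exists>a\<in>elems A. \<exists>\<xi>\<in>vectors H. p a \<xi> \<noteq> vzero H) \<and>
     (\<forall>V. closed_subspace H V \<and> (\<forall>a\<in>elems A. p a ` V \<subseteq> V) \<longrightarrow> V = {vzero H} \<or> V = vectors H))"

definition equivalent_reps :: "'a cstar \<Rightarrow> ('a, 'h) rep \<Rightarrow> ('a, 'k) rep \<Rightarrow> bool" where
  "equivalent_reps A \<pi> \<rho> \<longleftrightarrow> (case \<pi> of (H, p) \<Rightarrow> case \<rho> of (K, r) \<Rightarrow>
     \<exists>u. unitary_map H K u \<and> (\<forall>a\<in>elems A. \<forall>\<xi>\<in>vectors H. u (p a \<xi>) = r a (u \<xi>)))"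

definition rep_class :: "'a cstar \<Rightarrow> ('a, 'h) rep \<Rightarrow> ('a, 'h) rep set" where
  "rep_class A \<pi> = {\<rho>. irreducible_rep A \<rho> \<and> equivalent_reps A \<pi> \<rho>}"

text \<open>
  The points of the spectrum are classes of irreducible representations whose Hilbert space
  has its carrier in the type \<open>'h\<close>.  This is the whole spectrum as soon as \<open>'h\<close> has enough
  elements to accommodate every irreducible representation; for a separable algebra the
  cardinality of the continuum suffices.
\<close>

definition spectrum :: "'a cstar \<Rightarrow> ('a, 'h) rep set set" where
  "spectrum A = rep_class A ` {\<pi>. irreducible_rep A \<pi>}"

definition closed_ideal :: "'a cstar \<Rightarrow> 'a set \<Rightarrow> bool" where
  "closed_ideal A I \<longleftrightarrow>
     I \<subseteq> elems A \<and> I \<noteq> {} \<and> (\<forall>a\<in>I. \<forall>b\<in>I. cadd A a b \<in> I) \<and> (\<forall>c. \<forall>a\<in>I. cscale A c a \<in> I) \<and>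
     (\<forall>a\<in>elems A. \<forall>b\<in>I. cmult A a b \<in> I \<and> cmult A b a \<in> I) \<and>
     (\<forall>a\<in>elems A. (\<forall>\<epsilon>>0. \<exists>b\<in>I. cnorm A (cadd A a (cscale A (- 1) b)) < \<epsilon>) \<longrightarrow> a \<in> I)"

definition rep_kernel :: "'a cstar \<Rightarrow> ('a, 'h) rep \<Rightarrow> 'a set" where
  "rep_kernel A \<pi> = (case \<pi> of (H, p) \<Rightarrow> {a\<in>elems A. \<forall>\<xi>\<in>vectors H. p a \<xi> = vzero H})"

text \<open>The hull-kernel (Jacobson) topology.\<close>

definition spectrum_topology :: "'a cstar \<Rightarrow> ('a, 'h) rep set topology" where
  "spectrum_topology A = topology_generated_by
     {{c \<in> spectrum A. \<forall>\<pi>\<in>c. \<not> I \<subseteq> rep_kernel A \<pi>} | I. closed_ideal A I}"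

definition linear_functional :: "'a cstar \<Rightarrow> ('a \<Rightarrow> complex) \<Rightarrow> bool" where
  "linear_functional A \<psi> \<longleftrightarrow>
     (\<forall>a\<in>elems A. \<forall>b\<in>elems A. \<psi> (cadd A a b) = \<psi> a + \<psi> b) \<and>
     (\<forall>c. \<forall>a\<in>elems A. \<psi> (cscale A c a) = c * \<psi> a)"

text \<open>Elements of the dual are only determined by their values on the carrier.\<close>

definition dual :: "'a cstar \<Rightarrow> ('a \<Rightarrow> complex) set" where
  "dual A = {\<psi>. linear_functional A \<psi> \<and> (\<exists>c. \<forall>a\<in>elems A. cmod (\<psi> a) \<le> c * cnorm A a)}"

definition states :: "'a cstar \<Rightarrow> ('a \<Rightarrow> complex) set" where
  "states A = {\<phi>\<in>dual A. (\<forall>a\<in>elems A. \<phi> (cmult A (cadj A a) a) \<in> \<real>\<^sub>\<ge>\<^sub>0) \<and>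
     (SUP a\<in>{a\<in>elems A. cnorm A a \<le> 1}. cmod (\<phi> a)) = 1}"

definition pure_state :: "'a cstar \<Rightarrow> ('a \<Rightarrow> complex) \<Rightarrow> bool" where
  "pure_state A \<phi> \<longleftrightarrow> \<phi> \<in> states A \<and>
     (\<forall>\<psi>\<in>states A. \<forall>\<omega>\<in>states A. \<forall>r::real. 0 < r \<and> r < 1 \<and>
        (\<forall>a\<in>elems A. \<phi> a = of_real r * \<psi> a + of_real (1 - r) * \<omega> a) \<longrightarrow>
        (\<forall>a\<in>elems A. \<psi> a = \<phi> a \<and> \<omega> a = \<phi> a))"

definition vector_functional :: "('a, 'h) rep \<Rightarrow> 'h \<Rightarrow> 'a \<Rightarrow> complex" where
  "vector_functional \<pi> \<eta> = (\<lambda>a. vinner (fst \<pi>) (snd \<pi> a \<eta>) \<eta>)"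

text \<open>
  A pure state is associated with the irreducible representation \<open>\<pi>\<close> if its GNS representation
  is equivalent to \<open>\<pi>\<close>, that is, if it is the vector state of some unit vector (necessarily
  cyclic) of \<open>\<pi>\<close>.
\<close>

definition associated_pure_state :: "'a cstar \<Rightarrow> ('a, 'h) rep \<Rightarrow> ('a \<Rightarrow> complex) \<Rightarrow> bool" where
  "associated_pure_state A \<pi> \<phi> \<longleftrightarrow> pure_state A \<phi> \<and>
     (\<exists>\<xi>\<in>vectors (fst \<pi>). vnorm (fst \<pi>) \<xi> = 1 \<and> (\<forall>a\<in>elems A. \<phi> a = vector_functional \<pi> \<xi> a))"

definition weak_star_nbhds :: "'a cstar \<Rightarrow> ('a \<Rightarrow> complex) set set" where
  "weak_star_nbhds A =
     {{\<psi>\<in>dual A. \<forall>a\<in>F. cmod (\<psi> a) < \<epsilon>} | F \<epsilon>. finite F \<and> F \<subseteq> elems A \<and> 0 < \<epsilon>}"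

definition orthonormal :: "'h hilbert \<Rightarrow> 'h set \<Rightarrow> bool" where
  "orthonormal H E \<longleftrightarrow>
     E \<subseteq> vectors H \<and> (\<forall>\<xi>\<in>E. \<forall>\<eta>\<in>E. vinner H \<xi> \<eta> = (if \<xi> = \<eta> then 1 else 0))"

definition orthonormal_count ::
    "('a, 'h) rep \<Rightarrow> ('a \<Rightarrow> complex) \<Rightarrow> ('a \<Rightarrow> complex) set \<Rightarrow> enat" where
  "orthonormal_count \<sigma> \<phi> N =
     (SUP E\<in>{E. finite E \<and> orthonormal (fst \<sigma>) E \<and>
               (\<forall>\<eta>\<in>E. vnorm (fst \<sigma>) \<eta> = 1 \<and> vector_functional \<sigma> \<eta> \<in> {\<lambda>a. \<phi> a + \<psi> a | \<psi>. \<psi> \<in> N})}.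
        enat (card E))"

text \<open>
  \<open>M\<^sub>L(\<pi>, \<Omega>)\<close> for a net \<open>\<Omega>\<close>, given as a family together with its filter of tails.  The inner
  infimum over \<open>N\<close> is the same for every pure state \<open>\<phi>\<close> associated with \<open>\<pi>\<close>, and such \<open>\<phi>\<close>
  exist when \<open>\<pi>\<close> is irreducible, so the outer infimum merely avoids choosing one.
\<close>

definition lower_multiplicity ::
    "'a cstar \<Rightarrow> ('a, 'h) rep \<Rightarrow> ('i \<Rightarrow> ('a, 'h) rep) \<Rightarrow> 'i filter \<Rightarrow> enat" where
  "lower_multiplicity A \<pi> \<Omega> F =
     (INF \<phi>\<in>{\<phi>. associated_pure_state A \<pi> \<phi>}. INF N\<in>weak_star_nbhds A.
        Liminf F (\<lambda>i. orthonormal_count (\<Omega> i) \<phi> N))"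

section \<open>The crossed product\<close>

definition C0 :: "('x::topological_space \<Rightarrow> complex) set" where
  "C0 = {f. continuous_on UNIV f \<and> (\<forall>\<epsilon>>0. compact {x. \<epsilon> \<le> cmod (f x)})}"

text \<open>\<open>C\<^sub>c(G, C\<^sub>0(X))\<close>, with the supremum norm on \<open>C\<^sub>0(X)\<close>.\<close>

definition Cc_C0 :: "('g::topological_space \<Rightarrow> 'x::topological_space \<Rightarrow> complex) set" where
  "Cc_C0 = {f. (\<forall>s. f s \<in> C0) \<and> (\<forall>s. uniform_limit UNIV f (f s) (at s)) \<and>
               compact (closure {s. f s \<noteq> (\<lambda>x. 0)})}"

record ('g, 'x, 'h) covariant_pair =
  cspace :: "'h hilbert"
  frep :: "('x \<Rightarrow> complex) \<Rightarrow> 'h \<Rightarrow> 'h"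
  grep :: "'g \<Rightarrow> 'h \<Rightarrow> 'h"

definition covariant_reps ::
    "('g::topological_ab_group_add \<Rightarrow> 'x::topological_space \<Rightarrow> 'x) \<Rightarrow> ('g, 'x, 'h) covariant_pair set" where
  "covariant_reps act = {\<rho>. let H = cspace \<rho>; \<pi> = frep \<rho>; U = grep \<rho> in
     hilbert_space H \<and>
     (\<forall>f\<in>C0. bounded_operator H (\<pi> f)) \<and>
     (\<forall>\<xi>\<in>vectors H. \<forall>f\<in>C0.
        (\<forall>g\<in>C0. \<pi> (\<lambda>x. f x + g x) \<xi> = vadd H (\<pi> f \<xi>) (\<pi> g \<xi>) \<and>
                 \<pi> (\<lambda>x. f x * g x) \<xi> = \<pi> f (\<pi> g \<xi>)) \<and>
        (\<forall>c. \<pi> (\<lambda>x. c * f x) \<xi> = vscale H c (\<pi> f \<xi>)) \<and>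
        (\<forall>\<eta>\<in>vectors H. vinner H (\<pi> (\<lambda>x. cnj (f x)) \<xi>) \<eta> = vinner H \<xi> (\<pi> f \<eta>))) \<and>
     (\<forall>s. unitary_map H H (U s)) \<and>
     (\<forall>s t. \<forall>\<xi>\<in>vectors H. U (s + t) \<xi> = U s (U t \<xi>)) \<and>
     (\<forall>\<xi>\<in>vectors H. \<forall>s. ((\<lambda>t. vnorm H (vdiff H (U t \<xi>) (U s \<xi>))) \<longlongrightarrow> 0) (at s)) \<and>
     (\<forall>s. \<forall>f\<in>C0. \<forall>\<xi>\<in>vectors H. U s (\<pi> f \<xi>) = \<pi> (\<lambda>x. f (act (- s) x)) (U s \<xi>))}"

text \<open>The operator \<open>\<integral> \<pi>(f(s)) U\<^sub>s d\<mu>(s)\<close>, as a weak integral.\<close>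

definition integrated_op ::
    "'g measure \<Rightarrow> ('g, 'x, 'h) covariant_pair \<Rightarrow> ('g \<Rightarrow> 'x \<Rightarrow> complex) \<Rightarrow> 'h \<Rightarrow> 'h" where
  "integrated_op \<mu> \<rho> f = (\<lambda>\<xi>\<in>vectors (cspace \<rho>).
     THE \<zeta>. \<zeta> \<in> vectors (cspace \<rho>) \<and>
       (\<forall>\<eta>\<in>vectors (cspace \<rho>).
          vinner (cspace \<rho>) \<zeta> \<eta> = (LINT s|\<mu>. vinner (cspace \<rho>) (frep \<rho> (f s) (grep \<rho> s \<xi>)) \<eta>)))"

text \<open>
  The \<open>\<ell>\<^sup>\<infinity>\<close>-direct product of the algebras of bounded operators on the spaces \<open>H i\<close>, \<open>i \<in> I\<close>.
\<close>

definition operator_product :: "'i set \<Rightarrow> ('i \<Rightarrow> 'h hilbert) \<Rightarrow> ('i \<Rightarrow> 'h \<Rightarrow> 'h) cstar" where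
  "operator_product I H =
     \<lparr>elems = {a \<in> (\<Pi>\<^sub>E i\<in>I. {T \<in> extensional (vectors (H i)). bounded_operator (H i) T}).
                bdd_above ((\<lambda>i. op_norm (H i) (a i)) ` I)},
      cadd = (\<lambda>a b. \<lambda>i\<in>I. \<lambda>\<xi>\<in>vectors (H i). vadd (H i) (a i \<xi>) (b i \<xi>)),
      cscale = (\<lambda>c a. \<lambda>i\<in>I. \<lambda>\<xi>\<in>vectors (H i). vscale (H i) c (a i \<xi>)),
      cmult = (\<lambda>a b. \<lambda>i\<in>I. \<lambda>\<xi>\<in>vectors (H i). a i (b i \<xi>)),
      cadj = (\<lambda>a. \<lambda>i\<in>I. adjoint_op (H i) (a i)),
      cnorm = (\<lambda>a. SUP i\<in>I. op_norm (H i) (a i))\<rparr>"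

text \<open>
  \<open>C\<^sub>0(X) \<rtimes> G\<close> is the completion of \<open>C\<^sub>c(G, C\<^sub>0(X))\<close> in the universal norm, the supremum of
  \<open>\<parallel>(\<pi> \<rtimes> U)(f)\<parallel>\<close> over all covariant pairs \<open>(\<pi>, U)\<close>.  It is realised as the closure of the image
  of \<open>C\<^sub>c(G, C\<^sub>0(X))\<close> in the product, over all covariant pairs, of the algebras of bounded operators;
  so an element is a family of operators, and the integrated form of a covariant pair is
  evaluation at this pair.  The Hilbert spaces have their carrier in \<open>'h\<close>: if \<open>G\<close> and \<open>X\<close> are
  second-countable, the universal norm is attained on separable spaces, and it is enough that
  \<open>'h\<close> has at least the cardinality of the continuum.
\<close>

definition crossed_product ::
    "('g::topological_ab_group_add \<Rightarrow> 'x::topological_space \<Rightarrow> 'x) \<Rightarrow> 'g measure \<Rightarrow>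
     (('g, 'x, 'h) covariant_pair \<Rightarrow> 'h \<Rightarrow> 'h) cstar" where
  "crossed_product act \<mu> =
     (let B = operator_product (covariant_reps act) cspace in
      B\<lparr>elems := {a \<in> elems B. \<forall>\<epsilon>>0. \<exists>f\<in>Cc_C0.
          cnorm B (cadd B a (cscale B (- 1) (\<lambda>\<rho>\<in>covariant_reps act. integrated_op \<mu> \<rho> f))) < \<epsilon>}\<rparr>)"

definition integrated_form ::
    "('g, 'x, 'h) covariant_pair \<Rightarrow> (('g, 'x, 'h) covariant_pair \<Rightarrow> 'h \<Rightarrow> 'h, 'h) rep" where
  "integrated_form \<rho> = (cspace \<rho>, \<lambda>a. a \<rho>)"

section \<open>Induced representations\<close>

definition characters :: "('g::topological_ab_group_add \<Rightarrow> complex) set" where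
  "characters = {\<tau>. continuous_on UNIV \<tau> \<and> (\<forall>s. cmod (\<tau> s) = 1) \<and> (\<forall>s t. \<tau> (s + t) = \<tau> s * \<tau> t)}"

text \<open>
  \<open>\<nu>\<close> is the measure on \<open>G/S\<^sub>x\<close>.  For \<open>s\<close> in a coset \<open>c\<close> of the stabilizer of \<open>x\<close>, the point \<open>s \<cdot> x\<close>
  does not depend on \<open>s\<close>.
\<close>

definition induced_pair ::
    "('g::topological_ab_group_add \<Rightarrow> 'x \<Rightarrow> 'x) \<Rightarrow> 'g set measure \<Rightarrow> 'x \<Rightarrow> ('g \<Rightarrow> complex) \<Rightarrow>
     ('g, 'x, ('g set \<Rightarrow> complex) set) covariant_pair" where
  "induced_pair act \<nu> x \<tau> =
     \<lparr>cspace = L2 \<nu>,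
      frep = (\<lambda>f \<xi>. l2_class \<nu> (\<lambda>c. f (act (SOME s. s \<in> c) x) * l2_rep \<xi> c)),
      grep = (\<lambda>t \<xi>. l2_class \<nu> (\<lambda>c. \<tau> t * l2_rep \<xi> ((- t) +o c)))\<rparr>"

definition Ind ::
    "('g::topological_ab_group_add \<Rightarrow> 'x \<Rightarrow> 'x) \<Rightarrow> ('g set \<Rightarrow> 'g set measure) \<Rightarrow> 'x \<Rightarrow> ('g \<Rightarrow> complex) \<Rightarrow>
     (('g, 'x, ('g set \<Rightarrow> complex) set) covariant_pair \<Rightarrow>
        ('g set \<Rightarrow> complex) set \<Rightarrow> ('g set \<Rightarrow> complex) set, ('g set \<Rightarrow> complex) set) rep" where
  "Ind act \<nu> x \<tau> = integrated_form (induced_pair act (\<nu> (stabilizer act x)) x \<tau>)"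

end

theory Submission
  imports Defs
begin

text \<open>
  Write \<open>H\<^sub>n\<close> for the stabilizer of \<open>x\<^sub>n\<close>.  For \<open>h \<in> C\<^sub>c(G)\<close>, periodizing \<open>s \<mapsto> \<tau>\<^sub>n(s) h(s - t\<^sub>n\<^sub>j)\<close> over \<open>H\<^sub>n\<close>
  gives a vector of \<open>L\<^sup>2(G/H\<^sub>n)\<close>.  By Weil's formula its vector state is an integral over \<open>G \<times> G\<close> whose
  integrand depends on \<open>n\<close> only through the point \<open>t\<^sub>n\<^sub>j \<cdot> x\<^sub>n\<close> and the function \<open>u \<mapsto> \<integral> h(u + r) \<tau>\<^sub>n(r) dr\<close>,
  the integral being over \<open>H\<^sub>n\<close>.  These converge, because the normalised Haar measure of a closed
  subgroup is continuous for the Fell topology and because \<open>\<tau>\<^sub>n(r\<^sub>n) \<rightarrow> \<tau>(r)\<close> whenever \<open>r\<^sub>n \<in> H\<^sub>n\<close> converges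
  to \<open>r\<close>: the group element \<open>r\<^sub>n\<close> acts as the scalar \<open>\<tau>\<^sub>n(r\<^sub>n)\<close> in \<open>Ind(x\<^sub>n, \<tau>\<^sub>n)\<close>, and the hull-kernel topology
  detects the limits of such eigenvalues.  So for each \<open>j\<close> the vector states converge to that of the
  periodization of \<open>\<tau> h\<close> in \<open>Ind(z, \<tau>)\<close>, and by irreducibility these vectors are dense.  Since \<open>W\<close> is a
  neighbourhood of the identity and \<open>H\<^sub>n\<close> converges to the stabilizer of \<open>z\<close>, the disjointness of the
  sets \<open>W + t\<^sub>n\<^sub>j + H\<^sub>n\<close> forces \<open>t\<^sub>n\<^sub>i - t\<^sub>n\<^sub>j + H\<^sub>n\<close>, \<open>i \<noteq> j\<close>, to leave every compact set, so the vectors for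
  different \<open>j\<close> are eventually orthogonal.
\<close>

section \<open>Hilbert spaces with explicit carrier\<close>

text \<open>That \<open>Ind(x, \<tau>)\<close> comes from a covariant pair with irreducible
  integrated form is never computed: strong continuity, covariance and irreducibility are read off
  from the assumption that the classes are points of the spectrum. The hull-kernel topology sees
  only elements that vanish identically along a subsequence, whereas averaging over powers of a
  group element makes an element vanish at one index at a time. Hence the averaging is iterated with
  geometrically decreasing errors, and a limit in the crossed product vanishes exactly at infinitely
  many indices. Since the algebra consists of families of operators indexed by all covariant pairs,
  every estimate there must be uniform in the pair. The factor \<open>\<tau>\<^sub>n(s)\<close> in
  the vectors is there because nothing is known of \<open>\<tau>\<^sub>n\<close> off
  \<open>H\<^sub>n\<close>: it cancels from all matrix coefficients except for its values on
  \<open>H\<^sub>n\<close>, where it does converge. Finally, a weak-star neighbourhood tests only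
  finitely many elements, so one function h, chosen for the given pure state and neighbourhood,
  serves all n and j.\<close>

primrec vsum :: "'h hilbert \<Rightarrow> (nat \<Rightarrow> 'h) \<Rightarrow> nat \<Rightarrow> 'h" where
  "vsum H f 0 = vzero H"
| "vsum H f (Suc n) = vadd H (vsum H f n) (f n)"

context hilbert_space
begin

lemma diff_closed [simp]: "\<xi> \<in> vectors H \<Longrightarrow> \<eta> \<in> vectors H \<Longrightarrow> vdiff H \<xi> \<eta> \<in> vectors H"
  by (simp add: vdiff_def add_closed scale_closed)

declare zero_closed [simp] add_closed [simp] scale_closed [simp]

lemma inner_add_right:
  "\<xi> \<in> vectors H \<Longrightarrow> \<eta> \<in> vectors H \<Longrightarrow> \<zeta> \<in> vectors H \<Longrightarrow>
    vinner H \<zeta> (vadd H \<xi> \<eta>) = vinner H \<zeta> \<xi> + vinner H \<zeta> \<eta>"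
  by (metis add_closed complex_cnj_add inner_add inner_cnj)

lemma inner_scale_right:
  "\<xi> \<in> vectors H \<Longrightarrow> \<eta> \<in> vectors H \<Longrightarrow> vinner H \<xi> (vscale H c \<eta>) = cnj c * vinner H \<xi> \<eta>"
  by (metis complex_cnj_mult inner_cnj inner_scale scale_closed)

lemma inner_diff:
  "\<xi> \<in> vectors H \<Longrightarrow> \<eta> \<in> vectors H \<Longrightarrow> \<zeta> \<in> vectors H \<Longrightarrow>
    vinner H (vdiff H \<xi> \<eta>) \<zeta> = vinner H \<xi> \<zeta> - vinner H \<eta> \<zeta>"
  by (simp add: vdiff_def inner_add inner_scale)

lemma inner_diff_right:
  "\<xi> \<in> vectors H \<Longrightarrow> \<eta> \<in> vectors H \<Longrightarrow> \<zeta> \<in> vectors H \<Longrightarrow>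
    vinner H \<zeta> (vdiff H \<xi> \<eta>) = vinner H \<zeta> \<xi> - vinner H \<zeta> \<eta>"
  by (simp add: vdiff_def inner_add_right inner_scale_right)

lemma inner_zero [simp]: "\<xi> \<in> vectors H \<Longrightarrow> vinner H (vzero H) \<xi> = 0"
  by (metis inner_scale mult_zero_left scale_zero)

lemma inner_zero_right [simp]: "\<xi> \<in> vectors H \<Longrightarrow> vinner H \<xi> (vzero H) = 0"
  by (metis inner_cnj inner_zero complex_cnj_zero zero_closed)

text \<open>Apply definiteness to the difference. With an explicit carrier this is also how linear
  identities between vectors are verified below: inner products turn them into identities of complex
  numbers.\<close>

lemma vec_eqI:
  assumes "\<xi> \<in> vectors H" "\<eta> \<in> vectors H" "\<And>\<zeta>. \<zeta> \<in> vectors H \<Longrightarrow> vinner H \<xi> \<zeta> = vinner H \<eta> \<zeta>"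
  shows "\<xi> = \<eta>"
proof -
  have "vdiff H \<xi> \<eta> = vzero H"
    using assms by (intro inner_definite) (simp_all add: inner_diff)
  then have "vadd H (vdiff H \<xi> \<eta>) \<eta> = \<eta>"
    using assms(2) by (metis add_commute add_zero zero_closed)
  moreover have "vadd H (vscale H (- 1) \<eta>) \<eta> = vzero H"
    using scale_add_left[of \<eta> "-1" 1] assms(2) by (simp add: scale_one scale_zero)
  ultimately show ?thesis
    using assms(1,2) by (simp add: vdiff_def add_assoc add_zero)
qed

lemma inner_self_real: "\<xi> \<in> vectors H \<Longrightarrow> vinner H \<xi> \<xi> = complex_of_real ((vnorm H \<xi>)\<^sup>2)"
  using inner_cnj[of \<xi> \<xi>] inner_nonneg[of \<xi>]
  by (auto simp: vnorm_def complex_eq_iff)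

lemma norm_nonneg [simp]: "\<xi> \<in> vectors H \<Longrightarrow> 0 \<le> vnorm H \<xi>"
  by (simp add: vnorm_def inner_nonneg)

lemma norm_eq_0_iff: "\<xi> \<in> vectors H \<Longrightarrow> vnorm H \<xi> = 0 \<longleftrightarrow> \<xi> = vzero H"
  using inner_self_real[of \<xi>] inner_definite[of \<xi>] by (auto simp: vnorm_def)

lemma norm_zero [simp]: "vnorm H (vzero H) = 0"
  by (simp add: norm_eq_0_iff)

lemma cauchy_schwarz:
  assumes "\<xi> \<in> vectors H" "\<eta> \<in> vectors H"
  shows "cmod (vinner H \<xi> \<eta>) \<le> vnorm H \<xi> * vnorm H \<eta>"
proof (cases "vnorm H \<eta> = 0")
  case True
  then show ?thesis using assms by (simp add: norm_eq_0_iff)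
next
  case False
  let ?n = "(vnorm H \<eta>)\<^sup>2" and ?c = "vinner H \<xi> \<eta>"
  have np: "0 < ?n" using False by simp
  \<comment> \<open>This is \<open>?n\<close> times the component of \<xi> orthogonal to \<eta>;
    scaling by the squared norm of \<eta> avoids a division.\<close>
  define \<zeta> where "\<zeta> = vdiff H (vscale H ?n \<xi>) (vscale H ?c \<eta>)"
  have "vinner H \<zeta> \<zeta> = of_real (?n * ?n * (vnorm H \<xi>)\<^sup>2 - ?n * (cmod ?c)\<^sup>2)"
    using assms inner_cnj[of \<eta> \<xi>] inner_self_real[of \<xi>] inner_self_real[of \<eta>]
    unfolding \<zeta>_def
    by (simp add: inner_diff inner_diff_right inner_scale inner_scale_right complex_norm_square
        algebra_simps del: of_real_power)
      (simp add: power4_eq_xxxx power2_eq_square)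
  then have "Re (vinner H \<zeta> \<zeta>) = ?n * ?n * (vnorm H \<xi>)\<^sup>2 - ?n * (cmod ?c)\<^sup>2"
    by (metis Re_complex_of_real)
  moreover have "0 \<le> Re (vinner H \<zeta> \<zeta>)" using assms by (simp add: \<zeta>_def inner_nonneg)
  ultimately have "?n * (cmod ?c)\<^sup>2 \<le> ?n * (?n * (vnorm H \<xi>)\<^sup>2)"
    by (metis diff_ge_0_iff_ge mult.assoc)
  then have "(cmod ?c)\<^sup>2 \<le> ?n * (vnorm H \<xi>)\<^sup>2"
    using np by (rule mult_left_le_imp_le)
  then have "(cmod ?c)\<^sup>2 \<le> (vnorm H \<xi> * vnorm H \<eta>)\<^sup>2"
    by (simp only: power_mult_distrib mult.commute)
  then show ?thesis
    using assms by (simp add: power2_le_iff_abs_le)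
qed

text \<open>Testing with \<eta> = \<xi> is enough. Operators here are defined by weak integrals, so
  this is the usual passage from weak estimates to norm estimates.\<close>

lemma norm_leI:
  assumes "\<xi> \<in> vectors H" "0 \<le> c" "\<And>\<eta>. \<eta> \<in> vectors H \<Longrightarrow> cmod (vinner H \<xi> \<eta>) \<le> c * vnorm H \<eta>"
  shows "vnorm H \<xi> \<le> c"
proof (rule ccontr)
  assume *: "\<not> ?thesis"
  then have "0 < vnorm H \<xi>" using assms(2) by linarith
  moreover have "(vnorm H \<xi>)\<^sup>2 \<le> c * vnorm H \<xi>"
    using assms(3)[OF assms(1)] inner_self_real[OF assms(1)] by (simp add: norm_power)
  ultimately show False using * by (simp add: power2_eq_square)
qed

lemma norm_scale: "\<xi> \<in> vectors H \<Longrightarrow> vnorm H (vscale H c \<xi>) = cmod c * vnorm H \<xi>"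
proof -
  assume x: "\<xi> \<in> vectors H"
  have "vinner H (vscale H c \<xi>) (vscale H c \<xi>) = c * cnj c * vinner H \<xi> \<xi>"
    using x by (simp add: inner_scale inner_scale_right)
  also have "\<dots> = of_real ((cmod c)\<^sup>2 * Re (vinner H \<xi> \<xi>))"
    using x by (simp add: inner_self_real flip: complex_norm_square)
  finally show ?thesis
    by (simp only: vnorm_def Re_complex_of_real) (simp add: real_sqrt_mult)
qed

lemma norm_add_le:
  assumes "\<xi> \<in> vectors H" "\<eta> \<in> vectors H"
  shows "vnorm H (vadd H \<xi> \<eta>) \<le> vnorm H \<xi> + vnorm H \<eta>"
proof (rule norm_leI)
  fix \<zeta> assume z: "\<zeta> \<in> vectors H"
  have "cmod (vinner H (vadd H \<xi> \<eta>) \<zeta>) \<le> cmod (vinner H \<xi> \<zeta>) + cmod (vinner H \<eta> \<zeta>)"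
    using assms z by (simp add: inner_add norm_triangle_ineq)
  then show "cmod (vinner H (vadd H \<xi> \<eta>) \<zeta>) \<le> (vnorm H \<xi> + vnorm H \<eta>) * vnorm H \<zeta>"
    using cauchy_schwarz[OF assms(1) z] cauchy_schwarz[OF assms(2) z] by (simp add: algebra_simps)
qed (use assms in auto)

lemma diff_self [simp]: "\<xi> \<in> vectors H \<Longrightarrow> vdiff H \<xi> \<xi> = vzero H"
  by (rule vec_eqI) (simp_all add: inner_diff)

lemma diff_zero [simp]: "\<xi> \<in> vectors H \<Longrightarrow> vdiff H \<xi> (vzero H) = \<xi>"
  by (rule vec_eqI) (simp_all add: inner_diff)

lemma norm_diff_commute:
  assumes "\<xi> \<in> vectors H" "\<eta> \<in> vectors H"
  shows "vnorm H (vdiff H \<xi> \<eta>) = vnorm H (vdiff H \<eta> \<xi>)"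
proof -
  have "vdiff H \<xi> \<eta> = vscale H (-1) (vdiff H \<eta> \<xi>)"
    by (rule vec_eqI) (use assms in \<open>simp_all add: inner_diff inner_scale\<close>)
  then show ?thesis using assms by (simp add: norm_scale)
qed

lemma norm_diff_triangle:
  assumes "\<xi> \<in> vectors H" "\<eta> \<in> vectors H" "\<zeta> \<in> vectors H"
  shows "vnorm H (vdiff H \<xi> \<zeta>) \<le> vnorm H (vdiff H \<xi> \<eta>) + vnorm H (vdiff H \<eta> \<zeta>)"
proof -
  have "vdiff H \<xi> \<zeta> = vadd H (vdiff H \<xi> \<eta>) (vdiff H \<eta> \<zeta>)"
    by (rule vec_eqI) (use assms in \<open>simp_all add: inner_diff inner_add\<close>)
  then show ?thesis using assms by (simp add: norm_add_le)
qed

lemma norm_diff_triangle_le: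
  assumes "\<xi> \<in> vectors H" "\<eta> \<in> vectors H" "\<zeta> \<in> vectors H"
    and "vnorm H (vdiff H \<xi> \<eta>) \<le> a" "vnorm H (vdiff H \<eta> \<zeta>) \<le> b"
  shows "vnorm H (vdiff H \<xi> \<zeta>) \<le> a + b"
  using norm_diff_triangle[OF assms(1-3)] assms(4,5) by linarith

lemma norm_le_diff:
  assumes "\<xi> \<in> vectors H" "\<eta> \<in> vectors H"
  shows "vnorm H \<xi> \<le> vnorm H \<eta> + vnorm H (vdiff H \<xi> \<eta>)"
  using norm_diff_triangle[of \<xi> \<eta> "vzero H"] assms by simp

lemma norm_diff_add_le:
  assumes "\<xi> \<in> vectors H" "\<eta> \<in> vectors H" "\<xi>' \<in> vectors H" "\<eta>' \<in> vectors H"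
  shows "vnorm H (vdiff H (vadd H \<xi> \<eta>) (vadd H \<xi>' \<eta>'))
    \<le> vnorm H (vdiff H \<xi> \<xi>') + vnorm H (vdiff H \<eta> \<eta>')"
proof -
  have "vdiff H (vadd H \<xi> \<eta>) (vadd H \<xi>' \<eta>') = vadd H (vdiff H \<xi> \<xi>') (vdiff H \<eta> \<eta>')"
    by (rule vec_eqI) (use assms in \<open>simp_all add: inner_diff inner_add\<close>)
  then show ?thesis using assms by (simp add: norm_add_le)
qed

lemma norm_diff_scale:
  assumes "\<xi> \<in> vectors H" "\<eta> \<in> vectors H"
  shows "vnorm H (vdiff H (vscale H c \<xi>) (vscale H c \<eta>)) = cmod c * vnorm H (vdiff H \<xi> \<eta>)"
proof -
  have "vdiff H (vscale H c \<xi>) (vscale H c \<eta>) = vscale H c (vdiff H \<xi> \<eta>)"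
    by (rule vec_eqI) (use assms in \<open>simp_all add: inner_diff inner_scale algebra_simps\<close>)
  then show ?thesis using assms by (simp add: norm_scale)
qed

lemma norm_diff_le_0:
  assumes "\<xi> \<in> vectors H" "\<eta> \<in> vectors H" "\<And>\<epsilon>. 0 < \<epsilon> \<Longrightarrow> vnorm H (vdiff H \<xi> \<eta>) \<le> \<epsilon>"
  shows "\<xi> = \<eta>"
proof -
  have "vnorm H (vdiff H \<xi> \<eta>) \<le> 0"
    by (rule field_le_epsilon) (simp add: assms(3))
  then have "vdiff H \<xi> \<eta> = vzero H"
    using assms(1,2) by (intro norm_eq_0_iff[THEN iffD1] order_antisym) auto
  then have "vinner H \<xi> \<zeta> = vinner H \<eta> \<zeta>" if "\<zeta> \<in> vectors H" for \<zeta>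
    using inner_diff[OF assms(1,2) that] that by simp
  then show ?thesis using assms vec_eqI by blast
qed

lemma vsum_closed [simp]: "(\<And>i. i < n \<Longrightarrow> f i \<in> vectors H) \<Longrightarrow> vsum H f n \<in> vectors H"
  by (induction n) auto

lemma inner_vsum:
  "(\<And>i. i < n \<Longrightarrow> f i \<in> vectors H) \<Longrightarrow> \<zeta> \<in> vectors H \<Longrightarrow>
    vinner H (vsum H f n) \<zeta> = (\<Sum>i<n. vinner H (f i) \<zeta>)"
  by (induction n) (auto simp: inner_add)

lemma bounded_operatorD:
  assumes "bounded_operator H T"
  shows "\<xi> \<in> vectors H \<Longrightarrow> T \<xi> \<in> vectors H"
    and "\<xi> \<in> vectors H \<Longrightarrow> \<eta> \<in> vectors H \<Longrightarrow> T (vadd H \<xi> \<eta>) = vadd H (T \<xi>) (T \<eta>)"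
    and "\<xi> \<in> vectors H \<Longrightarrow> T (vscale H c \<xi>) = vscale H c (T \<xi>)"
    and "\<xi> \<in> vectors H \<Longrightarrow> \<eta> \<in> vectors H \<Longrightarrow> T (vdiff H \<xi> \<eta>) = vdiff H (T \<xi>) (T \<eta>)"
  using assms by (auto simp: bounded_operator_def linear_map_def vdiff_def)

lemma bounded_operator_bound:
  assumes "bounded_operator H T"
  obtains c where "0 < c" "\<And>\<xi>. \<xi> \<in> vectors H \<Longrightarrow> vnorm H (T \<xi>) \<le> c * vnorm H \<xi>"
proof -
  obtain c where c: "\<And>\<xi>. \<xi> \<in> vectors H \<Longrightarrow> vnorm H (T \<xi>) \<le> c * vnorm H \<xi>"
    using assms by (auto simp: bounded_operator_def)
  have "vnorm H (T \<xi>) \<le> (\<bar>c\<bar> + 1) * vnorm H \<xi>" if "\<xi> \<in> vectors H" for \<xi>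
    using c[OF that] mult_right_mono[of c "\<bar>c\<bar> + 1" "vnorm H \<xi>"] that by force
  then show thesis by (intro that[of "\<bar>c\<bar> + 1"]) auto
qed

lemma op_norm_le:
  assumes "0 \<le> c" "\<And>\<xi>. \<xi> \<in> vectors H \<Longrightarrow> vnorm H (T \<xi>) \<le> c * vnorm H \<xi>"
  shows "op_norm H T \<le> c"
  unfolding op_norm_def
proof (rule cSUP_least)
  show "{\<xi> \<in> vectors H. vnorm H \<xi> \<le> 1} \<noteq> {}" using zero_closed norm_zero by fastforce
  show "vnorm H (T \<xi>) \<le> c" if "\<xi> \<in> {\<xi> \<in> vectors H. vnorm H \<xi> \<le> 1}" for \<xi>
    using that assms(2)[of \<xi>] mult_left_mono[of "vnorm H \<xi>" 1 c] assms(1) by auto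
qed

text \<open>The supremum in \<open>op_norm\<close> is one of reals, so it dominates its members only
  when they are bounded above; that is what \<open>bounded_operator\<close> supplies. Vectors of
  norm 0 are treated separately because they cannot be normalised.\<close>

lemma op_norm_bound:
  assumes T: "bounded_operator H T" and x: "\<xi> \<in> vectors H"
  shows "vnorm H (T \<xi>) \<le> op_norm H T * vnorm H \<xi>"
proof (cases "vnorm H \<xi> = 0")
  case True
  then have "\<xi> = vzero H" using x by (simp add: norm_eq_0_iff)
  then have "T \<xi> = vzero H"
    using bounded_operatorD(3)[OF T x, of 0] bounded_operatorD(1)[OF T x] x by (simp add: scale_zero)
  then show ?thesis using True by simp
next
  case False
  then have p: "0 < vnorm H \<xi>" using norm_nonneg[OF x] by linarith
  obtain c where c: "0 < c" "\<And>\<xi>. \<xi> \<in> vectors H \<Longrightarrow> vnorm H (T \<xi>) \<le> c * vnorm H \<xi>"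
    using bounded_operator_bound[OF T] by blast
  define \<zeta> where "\<zeta> = vscale H (of_real (1 / vnorm H \<xi>)) \<xi>"
  have z: "\<zeta> \<in> vectors H" "vnorm H \<zeta> = 1"
    unfolding \<zeta>_def using x p by (simp, subst norm_scale) (simp_all add: norm_divide)
  have "vnorm H (T \<zeta>) \<le> op_norm H T"
    unfolding op_norm_def
  proof (rule cSUP_upper[where f = "\<lambda>\<xi>. vnorm H (T \<xi>)"])
    show "bdd_above ((\<lambda>\<xi>. vnorm H (T \<xi>)) ` {\<xi> \<in> vectors H. vnorm H \<xi> \<le> 1})"
    proof (rule bdd_aboveI2)
      show "vnorm H (T \<xi>) \<le> c" if "\<xi> \<in> {\<xi> \<in> vectors H. vnorm H \<xi> \<le> 1}" for \<xi>
        using order_trans[OF c(2) mult_left_mono[of "vnorm H \<xi>" 1 c]] that c(1) by simp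
    qed
  qed (use z in auto)
  moreover have "vnorm H (T \<zeta>) = vnorm H (T \<xi>) / vnorm H \<xi>"
    using x p bounded_operatorD(1)[OF T x] norm_nonneg[OF x]
    by (simp add: \<zeta>_def bounded_operatorD(3)[OF T x] norm_scale norm_divide)
  ultimately show ?thesis using p by (simp add: field_simps)
qed

end

lemma unitary_mapD:
  assumes "unitary_map H K u" "hilbert_space H"
  shows "\<xi> \<in> vectors H \<Longrightarrow> u \<xi> \<in> vectors K"
    and "\<xi> \<in> vectors H \<Longrightarrow> \<eta> \<in> vectors H \<Longrightarrow> u (vadd H \<xi> \<eta>) = vadd K (u \<xi>) (u \<eta>)"
    and "\<xi> \<in> vectors H \<Longrightarrow> u (vscale H c \<xi>) = vscale K c (u \<xi>)"
    and "\<xi> \<in> vectors H \<Longrightarrow> \<eta> \<in> vectors H \<Longrightarrow> u (vdiff H \<xi> \<eta>) = vdiff K (u \<xi>) (u \<eta>)"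
    and "\<xi> \<in> vectors H \<Longrightarrow> vnorm K (u \<xi>) = vnorm H \<xi>"
    and "\<xi> \<in> vectors H \<Longrightarrow> \<eta> \<in> vectors H \<Longrightarrow> vinner K (u \<xi>) (u \<eta>) = vinner H \<xi> \<eta>"
    and "\<zeta> \<in> vectors K \<Longrightarrow> \<exists>\<xi>\<in>vectors H. u \<xi> = \<zeta>"
    and "\<xi> \<in> vectors H \<Longrightarrow> \<eta> \<in> vectors H \<Longrightarrow> u \<xi> = u \<eta> \<Longrightarrow> \<xi> = \<eta>"
proof -
  interpret hilbert_space H by fact
  have lin: "u \<in> vectors H \<rightarrow> vectors K"
      "\<And>\<xi> \<eta>. \<xi> \<in> vectors H \<Longrightarrow> \<eta> \<in> vectors H \<Longrightarrow> u (vadd H \<xi> \<eta>) = vadd K (u \<xi>) (u \<eta>)"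
      "\<And>c \<xi>. \<xi> \<in> vectors H \<Longrightarrow> u (vscale H c \<xi>) = vscale K c (u \<xi>)"
    using assms(1) unfolding unitary_map_def linear_map_def by blast+
  show "\<xi> \<in> vectors H \<Longrightarrow> u \<xi> \<in> vectors K" using lin by blast
  show "\<xi> \<in> vectors H \<Longrightarrow> \<eta> \<in> vectors H \<Longrightarrow> u (vadd H \<xi> \<eta>) = vadd K (u \<xi>) (u \<eta>)"
    "\<xi> \<in> vectors H \<Longrightarrow> u (vscale H c \<xi>) = vscale K c (u \<xi>)" using lin by simp_all
  show "\<xi> \<in> vectors H \<Longrightarrow> \<eta> \<in> vectors H \<Longrightarrow> u (vdiff H \<xi> \<eta>) = vdiff K (u \<xi>) (u \<eta>)"
    by (simp add: vdiff_def lin)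
  have *: "\<xi> \<in> vectors H \<Longrightarrow> \<eta> \<in> vectors H \<Longrightarrow> vinner K (u \<xi>) (u \<eta>) = vinner H \<xi> \<eta>" for \<xi> \<eta>
    using assms(1) unfolding unitary_map_def by blast
  show "\<xi> \<in> vectors H \<Longrightarrow> \<eta> \<in> vectors H \<Longrightarrow> vinner K (u \<xi>) (u \<eta>) = vinner H \<xi> \<eta>"
    "\<xi> \<in> vectors H \<Longrightarrow> vnorm K (u \<xi>) = vnorm H \<xi>" by (simp_all add: vnorm_def *)
  have "bij_betw u (vectors H) (vectors K)"
    using assms(1) unfolding unitary_map_def by blast
  then show "\<zeta> \<in> vectors K \<Longrightarrow> \<exists>\<xi>\<in>vectors H. u \<xi> = \<zeta>"
    "\<xi> \<in> vectors H \<Longrightarrow> \<eta> \<in> vectors H \<Longrightarrow> u \<xi> = u \<eta> \<Longrightarrow> \<xi> = \<eta>"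
    by (metis bij_betw_iff_bijections, metis bij_betw_iff_bijections)
qed

lemma unitary_map_zero:
  assumes "unitary_map H K u" and "hilbert_space H" and "hilbert_space K"
  shows "u (vzero H) = vzero K"
proof -
  have "vzero H \<in> vectors H" by (rule hilbert_space.zero_closed[OF assms(2)])
  then have "u (vscale H 0 (vzero H)) = vscale K 0 (u (vzero H))" "u (vzero H) \<in> vectors K"
    by (simp_all add: unitary_mapD(1,3)[OF assms(1,2)])
  then show ?thesis
    using \<open>vzero H \<in> vectors H\<close>
    by (simp add: hilbert_space.scale_zero[OF assms(2)] hilbert_space.scale_zero[OF assms(3)])
qed

section \<open>Compactness and integration on second-countable spaces\<close>

text \<open>By Lindelof's theorem countably many relatively compact open sets cover the space. This
  yields the sigma-finiteness that Fubini's theorem requires.\<close>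

lemma sigma_compact_space:
  assumes "locally_compact_space (euclidean :: 'a::{second_countable_topology, t2_space} topology)"
  obtains K where "\<And>n :: nat. compact (K n :: 'a set)" "(\<Union>n. K n) = UNIV"
proof -
  define \<F> where "\<F> = {U. open (U :: 'a set) \<and> (\<exists>C. compact C \<and> U \<subseteq> C)}"
  have "\<exists>U\<in>\<F>. x \<in> U" for x :: 'a
    using assms unfolding locally_compact_space_def \<F>_def by (auto; metis)
  then have U: "\<Union>\<F> = UNIV" by blast
  obtain \<F>' where F': "\<F>' \<subseteq> \<F>" "countable \<F>'" "\<Union>\<F>' = \<Union>\<F>"
    using Lindelof[of \<F>] unfolding \<F>_def by blast
  have "\<F>' \<noteq> {}" using F' U by auto
  then have r: "range (from_nat_into \<F>') = \<F>'" using F'(2) by simp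
  have "\<exists>C. compact C \<and> from_nat_into \<F>' n \<subseteq> C" for n
    using r F'(1) unfolding \<F>_def by blast
  then obtain K where K: "\<And>n. compact (K n)" "\<And>n. from_nat_into \<F>' n \<subseteq> K n" by metis
  have "x \<in> (\<Union>n. K n)" for x
  proof -
    obtain V where V: "V \<in> range (from_nat_into \<F>')" "x \<in> V" using F'(3) U r by (metis UNIV_I UnionE)
    then show ?thesis using K(2) by blast
  qed
  then have "(\<Union>n. K n) = UNIV" by blast
  with K(1) show thesis by (rule that)
qed

lemma locally_compactE:
  assumes "locally_compact_space (euclidean :: 'a::topological_space topology)"
  obtains U C where "open U" "compact C" "(x :: 'a) \<in> U" "U \<subseteq> C"
proof -
  have "\<exists>U C. open U \<and> compact C \<and> x \<in> U \<and> U \<subseteq> C"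
    using assms unfolding locally_compact_space_def by auto
  then show thesis using that by blast
qed

lemma compact_plus:
  fixes K L :: "'a::topological_monoid_add set"
  assumes "compact K" "compact L"
  shows "compact (K + L)"
proof -
  have "K + L = (\<lambda>(a, b). a + b) ` (K \<times> L)" by (auto simp: set_plus_def)
  then show ?thesis
    using assms by (auto intro!: compact_continuous_image compact_Times continuous_intros
        simp: case_prod_unfold)
qed

lemma compact_uminus:
  fixes K :: "'a::topological_group_add set"
  assumes "compact K"
  shows "compact (uminus ` K)"
  by (intro compact_continuous_image continuous_intros assms)

text \<open>For a subgroup H the set K + H is the preimage of the image of K in the quotient; its
  closedness makes such images measurable.\<close>

lemma closed_plus_compact:
  fixes K H :: "'a::{topological_ab_group_add, first_countable_topology, t2_space} set"
  assumes K: "compact K" and H: "closed H"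
  shows "closed (K + H)"
  unfolding closed_sequential_limits
proof clarify
  fix u l assume u: "\<forall>n. u n \<in> K + H" and l: "u \<longlonglongrightarrow> l"
  from u have "\<forall>n. \<exists>a b. a \<in> K \<and> b \<in> H \<and> u n = a + b" by (simp add: set_plus_def) blast
  then obtain a b where ab: "\<And>n. a n \<in> K" "\<And>n. b n \<in> H" "\<And>n. u n = a n + b n" by metis
  obtain a0 r where r: "a0 \<in> K" "strict_mono r" "(a \<circ> r) \<longlonglongrightarrow> a0"
    using seq_compactE[OF compact_imp_seq_compact[OF K], of a] ab(1) by metis
  have "(\<lambda>n. u (r n) - a (r n)) \<longlonglongrightarrow> l - a0"
    using r(3) LIMSEQ_subseq_LIMSEQ[OF l r(2)] by (auto intro!: tendsto_diff simp: o_def)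
  then have "(\<lambda>n. b (r n)) \<longlonglongrightarrow> l - a0" by (simp add: ab(3))
  then have "l - a0 \<in> H" by (rule closed_sequentially[OF H, rotated]) (rule ab(2))
  then show "l \<in> K + H" using r(1) by (metis add.commute diff_add_cancel set_plus_intro)
qed

text \<open>Provides one compact set that carries all translates of a compactly supported function
  along a convergent sequence, as dominated convergence needs.\<close>

lemma convergent_seq_compact:
  fixes u :: "nat \<Rightarrow> 'a::topological_space"
  assumes "u \<longlonglongrightarrow> l"
  shows "compact (insert l (range u))"
proof (rule compactI)
  fix \<C> assume C: "\<forall>T\<in>\<C>. open T" "insert l (range u) \<subseteq> \<Union>\<C>"
  then obtain T where T: "T \<in> \<C>" "l \<in> T" by blast
  then have "eventually (\<lambda>n. u n \<in> T) sequentially"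
    using assms C(1) by (intro topological_tendstoD) auto
  then obtain N where N: "\<And>n. n \<ge> N \<Longrightarrow> u n \<in> T" by (auto simp: eventually_sequentially)
  have "\<forall>n. \<exists>S\<in>\<C>. u n \<in> S" using C(2) by blast
  then obtain S where S: "\<And>n. S n \<in> \<C>" "\<And>n. u n \<in> S n" by metis
  have "insert l (range u) \<subseteq> \<Union>(insert T (S ` {..<N}))"
    using N S(2) T(2) by (auto simp: not_less) (metis lessThan_iff not_le_imp_less)
  then show "\<exists>\<C>'\<subseteq>\<C>. finite \<C>' \<and> insert l (range u) \<subseteq> \<Union>\<C>'"
    using T(1) S(1) by (intro exI[of _ "insert T (S ` {..<N})"]) auto
qed

lemma Cc_bounded:
  fixes f :: "'a::topological_space \<Rightarrow> 'b::real_normed_vector"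
  assumes "f \<in> Cc"
  obtains K B where "compact K" "\<And>s. s \<notin> K \<Longrightarrow> f s = 0" "0 \<le> B" "\<And>s. norm (f s) \<le> B"
proof -
  define K where "K = closure {x. f x \<noteq> 0}"
  have K: "compact K" and f: "continuous_on UNIV f" using assms by (auto simp: Cc_def K_def)
  have z: "f s = 0" if "s \<notin> K" for s
    using that closure_subset[of "{x. f x \<noteq> 0}"] by (auto simp: K_def)
  have "bounded (f ` K)"
    using K f by (meson compact_continuous_image compact_imp_bounded continuous_on_subset subset_UNIV)
  then obtain B where "\<And>s. s \<in> K \<Longrightarrow> norm (f s) \<le> B" by (auto simp: bounded_iff)
  then have "norm (f s) \<le> \<bar>B\<bar>" for s using z[of s] by (cases "s \<in> K") force+
  then show thesis using K z by (intro that[of K "\<bar>B\<bar>"]) auto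
qed

lemma CcI:
  fixes f :: "'a::t2_space \<Rightarrow> 'b::real_normed_vector"
  assumes "continuous_on UNIV f" "compact K" "\<And>s. s \<notin> K \<Longrightarrow> f s = 0"
  shows "f \<in> Cc"
proof -
  have "{x. f x \<noteq> 0} \<subseteq> K" using assms(3) by blast
  then have "closure {x. f x \<noteq> 0} \<subseteq> K"
    using assms(2) by (simp add: closure_minimal compact_imp_closed)
  then show ?thesis
    using assms(1) compact_Int_closed[OF assms(2), of "closure {x. f x \<noteq> 0}"]
    by (simp add: Cc_def Int_absorb1)
qed

lemma Cc_continuous: "f \<in> Cc \<Longrightarrow> continuous_on UNIV f"
  by (simp add: Cc_def)

lemma integrable_compact_support:
  fixes f :: "'a::t2_space \<Rightarrow> 'b::{banach, second_countable_topology}"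
  assumes M: "sets M = sets borel" and K: "compact K" "emeasure M K < \<infinity>"
    and f: "f \<in> borel_measurable borel" "\<And>s. s \<notin> K \<Longrightarrow> f s = 0" "\<And>s. norm (f s) \<le> B"
  shows "integrable M f" and "norm (LINT s|M. f s) \<le> B * measure M K"
proof -
  have Ks: "K \<in> sets M" using K(1) M by (simp add: borel_compact)
  have fM: "f \<in> borel_measurable M" using f(1) measurable_cong_sets[OF M refl] by blast
  have i: "integrable M (\<lambda>s. B * indicat_real K s)"
    using Ks K(2) by (intro integrable_mult_right integrable_real_indicator) auto
  have le: "norm (f s) \<le> norm (B * indicat_real K s)" for s
    using f(2)[of s] f(3)[of s] by (auto simp: indicator_def)
  show I: "integrable M f"
    by (rule Bochner_Integration.integrable_bound[OF i fM]) (use le in auto)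
  have "norm (LINT s|M. f s) \<le> (LINT s|M. norm (f s))" by simp
  also have "\<dots> \<le> (LINT s|M. B * indicat_real K s)"
    using I i le f(3) by (intro integral_mono) (auto simp: indicator_def f(2))
  also have "\<dots> = B * measure M K"
    using Ks K(2) by (simp add: measure_def)
  finally show "norm (LINT s|M. f s) \<le> B * measure M K" .
qed

lemma tendsto_integral_compact_support:
  fixes f :: "'a::t2_space \<Rightarrow> 'b::{banach, second_countable_topology}"
  assumes M: "sets M = sets borel" and K: "compact K" "emeasure M K < \<infinity>"
    and meas: "\<And>n. F n \<in> borel_measurable borel" "f \<in> borel_measurable borel"
    and z: "\<And>n s. s \<notin> K \<Longrightarrow> F n s = 0" and B: "\<And>n s. norm (F n s) \<le> B"
    and lim: "AE s in M. (\<lambda>n. F n s) \<longlonglongrightarrow> f s"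
  shows "(\<lambda>n. LINT s|M. F n s) \<longlonglongrightarrow> (LINT s|M. f s)"
proof (rule integral_dominated_convergence[where w = "\<lambda>s. B * indicat_real K s"])
  have Ks: "K \<in> sets M" using K(1) M by (simp add: borel_compact)
  show "integrable M (\<lambda>s. B * indicat_real K s)"
    using Ks K(2) by (intro integrable_mult_right integrable_real_indicator) auto
  show "f \<in> borel_measurable M" "F n \<in> borel_measurable M" for n
    using meas measurable_cong_sets[OF M refl] by blast+
  show "AE s in M. norm (F n s) \<le> B * indicat_real K s" for n
    using B[of n] z[of _ n] by (auto simp: indicator_def)
qed (fact lim)

lemma continuous_borel: "continuous_on UNIV f \<Longrightarrow> f \<in> borel_measurable borel"
  by (rule borel_measurable_continuous_onI)

lemma sequential_continuity:
  fixes f :: "'a::first_countable_topology \<Rightarrow> 'b::topological_space"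
  assumes "\<And>u l. u \<longlonglongrightarrow> l \<Longrightarrow> (\<lambda>n. f (u n)) \<longlonglongrightarrow> f l"
  shows "continuous_on UNIV f"
  unfolding continuous_on_def tendsto_at_iff_sequentially using assms by (simp add: o_def)

text \<open>A finite subcover is made disjoint by removing the earlier members. The sample point
  \<open>p i\<close> is the centre of a covering set and need not lie in \<open>E i\<close>;
  \<open>P (p i) s\<close> is meant as closeness of a value at s to the value at that
  centre.\<close>

lemma compact_partition:
  fixes K :: "'a::t2_space set"
  assumes K: "compact K" and P: "\<And>s. s \<in> K \<Longrightarrow> eventually (P s) (nhds s)"
  obtains n :: nat and p E where "\<And>i. i < n \<Longrightarrow> p i \<in> K" "\<And>i. i < n \<Longrightarrow> E i \<in> sets borel"
    "disjoint_family_on E {..<n}" "(\<Union>i<n. E i) = K" "\<And>i s. i < n \<Longrightarrow> s \<in> E i \<Longrightarrow> P (p i) s"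
proof -
  have "\<forall>s\<in>K. \<exists>U. open U \<and> s \<in> U \<and> (\<forall>s'\<in>U. P s s')"
    using P by (auto simp: eventually_nhds)
  then obtain U where U: "\<And>s. s \<in> K \<Longrightarrow> open (U s) \<and> s \<in> U s \<and> (\<forall>s'\<in>U s. P s s')" by metis
  obtain C where C: "C \<subseteq> K" "finite C" "K \<subseteq> (\<Union>c\<in>C. U c)"
    using compactE_image[OF K, of K U] U by blast
  obtain p where p: "bij_betw p {0..<card C} C" using ex_bij_betw_nat_finite[OF C(2)] by blast
  let ?n = "card C"
  have pC: "p ` {..<?n} = C" using p by (simp add: bij_betw_def atLeast0LessThan)
  then have pK: "p i \<in> K" if "i < ?n" for i using that C(1) by blast
  define E where "E i = (K \<inter> U (p i)) - (\<Union>j<i. U (p j))" for i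
  have "disjoint_family_on E {..<?n}"
    unfolding disjoint_family_on_def
  proof clarsimp
    fix i j :: nat assume "i \<noteq> j"
    then show "E i \<inter> E j = {}" by (cases "i < j") (auto simp: E_def)
  qed
  moreover have "(\<Union>i<?n. E i) = K"
  proof (rule set_eqI, rule iffI)
    fix s assume s: "s \<in> K"
    then obtain c where c: "c \<in> p ` {..<?n}" "s \<in> U c" using C(3) unfolding pC by auto
    then obtain i where i: "i < ?n" "s \<in> U (p i)" by auto
    define j where "j = (LEAST j. s \<in> U (p j))"
    have j: "s \<in> U (p j)" "j \<le> i" "\<And>l. l < j \<Longrightarrow> s \<notin> U (p l)"
      unfolding j_def using i(2) by (auto intro: LeastI Least_le dest: not_less_Least)
    then show "s \<in> (\<Union>i<?n. E i)" using s i(1) by (auto simp: E_def intro!: bexI[of _ j])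
  qed (auto simp: E_def)
  moreover have "E i \<in> sets borel" if "i < ?n" for i
  proof -
    have "open (U (p i))" "open (\<Union>j<i. U (p j))" using U pK that by auto
    then show ?thesis
      unfolding E_def by (intro sets.Diff sets.Int borel_compact borel_open K)
  qed
  moreover have "P (p i) s" if "i < ?n" "s \<in> E i" for i s
    using U[OF pK[OF that(1)]] that(2) by (auto simp: E_def)
  ultimately show thesis using pK by (intro that[of ?n p E]) auto
qed

section \<open>Weak integrals of vector-valued functions and their Riemann sums\<close>

context hilbert_space
begin

text \<open>The Riemann sum is the weak integral of the step function with value
  \<open>F (p i)\<close> on \<open>E i\<close>, so the error is an integral over K of something
  bounded by \<epsilon> times the norm of \<eta>. The partition is an argument and not constructed
  inside, because one partition will later have to serve all covariant pairs at once.\<close>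

lemma riemann_sum_approx:
  fixes F :: "'a::t2_space \<Rightarrow> 'h"
  assumes M: "sets M = sets borel" and K: "compact K" "emeasure M K < \<infinity>"
    and F: "\<And>s. F s \<in> vectors H" "\<And>s. s \<notin> K \<Longrightarrow> F s = vzero H"
    and meas: "(\<lambda>s. vinner H (F s) \<eta>) \<in> borel_measurable borel"
    and p: "\<And>i. i < n \<Longrightarrow> p i \<in> K" and E: "\<And>i. i < n \<Longrightarrow> E i \<in> sets borel"
    and disj: "disjoint_family_on E {..<n}" and un: "(\<Union>i<n. E i) = K"
    and approx: "\<And>i s. i < n \<Longrightarrow> s \<in> E i \<Longrightarrow> vnorm H (vdiff H (F s) (F (p i))) \<le> \<epsilon>"
    and \<epsilon>: "0 \<le> \<epsilon>" and \<eta>: "\<eta> \<in> vectors H"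
  shows "cmod ((LINT s|M. vinner H (F s) \<eta>) -
           vinner H (vsum H (\<lambda>i. vscale H (measure M (E i)) (F (p i))) n) \<eta>)
         \<le> \<epsilon> * measure M K * vnorm H \<eta>"
proof -
  define g where "g s = (\<Sum>i<n. indicat_real (E i) s *\<^sub>R vinner H (F (p i)) \<eta>)" for s
  have EM: "E i \<in> sets M" if "i < n" for i using E[OF that] M by simp
  have KM: "K \<in> sets M" using K(1) M by (simp add: borel_compact)
  have Efin: "emeasure M (E i) < \<infinity>" if "i < n" for i
  proof -
    have "E i \<subseteq> K" using un that by blast
    then show ?thesis using emeasure_mono[OF _ KM] K(2) by (metis le_less_trans)
  qed
  have gi: "integrable M (\<lambda>s. indicat_real (E i) s *\<^sub>R vinner H (F (p i)) \<eta>)" if "i < n" for i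
    using Efin EM that by auto
  have "(LINT s|M. g s) = (\<Sum>i<n. LINT s|M. indicat_real (E i) s *\<^sub>R vinner H (F (p i)) \<eta>)"
    unfolding g_def by (rule Bochner_Integration.integral_sum) (use gi in auto)
  also have "\<dots> = (\<Sum>i<n. measure M (E i) *\<^sub>R vinner H (F (p i)) \<eta>)"
    using Efin EM by (intro sum.cong refl) (simp add: measure_def)
  also have "\<dots> = vinner H (vsum H (\<lambda>i. vscale H (measure M (E i)) (F (p i))) n) \<eta>"
    using F \<eta> by (simp add: inner_vsum inner_scale scaleR_conv_of_real)
  finally have g: "(LINT s|M. g s) = vinner H (vsum H (\<lambda>i. vscale H (measure M (E i)) (F (p i))) n) \<eta>" .
  have gint: "integrable M g" unfolding g_def by (rule Bochner_Integration.integrable_sum) (use gi in auto)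
  have gE: "g s = vinner H (F (p i)) \<eta>" if "i < n" "s \<in> E i" for i s
  proof -
    have "indicat_real (E j) s = (if j = i then 1 else 0)" if "j < n" for j
      using disj \<open>i < n\<close> \<open>s \<in> E i\<close> that by (auto simp: disjoint_family_on_def indicator_def)
    then have "g s = (\<Sum>j<n. if j = i then vinner H (F (p j)) \<eta> else 0)"
      unfolding g_def by (intro sum.cong) auto
    then show ?thesis using that(1) by simp
  qed
  have g0: "g s = 0" if "s \<notin> K" for s
    unfolding g_def using that un by (intro sum.neutral) (auto simp: indicator_def)
  have le: "cmod (vinner H (F s) \<eta> - g s) \<le> \<epsilon> * vnorm H \<eta>" for s
  proof (cases "s \<in> K")
    case True
    then obtain i where i: "i < n" "s \<in> E i" using un by blast
    have "cmod (vinner H (vdiff H (F s) (F (p i))) \<eta>) \<le> vnorm H (vdiff H (F s) (F (p i))) * vnorm H \<eta>"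
      using F(1) \<eta> by (simp add: cauchy_schwarz)
    also have "\<dots> \<le> \<epsilon> * vnorm H \<eta>" using approx[OF i] \<eta> by (simp add: mult_right_mono)
    finally show ?thesis using F(1) \<eta> by (simp add: inner_diff gE[OF i])
  qed (use g0 F(2) \<eta> \<epsilon> in auto)
  have gm: "g \<in> borel_measurable borel"
    using borel_measurable_integrable[OF gint] measurable_cong_sets[OF M refl] by blast
  have dm: "(\<lambda>s. vinner H (F s) \<eta> - g s) \<in> borel_measurable borel"
    using meas gm by (rule borel_measurable_diff)
  have d0: "vinner H (F s) \<eta> - g s = 0" if "s \<notin> K" for s
    using g0[OF that] F(2)[OF that] \<eta> by simp
  note I = integrable_compact_support[OF M K dm d0 le]
  have "integrable M (\<lambda>s. vinner H (F s) \<eta>)"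
    using Bochner_Integration.integrable_add[OF I(1) gint] by simp
  then have "(LINT s|M. vinner H (F s) \<eta> - g s) = (LINT s|M. vinner H (F s) \<eta>) - (LINT s|M. g s)"
    using gint by simp
  then show ?thesis using I(2) g by (simp add: mult.assoc mult.commute mult.left_commute)
qed

lemma inner_continuous:
  fixes F :: "'a::topological_space \<Rightarrow> 'h"
  assumes F: "\<And>s. F s \<in> vectors H"
    and cont: "\<And>s \<epsilon>. 0 < \<epsilon> \<Longrightarrow> eventually (\<lambda>s'. vnorm H (vdiff H (F s') (F s)) \<le> \<epsilon>) (nhds s)"
    and \<eta>: "\<eta> \<in> vectors H"
  shows "continuous_on UNIV (\<lambda>s. vinner H (F s) \<eta>)"
  unfolding continuous_on_def
proof
  fix s
  have "((\<lambda>s. vinner H (F s) \<eta>) \<longlongrightarrow> vinner H (F s) \<eta>) (nhds s)"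
  proof (rule tendstoI)
    fix e :: real assume e: "0 < e"
    have p: "0 < vnorm H \<eta> + 1" using norm_nonneg[OF \<eta>] by linarith
    define d where "d = e / (vnorm H \<eta> + 1) / 2"
    have d: "0 < d" using e p by (simp add: d_def)
    have "d * vnorm H \<eta> < d * (vnorm H \<eta> + 1)" using d by (intro mult_strict_left_mono) auto
    also have "\<dots> = e / 2" using p by (simp add: d_def field_simps)
    finally have d2: "d * vnorm H \<eta> < e" using e by simp
    show "eventually (\<lambda>s'. dist (vinner H (F s') \<eta>) (vinner H (F s) \<eta>) < e) (nhds s)"
      using cont[OF d]
    proof eventually_elim
      case (elim s')
      have "dist (vinner H (F s') \<eta>) (vinner H (F s) \<eta>) = cmod (vinner H (vdiff H (F s') (F s)) \<eta>)"
        using F \<eta> by (simp add: inner_diff dist_norm)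
      also have "\<dots> \<le> vnorm H (vdiff H (F s') (F s)) * vnorm H \<eta>"
        using F \<eta> by (simp add: cauchy_schwarz)
      also have "\<dots> \<le> d * vnorm H \<eta>" using elim \<eta> by (simp add: mult_right_mono)
      finally show ?case using d2 by simp
    qed
  qed
  then show "((\<lambda>s. vinner H (F s) \<eta>) \<longlongrightarrow> vinner H (F s) \<eta>) (at s within UNIV)"
    by (rule tendsto_mono[rotated]) (simp add: at_within_def)
qed

lemma weak_integral_approx:
  fixes F :: "'a::t2_space \<Rightarrow> 'h"
  assumes M: "sets M = sets borel" and K: "compact K" "emeasure M K < \<infinity>"
    and F: "\<And>s. F s \<in> vectors H" "\<And>s. s \<notin> K \<Longrightarrow> F s = vzero H"
    and cont: "\<And>s \<epsilon>. 0 < \<epsilon> \<Longrightarrow> eventually (\<lambda>s'. vnorm H (vdiff H (F s') (F s)) \<le> \<epsilon>) (nhds s)"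
    and \<epsilon>: "0 < \<epsilon>"
  shows "\<exists>n p (c :: nat \<Rightarrow> real). (\<forall>i<n. p i \<in> K) \<and>
    (\<forall>\<eta>\<in>vectors H. cmod ((LINT s|M. vinner H (F s) \<eta>) -
       vinner H (vsum H (\<lambda>i. vscale H (c i) (F (p i))) n) \<eta>) \<le> \<epsilon> * vnorm H \<eta>)"
proof -
  \<comment> \<open>The added 1 keeps the divisor positive when K is a null set; the same device
    recurs below with norms and other constants.\<close>
  define d where "d = \<epsilon> / (measure M K + 1)"
  have mp: "0 < measure M K + 1" by (simp add: add_nonneg_pos)
  have d: "0 < d" "d * measure M K \<le> \<epsilon>" using \<epsilon> mp by (auto simp: d_def field_simps)
  have "eventually (\<lambda>s'. vnorm H (vdiff H (F s') (F s)) \<le> d) (nhds s)" for s by (rule cont[OF d(1)])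
  then obtain n p E where p: "\<And>i. i < n \<Longrightarrow> p i \<in> K" and E: "\<And>i. i < n \<Longrightarrow> E i \<in> sets borel"
    "disjoint_family_on E {..<n}" "(\<Union>i<n. E i) = K"
    "\<And>i s. i < (n::nat) \<Longrightarrow> s \<in> E i \<Longrightarrow> vnorm H (vdiff H (F s) (F (p i))) \<le> d"
    by (rule compact_partition[OF K(1), where P = "\<lambda>s s'. vnorm H (vdiff H (F s') (F s)) \<le> d"]) blast
  show ?thesis
  proof (intro exI conjI allI impI ballI)
    show "i < n \<Longrightarrow> p i \<in> K" for i by (rule p)
    fix \<eta> assume \<eta>: "\<eta> \<in> vectors H"
    have "cmod ((LINT s|M. vinner H (F s) \<eta>) -
       vinner H (vsum H (\<lambda>i. vscale H (measure M (E i)) (F (p i))) n) \<eta>) \<le> d * measure M K * vnorm H \<eta>"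
      by (rule riemann_sum_approx[OF M K F continuous_borel[OF inner_continuous[OF F(1) cont \<eta>]]
            p E less_imp_le[OF d(1)] \<eta>])
    also have "\<dots> \<le> \<epsilon> * vnorm H \<eta>" using d(2) \<eta> by (simp add: mult_right_mono)
    finally show "cmod ((LINT s|M. vinner H (F s) \<eta>) -
       vinner H (vsum H (\<lambda>i. vscale H (measure M (E i)) (F (p i))) n) \<eta>) \<le> \<epsilon> * vnorm H \<eta>" .
  qed
qed

text \<open>Riemann sums with error at most 1/(m+1) form a Cauchy sequence, and their limit
  represents the functional. Completeness thus replaces the Riesz representation theorem.\<close>

lemma weak_integral_exists:
  fixes F :: "'a::t2_space \<Rightarrow> 'h"
  assumes M: "sets M = sets borel" and K: "compact K" "emeasure M K < \<infinity>"
    and F: "\<And>s. F s \<in> vectors H" "\<And>s. s \<notin> K \<Longrightarrow> F s = vzero H"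
    and cont: "\<And>s \<epsilon>. 0 < \<epsilon> \<Longrightarrow> eventually (\<lambda>s'. vnorm H (vdiff H (F s') (F s)) \<le> \<epsilon>) (nhds s)"
  shows "\<exists>\<zeta>\<in>vectors H. \<forall>\<eta>\<in>vectors H. vinner H \<zeta> \<eta> = (LINT s|M. vinner H (F s) \<eta>)"
proof -
  let ?I = "\<lambda>\<eta>. LINT s|M. vinner H (F s) \<eta>"
  have "\<exists>v\<in>vectors H. \<forall>\<eta>\<in>vectors H. cmod (?I \<eta> - vinner H v \<eta>) \<le> (1 / real (Suc m)) * vnorm H \<eta>" for m
  proof -
    have "0 < 1 / real (Suc m)" by simp
    from weak_integral_approx[OF M K F cont this] obtain n p and c :: "nat \<Rightarrow> real"
      where "\<forall>\<eta>\<in>vectors H. cmod (?I \<eta> -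
       vinner H (vsum H (\<lambda>i. vscale H (complex_of_real (c i)) (F (p i))) n) \<eta>) \<le> (1 / real (Suc m)) * vnorm H \<eta>"
      by auto
    then show ?thesis
      using F(1) by (intro bexI[of _ "vsum H (\<lambda>i. vscale H (complex_of_real (c i)) (F (p i))) n"]) auto
  qed
  then obtain v where v: "\<And>m. v m \<in> vectors H"
    "\<And>m \<eta>. \<eta> \<in> vectors H \<Longrightarrow> cmod (?I \<eta> - vinner H (v m) \<eta>) \<le> (1 / real (Suc m)) * vnorm H \<eta>"
    by metis
  have dv: "vnorm H (vdiff H (v m) (v n)) \<le> 1 / real (Suc m) + 1 / real (Suc n)" for m n
  proof (rule norm_leI)
    fix \<eta> assume \<eta>: "\<eta> \<in> vectors H"
    have "cmod (vinner H (vdiff H (v m) (v n)) \<eta>)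
      \<le> cmod (?I \<eta> - vinner H (v m) \<eta>) + cmod (?I \<eta> - vinner H (v n) \<eta>)"
      using v(1) \<eta> norm_triangle_ineq4[of "?I \<eta> - vinner H (v n) \<eta>" "?I \<eta> - vinner H (v m) \<eta>"]
      by (simp add: inner_diff)
    also have "\<dots> \<le> (1 / real (Suc m) + 1 / real (Suc n)) * vnorm H \<eta>"
      using v(2)[OF \<eta>, of m] v(2)[OF \<eta>, of n] by (simp only: distrib_right)
    finally show "cmod (vinner H (vdiff H (v m) (v n)) \<eta>) \<le> (1 / real (Suc m) + 1 / real (Suc n)) * vnorm H \<eta>" .
  qed (use v in auto)
  have small: "\<exists>N. \<forall>m\<ge>N. 1 / real (Suc m) < e" if "0 < e" for e :: real
  proof -
    obtain N where N: "1 / real (Suc N) < e" using \<open>0 < e\<close> nat_approx_posE by blast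
    have "1 / real (Suc m) < e" if "m \<ge> N" for m
    proof -
      have "1 / real (Suc m) \<le> 1 / real (Suc N)" using that by (intro divide_left_mono) auto
      then show ?thesis using N by linarith
    qed
    then show ?thesis by blast
  qed
  have "\<exists>\<zeta>\<in>vectors H. (\<lambda>n. vnorm H (vdiff H (v n) \<zeta>)) \<longlonglongrightarrow> 0"
  proof (rule complete)
    show "\<forall>\<epsilon>>0. \<exists>N. \<forall>m\<ge>N. \<forall>n\<ge>N. vnorm H (vdiff H (v m) (v n)) < \<epsilon>"
    proof (intro allI impI)
      fix \<epsilon> :: real assume "0 < \<epsilon>"
      then obtain N where N: "\<And>m. m \<ge> N \<Longrightarrow> 1 / real (Suc m) < \<epsilon> / 2"
        using small[of "\<epsilon> / 2"] by auto
      have "vnorm H (vdiff H (v m) (v n)) < \<epsilon>" if "m \<ge> N" "n \<ge> N" for m n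
        using dv[of m n] N[OF that(1)] N[OF that(2)] by linarith
      then show "\<exists>N. \<forall>m\<ge>N. \<forall>n\<ge>N. vnorm H (vdiff H (v m) (v n)) < \<epsilon>" by blast
    qed
  qed (use v in auto)
  then obtain \<zeta> where \<zeta>: "\<zeta> \<in> vectors H" "(\<lambda>n. vnorm H (vdiff H (v n) \<zeta>)) \<longlonglongrightarrow> 0" by blast
  have "vinner H \<zeta> \<eta> = ?I \<eta>" if \<eta>: "\<eta> \<in> vectors H" for \<eta>
  proof (rule LIMSEQ_unique)
    have "(\<lambda>n. vinner H (v n) \<eta> - vinner H \<zeta> \<eta>) \<longlonglongrightarrow> 0"
    proof (rule Lim_null_comparison)
      show "\<forall>\<^sub>F n in sequentially. norm (vinner H (v n) \<eta> - vinner H \<zeta> \<eta>) \<le> vnorm H (vdiff H (v n) \<zeta>) * vnorm H \<eta>"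
        using cauchy_schwarz[OF diff_closed[OF v(1) \<zeta>(1)] \<eta>] v(1) \<zeta>(1) \<eta> by (simp add: inner_diff)
      show "(\<lambda>n. vnorm H (vdiff H (v n) \<zeta>) * vnorm H \<eta>) \<longlonglongrightarrow> 0"
        using tendsto_mult_left_zero[OF \<zeta>(2)] .
    qed
    then show "(\<lambda>n. vinner H (v n) \<eta>) \<longlonglongrightarrow> vinner H \<zeta> \<eta>" by (rule LIM_zero_cancel)
    have "(\<lambda>n. vinner H (v n) \<eta> - ?I \<eta>) \<longlonglongrightarrow> 0"
    proof (rule Lim_null_comparison)
      show "\<forall>\<^sub>F n in sequentially. norm (vinner H (v n) \<eta> - ?I \<eta>) \<le> (1 / real (Suc n)) * vnorm H \<eta>"
        using v(2)[OF \<eta>] by (simp add: norm_minus_commute)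
      show "(\<lambda>n. (1 / real (Suc n)) * vnorm H \<eta>) \<longlonglongrightarrow> 0"
        using tendsto_mult_left_zero[OF LIMSEQ_Suc[OF lim_1_over_n]] by simp
    qed
    then show "(\<lambda>n. vinner H (v n) \<eta>) \<longlonglongrightarrow> ?I \<eta>" by (rule LIM_zero_cancel)
  qed
  then show ?thesis using \<zeta>(1) by blast
qed

end

section \<open>Functions vanishing at infinity\<close>

text \<open>The third assumption says that g is small wherever f is small. A superlevel set of g is
  then a closed subset of a compact one of f.\<close>

lemma C0_dominated:
  assumes "continuous_on UNIV g" "f \<in> C0"
    and "\<And>\<epsilon>. 0 < \<epsilon> \<Longrightarrow> \<exists>\<delta>>0. \<forall>x. \<epsilon> \<le> cmod (g x) \<longrightarrow> \<delta> \<le> cmod (f x)"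
  shows "g \<in> C0"
  unfolding C0_def
proof (intro CollectI conjI allI impI)
  fix \<epsilon> :: real assume "0 < \<epsilon>"
  then obtain \<delta> where \<delta>: "\<delta> > 0" "\<And>x. \<epsilon> \<le> cmod (g x) \<Longrightarrow> \<delta> \<le> cmod (f x)" using assms(3) by blast
  have "closed {x. \<epsilon> \<le> cmod (g x)}"
    using assms(1) by (intro closed_Collect_le continuous_intros)
  moreover have "compact {x. \<delta> \<le> cmod (f x)}" using assms(2) \<delta>(1) by (simp add: C0_def)
  ultimately have "compact ({x. \<delta> \<le> cmod (f x)} \<inter> {x. \<epsilon> \<le> cmod (g x)})" by (rule compact_Int_closed[rotated])
  moreover have "{x. \<delta> \<le> cmod (f x)} \<inter> {x. \<epsilon> \<le> cmod (g x)} = {x. \<epsilon> \<le> cmod (g x)}" using \<delta>(2) by auto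
  ultimately show "compact {x. \<epsilon> \<le> cmod (g x)}" by simp
qed (fact assms(1))

lemma C0_continuous: "f \<in> C0 \<Longrightarrow> continuous_on UNIV f"
  by (simp add: C0_def)

lemma C0_compact: "f \<in> C0 \<Longrightarrow> 0 < \<epsilon> \<Longrightarrow> compact {x. \<epsilon> \<le> cmod (f x)}"
  by (simp add: C0_def)

lemma C0_zero [simp]: "(\<lambda>x. 0) \<in> C0"
  by (simp add: C0_def)

lemma C0_scale:
  assumes f: "f \<in> C0"
  shows "(\<lambda>x. c * f x) \<in> C0"
proof (cases "c = 0")
  case False
  show ?thesis
  proof (rule C0_dominated[OF _ f])
    show "continuous_on UNIV (\<lambda>x. c * f x)"
      using C0_continuous[OF f] by (intro continuous_intros)
    fix \<epsilon> :: real assume "0 < \<epsilon>"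
    then show "\<exists>\<delta>>0. \<forall>x. \<epsilon> \<le> cmod (c * f x) \<longrightarrow> \<delta> \<le> cmod (f x)"
      using False by (intro exI[of _ "\<epsilon> / cmod c"]) (auto simp: norm_mult field_simps)
  qed
next
  case True
  then show ?thesis by simp
qed

lemma C0_cnj:
  assumes f: "f \<in> C0"
  shows "(\<lambda>x. cnj (f x)) \<in> C0"
proof (rule C0_dominated[OF _ f])
  show "continuous_on UNIV (\<lambda>x. cnj (f x))"
    using C0_continuous[OF f] by (intro continuous_intros)
qed auto

lemma C0_add:
  assumes "f \<in> C0" "g \<in> C0"
  shows "(\<lambda>x. f x + g x) \<in> C0"
  unfolding C0_def
proof (intro CollectI conjI allI impI)
  show cont: "continuous_on UNIV (\<lambda>x. f x + g x)"
    using C0_continuous[OF assms(1)] C0_continuous[OF assms(2)] by (intro continuous_intros)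
  fix \<epsilon> :: real assume "0 < \<epsilon>"
  let ?S = "\<lambda>h. {x. \<epsilon> / 2 \<le> cmod (h x)}"
  have "compact (?S f \<union> ?S g)" using assms \<open>0 < \<epsilon>\<close> by (intro compact_Un C0_compact) auto
  moreover have "closed {x. \<epsilon> \<le> cmod (f x + g x)}"
    by (rule closed_Collect_le[OF continuous_on_const continuous_on_norm[OF cont]])
  ultimately have "compact ((?S f \<union> ?S g) \<inter> {x. \<epsilon> \<le> cmod (f x + g x)})" by (rule compact_Int_closed)
  moreover have "(?S f \<union> ?S g) \<inter> {x. \<epsilon> \<le> cmod (f x + g x)} = {x. \<epsilon> \<le> cmod (f x + g x)}"
  proof -
    have "\<epsilon> / 2 \<le> cmod (f x) \<or> \<epsilon> / 2 \<le> cmod (g x)" if "\<epsilon> \<le> cmod (f x + g x)" for x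
      using that norm_triangle_ineq[of "f x" "g x"] by linarith
    then show ?thesis by auto
  qed
  ultimately show "compact {x. \<epsilon> \<le> cmod (f x + g x)}" by simp
qed

lemma C0_diff: "f \<in> C0 \<Longrightarrow> g \<in> C0 \<Longrightarrow> (\<lambda>x. f x - g x) \<in> C0"
  using C0_add[of f "\<lambda>x. - 1 * g x"] C0_scale[of g "- 1"] by simp

lemma C0_bounded:
  assumes "f \<in> C0"
  obtains B where "0 < B" "\<And>x. cmod (f x) \<le> B"
proof -
  have "compact (f ` {x. 1 \<le> cmod (f x)})"
    using assms by (intro compact_continuous_image)
      (auto simp: C0_def intro: continuous_on_subset)
  then obtain B where B: "\<And>x. 1 \<le> cmod (f x) \<Longrightarrow> cmod (f x) \<le> B"
    using compact_imp_bounded by (fastforce simp: bounded_iff)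
  have "cmod (f x) \<le> \<bar>B\<bar> + 1" for x
    using B[of x] by (cases "1 \<le> cmod (f x)") auto
  then show thesis by (intro that[of "\<bar>B\<bar> + 1"]) auto
qed

lemma C0_mult:
  assumes "f \<in> C0" "g \<in> C0"
  shows "(\<lambda>x. f x * g x) \<in> C0"
proof (rule C0_dominated[OF _ assms(2)])
  show "continuous_on UNIV (\<lambda>x. f x * g x)"
    using C0_continuous[OF assms(1)] C0_continuous[OF assms(2)] by (intro continuous_intros)
  fix \<epsilon> :: real assume \<epsilon>: "0 < \<epsilon>"
  obtain B where B: "0 < B" "\<And>x. cmod (f x) \<le> B" using C0_bounded[OF assms(1)] by blast
  have "\<epsilon> / B \<le> cmod (g x)" if "\<epsilon> \<le> cmod (f x * g x)" for x
  proof -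
    have "\<epsilon> \<le> B * cmod (g x)"
      using that mult_right_mono[OF B(2)[of x] norm_ge_zero[of "g x"]] by (simp add: norm_mult)
    then show ?thesis using B(1) by (simp add: field_simps)
  qed
  then show "\<exists>\<delta>>0. \<forall>x. \<epsilon> \<le> cmod (f x * g x) \<longrightarrow> \<delta> \<le> cmod (g x)"
    using B(1) \<epsilon> by (intro exI[of _ "\<epsilon> / B"]) auto
qed

lemma C0_homeo:
  assumes f: "f \<in> C0" and h: "continuous_on UNIV h" "continuous_on UNIV h'" "\<And>x. h' (h x) = x" "\<And>x. h (h' x) = x"
  shows "(\<lambda>x. f (h x)) \<in> C0"
  unfolding C0_def
proof (intro CollectI conjI allI impI)
  show "continuous_on UNIV (\<lambda>x. f (h x))"
    using C0_continuous[OF f] h(1) by (auto intro: continuous_on_compose2)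
  fix \<epsilon> :: real assume \<epsilon>: "0 < \<epsilon>"
  have "{x. \<epsilon> \<le> cmod (f (h x))} = h' ` {x. \<epsilon> \<le> cmod (f x)}"
    using h(3,4) by (auto intro: image_eqI[of _ _ "h _"])
  moreover have "compact {x. \<epsilon> \<le> cmod (f x)}" using f \<epsilon> by (simp add: C0_def)
  ultimately show "compact {x. \<epsilon> \<le> cmod (f (h x))}"
    using h(2) by (metis compact_continuous_image continuous_on_subset subset_UNIV)
qed

lemma Cc_C0_C0: "f \<in> Cc_C0 \<Longrightarrow> f s \<in> C0"
  by (simp add: Cc_C0_def)

lemma Cc_C0_eventually:
  assumes "f \<in> Cc_C0" "0 < \<epsilon>"
  shows "eventually (\<lambda>s. \<forall>x. cmod (f s x - f s0 x) < \<epsilon>) (nhds s0)"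
proof -
  have "uniform_limit UNIV f (f s0) (at s0)" using assms(1) by (simp add: Cc_C0_def)
  then have "eventually (\<lambda>s. \<forall>x. cmod (f s x - f s0 x) < \<epsilon>) (at s0)"
    using assms(2) by (auto dest: uniform_limitD simp: dist_norm)
  then show ?thesis using assms(2) by (auto simp: eventually_nhds_conv_at)
qed

lemma Cc_C0I:
  assumes "\<And>s. f s \<in> C0" "\<And>s \<epsilon>. 0 < \<epsilon> \<Longrightarrow> eventually (\<lambda>s'. \<forall>x. cmod (f s' x - f s x) < \<epsilon>) (nhds s)"
    and "compact (K :: 'a::t2_space set)" "\<And>s. s \<notin> K \<Longrightarrow> f s = (\<lambda>x. 0)"
  shows "f \<in> Cc_C0"
proof -
  have "uniform_limit UNIV f (f s) (at s)" for s
    using assms(2) by (intro uniform_limitI) (auto simp: dist_norm eventually_nhds_conv_at)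
  moreover have "compact (closure {s. f s \<noteq> (\<lambda>x. 0)})"
  proof -
    have "{s. f s \<noteq> (\<lambda>x. 0)} \<subseteq> K" using assms(4) by blast
    then have "closure {s. f s \<noteq> (\<lambda>x. 0)} \<subseteq> K"
      using assms(3) by (simp add: closure_minimal compact_imp_closed)
    then show ?thesis
      using compact_Int_closed[OF assms(3), of "closure {s. f s \<noteq> (\<lambda>x. 0)}"] by (simp add: Int_absorb1)
  qed
  ultimately show ?thesis using assms(1) by (simp add: Cc_C0_def)
qed

lemma Cc_C0_support:
  assumes "f \<in> Cc_C0"
  obtains K where "compact K" "\<And>s. s \<notin> K \<Longrightarrow> f s = (\<lambda>x. 0)"
  using assms closure_subset[of "{s. f s \<noteq> (\<lambda>x. 0)}"]
  by (intro that[of "closure {s. f s \<noteq> (\<lambda>x. 0)}"]) (auto simp: Cc_C0_def)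

lemma Cc_C0_tendsto:
  assumes "f \<in> Cc_C0" "s \<longlonglongrightarrow> s0" "x \<longlonglongrightarrow> x0"
  shows "(\<lambda>n. f (s n) (x n)) \<longlonglongrightarrow> f s0 x0"
proof (rule tendstoI)
  fix e :: real assume e: "0 < e"
  have "eventually (\<lambda>n. \<forall>y. cmod (f (s n) y - f s0 y) < e / 2) sequentially"
    using eventually_compose_filterlim[OF Cc_C0_eventually[OF assms(1), of "e/2" s0] assms(2)] e by simp
  moreover have "(\<lambda>n. f s0 (x n)) \<longlonglongrightarrow> f s0 x0"
    using C0_continuous[OF Cc_C0_C0[OF assms(1)], of s0] assms(3)
    by (intro continuous_on_tendsto_compose[of UNIV "f s0"]) auto
  then have "eventually (\<lambda>n. cmod (f s0 (x n) - f s0 x0) < e / 2) sequentially"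
    using e tendstoD[of _ _ _ "e/2"] by (fastforce simp: dist_norm)
  ultimately show "eventually (\<lambda>n. dist (f (s n) (x n)) (f s0 x0) < e) sequentially"
  proof eventually_elim
    case (elim n)
    have "cmod (f (s n) (x n) - f s0 x0) \<le> cmod (f (s n) (x n) - f s0 (x n)) + cmod (f s0 (x n) - f s0 x0)"
      using norm_triangle_ineq[of "f (s n) (x n) - f s0 (x n)" "f s0 (x n) - f s0 x0"] by simp
    then show ?case using elim(1)[rule_format, of "x n"] elim(2) by (simp add: dist_norm)
  qed
qed

text \<open>In terms of sequences: \<open>{(s, x). \<epsilon> \<le> |f s x|}\<close> is relatively compact.\<close>

lemma Cc_C0_subseq:
  fixes f :: "'g::{first_countable_topology, t2_space} \<Rightarrow> 'x::first_countable_topology \<Rightarrow> complex"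
  assumes f: "f \<in> Cc_C0" and \<epsilon>: "0 < \<epsilon>" and big: "\<And>n. \<epsilon> \<le> cmod (f (s n) (x n))"
  shows "\<exists>r s0 x0. strict_mono (r :: nat \<Rightarrow> nat) \<and> (s \<circ> r) \<longlonglongrightarrow> s0 \<and> (x \<circ> r) \<longlonglongrightarrow> x0"
proof -
  obtain K where K: "compact K" "\<And>s. s \<notin> K \<Longrightarrow> f s = (\<lambda>x. 0)" using Cc_C0_support[OF f] by blast
  have "s n \<in> K" for n using big[of n] K(2)[of "s n"] \<epsilon> by (cases "s n \<in> K") auto
  then obtain s0 r where r: "strict_mono (r :: nat \<Rightarrow> nat)" "(s \<circ> r) \<longlonglongrightarrow> s0"
    using seq_compactE[OF compact_imp_seq_compact[OF K(1)], of s] by metis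
  \<comment> \<open>Near \<open>s0\<close> the functions \<open>f s\<close> differ from
    \<open>f s0\<close> by less than half of \<epsilon>, uniformly on X. So the points x end up in a
    superlevel set of the single function \<open>f s0\<close>, which is compact.\<close>
  have "eventually (\<lambda>n. \<forall>y. cmod (f (s (r n)) y - f s0 y) < \<epsilon> / 2) sequentially"
    using eventually_compose_filterlim[OF Cc_C0_eventually[OF f, of "\<epsilon>/2" s0] r(2)] \<epsilon> by simp
  then obtain N where N: "\<And>n y. n \<ge> N \<Longrightarrow> cmod (f (s (r n)) y - f s0 y) < \<epsilon> / 2"
    by (auto simp: eventually_sequentially)
  let ?C = "{y. \<epsilon> / 2 \<le> cmod (f s0 y)}"
  have C: "compact ?C" using \<epsilon> by (intro C0_compact Cc_C0_C0[OF f]) simp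
  have "x (r (n + N)) \<in> ?C" for n
  proof -
    have "cmod (f (s (r (n + N))) (x (r (n + N))) - f s0 (x (r (n + N)))) < \<epsilon> / 2" by (rule N) simp
    moreover have "cmod (f (s (r (n + N))) (x (r (n + N)))) \<le>
        cmod (f (s (r (n + N))) (x (r (n + N))) - f s0 (x (r (n + N)))) + cmod (f s0 (x (r (n + N))))"
      by (metis diff_add_cancel norm_triangle_ineq)
    ultimately have "\<epsilon> / 2 \<le> cmod (f s0 (x (r (n + N))))"
      using big[of "r (n + N)"] by linarith
    then show ?thesis by simp
  qed
  then obtain x0 r' where r': "strict_mono (r' :: nat \<Rightarrow> nat)" "((\<lambda>n. x (r (n + N))) \<circ> r') \<longlonglongrightarrow> x0"
    using seq_compactE[OF compact_imp_seq_compact[OF C], of "\<lambda>n. x (r (n + N))"] by metis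
  define q where "q n = r (r' n + N)" for n
  have q: "strict_mono (\<lambda>n. r' n + N)" using r'(1) by (simp add: strict_mono_def)
  have "strict_mono q" using q r(1) by (simp add: q_def strict_mono_def)
  moreover have "(s \<circ> q) \<longlonglongrightarrow> s0"
    using LIMSEQ_subseq_LIMSEQ[OF r(2) q] by (simp add: q_def o_def)
  moreover have "(x \<circ> q) \<longlonglongrightarrow> x0" using r'(2) by (simp add: q_def o_def)
  ultimately show ?thesis by blast
qed

text \<open>Arguments at which the values grow without bound would, by \<open>Cc_C0_subseq\<close>,
  have a subsequence converging in both variables, along which the values converge.\<close>

lemma Cc_C0_bounded:
  fixes f :: "'g::{first_countable_topology, t2_space} \<Rightarrow> 'x::first_countable_topology \<Rightarrow> complex"
  assumes f: "f \<in> Cc_C0"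
  obtains B where "0 < B" "\<And>s x. cmod (f s x) \<le> B"
proof (rule ccontr)
  assume *: "\<not> thesis"
  have "\<exists>s x. real (Suc n) < cmod (f s x)" for n
    using that[of "real (Suc n)"] * not_less by fastforce
  then obtain s x where sx: "\<And>n. real (Suc n) < cmod (f (s n) (x n))" by metis
  have "1 \<le> cmod (f (s n) (x n))" for n using sx[of n] by simp
  then obtain r s0 x0 where r: "strict_mono (r :: nat \<Rightarrow> nat)" "(s \<circ> r) \<longlonglongrightarrow> s0" "(x \<circ> r) \<longlonglongrightarrow> x0"
    using Cc_C0_subseq[OF f zero_less_one, of s x] by blast
  have "(\<lambda>n. f ((s \<circ> r) n) ((x \<circ> r) n)) \<longlonglongrightarrow> f s0 x0" by (rule Cc_C0_tendsto[OF f r(2,3)])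
  then have "Bseq (\<lambda>n. f (s (r n)) (x (r n)))"
    by (auto intro!: convergent_imp_Bseq simp: convergent_def)
  then obtain C where C: "\<And>n. cmod (f (s (r n)) (x (r n))) \<le> C" by (meson BseqE)
  obtain n where n: "C < real n" using reals_Archimedean2 by blast
  have "real n \<le> real (Suc (r n))" using seq_suble[OF r(1), of n] by simp
  then show False using n C[of n] sx[of "r n"] by linarith
qed

lemma Cc_C0_add:
  fixes f g :: "'g::t2_space \<Rightarrow> 'x::topological_space \<Rightarrow> complex"
  assumes f: "f \<in> Cc_C0" and g: "g \<in> Cc_C0"
  shows "(\<lambda>s x. f s x + g s x) \<in> Cc_C0"
proof -
  obtain K where K: "compact K" "\<And>s. s \<notin> K \<Longrightarrow> f s = (\<lambda>x. 0)" using Cc_C0_support[OF f] by blast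
  obtain L where L: "compact L" "\<And>s. s \<notin> L \<Longrightarrow> g s = (\<lambda>x. 0)" using Cc_C0_support[OF g] by blast
  show ?thesis
  proof (rule Cc_C0I[of _ "K \<union> L"])
    fix s and \<epsilon> :: real assume \<epsilon>: "0 < \<epsilon>"
    then have "0 < \<epsilon> / 2" by simp
    from Cc_C0_eventually[OF f this, of s] Cc_C0_eventually[OF g this, of s]
    show "eventually (\<lambda>s'. \<forall>x. cmod (f s' x + g s' x - (f s x + g s x)) < \<epsilon>) (nhds s)"
    proof eventually_elim
      case (elim s')
      have "cmod (f s' x + g s' x - (f s x + g s x)) < \<epsilon>" for x
        using norm_triangle_ineq[of "f s' x - f s x" "g s' x - g s x"]
          elim(1)[rule_format, of x] elim(2)[rule_format, of x] by (simp add: algebra_simps)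
      then show ?case by blast
    qed
  next
    show "(\<lambda>x. f s x + g s x) \<in> C0" for s by (intro C0_add Cc_C0_C0 f g)
  qed (use K L in \<open>auto intro!: compact_Un\<close>)
qed

text \<open>The conditions on h cover elements of \<open>C0\<close> as well as constants, which need
  not vanish at infinity.\<close>

lemma Cc_C0_mult_left:
  fixes f :: "'g::t2_space \<Rightarrow> 'x::topological_space \<Rightarrow> complex"
  assumes f: "f \<in> Cc_C0" and h: "\<And>g. g \<in> C0 \<Longrightarrow> (\<lambda>x. h x * g x) \<in> C0" and B: "0 < B" "\<And>x. cmod (h x) \<le> B"
  shows "(\<lambda>s x. h x * f s x) \<in> Cc_C0"
proof -
  obtain K where K: "compact K" "\<And>s. s \<notin> K \<Longrightarrow> f s = (\<lambda>x. 0)" using Cc_C0_support[OF f] by blast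
  show ?thesis
  proof (rule Cc_C0I[OF _ _ K(1)])
    fix s and \<epsilon> :: real assume \<epsilon>: "0 < \<epsilon>"
    then have "0 < \<epsilon> / B" using B(1) by simp
    from Cc_C0_eventually[OF f this, of s]
    show "eventually (\<lambda>s'. \<forall>x. cmod (h x * f s' x - h x * f s x) < \<epsilon>) (nhds s)"
    proof eventually_elim
      case (elim s')
      have "cmod (h x * f s' x - h x * f s x) < \<epsilon>" for x
      proof -
        have "cmod (h x * f s' x - h x * f s x) = cmod (h x) * cmod (f s' x - f s x)"
          by (simp flip: norm_mult right_diff_distrib)
        also have "\<dots> \<le> B * cmod (f s' x - f s x)" using B(2) by (simp add: mult_right_mono)
        also have "\<dots> < B * (\<epsilon> / B)" using elim B(1) by (intro mult_strict_left_mono) auto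
        finally show ?thesis using B(1) by simp
      qed
      then show ?case by blast
    qed
  qed (use K(2) f h Cc_C0_C0 in auto)
qed

section \<open>Covariant representations and their integrated forms\<close>

lemma haar_measure_sets:
  assumes "haar_measure euclidean L S m"
  shows "sets m = sets borel" "space m = UNIV"
  using assms by (simp_all add: haar_measure_def borel_def)

lemma haar_integral_translate:
  fixes f :: "'g::topological_ab_group_add \<Rightarrow> 'b::{banach, second_countable_topology}"
  assumes m: "haar_measure euclidean (+) S m" and s: "s \<in> S" and f: "f \<in> borel_measurable borel"
  shows "(LINT r|m. f (r - s)) = (LINT r|m. f r)"
proof -
  have sets: "sets m = sets borel" and space: "space m = UNIV" using haar_measure_sets[OF m] by auto
  have meas: "(\<lambda>r. r - s) \<in> measurable m m"
    unfolding measurable_cong_sets[OF sets sets]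
    by (rule borel_measurable_continuous_onI) (intro continuous_intros)
  have "distr m m (\<lambda>r. r - s) = m"
  proof (rule measure_eqI)
    fix A assume A: "A \<in> sets (distr m m (\<lambda>r. r - s))"
    have "(\<lambda>r. r - s) -` A = (+) s ` A"
    proof (rule set_eqI)
      fix r show "r \<in> (\<lambda>r. r - s) -` A \<longleftrightarrow> r \<in> (+) s ` A"
        by (auto intro!: image_eqI[of _ _ "r - s"])
    qed
    then show "emeasure (distr m m (\<lambda>r. r - s)) A = emeasure m A"
      using A m s meas by (simp add: emeasure_distr space haar_measure_def)
  qed simp
  then have "(LINT r|m. f r) = (LINT r|distr m m (\<lambda>r. r - s). f r)" by simp
  also have "\<dots> = (LINT r|m. f (r - s))"
    using f meas by (intro integral_distr) (auto simp: measurable_cong_sets[OF sets refl])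
  finally show ?thesis by simp
qed

section \<open>Translation of functions in C_c(G, C_0(X)) by group elements\<close>

locale transformation_group =
  fixes act :: "'g::{topological_ab_group_add, second_countable_topology, t2_space} \<Rightarrow>
      'x::{second_countable_topology, t2_space} \<Rightarrow> 'x"
    and \<mu> :: "'g measure"
  assumes lc: "locally_compact_space (euclidean :: 'g topology)"
    and action: "continuous_action act"
    and haar: "haar_measure euclidean (+) UNIV \<mu>"
begin

lemmas sets_mu = haar_measure_sets[OF haar]

lemma mu_compact: "compact K \<Longrightarrow> emeasure \<mu> K < \<infinity>"
  using haar by (simp add: haar_measure_def)

lemma act_zero [simp]: "act 0 x = x"
  using action by (simp add: continuous_action_def)

lemma act_add: "act (s + t) x = act s (act t x)"
  using action by (simp add: continuous_action_def)

lemma act_minus [simp]: "act s (act (- s) x) = x" "act (- s) (act s x) = x"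
  by (simp_all flip: act_add)

lemma act_tendsto:
  assumes "(s \<longlongrightarrow> s0) F" "(x \<longlongrightarrow> x0) F"
  shows "((\<lambda>n. act (s n) (x n)) \<longlongrightarrow> act s0 x0) F"
proof -
  have "continuous_on UNIV (\<lambda>(s, x). act s x)" using action by (simp add: continuous_action_def)
  from continuous_on_tendsto_compose[OF this tendsto_Pair[OF assms]] show ?thesis by simp
qed

lemma continuous_act: "continuous_on UNIV (act s)" "continuous_on UNIV (\<lambda>s. act s x)"
  unfolding continuous_on_def by (auto intro!: act_tendsto tendsto_intros)

lemma C0_act: "f \<in> C0 \<Longrightarrow> (\<lambda>x. f (act s x)) \<in> C0"
  by (rule C0_homeo[of f "act s" "act (- s)"]) (auto intro: continuous_act)

text \<open>What left multiplication by the unitary of s does to f in the crossed product, as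
  \<open>integrated_op_translate\<close> confirms.\<close>

definition translate :: "'g \<Rightarrow> ('g \<Rightarrow> 'x \<Rightarrow> complex) \<Rightarrow> 'g \<Rightarrow> 'x \<Rightarrow> complex" where
  "translate s f = (\<lambda>r x. f (r - s) (act (- s) x))"

lemma translate_Cc_C0:
  assumes f: "f \<in> Cc_C0"
  shows "translate s f \<in> Cc_C0"
proof -
  obtain K where K: "compact K" "\<And>s. s \<notin> K \<Longrightarrow> f s = (\<lambda>x. 0)" using Cc_C0_support[OF f] by blast
  show ?thesis
  proof (rule Cc_C0I[where K = "(\<lambda>r. r + s) ` K"])
    show "translate s f r \<in> C0" for r
      unfolding translate_def by (intro C0_act Cc_C0_C0 f)
    fix r and \<epsilon> :: real assume "0 < \<epsilon>"
    have "filterlim (\<lambda>r'. r' - s) (nhds (r - s)) (nhds r)"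
      by (intro tendsto_intros) (simp add: filterlim_ident)
    from eventually_compose_filterlim[OF Cc_C0_eventually[OF f \<open>0 < \<epsilon>\<close>] this]
    show "eventually (\<lambda>r'. \<forall>x. cmod (translate s f r' x - translate s f r x) < \<epsilon>) (nhds r)"
      by eventually_elim (simp add: translate_def)
  next
    show "compact ((\<lambda>r. r + s) ` K)"
      using K(1) by (intro compact_continuous_image continuous_intros)
    show "translate s f r = (\<lambda>x. 0)" if "r \<notin> (\<lambda>r. r + s) ` K" for r
    proof -
      have "r - s \<notin> K" using that by (metis diff_add_cancel image_eqI)
      then show ?thesis using K(2) by (simp add: translate_def)
    qed
  qed
qed

text \<open>Suppose that it fails along a sequence tending to 0. A gap larger than \<epsilon> forces
  the translated or the original value to reach half of \<epsilon> infinitely often, so by relative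
  compactness the arguments of one of them converge along a subsequence; those of the other then
  converge too, as the translations tend to 0.\<close>

lemma translate_continuous:
  assumes f: "f \<in> Cc_C0" and \<epsilon>: "0 < \<epsilon>"
  shows "eventually (\<lambda>s. \<forall>r x. cmod (translate s f r x - f r x) \<le> \<epsilon>) (nhds 0)"
  unfolding eventually_nhds_iff_sequentially
proof (intro allI impI, rule ccontr)
  fix s :: "nat \<Rightarrow> 'g" assume s: "s \<longlonglongrightarrow> 0"
    and "\<not> eventually (\<lambda>n. \<forall>r x. cmod (translate (s n) f r x - f r x) \<le> \<epsilon>) sequentially"
  then have fr: "\<exists>\<^sub>F n in sequentially. \<exists>r x. \<epsilon> < cmod (translate (s n) f r x - f r x)"
    by (simp add: frequently_def not_less)
  define P where "P n = (\<exists>r x. \<epsilon> < cmod (translate (s n) f r x - f r x))" for n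
  have "infinite {n. P n}" using fr by (simp add: P_def frequently_cofinite flip: cofinite_eq_sequentially)
  then obtain q :: "nat \<Rightarrow> nat" where q: "strict_mono q" "\<And>n. P (q n)"
    using infinite_enumerate by blast
  have sq: "(\<lambda>n. s (q n)) \<longlonglongrightarrow> 0" using LIMSEQ_subseq_LIMSEQ[OF s q(1)] by (simp add: o_def)
  obtain r x where rx: "\<And>n. \<epsilon> < cmod (translate (s (q n)) f (r n) (x n) - f (r n) (x n))"
    using q(2) unfolding P_def by metis
  define r' where "r' n = r n - s (q n)" for n
  define x' where "x' n = act (- s (q n)) (x n)" for n
  \<comment> \<open>Once the arguments converge, both values tend to the same limit, which
    contradicts the gap.\<close>
  have no: False if u: "strict_mono (u :: nat \<Rightarrow> nat)" and l: "(\<lambda>n. r (u n)) \<longlonglongrightarrow> r0" "(\<lambda>n. x (u n)) \<longlonglongrightarrow> x0" for u r0 x0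
  proof -
    have su: "(\<lambda>n. s (q (u n))) \<longlonglongrightarrow> 0" using LIMSEQ_subseq_LIMSEQ[OF sq u] by (simp add: o_def)
    have "(\<lambda>n. r' (u n)) \<longlonglongrightarrow> r0 - 0" unfolding r'_def by (intro tendsto_diff l su)
    moreover have "(\<lambda>n. x' (u n)) \<longlonglongrightarrow> act (- 0) x0"
      unfolding x'_def by (intro act_tendsto tendsto_minus l su)
    ultimately have "(\<lambda>n. f (r' (u n)) (x' (u n)) - f (r (u n)) (x (u n))) \<longlonglongrightarrow> f r0 x0 - f r0 x0"
      using l by (intro tendsto_diff Cc_C0_tendsto[OF f]) auto
    then have "(\<lambda>n. cmod (f (r' (u n)) (x' (u n)) - f (r (u n)) (x (u n)))) \<longlonglongrightarrow> 0"
      by (simp add: tendsto_norm_zero_iff)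
    then have "0 \<ge> \<epsilon>"
      using rx by (intro LIMSEQ_le_const) (auto simp: translate_def r'_def x'_def intro!: less_imp_le)
    then show False using \<epsilon> by simp
  qed
  have "\<epsilon> / 2 \<le> cmod (f (r' n) (x' n)) \<or> \<epsilon> / 2 \<le> cmod (f (r n) (x n))" for n
    using rx[of n] norm_triangle_ineq4[of "f (r' n) (x' n)" "f (r n) (x n)"]
    by (auto simp: translate_def r'_def x'_def)
  then have "UNIV = {n. \<epsilon> / 2 \<le> cmod (f (r' n) (x' n))} \<union> {n. \<epsilon> / 2 \<le> cmod (f (r n) (x n))}" by auto
  then have "infinite {n. \<epsilon> / 2 \<le> cmod (f (r' n) (x' n))} \<or> infinite {n. \<epsilon> / 2 \<le> cmod (f (r n) (x n))}"
    by (metis finite_UnI infinite_UNIV_nat)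
  then show False
  proof
    assume "infinite {n. \<epsilon> / 2 \<le> cmod (f (r' n) (x' n))}"
    then obtain v :: "nat \<Rightarrow> nat" where v: "strict_mono v" "\<And>n. \<epsilon> / 2 \<le> cmod (f (r' (v n)) (x' (v n)))"
      using infinite_enumerate by blast
    obtain w r0 x0 where w: "strict_mono (w :: nat \<Rightarrow> nat)" "((\<lambda>n. r' (v n)) \<circ> w) \<longlonglongrightarrow> r0" "((\<lambda>n. x' (v n)) \<circ> w) \<longlonglongrightarrow> x0"
      using Cc_C0_subseq[OF f, of "\<epsilon>/2" "\<lambda>n. r' (v n)" "\<lambda>n. x' (v n)"] v(2) \<epsilon> by auto
    have vw: "strict_mono (\<lambda>n. v (w n))" using v(1) w(1) by (simp add: strict_mono_def)
    have su: "(\<lambda>n. s (q (v (w n)))) \<longlonglongrightarrow> 0" using LIMSEQ_subseq_LIMSEQ[OF sq vw] by (simp add: o_def)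
    have "(\<lambda>n. r' (v (w n)) + s (q (v (w n)))) \<longlonglongrightarrow> r0 + 0"
      using w(2) su by (intro tendsto_add) (auto simp: o_def)
    moreover have "(\<lambda>n. act (s (q (v (w n)))) (x' (v (w n)))) \<longlonglongrightarrow> act 0 x0"
      using w(3) su by (intro act_tendsto) (auto simp: o_def)
    ultimately show False using no[OF vw] by (simp add: r'_def x'_def)
  next
    assume "infinite {n. \<epsilon> / 2 \<le> cmod (f (r n) (x n))}"
    then obtain v :: "nat \<Rightarrow> nat" where v: "strict_mono v" "\<And>n. \<epsilon> / 2 \<le> cmod (f (r (v n)) (x (v n)))"
      using infinite_enumerate by blast
    obtain w r0 x0 where w: "strict_mono (w :: nat \<Rightarrow> nat)" "((\<lambda>n. r (v n)) \<circ> w) \<longlonglongrightarrow> r0" "((\<lambda>n. x (v n)) \<circ> w) \<longlonglongrightarrow> x0"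
      using Cc_C0_subseq[OF f, of "\<epsilon>/2" "\<lambda>n. r (v n)" "\<lambda>n. x (v n)"] v(2) \<epsilon> by auto
    have vw: "strict_mono (\<lambda>n. v (w n))" using v(1) w(1) by (simp add: strict_mono_def)
    show False using no[OF vw] w(2,3) by (simp add: o_def)
  qed
qed

end

section \<open>One covariant pair: contractivity and the integrated form\<close>

locale covariant_rep = transformation_group act \<mu>
  for act :: "'g::{topological_ab_group_add, second_countable_topology, t2_space} \<Rightarrow>
      'x::{second_countable_topology, t2_space} \<Rightarrow> 'x" and \<mu> +
  fixes \<rho> :: "('g, 'x, 'h) covariant_pair"
  assumes covariant: "\<rho> \<in> covariant_reps act"
begin

sublocale hilbert_space "cspace \<rho>"
  using covariant by (simp add: covariant_reps_def Let_def)

abbreviation "H \<equiv> cspace \<rho>"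

lemma
  assumes "f \<in> C0"
  shows frep_bounded: "bounded_operator H (frep \<rho> f)"
    and frep_add: "g \<in> C0 \<Longrightarrow> \<xi> \<in> vectors H \<Longrightarrow>
      frep \<rho> (\<lambda>x. f x + g x) \<xi> = vadd H (frep \<rho> f \<xi>) (frep \<rho> g \<xi>)"
    and frep_mult: "g \<in> C0 \<Longrightarrow> \<xi> \<in> vectors H \<Longrightarrow> frep \<rho> (\<lambda>x. f x * g x) \<xi> = frep \<rho> f (frep \<rho> g \<xi>)"
    and frep_scale: "\<xi> \<in> vectors H \<Longrightarrow> frep \<rho> (\<lambda>x. c * f x) \<xi> = vscale H c (frep \<rho> f \<xi>)"
    and frep_cnj: "\<xi> \<in> vectors H \<Longrightarrow> \<eta> \<in> vectors H \<Longrightarrow>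
      vinner H (frep \<rho> (\<lambda>x. cnj (f x)) \<xi>) \<eta> = vinner H \<xi> (frep \<rho> f \<eta>)"
    and covariance: "\<xi> \<in> vectors H \<Longrightarrow> grep \<rho> s (frep \<rho> f \<xi>) = frep \<rho> (\<lambda>x. f (act (- s) x)) (grep \<rho> s \<xi>)"
  using covariant assms by (simp_all add: covariant_reps_def Let_def)

lemma
  shows grep_unitary: "unitary_map H H (grep \<rho> s)"
    and grep_add: "\<xi> \<in> vectors H \<Longrightarrow> grep \<rho> (s + t) \<xi> = grep \<rho> s (grep \<rho> t \<xi>)"
    and grep_at: "\<xi> \<in> vectors H \<Longrightarrow> ((\<lambda>t. vnorm H (vdiff H (grep \<rho> t \<xi>) (grep \<rho> s \<xi>))) \<longlongrightarrow> 0) (at s)"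
  using covariant by (simp_all add: covariant_reps_def Let_def)

lemmas grepD = unitary_mapD[OF grep_unitary hilbert_space_axioms]
lemmas frep_closed [simp] = bounded_operatorD(1)[OF frep_bounded]
lemmas grep_closed [simp] = grepD(1)

lemma grep_zero: "\<xi> \<in> vectors H \<Longrightarrow> grep \<rho> 0 \<xi> = \<xi>"
  using grep_add[of \<xi> 0 0] grepD(8)[of "grep \<rho> 0 \<xi>" \<xi> 0] by simp

lemma grep_adjoint:
  assumes "\<xi> \<in> vectors H" "\<eta> \<in> vectors H"
  shows "vinner H (grep \<rho> s \<xi>) \<eta> = vinner H \<xi> (grep \<rho> (- s) \<eta>)"
proof -
  have "vinner H (grep \<rho> s \<xi>) \<eta> = vinner H (grep \<rho> s \<xi>) (grep \<rho> s (grep \<rho> (- s) \<eta>))"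
    using grep_add[of \<eta> s "- s"] assms by (simp add: grep_zero)
  then show ?thesis using assms by (simp add: grepD(6))
qed

lemma grep_eventually:
  assumes "\<xi> \<in> vectors H" "0 < \<epsilon>"
  shows "eventually (\<lambda>t. vnorm H (vdiff H (grep \<rho> t \<xi>) (grep \<rho> s \<xi>)) < \<epsilon>) (nhds s)"
  using order_tendstoD(2)[OF grep_at[OF assms(1), of s] assms(2)] assms
  by (simp add: eventually_nhds_conv_at)

lemma frep_adjoint:
  assumes "f \<in> C0" "\<xi> \<in> vectors H" "\<eta> \<in> vectors H"
  shows "vinner H (frep \<rho> f \<xi>) \<eta> = vinner H \<xi> (frep \<rho> (\<lambda>x. cnj (f x)) \<eta>)"
  using frep_cnj[OF C0_cnj[OF assms(1)] assms(2,3)] by simp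

lemma frep_zero: "\<xi> \<in> vectors H \<Longrightarrow> frep \<rho> (\<lambda>x. 0) \<xi> = vzero H"
  using frep_scale[of "\<lambda>x. 0" \<xi> 0] by (simp add: scale_zero)

lemma frep_diff:
  assumes "f \<in> C0" "g \<in> C0" "\<xi> \<in> vectors H"
  shows "frep \<rho> (\<lambda>x. f x - g x) \<xi> = vdiff H (frep \<rho> f \<xi>) (frep \<rho> g \<xi>)"
  using frep_add[OF assms(1) C0_scale[OF assms(2), of "- 1"] assms(3)] frep_scale[OF assms(2,3), of "- 1"]
  by (simp add: vdiff_def)

text \<open>
  With \<open>h = |f|\<^sup>2 / B\<^sup>2\<close>, the function \<open>h - h\<^sup>2\<close> is the square of a real function, so that
  \<open>\<parallel>\<pi>(h)\<xi>\<parallel>\<^sup>2 \<le> \<langle>\<pi>(h)\<xi>, \<xi>\<rangle>\<close> and hence \<open>\<parallel>\<pi>(h)\<xi>\<parallel> \<le> \<parallel>\<xi>\<parallel>\<close>.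
\<close>

lemma frep_contractive:
  assumes f: "f \<in> C0" and B: "\<And>x. cmod (f x) \<le> B" and \<xi>: "\<xi> \<in> vectors H"
  shows "vnorm H (frep \<rho> f \<xi>) \<le> B * vnorm H \<xi>"
proof (cases "B = 0")
  case True
  then have "f = (\<lambda>x. 0)" using B by auto
  then show ?thesis using \<xi> True by (simp add: frep_zero)
next
  case False
  \<comment> \<open>Any point of X will do here; \<open>undefined\<close> names one.\<close>
  then have Bp: "0 < B" using B[of undefined] norm_ge_zero[of "f undefined"] by linarith
  define k where "k x = (cmod (f x))\<^sup>2 / B\<^sup>2" for x
  have k: "0 \<le> k x" "k x \<le> 1" for x
    using B[of x] Bp by (auto simp: k_def intro!: power_mono)
  define h where "h x = complex_of_real (k x)" for x
  define q where "q x = complex_of_real (sqrt (k x - k x * k x))" for x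
  have contf: "continuous_on UNIV f" by (rule C0_continuous[OF f])
  have contk: "continuous_on UNIV k" unfolding k_def using Bp by (intro continuous_intros contf) auto
  have hf: "h = (\<lambda>x. (1 / B\<^sup>2) * (cnj (f x) * f x))"
    by (rule ext) (simp add: h_def k_def complex_norm_square[symmetric] mult.commute[of "cnj _"])
  have h0: "h \<in> C0" unfolding hf by (intro C0_scale C0_mult C0_cnj f)
  have q0: "q \<in> C0"
  proof (rule C0_dominated[OF _ h0])
    show "continuous_on UNIV q" unfolding q_def by (intro continuous_intros contk)
    fix \<epsilon> :: real assume e: "0 < \<epsilon>"
    have "\<epsilon>\<^sup>2 \<le> cmod (h x)" if "\<epsilon> \<le> cmod (q x)" for x
    proof -
      have p: "0 \<le> k x - k x * k x" using k[of x] mult_left_le[of "k x" "k x"] by simp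
      then have "\<epsilon> \<le> sqrt (k x - k x * k x)" using that by (simp add: q_def)
      then have "\<epsilon>\<^sup>2 \<le> k x - k x * k x" using e p by (metis less_eq_real_def power_mono real_sqrt_pow2)
      also have "\<dots> \<le> k x" using k[of x] by simp
      finally show ?thesis using k[of x] by (simp add: h_def)
    qed
    then show "\<exists>\<delta>>0. \<forall>x. \<epsilon> \<le> cmod (q x) \<longrightarrow> \<delta> \<le> cmod (h x)" using e by (intro exI[of _ "\<epsilon>\<^sup>2"]) auto
  qed
  have hsum: "h = (\<lambda>x. q x * q x + h x * h x)"
  proof
    fix x
    have "0 \<le> k x - k x * k x" using k[of x] mult_left_le[of "k x" "k x"] by simp
    then have "q x * q x = complex_of_real (k x - k x * k x)"
      unfolding q_def by (metis of_real_mult real_sqrt_mult_self abs_of_nonneg)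
    then show "h x = q x * q x + h x * h x" by (simp add: h_def)
  qed
  have hc: "(\<lambda>x. cnj (h x)) = h" "(\<lambda>x. cnj (q x)) = q" by (auto simp: h_def q_def)
  have inner_sq: "vinner H (frep \<rho> (\<lambda>x. g x * g x) \<xi>) \<xi> = complex_of_real ((vnorm H (frep \<rho> g \<xi>))\<^sup>2)"
    if "g \<in> C0" "(\<lambda>x. cnj (g x)) = g" for g
    using frep_mult[OF that(1,1) \<xi>] frep_adjoint[OF that(1) frep_closed[OF that(1) \<xi>] \<xi>]
      that inner_self_real[OF frep_closed[OF that(1) \<xi>]] by simp
  have "vinner H (frep \<rho> h \<xi>) \<xi> =
      complex_of_real ((vnorm H (frep \<rho> q \<xi>))\<^sup>2) + complex_of_real ((vnorm H (frep \<rho> h \<xi>))\<^sup>2)"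
    by (subst hsum, subst frep_add)
      (use q0 h0 \<xi> hc in \<open>simp_all add: C0_mult inner_add inner_sq\<close>)
  then have re: "Re (vinner H (frep \<rho> h \<xi>) \<xi>) = (vnorm H (frep \<rho> q \<xi>))\<^sup>2 + (vnorm H (frep \<rho> h \<xi>))\<^sup>2"
    by simp
  have re2: "Re (vinner H (frep \<rho> h \<xi>) \<xi>) \<le> vnorm H (frep \<rho> h \<xi>) * vnorm H \<xi>"
    using complex_Re_le_cmod order_trans cauchy_schwarz[OF frep_closed[OF h0 \<xi>] \<xi>] by blast
  have "vnorm H (frep \<rho> h \<xi>) \<le> vnorm H \<xi>"
  proof (rule ccontr)
    assume *: "\<not> ?thesis"
    then have "0 < vnorm H (frep \<rho> h \<xi>)" using norm_nonneg[OF \<xi>] by linarith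
    then have "vnorm H (frep \<rho> h \<xi>) * vnorm H \<xi> < (vnorm H (frep \<rho> h \<xi>))\<^sup>2"
      using * by (simp add: power2_eq_square)
    then show False using re re2 zero_le_power2[of "vnorm H (frep \<rho> q \<xi>)"] by linarith
  qed
  then have re3: "Re (vinner H (frep \<rho> h \<xi>) \<xi>) \<le> vnorm H \<xi> * vnorm H \<xi>"
    using re2 mult_right_mono[OF _ norm_nonneg[OF \<xi>]] by (meson order_trans)
  \<comment> \<open>The left-hand side is the squared norm of \<open>frep \<rho> f \<xi>\<close>
    divided by the square of B, so the bound just obtained for it is the claim squared.\<close>
  have "vinner H (frep \<rho> h \<xi>) \<xi> = (1 / B\<^sup>2) * vinner H (frep \<rho> (\<lambda>x. cnj (f x) * f x) \<xi>) \<xi>"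
    unfolding hf using f \<xi> by (subst frep_scale) (simp_all add: C0_mult C0_cnj inner_scale)
  also have "vinner H (frep \<rho> (\<lambda>x. cnj (f x) * f x) \<xi>) \<xi> = complex_of_real ((vnorm H (frep \<rho> f \<xi>))\<^sup>2)"
    using frep_mult[OF C0_cnj[OF f] f \<xi>] frep_cnj[OF f frep_closed[OF f \<xi>] \<xi>]
      inner_self_real[OF frep_closed[OF f \<xi>]] by simp
  finally have "vinner H (frep \<rho> h \<xi>) \<xi> = complex_of_real ((vnorm H (frep \<rho> f \<xi>))\<^sup>2 / B\<^sup>2)" by simp
  then have "(vnorm H (frep \<rho> f \<xi>))\<^sup>2 / B\<^sup>2 \<le> (vnorm H \<xi>)\<^sup>2"
    using re3 by (metis Re_complex_of_real power2_eq_square)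
  then have "(vnorm H (frep \<rho> f \<xi>))\<^sup>2 \<le> (B * vnorm H \<xi>)\<^sup>2"
    using Bp by (simp add: field_simps power_mult_distrib)
  then show ?thesis using Bp \<xi> by (simp add: power2_le_iff_abs_le)
qed

lemma frep_grep_eventually:
  assumes f: "f \<in> Cc_C0" and \<xi>: "\<xi> \<in> vectors H" and \<epsilon>: "0 < \<epsilon>"
  shows "eventually (\<lambda>t. vnorm H (vdiff H (frep \<rho> (f t) (grep \<rho> t \<xi>)) (frep \<rho> (f s) (grep \<rho> s \<xi>))) \<le> \<epsilon>) (nhds s)"
proof -
  obtain B where B: "0 < B" "\<And>x. cmod (f s x) \<le> B" using C0_bounded[OF Cc_C0_C0[OF f]] by blast
  have n0: "0 \<le> vnorm H \<xi>" using \<xi> by simp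
  define d where "d = \<epsilon> / 2 / (vnorm H \<xi> + 1)"
  have d: "0 < d" using \<epsilon> n0 by (simp add: d_def add_nonneg_pos)
  have "d * vnorm H \<xi> \<le> d * (vnorm H \<xi> + 1)" using d by (intro mult_left_mono) auto
  also have "\<dots> = \<epsilon> / 2" using n0 by (simp add: d_def field_simps)
  finally have d2: "d * vnorm H \<xi> \<le> \<epsilon> / 2" .
  have "0 < \<epsilon> / 2 / B" using \<epsilon> B(1) by simp
  from Cc_C0_eventually[OF f d, of s] grep_eventually[OF \<xi> this, of s]
  show ?thesis
  proof eventually_elim
    case (elim t)
    have Ct: "f t \<in> C0" "f s \<in> C0" using Cc_C0_C0[OF f] by auto
    have "vnorm H (vdiff H (frep \<rho> (f t) (grep \<rho> t \<xi>)) (frep \<rho> (f s) (grep \<rho> t \<xi>)))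
        = vnorm H (frep \<rho> (\<lambda>x. f t x - f s x) (grep \<rho> t \<xi>))"
      using Ct \<xi> by (simp add: frep_diff)
    also have "\<dots> \<le> d * vnorm H (grep \<rho> t \<xi>)"
      using elim(1) Ct \<xi> by (intro frep_contractive) (auto intro: C0_diff less_imp_le)
    also have "\<dots> \<le> \<epsilon> / 2" using d2 \<xi> by (simp add: grepD(5))
    finally have 1: "vnorm H (vdiff H (frep \<rho> (f t) (grep \<rho> t \<xi>)) (frep \<rho> (f s) (grep \<rho> t \<xi>))) \<le> \<epsilon> / 2" .
    have "vnorm H (vdiff H (frep \<rho> (f s) (grep \<rho> t \<xi>)) (frep \<rho> (f s) (grep \<rho> s \<xi>)))
        = vnorm H (frep \<rho> (f s) (vdiff H (grep \<rho> t \<xi>) (grep \<rho> s \<xi>)))"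
      using Ct \<xi> by (simp add: bounded_operatorD(4)[OF frep_bounded])
    also have "\<dots> \<le> B * vnorm H (vdiff H (grep \<rho> t \<xi>) (grep \<rho> s \<xi>))"
      using B(2) Ct \<xi> by (intro frep_contractive) auto
    also have "\<dots> \<le> B * (\<epsilon> / 2 / B)" using elim(2) B(1) by (intro mult_left_mono) auto
    finally have 2: "vnorm H (vdiff H (frep \<rho> (f s) (grep \<rho> t \<xi>)) (frep \<rho> (f s) (grep \<rho> s \<xi>))) \<le> \<epsilon> / 2"
      using B(1) by simp
    have "vnorm H (vdiff H (frep \<rho> (f t) (grep \<rho> t \<xi>)) (frep \<rho> (f s) (grep \<rho> s \<xi>))) \<le> \<epsilon> / 2 + \<epsilon> / 2"
      by (rule norm_diff_triangle_le[OF _ _ _ 1 2]) (use Ct \<xi> in auto)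
    then show ?case by simp
  qed
qed

lemma frep_grep_inner_continuous:
  assumes f: "f \<in> Cc_C0" and "\<xi> \<in> vectors H" "\<eta> \<in> vectors H"
  shows "continuous_on UNIV (\<lambda>s. vinner H (frep \<rho> (f s) (grep \<rho> s \<xi>)) \<eta>)"
  using assms Cc_C0_C0[OF f] by (intro inner_continuous frep_grep_eventually) auto

lemma frep_grep_inner_integrable:
  assumes f: "f \<in> Cc_C0" and \<xi>: "\<xi> \<in> vectors H" and \<eta>: "\<eta> \<in> vectors H"
  shows "integrable \<mu> (\<lambda>s. vinner H (frep \<rho> (f s) (grep \<rho> s \<xi>)) \<eta>)"
    and "compact K \<Longrightarrow> (\<And>s. s \<notin> K \<Longrightarrow> f s = (\<lambda>x. 0)) \<Longrightarrow> (\<And>s x. cmod (f s x) \<le> B) \<Longrightarrow>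
      cmod (LINT s|\<mu>. vinner H (frep \<rho> (f s) (grep \<rho> s \<xi>)) \<eta>) \<le> B * vnorm H \<xi> * vnorm H \<eta> * measure \<mu> K"
proof -
  have bd: "cmod (vinner H (frep \<rho> (f s) (grep \<rho> s \<xi>)) \<eta>) \<le> B * vnorm H \<xi> * vnorm H \<eta>"
    if B: "\<And>s x. cmod (f s x) \<le> B" for s B
  proof -
    have C: "f s \<in> C0" by (rule Cc_C0_C0[OF f])
    have "cmod (vinner H (frep \<rho> (f s) (grep \<rho> s \<xi>)) \<eta>) \<le> vnorm H (frep \<rho> (f s) (grep \<rho> s \<xi>)) * vnorm H \<eta>"
      using C \<xi> \<eta> by (intro cauchy_schwarz) auto
    also have "\<dots> \<le> (B * vnorm H (grep \<rho> s \<xi>)) * vnorm H \<eta>"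
      using C \<xi> \<eta> B by (intro mult_right_mono frep_contractive) auto
    finally show ?thesis using \<xi> by (simp add: grepD(5))
  qed
  note m = continuous_borel[OF frep_grep_inner_continuous[OF f \<xi> \<eta>]]
  have z: "vinner H (frep \<rho> (f s) (grep \<rho> s \<xi>)) \<eta> = 0" if "f s = (\<lambda>x. 0)" for s
    using that \<xi> \<eta> by (simp add: frep_zero)
  show "integrable \<mu> (\<lambda>s. vinner H (frep \<rho> (f s) (grep \<rho> s \<xi>)) \<eta>)"
  proof -
    obtain K where K: "compact K" "\<And>s. s \<notin> K \<Longrightarrow> f s = (\<lambda>x. 0)" using Cc_C0_support[OF f] by blast
    obtain B where B: "0 < B" "\<And>s x. cmod (f s x) \<le> B" using Cc_C0_bounded[OF f] by blast
    show ?thesis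
      by (rule integrable_compact_support(1)[OF sets_mu(1) K(1) mu_compact[OF K(1)] m _ bd[OF B(2)]])
        (use K(2) z in auto)
  qed
  show "cmod (LINT s|\<mu>. vinner H (frep \<rho> (f s) (grep \<rho> s \<xi>)) \<eta>) \<le> B * vnorm H \<xi> * vnorm H \<eta> * measure \<mu> K"
    if "compact K" "\<And>s. s \<notin> K \<Longrightarrow> f s = (\<lambda>x. 0)" "\<And>s x. cmod (f s x) \<le> B"
    by (rule integrable_compact_support(2)[OF sets_mu(1) that(1) mu_compact[OF that(1)] m _ bd[OF that(3)]])
      (use that(2) z in auto)
qed

text \<open>Justifies the definite description in \<open>integrated_op\<close>:
  \<open>weak_integral_exists\<close> gives existence and \<open>vec_eqI\<close> uniqueness.\<close>

lemma
  assumes f: "f \<in> Cc_C0" and \<xi>: "\<xi> \<in> vectors H"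
  shows integrated_op_closed [simp]: "integrated_op \<mu> \<rho> f \<xi> \<in> vectors H"
    and integrated_op_inner: "\<eta> \<in> vectors H \<Longrightarrow>
      vinner H (integrated_op \<mu> \<rho> f \<xi>) \<eta> = (LINT s|\<mu>. vinner H (frep \<rho> (f s) (grep \<rho> s \<xi>)) \<eta>)"
proof -
  obtain K where K: "compact K" "\<And>s. s \<notin> K \<Longrightarrow> f s = (\<lambda>x. 0)" using Cc_C0_support[OF f] by blast
  let ?P = "\<lambda>\<zeta>. \<zeta> \<in> vectors H \<and>
    (\<forall>\<eta>\<in>vectors H. vinner H \<zeta> \<eta> = (LINT s|\<mu>. vinner H (frep \<rho> (f s) (grep \<rho> s \<xi>)) \<eta>))"
  have "\<exists>\<zeta>\<in>vectors H. \<forall>\<eta>\<in>vectors H. vinner H \<zeta> \<eta> = (LINT s|\<mu>. vinner H (frep \<rho> (f s) (grep \<rho> s \<xi>)) \<eta>)"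
    using K f \<xi> Cc_C0_C0[OF f]
    by (intro weak_integral_exists[OF sets_mu(1) K(1) mu_compact[OF K(1)]] frep_grep_eventually)
      (auto simp: frep_zero)
  then have "\<exists>!\<zeta>. ?P \<zeta>"
  proof (intro ex_ex1I)
    fix \<zeta> \<zeta>' assume "?P \<zeta>" "?P \<zeta>'"
    then show "\<zeta> = \<zeta>'" by (intro vec_eqI) auto
  qed auto
  from theI'[OF this] have "?P (integrated_op \<mu> \<rho> f \<xi>)" using \<xi> by (simp add: integrated_op_def)
  then show "integrated_op \<mu> \<rho> f \<xi> \<in> vectors H" "\<eta> \<in> vectors H \<Longrightarrow>
      vinner H (integrated_op \<mu> \<rho> f \<xi>) \<eta> = (LINT s|\<mu>. vinner H (frep \<rho> (f s) (grep \<rho> s \<xi>)) \<eta>)" by auto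
qed

lemma integrated_op_norm_le:
  assumes f: "f \<in> Cc_C0" and \<xi>: "\<xi> \<in> vectors H"
    and K: "compact K" "\<And>s. s \<notin> K \<Longrightarrow> f s = (\<lambda>x. 0)" and B: "0 \<le> B" "\<And>s x. cmod (f s x) \<le> B"
  shows "vnorm H (integrated_op \<mu> \<rho> f \<xi>) \<le> B * measure \<mu> K * vnorm H \<xi>"
  using frep_grep_inner_integrable(2)[OF f \<xi> _ K B(2)] f \<xi> B(1)
  by (intro norm_leI) (auto simp: integrated_op_inner algebra_simps)

lemma integrated_op_bounded:
  assumes f: "f \<in> Cc_C0"
  shows "bounded_operator H (integrated_op \<mu> \<rho> f)"
proof -
  obtain K where K: "compact K" "\<And>s. s \<notin> K \<Longrightarrow> f s = (\<lambda>x. 0)" using Cc_C0_support[OF f] by blast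
  obtain B where B: "0 < B" "\<And>s x. cmod (f s x) \<le> B" using Cc_C0_bounded[OF f] by blast
  note C = Cc_C0_C0[OF f]
  have add: "integrated_op \<mu> \<rho> f (vadd H \<xi> \<eta>) = vadd H (integrated_op \<mu> \<rho> f \<xi>) (integrated_op \<mu> \<rho> f \<eta>)"
    if "\<xi> \<in> vectors H" "\<eta> \<in> vectors H" for \<xi> \<eta>
    by (rule vec_eqI)
      (use f C that in \<open>simp_all add: integrated_op_inner inner_add grepD(2) bounded_operatorD(2)[OF frep_bounded]
        frep_grep_inner_integrable(1)\<close>)
  have scale: "integrated_op \<mu> \<rho> f (vscale H c \<xi>) = vscale H c (integrated_op \<mu> \<rho> f \<xi>)"
    if "\<xi> \<in> vectors H" for \<xi> c
    by (rule vec_eqI)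
      (use f C that in \<open>simp_all add: integrated_op_inner inner_scale grepD(3) bounded_operatorD(3)[OF frep_bounded]\<close>)
  have "vnorm H (integrated_op \<mu> \<rho> f \<xi>) \<le> (B * measure \<mu> K) * vnorm H \<xi>" if "\<xi> \<in> vectors H" for \<xi>
    by (rule integrated_op_norm_le[OF f that K]) (use B in auto)
  then show ?thesis
    unfolding bounded_operator_def linear_map_def using add scale f by (auto intro!: exI[of _ "B * measure \<mu> K"])
qed

lemma integrated_op_add:
  assumes f: "f \<in> Cc_C0" and g: "g \<in> Cc_C0" and \<xi>: "\<xi> \<in> vectors H"
  shows "integrated_op \<mu> \<rho> (\<lambda>s x. f s x + g s x) \<xi> = vadd H (integrated_op \<mu> \<rho> f \<xi>) (integrated_op \<mu> \<rho> g \<xi>)"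
  by (rule vec_eqI)
    (use assms Cc_C0_C0[OF f] Cc_C0_C0[OF g] in
      \<open>simp_all add: Cc_C0_add integrated_op_inner inner_add frep_add frep_grep_inner_integrable(1)\<close>)

lemma integrated_op_mult_left:
  assumes f: "f \<in> Cc_C0" and h: "h \<in> C0" and \<xi>: "\<xi> \<in> vectors H"
  shows "integrated_op \<mu> \<rho> (\<lambda>s x. h x * f s x) \<xi> = frep \<rho> h (integrated_op \<mu> \<rho> f \<xi>)"
proof -
  obtain B where B: "0 < B" "\<And>x. cmod (h x) \<le> B" using C0_bounded[OF h] by blast
  have hf: "(\<lambda>s x. h x * f s x) \<in> Cc_C0" by (rule Cc_C0_mult_left[OF f C0_mult[OF h] B])
  show ?thesis
    by (rule vec_eqI)
      (use assms hf Cc_C0_C0[OF f] in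
        \<open>simp_all add: integrated_op_inner frep_mult frep_adjoint[OF h] C0_cnj\<close>)
qed

lemma integrated_op_scale:
  assumes f: "f \<in> Cc_C0" and \<xi>: "\<xi> \<in> vectors H"
  shows "integrated_op \<mu> \<rho> (\<lambda>s x. c * f s x) \<xi> = vscale H c (integrated_op \<mu> \<rho> f \<xi>)"
proof -
  have hf: "(\<lambda>s x. c * f s x) \<in> Cc_C0"
    by (rule Cc_C0_mult_left[OF f C0_scale, of "cmod c + 1"]) (auto simp: add_nonneg_pos)
  show ?thesis
    by (rule vec_eqI)
      (use assms hf Cc_C0_C0[OF f] in \<open>simp_all add: integrated_op_inner frep_scale inner_scale\<close>)
qed

text \<open>Covariance takes \<open>grep \<rho> s\<close> out of the integrand, and invariance of
  \<mu> absorbs the shift of the variable.\<close>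

lemma integrated_op_translate:
  assumes f: "f \<in> Cc_C0" and \<xi>: "\<xi> \<in> vectors H"
  shows "integrated_op \<mu> \<rho> (translate s f) \<xi> = grep \<rho> s (integrated_op \<mu> \<rho> f \<xi>)"
proof (rule vec_eqI)
  fix \<eta> assume \<eta>: "\<eta> \<in> vectors H"
  note C = Cc_C0_C0[OF f]
  have eq: "vinner H (frep \<rho> (translate s f r) (grep \<rho> r \<xi>)) \<eta>
    = vinner H (frep \<rho> (f (r - s)) (grep \<rho> (r - s) \<xi>)) (grep \<rho> (- s) \<eta>)" for r
  proof -
    have "grep \<rho> r \<xi> = grep \<rho> s (grep \<rho> (r - s) \<xi>)"
      using grep_add[OF \<xi>, of s "r - s"] by simp
    then have "frep \<rho> (translate s f r) (grep \<rho> r \<xi>) = grep \<rho> s (frep \<rho> (f (r - s)) (grep \<rho> (r - s) \<xi>))"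
      using covariance[OF C, of "grep \<rho> (r - s) \<xi>" s] \<xi> by (simp add: translate_def)
    then show ?thesis using grep_adjoint C \<xi> \<eta> by simp
  qed
  have "vinner H (integrated_op \<mu> \<rho> (translate s f) \<xi>) \<eta>
     = (LINT r|\<mu>. vinner H (frep \<rho> (f (r - s)) (grep \<rho> (r - s) \<xi>)) (grep \<rho> (- s) \<eta>))"
    using translate_Cc_C0[OF f] \<xi> \<eta> by (simp add: integrated_op_inner eq)
  also have "\<dots> = (LINT r|\<mu>. vinner H (frep \<rho> (f r) (grep \<rho> r \<xi>)) (grep \<rho> (- s) \<eta>))"
    using \<xi> \<eta> by (intro haar_integral_translate[OF haar] continuous_borel frep_grep_inner_continuous f) auto
  also have "\<dots> = vinner H (grep \<rho> s (integrated_op \<mu> \<rho> f \<xi>)) \<eta>"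
    using f \<xi> \<eta> by (simp add: integrated_op_inner grep_adjoint)
  finally show "vinner H (integrated_op \<mu> \<rho> (translate s f) \<xi>) \<eta> = vinner H (grep \<rho> s (integrated_op \<mu> \<rho> f \<xi>)) \<eta>" .
qed (use f \<xi> translate_Cc_C0 in auto)

end

section \<open>The crossed product\<close>

context hilbert_space
begin

lemma bounded_operatorI:
  assumes "\<And>\<xi>. \<xi> \<in> vectors H \<Longrightarrow> T \<xi> \<in> vectors H"
    and "\<And>\<xi> \<eta>. \<xi> \<in> vectors H \<Longrightarrow> \<eta> \<in> vectors H \<Longrightarrow> T (vadd H \<xi> \<eta>) = vadd H (T \<xi>) (T \<eta>)"
    and "\<And>c \<xi>. \<xi> \<in> vectors H \<Longrightarrow> T (vscale H c \<xi>) = vscale H c (T \<xi>)"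
    and "\<And>\<xi>. \<xi> \<in> vectors H \<Longrightarrow> vnorm H (T \<xi>) \<le> c * vnorm H \<xi>"
  shows "bounded_operator H T"
  unfolding bounded_operator_def linear_map_def using assms by (intro conjI exI[of _ c]) auto

lemma bounded_operator_cong:
  assumes "bounded_operator H T" "\<And>\<xi>. \<xi> \<in> vectors H \<Longrightarrow> S \<xi> = T \<xi>"
  shows "bounded_operator H S"
proof -
  obtain c where "\<And>\<xi>. \<xi> \<in> vectors H \<Longrightarrow> vnorm H (T \<xi>) \<le> c * vnorm H \<xi>"
    using assms(1) by (auto simp: bounded_operator_def)
  then show ?thesis
    using bounded_operatorD[OF assms(1)] assms(2) by (intro bounded_operatorI[where c = c]) auto
qed

text \<open>The limit is formed vector by vector, and the Cauchy estimate passes to it with the same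
  rate \<open>e\<close>; the rate matters because limits will be taken over all covariant pairs
  simultaneously. The limit is cut down to the carrier since elements of
  \<open>operator_product\<close> are extensional.\<close>

lemma bounded_operator_limit:
  assumes T: "\<And>n. bounded_operator H (T n)"
    and C: "\<And>m n \<xi>. m \<le> n \<Longrightarrow> \<xi> \<in> vectors H \<Longrightarrow> vnorm H (vdiff H (T n \<xi>) (T m \<xi>)) \<le> e m * vnorm H \<xi>"
    and e: "e \<longlonglongrightarrow> 0"
  shows "\<exists>S\<in>extensional (vectors H). bounded_operator H S \<and>
    (\<forall>\<xi>\<in>vectors H. \<forall>m. vnorm H (vdiff H (S \<xi>) (T m \<xi>)) \<le> e m * vnorm H \<xi>)"
proof -
  note TD = bounded_operatorD[OF T]
  have "\<exists>\<zeta>\<in>vectors H. (\<lambda>n. vnorm H (vdiff H (T n \<xi>) \<zeta>)) \<longlonglongrightarrow> 0" if \<xi>: "\<xi> \<in> vectors H" for \<xi>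
  proof (rule complete)
    show "range (\<lambda>n. T n \<xi>) \<subseteq> vectors H" using TD(1)[OF \<xi>] by auto
    show "\<forall>\<epsilon>>0. \<exists>N. \<forall>m\<ge>N. \<forall>n\<ge>N. vnorm H (vdiff H (T m \<xi>) (T n \<xi>)) < \<epsilon>"
    proof (intro allI impI)
      fix \<epsilon> :: real assume \<epsilon>: "0 < \<epsilon>"
      have "(\<lambda>m. e m * vnorm H \<xi>) \<longlonglongrightarrow> 0" by (rule tendsto_mult_left_zero[OF e])
      then have "eventually (\<lambda>m. e m * vnorm H \<xi> < \<epsilon>) sequentially" using \<epsilon> by (rule order_tendstoD)
      then obtain N where N: "\<And>m. m \<ge> N \<Longrightarrow> e m * vnorm H \<xi> < \<epsilon>" by (auto simp: eventually_sequentially)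
      have "vnorm H (vdiff H (T m \<xi>) (T n \<xi>)) < \<epsilon>" if "m \<ge> N" "n \<ge> N" for m n
      proof (cases "m \<le> n")
        case True
        then show ?thesis
          using C[OF True \<xi>] N[OF that(1)] norm_diff_commute[OF TD(1)[OF \<xi>] TD(1)[OF \<xi>], of n m] by linarith
      next
        case False
        then show ?thesis using C[of n m, OF _ \<xi>] N[OF that(2)] by linarith
      qed
      then show "\<exists>N. \<forall>m\<ge>N. \<forall>n\<ge>N. vnorm H (vdiff H (T m \<xi>) (T n \<xi>)) < \<epsilon>" by blast
    qed
  qed
  then obtain S0 where S0: "\<And>\<xi>. \<xi> \<in> vectors H \<Longrightarrow> S0 \<xi> \<in> vectors H"
    "\<And>\<xi>. \<xi> \<in> vectors H \<Longrightarrow> (\<lambda>n. vnorm H (vdiff H (T n \<xi>) (S0 \<xi>))) \<longlonglongrightarrow> 0" by metis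
  have S0_bound: "vnorm H (vdiff H (S0 \<xi>) (T m \<xi>)) \<le> e m * vnorm H \<xi>" if \<xi>: "\<xi> \<in> vectors H" for \<xi> m
  proof (rule LIMSEQ_le_const)
    show "(\<lambda>n. vnorm H (vdiff H (T n \<xi>) (S0 \<xi>)) + e m * vnorm H \<xi>) \<longlonglongrightarrow> e m * vnorm H \<xi>"
      using tendsto_add[OF S0(2)[OF \<xi>] tendsto_const[of "e m * vnorm H \<xi>"]] by simp
    have "vnorm H (vdiff H (S0 \<xi>) (T m \<xi>)) \<le> vnorm H (vdiff H (T n \<xi>) (S0 \<xi>)) + e m * vnorm H \<xi>" if "n \<ge> m" for n
      using norm_diff_triangle_le[OF S0(1)[OF \<xi>] TD(1)[OF \<xi>, of n] TD(1)[OF \<xi>, of m] order_refl C[OF that \<xi>]]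
        norm_diff_commute[OF S0(1)[OF \<xi>] TD(1)[OF \<xi>, of n]] by simp
    then show "\<exists>N. \<forall>n\<ge>N. vnorm H (vdiff H (S0 \<xi>) (T m \<xi>)) \<le> vnorm H (vdiff H (T n \<xi>) (S0 \<xi>)) + e m * vnorm H \<xi>"
      by blast
  qed
  have lim: "(\<lambda>n. vinner H (T n \<xi>) \<eta>) \<longlonglongrightarrow> vinner H (S0 \<xi>) \<eta>" if \<xi>: "\<xi> \<in> vectors H" and \<eta>: "\<eta> \<in> vectors H" for \<xi> \<eta>
  proof (rule LIM_zero_cancel, rule Lim_null_comparison)
    show "\<forall>\<^sub>F n in sequentially. norm (vinner H (T n \<xi>) \<eta> - vinner H (S0 \<xi>) \<eta>) \<le> vnorm H (vdiff H (T n \<xi>) (S0 \<xi>)) * vnorm H \<eta>"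
      using cauchy_schwarz[OF diff_closed[OF TD(1)[OF \<xi>] S0(1)[OF \<xi>]] \<eta>] TD(1)[OF \<xi>] S0(1)[OF \<xi>] \<eta>
      by (simp add: inner_diff)
    show "(\<lambda>n. vnorm H (vdiff H (T n \<xi>) (S0 \<xi>)) * vnorm H \<eta>) \<longlonglongrightarrow> 0"
      by (rule tendsto_mult_left_zero[OF S0(2)[OF \<xi>]])
  qed
  obtain c where c: "\<And>\<xi>. \<xi> \<in> vectors H \<Longrightarrow> vnorm H (T 0 \<xi>) \<le> c * vnorm H \<xi>"
    using T[of 0] by (auto simp: bounded_operator_def)
  have "bounded_operator H S0"
  proof (rule bounded_operatorI)
    fix \<xi> \<eta> assume v: "\<xi> \<in> vectors H" "\<eta> \<in> vectors H"
    show "S0 (vadd H \<xi> \<eta>) = vadd H (S0 \<xi>) (S0 \<eta>)"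
    proof (rule vec_eqI)
      fix \<zeta> assume z: "\<zeta> \<in> vectors H"
      have "(\<lambda>n. vinner H (T n (vadd H \<xi> \<eta>)) \<zeta>) \<longlonglongrightarrow> vinner H (S0 \<xi>) \<zeta> + vinner H (S0 \<eta>) \<zeta>"
        using tendsto_add[OF lim[OF v(1) z] lim[OF v(2) z]] v z by (simp add: TD inner_add)
      then show "vinner H (S0 (vadd H \<xi> \<eta>)) \<zeta> = vinner H (vadd H (S0 \<xi>) (S0 \<eta>)) \<zeta>"
        using LIMSEQ_unique[OF lim[of "vadd H \<xi> \<eta>" \<zeta>]] v z S0(1) by (simp add: inner_add)
    qed (use v S0(1) in auto)
  next
    fix \<xi> and c :: complex assume v: "\<xi> \<in> vectors H"
    show "S0 (vscale H c \<xi>) = vscale H c (S0 \<xi>)"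
    proof (rule vec_eqI)
      fix \<zeta> assume z: "\<zeta> \<in> vectors H"
      have "(\<lambda>n. vinner H (T n (vscale H c \<xi>)) \<zeta>) \<longlonglongrightarrow> c * vinner H (S0 \<xi>) \<zeta>"
        using tendsto_mult_left[OF lim[OF v z], of c] v z by (simp add: TD inner_scale)
      then show "vinner H (S0 (vscale H c \<xi>)) \<zeta> = vinner H (vscale H c (S0 \<xi>)) \<zeta>"
        using LIMSEQ_unique[OF lim[of "vscale H c \<xi>" \<zeta>]] v z S0(1) by (simp add: inner_scale)
    qed (use v S0(1) in auto)
  next
    fix \<xi> assume v: "\<xi> \<in> vectors H"
    show "vnorm H (S0 \<xi>) \<le> (c + e 0) * vnorm H \<xi>"
      using norm_le_diff[OF S0(1)[OF v] TD(1)[OF v, of 0]] S0_bound[OF v, of 0] c[OF v]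
      by (simp add: algebra_simps)
  qed (use S0 in auto)
  then have "bounded_operator H (restrict S0 (vectors H))" by (rule bounded_operator_cong) simp
  then show ?thesis
    using S0_bound by (intro bexI[of _ "restrict S0 (vectors H)"]) auto
qed

end

context transformation_group
begin

lemma covariant_repI: "\<rho> \<in> covariant_reps act \<Longrightarrow> covariant_rep act \<mu> \<rho>"
  by unfold_locales

lemma crossed_product_simps:
  fixes A defines "A \<equiv> (crossed_product act \<mu> :: (('g, 'x, 'h) covariant_pair \<Rightarrow> 'h \<Rightarrow> 'h) cstar)"
  shows "cadd A a b = (\<lambda>\<rho>\<in>covariant_reps act. \<lambda>\<xi>\<in>vectors (cspace \<rho>). vadd (cspace \<rho>) (a \<rho> \<xi>) (b \<rho> \<xi>))"
    and "cscale A k a = (\<lambda>\<rho>\<in>covariant_reps act. \<lambda>\<xi>\<in>vectors (cspace \<rho>). vscale (cspace \<rho>) k (a \<rho> \<xi>))"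
    and "cmult A a b = (\<lambda>\<rho>\<in>covariant_reps act. \<lambda>\<xi>\<in>vectors (cspace \<rho>). a \<rho> (b \<rho> \<xi>))"
    and "cnorm A a = (SUP \<rho>\<in>covariant_reps act. op_norm (cspace \<rho>) (a \<rho>))"
  by (simp_all add: A_def crossed_product_def operator_product_def Let_def)

end

text \<open>\<open>cnorm\<close> is a supremum of reals over all covariant pairs, which says
  something only if there is at least one; \<rho>0 provides it.\<close>

locale nontrivial_transformation_group = transformation_group act \<mu>
  for act :: "'g::{topological_ab_group_add, second_countable_topology, t2_space} \<Rightarrow>
      'x::{second_countable_topology, t2_space} \<Rightarrow> 'x" and \<mu> +
  fixes \<rho>0 :: "('g, 'x, 'h) covariant_pair"
  assumes ex_covariant: "\<rho>0 \<in> covariant_reps act"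
begin

abbreviation A :: "(('g, 'x, 'h) covariant_pair \<Rightarrow> 'h \<Rightarrow> 'h) cstar" where "A \<equiv> crossed_product act \<mu>"
abbreviation R :: "('g, 'x, 'h) covariant_pair set" where "R \<equiv> covariant_reps act"

text \<open>Norm distance at most \<epsilon>, written without the real supremum of
  \<open>cnorm\<close>, which is informative only for families known to be bounded.
  \<open>cnorm_diff_le\<close> and \<open>op_close_cnorm\<close> translate between the two.\<close>

definition op_close ::
    "(('g, 'x, 'h) covariant_pair \<Rightarrow> 'h \<Rightarrow> 'h) \<Rightarrow> (('g, 'x, 'h) covariant_pair \<Rightarrow> 'h \<Rightarrow> 'h) \<Rightarrow> real \<Rightarrow> bool" where
  "op_close a b \<epsilon> \<longleftrightarrow> (\<forall>\<rho>\<in>covariant_reps act. \<forall>\<xi>\<in>vectors (cspace \<rho>).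
     vnorm (cspace \<rho>) (vdiff (cspace \<rho>) (a \<rho> \<xi>) (b \<rho> \<xi>)) \<le> \<epsilon> * vnorm (cspace \<rho>) \<xi>)"

definition op_family :: "(('g, 'x, 'h) covariant_pair \<Rightarrow> 'h \<Rightarrow> 'h) \<Rightarrow> bool" where
  "op_family a \<longleftrightarrow> a \<in> extensional (covariant_reps act) \<and> (\<forall>\<rho>\<in>covariant_reps act.
     a \<rho> \<in> extensional (vectors (cspace \<rho>)) \<and> bounded_operator (cspace \<rho>) (a \<rho>))"

definition integrated :: "('g \<Rightarrow> 'x \<Rightarrow> complex) \<Rightarrow> ('g, 'x, 'h) covariant_pair \<Rightarrow> 'h \<Rightarrow> 'h" where
  "integrated f = (\<lambda>\<rho>\<in>covariant_reps act. integrated_op \<mu> \<rho> f)"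

definition op_bounded :: "(('g, 'x, 'h) covariant_pair \<Rightarrow> 'h \<Rightarrow> 'h) \<Rightarrow> real \<Rightarrow> bool" where
  "op_bounded a c \<longleftrightarrow> (\<forall>\<rho>\<in>covariant_reps act. \<forall>\<xi>\<in>vectors (cspace \<rho>).
     vnorm (cspace \<rho>) (a \<rho> \<xi>) \<le> c * vnorm (cspace \<rho>) \<xi>)"

lemma op_familyD:
  assumes "op_family a" "\<rho> \<in> covariant_reps act"
  shows "bounded_operator (cspace \<rho>) (a \<rho>)" "\<xi> \<in> vectors (cspace \<rho>) \<Longrightarrow> a \<rho> \<xi> \<in> vectors (cspace \<rho>)"
proof -
  interpret covariant_rep act \<mu> \<rho> by (rule covariant_repI[OF assms(2)])
  show b: "bounded_operator (cspace \<rho>) (a \<rho>)" using assms by (simp add: op_family_def)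
  show "\<xi> \<in> vectors (cspace \<rho>) \<Longrightarrow> a \<rho> \<xi> \<in> vectors (cspace \<rho>)" by (rule bounded_operatorD(1)[OF b])
qed

lemma op_close_trans:
  assumes fam: "op_family a" "op_family b" "op_family c" and cl: "op_close a b \<epsilon>" "op_close b c \<delta>"
  shows "op_close a c (\<epsilon> + \<delta>)"
  unfolding op_close_def
proof (intro ballI)
  fix \<rho> \<xi> assume \<rho>: "\<rho> \<in> R" and \<xi>: "\<xi> \<in> vectors (cspace \<rho>)"
  interpret covariant_rep act \<mu> \<rho> by (rule covariant_repI[OF \<rho>])
  show "vnorm H (vdiff H (a \<rho> \<xi>) (c \<rho> \<xi>)) \<le> (\<epsilon> + \<delta>) * vnorm H \<xi>"
    unfolding distrib_right
    by (rule norm_diff_triangle_le[where \<eta> = "b \<rho> \<xi>"]) (use cl \<rho> \<xi> op_familyD(2)[OF fam(1)] op_familyD(2)[OF fam(2)]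
        op_familyD(2)[OF fam(3)] in \<open>auto simp: op_close_def\<close>)
qed

lemma op_bounded_close:
  assumes fam: "op_family a" "op_family b" and "op_close a b \<epsilon>" "op_bounded b c"
  shows "op_bounded a (c + \<epsilon>)"
  unfolding op_bounded_def
proof (intro ballI)
  fix \<rho> \<xi> assume \<rho>: "\<rho> \<in> R" and \<xi>: "\<xi> \<in> vectors (cspace \<rho>)"
  interpret covariant_rep act \<mu> \<rho> by (rule covariant_repI[OF \<rho>])
  show "vnorm H (a \<rho> \<xi>) \<le> (c + \<epsilon>) * vnorm H \<xi>"
    using norm_le_diff[OF op_familyD(2)[OF fam(1) \<rho> \<xi>] op_familyD(2)[OF fam(2) \<rho> \<xi>]] assms(3,4) \<rho> \<xi>
    unfolding op_close_def op_bounded_def by (fastforce simp: distrib_right)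
qed

lemma integrated_family:
  assumes "f \<in> Cc_C0"
  shows "op_family (integrated f)"
proof -
  have "integrated_op \<mu> \<rho> f \<in> extensional (vectors (cspace \<rho>))" for \<rho> :: "('g, 'x, 'h) covariant_pair"
    by (simp add: integrated_op_def)
  moreover have "bounded_operator (cspace \<rho>) (integrated_op \<mu> \<rho> f)" if "\<rho> \<in> R" for \<rho>
    by (rule covariant_rep.integrated_op_bounded[OF covariant_repI[OF that] assms])
  ultimately show ?thesis by (simp add: op_family_def integrated_def)
qed

lemma integrated_op_bounded_const:
  assumes "f \<in> Cc_C0"
  shows "\<exists>c\<ge>0. op_bounded (integrated f) c"
proof -
  obtain K where K: "compact K" "\<And>s. s \<notin> K \<Longrightarrow> f s = (\<lambda>x. 0)" using Cc_C0_support[OF assms] by blast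
  obtain B where B: "0 < B" "\<And>s x. cmod (f s x) \<le> B" using Cc_C0_bounded[OF assms] by blast
  have "op_bounded (integrated f) (B * measure \<mu> K)"
    unfolding op_bounded_def
  proof (intro ballI)
    fix \<rho> \<xi> assume \<rho>: "\<rho> \<in> R" and \<xi>: "\<xi> \<in> vectors (cspace \<rho>)"
    show "vnorm (cspace \<rho>) (integrated f \<rho> \<xi>) \<le> B * measure \<mu> K * vnorm (cspace \<rho>) \<xi>"
      using covariant_rep.integrated_op_norm_le[OF covariant_repI[OF \<rho>] assms \<xi> K less_imp_le[OF B(1)] B(2)] \<rho>
      by (simp add: integrated_def)
  qed
  then show ?thesis using B(1) by (intro exI[of _ "B * measure \<mu> K"]) auto
qed

lemma op_norm_diff:
  assumes "op_family a" "op_family b" "\<rho> \<in> R"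
  shows "op_norm (cspace \<rho>) (cadd A a (cscale A (- 1) b) \<rho>)
    = op_norm (cspace \<rho>) (\<lambda>\<xi>. vdiff (cspace \<rho>) (a \<rho> \<xi>) (b \<rho> \<xi>))"
  unfolding op_norm_def using assms(3)
  by (intro SUP_cong) (auto simp: crossed_product_simps vdiff_def)

lemma bounded_operator_vdiff:
  assumes "op_family a" "op_family b" "\<rho> \<in> R"
  shows "bounded_operator (cspace \<rho>) (\<lambda>\<xi>. vdiff (cspace \<rho>) (a \<rho> \<xi>) (b \<rho> \<xi>))"
proof -
  interpret covariant_rep act \<mu> \<rho> by (rule covariant_repI[OF assms(3)])
  note ab = op_familyD(1)[OF assms(1,3)] op_familyD(1)[OF assms(2,3)]
  note D = bounded_operatorD[OF ab(1)] bounded_operatorD[OF ab(2)]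
  obtain c d where c: "\<And>\<xi>. \<xi> \<in> vectors H \<Longrightarrow> vnorm H (a \<rho> \<xi>) \<le> c * vnorm H \<xi>"
    and d: "\<And>\<xi>. \<xi> \<in> vectors H \<Longrightarrow> vnorm H (b \<rho> \<xi>) \<le> d * vnorm H \<xi>"
    using ab by (auto simp: bounded_operator_def)
  show ?thesis
  proof (rule bounded_operatorI[where c = "c + d"])
    fix \<xi> assume \<xi>: "\<xi> \<in> vectors H"
    have "vnorm H (vdiff H (a \<rho> \<xi>) (b \<rho> \<xi>)) \<le> vnorm H (vdiff H (a \<rho> \<xi>) (vzero H)) + vnorm H (vdiff H (vzero H) (b \<rho> \<xi>))"
      using D \<xi> by (intro norm_diff_triangle) auto
    also have "\<dots> = vnorm H (a \<rho> \<xi>) + vnorm H (b \<rho> \<xi>)"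
      using D \<xi> norm_diff_commute[of "vzero H" "b \<rho> \<xi>"] by simp
    finally show "vnorm H (vdiff H (a \<rho> \<xi>) (b \<rho> \<xi>)) \<le> (c + d) * vnorm H \<xi>"
      using c[OF \<xi>] d[OF \<xi>] by (simp add: distrib_right)
  next
    fix \<xi> \<eta> assume "\<xi> \<in> vectors H" "\<eta> \<in> vectors H"
    then show "vdiff H (a \<rho> (vadd H \<xi> \<eta>)) (b \<rho> (vadd H \<xi> \<eta>)) = vadd H (vdiff H (a \<rho> \<xi>) (b \<rho> \<xi>)) (vdiff H (a \<rho> \<eta>) (b \<rho> \<eta>))"
      by (intro vec_eqI) (simp_all add: D inner_diff inner_add)
  next
    fix k \<xi> assume "\<xi> \<in> vectors H"
    then show "vdiff H (a \<rho> (vscale H k \<xi>)) (b \<rho> (vscale H k \<xi>)) = vscale H k (vdiff H (a \<rho> \<xi>) (b \<rho> \<xi>))"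
      by (intro vec_eqI) (simp_all add: D inner_diff inner_scale algebra_simps)
  qed (use D in auto)
qed

lemma cnorm_diff_le:
  assumes "op_close a b \<epsilon>" "op_family a" "op_family b" "0 \<le> \<epsilon>"
  shows "cnorm A (cadd A a (cscale A (- 1) b)) \<le> \<epsilon>"
  unfolding crossed_product_simps(4)
proof (rule cSUP_least)
  fix \<rho> assume \<rho>: "\<rho> \<in> R"
  interpret covariant_rep act \<mu> \<rho> by (rule covariant_repI[OF \<rho>])
  show "op_norm H (cadd A a (cscale A (- 1) b) \<rho>) \<le> \<epsilon>"
    unfolding op_norm_diff[OF assms(2,3) \<rho>] by (rule op_norm_le) (use assms \<rho> in \<open>auto simp: op_close_def\<close>)
qed (use ex_covariant in auto)

lemma op_norm_le_bounded:
  assumes "op_bounded a c" "0 \<le> c" "\<rho> \<in> R"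
  shows "op_norm (cspace \<rho>) (a \<rho>) \<le> c"
proof -
  interpret covariant_rep act \<mu> \<rho> by (rule covariant_repI[OF assms(3)])
  show ?thesis by (rule op_norm_le) (use assms in \<open>auto simp: op_bounded_def\<close>)
qed

text \<open>The bounds c and d make the set of operator norms bounded above, so that the supremum in
  \<open>cnorm\<close> dominates each of them.\<close>

lemma op_close_cnorm:
  assumes fam: "op_family a" "op_family b" and c: "op_bounded a c" "op_bounded b d" "0 \<le> c" "0 \<le> d"
    and le: "cnorm A (cadd A a (cscale A (- 1) b)) \<le> \<epsilon>"
  shows "op_close a b \<epsilon>"
  unfolding op_close_def
proof (intro ballI)
  let ?T = "\<lambda>\<rho> \<xi>. vdiff (cspace \<rho>) (a \<rho> \<xi>) (b \<rho> \<xi>)"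
  have bd: "op_norm (cspace \<rho>) (cadd A a (cscale A (- 1) b) \<rho>) \<le> c + d" if \<rho>: "\<rho> \<in> R" for \<rho>
  proof -
    interpret covariant_rep act \<mu> \<rho> by (rule covariant_repI[OF \<rho>])
    have "vnorm H (?T \<rho> \<xi>) \<le> (c + d) * vnorm H \<xi>" if "\<xi> \<in> vectors H" for \<xi>
      using norm_diff_triangle[of "a \<rho> \<xi>" "vzero H" "b \<rho> \<xi>"] norm_diff_commute[of "vzero H" "b \<rho> \<xi>"]
        op_familyD(2)[OF fam(1) \<rho> that] op_familyD(2)[OF fam(2) \<rho> that] c(1,2) that \<rho>
      unfolding op_bounded_def by (fastforce simp: distrib_right)
    then show ?thesis
      unfolding op_norm_diff[OF fam \<rho>] using c by (intro op_norm_le) auto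
  qed
  fix \<rho> \<xi> assume \<rho>: "\<rho> \<in> R" and \<xi>: "\<xi> \<in> vectors (cspace \<rho>)"
  interpret covariant_rep act \<mu> \<rho> by (rule covariant_repI[OF \<rho>])
  have "op_norm H (?T \<rho>) \<le> cnorm A (cadd A a (cscale A (- 1) b))"
    unfolding crossed_product_simps(4) op_norm_diff[OF fam \<rho>, symmetric]
    by (rule cSUP_upper[OF \<rho>]) (use bd in \<open>auto intro!: bdd_aboveI2\<close>)
  then have "op_norm H (?T \<rho>) \<le> \<epsilon>" using le by simp
  then have "op_norm H (?T \<rho>) * vnorm H \<xi> \<le> \<epsilon> * vnorm H \<xi>" using \<xi> by (intro mult_right_mono) auto
  then show "vnorm H (?T \<rho> \<xi>) \<le> \<epsilon> * vnorm H \<xi>"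
    using op_norm_bound[OF bounded_operator_vdiff[OF fam \<rho>] \<xi>] by linarith
qed

text \<open>Trades the norm of the ambient product for \<open>op_close\<close>, so that membership
  in the crossed product can be checked pair by pair.\<close>

lemma elems_iff:
  "a \<in> elems A \<longleftrightarrow> op_family a \<and> (\<forall>\<epsilon>>0. \<exists>f\<in>Cc_C0. op_close a (integrated f) \<epsilon>)"
proof -
  let ?B = "operator_product R cspace :: (('g, 'x, 'h) covariant_pair \<Rightarrow> 'h \<Rightarrow> 'h) cstar"
  have eq: "a \<in> elems A \<longleftrightarrow> a \<in> elems ?B \<and>
      (\<forall>\<epsilon>>0. \<exists>f\<in>Cc_C0. cnorm A (cadd A a (cscale A (- 1) (integrated f))) < \<epsilon>)"
    by (simp add: crossed_product_def Let_def integrated_def)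
  have eB: "a \<in> elems ?B \<longleftrightarrow> op_family a \<and> bdd_above ((\<lambda>\<rho>. op_norm (cspace \<rho>) (a \<rho>)) ` R)"
    by (auto simp: operator_product_def op_family_def PiE_def Pi_def)
  show ?thesis
  proof
    assume a: "a \<in> elems A"
    then have fam: "op_family a" and bdd: "bdd_above ((\<lambda>\<rho>. op_norm (cspace \<rho>) (a \<rho>)) ` R)"
      using eq eB by auto
    obtain c where c: "\<And>\<rho>. \<rho> \<in> R \<Longrightarrow> op_norm (cspace \<rho>) (a \<rho>) \<le> c"
      using bdd by (auto simp: bdd_above_def)
    have bda: "op_bounded a (max c 0)"
      unfolding op_bounded_def
    proof (intro ballI)
      fix \<rho> \<xi> assume \<rho>: "\<rho> \<in> R" and \<xi>: "\<xi> \<in> vectors (cspace \<rho>)"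
      interpret covariant_rep act \<mu> \<rho> by (rule covariant_repI[OF \<rho>])
      have "op_norm H (a \<rho>) * vnorm H \<xi> \<le> max c 0 * vnorm H \<xi>"
        using c[OF \<rho>] \<xi> by (intro mult_right_mono) auto
      then show "vnorm H (a \<rho> \<xi>) \<le> max c 0 * vnorm H \<xi>"
        using op_norm_bound[OF op_familyD(1)[OF fam \<rho>] \<xi>] by linarith
    qed
    have "\<exists>f\<in>Cc_C0. op_close a (integrated f) \<epsilon>" if "0 < \<epsilon>" for \<epsilon>
    proof -
      have "\<exists>f\<in>Cc_C0. cnorm A (cadd A a (cscale A (- 1) (integrated f))) < \<epsilon>"
        using a that by (simp add: eq)
      then obtain f where f: "f \<in> Cc_C0" "cnorm A (cadd A a (cscale A (- 1) (integrated f))) < \<epsilon>"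
        by (rule bexE)
      obtain d where d: "d \<ge> 0" "op_bounded (integrated f) d"
        using integrated_op_bounded_const[OF f(1)] by blast
      have "op_close a (integrated f) \<epsilon>"
        by (rule op_close_cnorm[OF fam integrated_family[OF f(1)] bda d(2) _ d(1) less_imp_le[OF f(2)]]) simp
      then show ?thesis using f(1) by blast
    qed
    then show "op_family a \<and> (\<forall>\<epsilon>>0. \<exists>f\<in>Cc_C0. op_close a (integrated f) \<epsilon>)" using fam by blast
  next
    assume a: "op_family a \<and> (\<forall>\<epsilon>>0. \<exists>f\<in>Cc_C0. op_close a (integrated f) \<epsilon>)"
    then have fam: "op_family a" by simp
    \<comment> \<open>An integrated form at distance 1 already shows that the family is uniformly
      bounded, as membership in the ambient product demands.\<close>
    have "\<exists>f\<in>Cc_C0. op_close a (integrated f) 1" using a by simp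
    then obtain f where f: "f \<in> Cc_C0" "op_close a (integrated f) 1" by (rule bexE)
    obtain d where d: "d \<ge> 0" "op_bounded (integrated f) d"
      using integrated_op_bounded_const[OF f(1)] by blast
    have "op_bounded a (d + 1)" by (rule op_bounded_close[OF fam integrated_family[OF f(1)] f(2) d(2)])
    then have "bdd_above ((\<lambda>\<rho>. op_norm (cspace \<rho>) (a \<rho>)) ` R)"
      using op_norm_le_bounded d(1) by (intro bdd_aboveI2[where M = "d + 1"]) auto
    moreover have "\<exists>f\<in>Cc_C0. cnorm A (cadd A a (cscale A (- 1) (integrated f))) < \<epsilon>" if "0 < \<epsilon>" for \<epsilon>
    proof -
      have "0 < \<epsilon> / 2" using that by simp
      then obtain f where f: "f \<in> Cc_C0" "op_close a (integrated f) (\<epsilon> / 2)" using a by blast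
      have "cnorm A (cadd A a (cscale A (- 1) (integrated f))) \<le> \<epsilon> / 2"
        by (rule cnorm_diff_le[OF f(2) fam integrated_family[OF f(1)]]) (use that in simp)
      then show ?thesis using f(1) that by (intro bexI[of _ f]) auto
    qed
    ultimately show "a \<in> elems A" using eq eB fam by blast
  qed
qed

lemma elems_family: "a \<in> elems A \<Longrightarrow> op_family a"
  by (simp add: elems_iff)

lemma elems_closed [simp]: "a \<in> elems A \<Longrightarrow> \<rho> \<in> R \<Longrightarrow> \<xi> \<in> vectors (cspace \<rho>) \<Longrightarrow> a \<rho> \<xi> \<in> vectors (cspace \<rho>)"
  by (rule op_familyD(2)[OF elems_family])

lemma elems_approx:
  assumes "a \<in> elems A" "0 < \<epsilon>"
  obtains f where "f \<in> Cc_C0" "op_close a (integrated f) \<epsilon>"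
  using assms by (auto simp: elems_iff)

lemma elems_bounded:
  assumes "a \<in> elems A"
  obtains c where "0 < c" "op_bounded a c"
proof -
  obtain f where f: "f \<in> Cc_C0" "op_close a (integrated f) 1" by (rule elems_approx[OF assms zero_less_one])
  obtain d where d: "d \<ge> 0" "op_bounded (integrated f) d"
    using integrated_op_bounded_const[OF f(1)] by blast
  show thesis
    using that[of "d + 1"] op_bounded_close[OF elems_family[OF assms] integrated_family[OF f(1)] f(2) d(2)] d(1)
    by auto
qed

lemma op_close_refl:
  assumes a: "op_family a" and e: "0 \<le> \<epsilon>"
  shows "op_close a a \<epsilon>"
  unfolding op_close_def
proof (intro ballI)
  fix \<rho> \<xi> assume \<rho>: "\<rho> \<in> R" and \<xi>: "\<xi> \<in> vectors (cspace \<rho>)"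
  interpret covariant_rep act \<mu> \<rho> by (rule covariant_repI[OF \<rho>])
  show "vnorm H (vdiff H (a \<rho> \<xi>) (a \<rho> \<xi>)) \<le> \<epsilon> * vnorm H \<xi>"
    using op_familyD(2)[OF a \<rho> \<xi>] \<xi> e by simp
qed

lemma integrated_elems:
  assumes "f \<in> Cc_C0"
  shows "integrated f \<in> elems A"
  using op_close_refl[OF integrated_family[OF assms]] integrated_family[OF assms] assms
  unfolding elems_iff by (meson less_imp_le)

lemma elems_limit:
  assumes fam: "op_family a" and ap: "\<And>\<epsilon>. 0 < \<epsilon> \<Longrightarrow> \<exists>b\<in>elems A. op_close a b \<epsilon>"
  shows "a \<in> elems A"
  unfolding elems_iff
proof (intro conjI allI impI)
  fix \<epsilon> :: real assume "0 < \<epsilon>"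
  then have e: "0 < \<epsilon> / 2" by simp
  obtain b where b: "b \<in> elems A" "op_close a b (\<epsilon> / 2)" using ap[OF e] by blast
  obtain f where f: "f \<in> Cc_C0" "op_close b (integrated f) (\<epsilon> / 2)" by (rule elems_approx[OF b(1) e])
  have "op_close a (integrated f) (\<epsilon> / 2 + \<epsilon> / 2)"
    by (rule op_close_trans[OF fam elems_family[OF b(1)] integrated_family[OF f(1)] b(2) f(2)])
  then show "\<exists>f\<in>Cc_C0. op_close a (integrated f) \<epsilon>" using f(1) by auto
qed (fact fam)

text \<open>Left multiplication by a family such as \<open>frep \<rho> h\<close> or
  \<open>grep \<rho> s\<close> that need not belong to the algebra itself: the action of a
  multiplier.\<close>

definition lmult :: "(('g, 'x, 'h) covariant_pair \<Rightarrow> 'h \<Rightarrow> 'h) \<Rightarrow>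
    (('g, 'x, 'h) covariant_pair \<Rightarrow> 'h \<Rightarrow> 'h) \<Rightarrow> ('g, 'x, 'h) covariant_pair \<Rightarrow> 'h \<Rightarrow> 'h" where
  "lmult \<Phi> a = (\<lambda>\<rho>\<in>R. \<lambda>\<xi>\<in>vectors (cspace \<rho>). \<Phi> \<rho> (a \<rho> \<xi>))"

lemma lmult_integrated:
  assumes "\<And>\<rho> \<xi>. \<rho> \<in> R \<Longrightarrow> \<xi> \<in> vectors (cspace \<rho>) \<Longrightarrow> integrated_op \<mu> \<rho> g \<xi> = \<Phi> \<rho> (integrated_op \<mu> \<rho> f \<xi>)"
  shows "lmult \<Phi> (integrated f) = integrated g"
proof -
  have "(\<lambda>\<xi>\<in>vectors (cspace \<rho>). \<Phi> \<rho> (integrated_op \<mu> \<rho> f \<xi>)) = integrated_op \<mu> \<rho> g" if "\<rho> \<in> R" for \<rho>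
    using assms[OF that] by (intro extensionalityI[of _ "vectors (cspace \<rho>)"]) (auto simp: integrated_op_def)
  then show ?thesis by (auto simp: lmult_def integrated_def)
qed

text \<open>Left multiplication by a uniformly bounded family is continuous, so it preserves the
  closure once it sends integrated forms into the algebra.\<close>

lemma lmult_elems:
  assumes \<Phi>: "\<And>\<rho>. \<rho> \<in> R \<Longrightarrow> bounded_operator (cspace \<rho>) (\<Phi> \<rho>)" and c: "op_bounded \<Phi> c" "0 < c"
    and cl: "\<And>f. f \<in> Cc_C0 \<Longrightarrow> lmult \<Phi> (integrated f) \<in> elems A" and a: "a \<in> elems A"
  shows "lmult \<Phi> a \<in> elems A"
proof (rule elems_limit)
  show "op_family (lmult \<Phi> a)"
    unfolding op_family_def
  proof (intro conjI ballI)
    fix \<rho> assume \<rho>: "\<rho> \<in> R"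
    interpret covariant_rep act \<mu> \<rho> by (rule covariant_repI[OF \<rho>])
    note D = bounded_operatorD[OF \<Phi>[OF \<rho>]] bounded_operatorD[OF op_familyD(1)[OF elems_family[OF a] \<rho>]]
    obtain d where d: "0 < d" "\<And>\<xi>. \<xi> \<in> vectors H \<Longrightarrow> vnorm H (a \<rho> \<xi>) \<le> d * vnorm H \<xi>"
      using bounded_operator_bound[OF op_familyD(1)[OF elems_family[OF a] \<rho>]] by blast
    show "lmult \<Phi> a \<rho> \<in> extensional (vectors H)" using \<rho> by (simp add: lmult_def)
    have "vnorm H (\<Phi> \<rho> (a \<rho> \<xi>)) \<le> c * d * vnorm H \<xi>" if "\<xi> \<in> vectors H" for \<xi>
    proof -
      have "vnorm H (\<Phi> \<rho> (a \<rho> \<xi>)) \<le> c * vnorm H (a \<rho> \<xi>)" using c(1) D \<rho> that by (simp add: op_bounded_def)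
      also have "\<dots> \<le> c * (d * vnorm H \<xi>)" using d(2)[OF that] c(2) by simp
      finally show ?thesis by simp
    qed
    then show "bounded_operator H (lmult \<Phi> a \<rho>)"
      using \<rho> D by (intro bounded_operatorI[where c = "c * d"]) (simp_all add: lmult_def)
  qed (simp add: lmult_def)
  fix \<epsilon> :: real assume \<epsilon>: "0 < \<epsilon>"
  then have e: "0 < \<epsilon> / c" using c by simp
  obtain f where f: "f \<in> Cc_C0" "op_close a (integrated f) (\<epsilon> / c)" by (rule elems_approx[OF a e])
  have "op_close (lmult \<Phi> a) (lmult \<Phi> (integrated f)) \<epsilon>"
    unfolding op_close_def
  proof (intro ballI)
    fix \<rho> \<xi> assume \<rho>: "\<rho> \<in> R" and \<xi>: "\<xi> \<in> vectors (cspace \<rho>)"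
    interpret covariant_rep act \<mu> \<rho> by (rule covariant_repI[OF \<rho>])
    have v: "a \<rho> \<xi> \<in> vectors H" "integrated f \<rho> \<xi> \<in> vectors H"
      using a integrated_elems[OF f(1)] \<rho> \<xi> by auto
    have "vnorm H (vdiff H (lmult \<Phi> a \<rho> \<xi>) (lmult \<Phi> (integrated f) \<rho> \<xi>)) = vnorm H (\<Phi> \<rho> (vdiff H (a \<rho> \<xi>) (integrated f \<rho> \<xi>)))"
      using \<rho> \<xi> v by (simp add: lmult_def bounded_operatorD(4)[OF \<Phi>])
    also have "\<dots> \<le> c * vnorm H (vdiff H (a \<rho> \<xi>) (integrated f \<rho> \<xi>))"
      using c(1) \<rho> v by (simp add: op_bounded_def)
    also have "\<dots> \<le> c * (\<epsilon> / c * vnorm H \<xi>)"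
      using f(2) \<rho> \<xi> c(2) by (intro mult_left_mono) (auto simp: op_close_def)
    finally show "vnorm H (vdiff H (lmult \<Phi> a \<rho> \<xi>) (lmult \<Phi> (integrated f) \<rho> \<xi>)) \<le> \<epsilon> * vnorm H \<xi>"
      using c(2) by simp
  qed
  then show "\<exists>b\<in>elems A. op_close (lmult \<Phi> a) b \<epsilon>" using cl[OF f(1)] by blast
qed

lemma lmult_scale:
  assumes a: "a \<in> elems A"
  shows "lmult (\<lambda>\<rho>. vscale (cspace \<rho>) k) a \<in> elems A"
proof (rule lmult_elems[OF _ _ _ _ a, where c = "cmod k + 1"])
  show "0 < cmod k + 1" by (simp add: add_nonneg_pos)
next
  show "bounded_operator (cspace \<rho>) (vscale (cspace \<rho>) k)" if \<rho>: "\<rho> \<in> R" for \<rho>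
  proof -
    interpret covariant_rep act \<mu> \<rho> by (rule covariant_repI[OF \<rho>])
    show ?thesis by (rule bounded_operatorI[where c = "cmod k"]) (simp_all add: scale_add_right scale_scale norm_scale mult.commute)
  qed
  show "op_bounded (\<lambda>\<rho>. vscale (cspace \<rho>) k) (cmod k + 1)"
    unfolding op_bounded_def
  proof (intro ballI)
    fix \<rho> \<xi> assume \<rho>: "\<rho> \<in> R" and \<xi>: "\<xi> \<in> vectors (cspace \<rho>)"
    interpret covariant_rep act \<mu> \<rho> by (rule covariant_repI[OF \<rho>])
    show "vnorm H (vscale H k \<xi>) \<le> (cmod k + 1) * vnorm H \<xi>" using \<xi> by (simp add: norm_scale distrib_right)
  qed
  fix f :: "'g \<Rightarrow> 'x \<Rightarrow> complex" assume f: "f \<in> Cc_C0"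
  have kf: "(\<lambda>s x. k * f s x) \<in> Cc_C0"
    by (rule Cc_C0_mult_left[OF f C0_scale, of "cmod k + 1"]) (auto simp: add_nonneg_pos)
  have "lmult (\<lambda>\<rho>. vscale (cspace \<rho>) k) (integrated f) = integrated (\<lambda>s x. k * f s x)"
    by (rule lmult_integrated) (rule covariant_rep.integrated_op_scale[OF covariant_repI f])
  then show "lmult (\<lambda>\<rho>. vscale (cspace \<rho>) k) (integrated f) \<in> elems A" using integrated_elems[OF kf] by simp
qed

lemma lmult_apply: "\<rho> \<in> R \<Longrightarrow> \<xi> \<in> vectors (cspace \<rho>) \<Longrightarrow> lmult \<Phi> a \<rho> \<xi> = \<Phi> \<rho> (a \<rho> \<xi>)"
  by (simp add: lmult_def)

lemma cscale_elems: "a \<in> elems A \<Longrightarrow> cscale A k a \<in> elems A"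
  using lmult_scale[of a k] by (simp add: crossed_product_simps lmult_def)

lemma lmult_frep:
  assumes h: "h \<in> C0" and a: "a \<in> elems A"
  shows "lmult (\<lambda>\<rho>. frep \<rho> h) a \<in> elems A"
proof -
  obtain B where B: "0 < B" "\<And>x. cmod (h x) \<le> B" using C0_bounded[OF h] by blast
  show ?thesis
  proof (rule lmult_elems[OF _ _ B(1) _ a])
    show "bounded_operator (cspace \<rho>) (frep \<rho> h)" if "\<rho> \<in> R" for \<rho>
      by (rule covariant_rep.frep_bounded[OF covariant_repI[OF that] h])
    show "op_bounded (\<lambda>\<rho>. frep \<rho> h) B"
      unfolding op_bounded_def by (intro ballI covariant_rep.frep_contractive[OF covariant_repI h B(2)])
    fix f :: "'g \<Rightarrow> 'x \<Rightarrow> complex" assume f: "f \<in> Cc_C0"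
    have hf: "(\<lambda>s x. h x * f s x) \<in> Cc_C0" by (rule Cc_C0_mult_left[OF f C0_mult[OF h] B])
    have "lmult (\<lambda>\<rho>. frep \<rho> h) (integrated f) = integrated (\<lambda>s x. h x * f s x)"
      by (rule lmult_integrated) (rule covariant_rep.integrated_op_mult_left[OF covariant_repI f h])
    then show "lmult (\<lambda>\<rho>. frep \<rho> h) (integrated f) \<in> elems A" using integrated_elems[OF hf] by simp
  qed
qed

lemma lmult_grep:
  assumes a: "a \<in> elems A"
  shows "lmult (\<lambda>\<rho>. grep \<rho> s) a \<in> elems A"
proof (rule lmult_elems[OF _ _ zero_less_one _ a])
  show "bounded_operator (cspace \<rho>) (grep \<rho> s)" if \<rho>: "\<rho> \<in> R" for \<rho>
  proof -
    interpret covariant_rep act \<mu> \<rho> by (rule covariant_repI[OF \<rho>])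
    show ?thesis by (rule bounded_operatorI[where c = 1]) (simp_all add: grepD(2,3,5))
  qed
  show "op_bounded (\<lambda>\<rho>. grep \<rho> s) 1"
    unfolding op_bounded_def
  proof (intro ballI)
    fix \<rho> \<xi> assume \<rho>: "\<rho> \<in> R" and \<xi>: "\<xi> \<in> vectors (cspace \<rho>)"
    interpret covariant_rep act \<mu> \<rho> by (rule covariant_repI[OF \<rho>])
    show "vnorm H (grep \<rho> s \<xi>) \<le> 1 * vnorm H \<xi>" using \<xi> by (simp add: grepD(5))
  qed
  fix f :: "'g \<Rightarrow> 'x \<Rightarrow> complex" assume f: "f \<in> Cc_C0"
  have "lmult (\<lambda>\<rho>. grep \<rho> s) (integrated f) = integrated (translate s f)"
    by (rule lmult_integrated) (rule covariant_rep.integrated_op_translate[OF covariant_repI f])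
  then show "lmult (\<lambda>\<rho>. grep \<rho> s) (integrated f) \<in> elems A"
    using integrated_elems[OF translate_Cc_C0[OF f]] by simp
qed

lemma cadd_elems:
  assumes a: "a \<in> elems A" and b: "b \<in> elems A"
  shows "cadd A a b \<in> elems A"
proof -
  have fam: "op_family (cadd A a b)"
    unfolding op_family_def
  proof (intro conjI ballI)
    fix \<rho> assume \<rho>: "\<rho> \<in> R"
    interpret covariant_rep act \<mu> \<rho> by (rule covariant_repI[OF \<rho>])
    note ab = op_familyD(1)[OF elems_family[OF a] \<rho>] op_familyD(1)[OF elems_family[OF b] \<rho>]
    note D = bounded_operatorD[OF ab(1)] bounded_operatorD[OF ab(2)]
    show "cadd A a b \<rho> \<in> extensional (vectors H)" using \<rho> by (simp add: crossed_product_simps)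
    obtain c d where c: "\<And>\<xi>. \<xi> \<in> vectors H \<Longrightarrow> vnorm H (a \<rho> \<xi>) \<le> c * vnorm H \<xi>"
      and d: "\<And>\<xi>. \<xi> \<in> vectors H \<Longrightarrow> vnorm H (b \<rho> \<xi>) \<le> d * vnorm H \<xi>"
      using ab by (auto simp: bounded_operator_def)
    have "bounded_operator H (\<lambda>\<xi>. vadd H (a \<rho> \<xi>) (b \<rho> \<xi>))"
    proof (rule bounded_operatorI[where c = "c + d"])
      fix \<xi> assume \<xi>: "\<xi> \<in> vectors H"
      show "vnorm H (vadd H (a \<rho> \<xi>) (b \<rho> \<xi>)) \<le> (c + d) * vnorm H \<xi>"
        using norm_add_le[of "a \<rho> \<xi>" "b \<rho> \<xi>"] c[OF \<xi>] d[OF \<xi>] D \<xi> by (simp add: distrib_right)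
    next
      fix \<xi> \<eta> assume "\<xi> \<in> vectors H" "\<eta> \<in> vectors H"
      then show "vadd H (a \<rho> (vadd H \<xi> \<eta>)) (b \<rho> (vadd H \<xi> \<eta>)) = vadd H (vadd H (a \<rho> \<xi>) (b \<rho> \<xi>)) (vadd H (a \<rho> \<eta>) (b \<rho> \<eta>))"
        by (intro vec_eqI) (simp_all add: D inner_add)
    next
      fix k \<xi> assume "\<xi> \<in> vectors H"
      then show "vadd H (a \<rho> (vscale H k \<xi>)) (b \<rho> (vscale H k \<xi>)) = vscale H k (vadd H (a \<rho> \<xi>) (b \<rho> \<xi>))"
        by (simp add: D scale_add_right)
    qed (use D in auto)
    then show "bounded_operator H (cadd A a b \<rho>)"
      by (rule bounded_operator_cong) (use \<rho> in \<open>simp add: crossed_product_simps\<close>)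
  qed (simp add: crossed_product_simps)
  show ?thesis
    unfolding elems_iff
  proof (intro conjI allI impI)
    fix \<epsilon> :: real assume "0 < \<epsilon>"
    then have e: "0 < \<epsilon> / 2" by simp
    obtain f where f: "f \<in> Cc_C0" "op_close a (integrated f) (\<epsilon> / 2)" by (rule elems_approx[OF a e])
    obtain g where g: "g \<in> Cc_C0" "op_close b (integrated g) (\<epsilon> / 2)" by (rule elems_approx[OF b e])
    have "op_close (cadd A a b) (integrated (\<lambda>s x. f s x + g s x)) \<epsilon>"
      unfolding op_close_def
    proof (intro ballI)
      fix \<rho> \<xi> assume \<rho>: "\<rho> \<in> R" and \<xi>: "\<xi> \<in> vectors (cspace \<rho>)"
      interpret covariant_rep act \<mu> \<rho> by (rule covariant_repI[OF \<rho>])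
      have "vdiff H (cadd A a b \<rho> \<xi>) (integrated (\<lambda>s x. f s x + g s x) \<rho> \<xi>)
        = vdiff H (vadd H (a \<rho> \<xi>) (b \<rho> \<xi>)) (vadd H (integrated f \<rho> \<xi>) (integrated g \<rho> \<xi>))"
        using \<rho> \<xi> f(1) g(1) by (simp add: crossed_product_simps integrated_def integrated_op_add)
      also have "vnorm H \<dots> \<le> vnorm H (vdiff H (a \<rho> \<xi>) (integrated f \<rho> \<xi>)) + vnorm H (vdiff H (b \<rho> \<xi>) (integrated g \<rho> \<xi>))"
        using a b integrated_elems[OF f(1)] integrated_elems[OF g(1)] \<rho> \<xi> by (intro norm_diff_add_le) auto
      also have "\<dots> \<le> \<epsilon> / 2 * vnorm H \<xi> + \<epsilon> / 2 * vnorm H \<xi>"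
        using f(2) g(2) \<rho> \<xi> unfolding op_close_def by (intro add_mono) auto
      finally show "vnorm H (vdiff H (cadd A a b \<rho> \<xi>) (integrated (\<lambda>s x. f s x + g s x) \<rho> \<xi>)) \<le> \<epsilon> * vnorm H \<xi>"
        by simp
    qed
    then show "\<exists>f\<in>Cc_C0. op_close (cadd A a b) (integrated f) \<epsilon>" using Cc_C0_add[OF f(1) g(1)] by blast
  qed (fact fam)
qed

lemma sum_elems:
  assumes "\<And>i. i < n \<Longrightarrow> a i \<in> elems A"
  shows "\<exists>b\<in>elems A. \<forall>\<rho>\<in>R. \<forall>\<xi>\<in>vectors (cspace \<rho>).
    b \<rho> \<xi> = vsum (cspace \<rho>) (\<lambda>i. vscale (cspace \<rho>) (c i) (a i \<rho> \<xi>)) n"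
  using assms
proof (induction n)
  case 0
  have z: "(\<lambda>s x. 0) \<in> (Cc_C0 :: ('g \<Rightarrow> 'x \<Rightarrow> complex) set)" by (rule Cc_C0I[of _ "{}"]) auto
  have "cscale A 0 (integrated (\<lambda>s x. 0)) \<rho> \<xi> = vzero (cspace \<rho>)" if \<rho>: "\<rho> \<in> R" and \<xi>: "\<xi> \<in> vectors (cspace \<rho>)" for \<rho> \<xi>
  proof -
    interpret covariant_rep act \<mu> \<rho> by (rule covariant_repI[OF \<rho>])
    show ?thesis using \<rho> \<xi> integrated_elems[OF z] by (simp add: crossed_product_simps scale_zero)
  qed
  then show ?case using cscale_elems[OF integrated_elems[OF z], of 0] by (intro bexI) auto
next
  case (Suc n)
  have "\<exists>b\<in>elems A. \<forall>\<rho>\<in>R. \<forall>\<xi>\<in>vectors (cspace \<rho>).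
    b \<rho> \<xi> = vsum (cspace \<rho>) (\<lambda>i. vscale (cspace \<rho>) (c i) (a i \<rho> \<xi>)) n"
    by (rule Suc.IH) (simp add: Suc.prems)
  then obtain b where b: "b \<in> elems A" "\<forall>\<rho>\<in>R. \<forall>\<xi>\<in>vectors (cspace \<rho>).
    b \<rho> \<xi> = vsum (cspace \<rho>) (\<lambda>i. vscale (cspace \<rho>) (c i) (a i \<rho> \<xi>)) n"
    by (rule bexE)
  show ?case
    using cadd_elems[OF b(1) cscale_elems[OF Suc.prems[OF lessI], of "c n"]] b(2)
    by (intro bexI[of _ "cadd A b (cscale A (c n) (a n))"]) (auto simp: crossed_product_simps)
qed

text \<open>The unitaries of a covariant pair are merely strongly continuous, but composed with a
  fixed element of the algebra they become norm continuous, uniformly over all pairs: for an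
  integrated form the difference is again an integrated form, that of \<open>translate t f\<close>
  minus f, which \<open>translate_continuous\<close> makes uniformly small.\<close>

lemma grep_eventually_uniform:
  assumes b: "b \<in> elems A" and \<epsilon>: "0 < \<epsilon>"
  shows "eventually (\<lambda>t. \<forall>\<rho>\<in>R. \<forall>\<xi>\<in>vectors (cspace \<rho>). vnorm (cspace \<rho>)
    (vdiff (cspace \<rho>) (grep \<rho> t (b \<rho> \<xi>)) (grep \<rho> s (b \<rho> \<xi>))) \<le> \<epsilon> * vnorm (cspace \<rho>) \<xi>) (nhds s)"
proof -
  have e: "0 < \<epsilon> / 3" using \<epsilon> by simp
  obtain f where f: "f \<in> Cc_C0" "op_close b (integrated f) (\<epsilon> / 3)" by (rule elems_approx[OF b e])
  obtain K where K: "compact K" "\<And>s. s \<notin> K \<Longrightarrow> f s = (\<lambda>x. 0)" using Cc_C0_support[OF f(1)] by blast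
  obtain U C where U: "open U" "compact C" "(0 :: 'g) \<in> U" "U \<subseteq> C"
    using locally_compactE[OF lc, of 0] by metis
  \<comment> \<open>A compact set that carries f and all its translates by elements of C, so that
    the norm bound has one measure factor for all small t.\<close>
  define L where "L = K \<union> (K + C)"
  have L: "compact L" unfolding L_def by (intro compact_Un compact_plus K(1) U(2))
  define d where "d = \<epsilon> / 3 / (measure \<mu> L + 1)"
  have mp: "0 < measure \<mu> L + 1" by (simp add: add_nonneg_pos)
  have d: "0 < d" "d * measure \<mu> L \<le> \<epsilon> / 3" using \<epsilon> mp by (auto simp: d_def field_simps)
  have "eventually (\<lambda>t. t \<in> U) (nhds 0)" using U by (simp add: eventually_nhds_in_open)
  with translate_continuous[OF f(1) d(1)]
  have ev0: "eventually (\<lambda>t. \<forall>\<rho>\<in>R. \<forall>\<xi>\<in>vectors (cspace \<rho>). vnorm (cspace \<rho>)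
    (vdiff (cspace \<rho>) (grep \<rho> t (b \<rho> \<xi>)) (b \<rho> \<xi>)) \<le> \<epsilon> * vnorm (cspace \<rho>) \<xi>) (nhds 0)"
  proof eventually_elim
    case (elim t)
    show ?case
    proof (intro ballI)
      fix \<rho> \<xi> assume \<rho>: "\<rho> \<in> R" and \<xi>: "\<xi> \<in> vectors (cspace \<rho>)"
      interpret covariant_rep act \<mu> \<rho> by (rule covariant_repI[OF \<rho>])
      let ?f = "integrated f \<rho> \<xi>"
      have v: "b \<rho> \<xi> \<in> vectors H" "?f \<in> vectors H" using b integrated_elems[OF f(1)] \<rho> \<xi> by auto
      define g where "g = (\<lambda>r x. translate t f r x + (- 1) * f r x)"
      have mf: "(\<lambda>r x. (- 1) * f r x) \<in> Cc_C0"
        by (rule Cc_C0_mult_left[OF f(1) C0_scale, of 1]) auto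
      have g: "g \<in> Cc_C0" unfolding g_def by (rule Cc_C0_add[OF translate_Cc_C0[OF f(1)] mf])
      have gz: "g r = (\<lambda>x. 0)" if "r \<notin> L" for r
      proof -
        have "r \<notin> K" using that by (simp add: L_def)
        moreover have "r - t \<notin> K"
        proof
          assume "r - t \<in> K"
          then have "(r - t) + t \<in> K + C" using elim(2) U(4) by (intro set_plus_intro) auto
          then show False using that by (simp add: L_def)
        qed
        ultimately show ?thesis using K(2) by (simp add: g_def translate_def)
      qed
      have "vdiff H (grep \<rho> t ?f) ?f = integrated_op \<mu> \<rho> g \<xi>"
        unfolding g_def using \<rho> \<xi> f(1) mf
        by (subst integrated_op_add[OF translate_Cc_C0[OF f(1)] mf \<xi>])
          (simp add: integrated_op_translate[OF f(1) \<xi>] integrated_op_scale[OF f(1) \<xi>, of "- 1", simplified] integrated_def vdiff_def)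
      then have "vnorm H (vdiff H (grep \<rho> t ?f) ?f) \<le> d * measure \<mu> L * vnorm H \<xi>"
        using integrated_op_norm_le[OF g \<xi> L gz less_imp_le[OF d(1)]] elim(1) by (simp add: g_def)
      also have "\<dots> \<le> \<epsilon> / 3 * vnorm H \<xi>" by (rule mult_right_mono[OF d(2) norm_nonneg[OF \<xi>]])
      finally have 2: "vnorm H (vdiff H (grep \<rho> t ?f) ?f) \<le> \<epsilon> / 3 * vnorm H \<xi>" .
      have 3: "vnorm H (vdiff H (b \<rho> \<xi>) ?f) \<le> \<epsilon> / 3 * vnorm H \<xi>" using f(2) \<rho> \<xi> by (simp add: op_close_def)
      have 1: "vnorm H (vdiff H (grep \<rho> t (b \<rho> \<xi>)) (grep \<rho> t ?f)) \<le> \<epsilon> / 3 * vnorm H \<xi>"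
        using 3 v by (simp add: grepD(5) flip: grepD(4))
      have "vnorm H (vdiff H (grep \<rho> t (b \<rho> \<xi>)) (b \<rho> \<xi>)) \<le> \<epsilon> / 3 * vnorm H \<xi> + (\<epsilon> / 3 * vnorm H \<xi> + \<epsilon> / 3 * vnorm H \<xi>)"
        using 3 v norm_diff_commute[of ?f "b \<rho> \<xi>"]
        by (intro norm_diff_triangle_le[OF _ _ _ 1] norm_diff_triangle_le[OF _ _ _ 2]) auto
      then show "vnorm H (vdiff H (grep \<rho> t (b \<rho> \<xi>)) (b \<rho> \<xi>)) \<le> \<epsilon> * vnorm H \<xi>" by simp
    qed
  qed
  have "filterlim (\<lambda>t. t - s) (nhds (s - s)) (nhds s)"
    by (intro tendsto_intros) (simp add: filterlim_ident)
  then have "filterlim (\<lambda>t. t - s) (nhds 0) (nhds s)" by simp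
  from eventually_compose_filterlim[OF ev0 this] show ?thesis
  proof eventually_elim
    case (elim t)
    show ?case
    proof (intro ballI)
      fix \<rho> \<xi> assume \<rho>: "\<rho> \<in> R" and \<xi>: "\<xi> \<in> vectors (cspace \<rho>)"
      interpret covariant_rep act \<mu> \<rho> by (rule covariant_repI[OF \<rho>])
      have v: "b \<rho> \<xi> \<in> vectors H" using b \<rho> \<xi> by auto
      have "vnorm H (vdiff H (grep \<rho> t (b \<rho> \<xi>)) (grep \<rho> s (b \<rho> \<xi>)))
        = vnorm H (grep \<rho> s (vdiff H (grep \<rho> (t - s) (b \<rho> \<xi>)) (b \<rho> \<xi>)))"
        using grep_add[OF v, of s "t - s"] v by (simp add: grepD(4))
      also have "\<dots> \<le> \<epsilon> * vnorm H \<xi>" using elim \<rho> \<xi> v by (simp add: grepD(5))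
      finally show "vnorm H (vdiff H (grep \<rho> t (b \<rho> \<xi>)) (grep \<rho> s (b \<rho> \<xi>))) \<le> \<epsilon> * vnorm H \<xi>" .
    qed
  qed
qed

text \<open>The product of an integrated form with b is the weak integral over s of b followed by
  \<open>grep \<rho> s\<close> and \<open>frep \<rho> (f s)\<close>. Its Riemann sums are in the
  algebra by \<open>lmult_frep\<close> and \<open>lmult_grep\<close>, and they approximate uniformly
  over all pairs by \<open>grep_eventually_uniform\<close>. This gives closure under products
  without the convolution formula.\<close>

lemma integrated_mult_approx:
  assumes f: "f \<in> Cc_C0" and b: "b \<in> elems A" and \<epsilon>: "0 < \<epsilon>"
  shows "\<exists>b'\<in>elems A. \<forall>\<rho>\<in>R. \<forall>\<xi>\<in>vectors (cspace \<rho>).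
    vnorm (cspace \<rho>) (vdiff (cspace \<rho>) (integrated f \<rho> (b \<rho> \<xi>)) (b' \<rho> \<xi>)) \<le> \<epsilon> * vnorm (cspace \<rho>) \<xi>"
proof -
  obtain K where K: "compact K" "\<And>s. s \<notin> K \<Longrightarrow> f s = (\<lambda>x. 0)" using Cc_C0_support[OF f] by blast
  obtain B where B: "0 < B" "\<And>s x. cmod (f s x) \<le> B" using Cc_C0_bounded[OF f] by blast
  obtain c where c: "0 < c" "op_bounded b c" by (rule elems_bounded[OF b])
  define d where "d = \<epsilon> / (measure \<mu> K + 1)"
  have mp: "0 < measure \<mu> K + 1" by (simp add: add_nonneg_pos)
  have d: "0 < d" "d * measure \<mu> K \<le> \<epsilon>" using \<epsilon> mp by (auto simp: d_def field_simps)
  let ?F = "\<lambda>\<rho> \<xi> s. frep \<rho> (f s) (grep \<rho> s (b \<rho> \<xi>))"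
  \<comment> \<open>The predicate quantifies over all pairs, so the partition obtained from it, and
    with it the Riemann sum \<open>b'\<close>, does not depend on \<rho>.\<close>
  define P where "P s s' \<longleftrightarrow> (\<forall>\<rho>\<in>R. \<forall>\<xi>\<in>vectors (cspace \<rho>).
    vnorm (cspace \<rho>) (vdiff (cspace \<rho>) (?F \<rho> \<xi> s') (?F \<rho> \<xi> s)) \<le> d * vnorm (cspace \<rho>) \<xi>)" for s s'
  have "eventually (P s) (nhds s)" for s
  proof -
    have d1: "0 < d / 2 / c" and d2: "0 < d / 2 / B" using d c B by auto
    from Cc_C0_eventually[OF f d1, of s] grep_eventually_uniform[OF b d2, of s]
    show ?thesis
    proof eventually_elim
      case (elim t)
      show ?case
        unfolding P_def
      proof (intro ballI)
        fix \<rho> \<xi> assume \<rho>: "\<rho> \<in> R" and \<xi>: "\<xi> \<in> vectors (cspace \<rho>)"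
        interpret covariant_rep act \<mu> \<rho> by (rule covariant_repI[OF \<rho>])
        let ?b = "b \<rho> \<xi>"
        have v: "?b \<in> vectors H" using b \<rho> \<xi> by auto
        have Ct: "f t \<in> C0" "f s \<in> C0" using Cc_C0_C0[OF f] by auto
        have "vnorm H (vdiff H (frep \<rho> (f t) (grep \<rho> t ?b)) (frep \<rho> (f s) (grep \<rho> t ?b)))
            = vnorm H (frep \<rho> (\<lambda>x. f t x - f s x) (grep \<rho> t ?b))"
          using Ct v by (simp add: frep_diff)
        also have "\<dots> \<le> (d / 2 / c) * vnorm H (grep \<rho> t ?b)"
          using elim(1) Ct v by (intro frep_contractive) (auto intro: C0_diff less_imp_le)
        also have "\<dots> \<le> (d / 2 / c) * (c * vnorm H \<xi>)"
          using c d1 \<rho> \<xi> v by (intro mult_left_mono) (auto simp: grepD(5) op_bounded_def)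
        finally have 1: "vnorm H (vdiff H (frep \<rho> (f t) (grep \<rho> t ?b)) (frep \<rho> (f s) (grep \<rho> t ?b))) \<le> d / 2 * vnorm H \<xi>"
          using c(1) by simp
        have "vnorm H (vdiff H (frep \<rho> (f s) (grep \<rho> t ?b)) (frep \<rho> (f s) (grep \<rho> s ?b)))
            = vnorm H (frep \<rho> (f s) (vdiff H (grep \<rho> t ?b) (grep \<rho> s ?b)))"
          using Ct v by (simp add: bounded_operatorD(4)[OF frep_bounded])
        also have "\<dots> \<le> B * vnorm H (vdiff H (grep \<rho> t ?b) (grep \<rho> s ?b))"
          using B(2) Ct v by (intro frep_contractive) auto
        also have "\<dots> \<le> B * (d / 2 / B * vnorm H \<xi>)" using elim(2) \<rho> \<xi> B(1) by (intro mult_left_mono) auto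
        finally have 2: "vnorm H (vdiff H (frep \<rho> (f s) (grep \<rho> t ?b)) (frep \<rho> (f s) (grep \<rho> s ?b))) \<le> d / 2 * vnorm H \<xi>"
          using B(1) by simp
        have "vnorm H (vdiff H (?F \<rho> \<xi> t) (?F \<rho> \<xi> s)) \<le> d / 2 * vnorm H \<xi> + d / 2 * vnorm H \<xi>"
          by (rule norm_diff_triangle_le[OF _ _ _ 1 2]) (use Ct v in auto)
        then show "vnorm H (vdiff H (?F \<rho> \<xi> t) (?F \<rho> \<xi> s)) \<le> d * vnorm H \<xi>" by simp
      qed
    qed
  qed
  then obtain n p E where p: "\<And>i. i < n \<Longrightarrow> p i \<in> K" and E: "\<And>i. i < n \<Longrightarrow> E i \<in> sets borel"
    "disjoint_family_on E {..<n}" "(\<Union>i<n. E i) = K"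
    and PE: "\<And>i s. i < (n::nat) \<Longrightarrow> s \<in> E i \<Longrightarrow> P (p i) s"
    by (rule compact_partition[OF K(1), where P = P]) blast
  have "lmult (\<lambda>\<rho>. frep \<rho> (f (p i))) (lmult (\<lambda>\<rho>. grep \<rho> (p i)) b) \<in> elems A" for i
    by (intro lmult_frep lmult_grep b Cc_C0_C0 f)
  then have "\<exists>b'\<in>elems A. \<forall>\<rho>\<in>R. \<forall>\<xi>\<in>vectors (cspace \<rho>).
    b' \<rho> \<xi> = vsum (cspace \<rho>) (\<lambda>i. vscale (cspace \<rho>) (measure \<mu> (E i))
      (lmult (\<lambda>\<rho>. frep \<rho> (f (p i))) (lmult (\<lambda>\<rho>. grep \<rho> (p i)) b) \<rho> \<xi>)) n"
    by (rule sum_elems)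
  then obtain b' where b': "b' \<in> elems A" "\<forall>\<rho>\<in>R. \<forall>\<xi>\<in>vectors (cspace \<rho>).
    b' \<rho> \<xi> = vsum (cspace \<rho>) (\<lambda>i. vscale (cspace \<rho>) (measure \<mu> (E i))
      (lmult (\<lambda>\<rho>. frep \<rho> (f (p i))) (lmult (\<lambda>\<rho>. grep \<rho> (p i)) b) \<rho> \<xi>)) n"
    by (rule bexE)
  show ?thesis
  proof (intro bexI[OF _ b'(1)] ballI)
    fix \<rho> \<xi> assume \<rho>: "\<rho> \<in> R" and \<xi>: "\<xi> \<in> vectors (cspace \<rho>)"
    interpret covariant_rep act \<mu> \<rho> by (rule covariant_repI[OF \<rho>])
    have v: "b \<rho> \<xi> \<in> vectors H" using b \<rho> \<xi> by auto
    have F: "?F \<rho> \<xi> s \<in> vectors H" for s using Cc_C0_C0[OF f] v by simp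
    have F0: "?F \<rho> \<xi> s = vzero H" if "s \<notin> K" for s using K(2)[OF that] v by (simp add: frep_zero)
    have b'eq: "b' \<rho> \<xi> = vsum H (\<lambda>i. vscale H (measure \<mu> (E i)) (?F \<rho> \<xi> (p i))) n"
      using b'(2) \<rho> \<xi> by (simp add: lmult_apply)
    show "vnorm H (vdiff H (integrated f \<rho> (b \<rho> \<xi>)) (b' \<rho> \<xi>)) \<le> \<epsilon> * vnorm H \<xi>"
    proof (rule norm_leI)
      fix \<eta> assume \<eta>: "\<eta> \<in> vectors H"
      have meas: "(\<lambda>s. vinner H (?F \<rho> \<xi> s) \<eta>) \<in> borel_measurable borel"
        by (rule continuous_borel[OF frep_grep_inner_continuous[OF f v \<eta>]])
      have "cmod ((LINT s|\<mu>. vinner H (?F \<rho> \<xi> s) \<eta>) - vinner H (b' \<rho> \<xi>) \<eta>) \<le> (d * vnorm H \<xi>) * measure \<mu> K * vnorm H \<eta>"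
        unfolding b'eq
        by (rule riemann_sum_approx[OF sets_mu(1) K(1) mu_compact[OF K(1)] F F0 meas p E _ _ \<eta>])
          (use PE \<rho> \<xi> d(1) in \<open>auto simp: P_def\<close>)
      also have "\<dots> \<le> (\<epsilon> * vnorm H \<xi>) * vnorm H \<eta>"
        using mult_right_mono[OF d(2), of "vnorm H \<xi> * vnorm H \<eta>"] \<xi> \<eta> by (simp add: algebra_simps)
      finally show "cmod (vinner H (vdiff H (integrated f \<rho> (b \<rho> \<xi>)) (b' \<rho> \<xi>)) \<eta>) \<le> (\<epsilon> * vnorm H \<xi>) * vnorm H \<eta>"
        using v \<eta> f \<rho> elems_closed[OF b'(1) \<rho> \<xi>] by (simp add: inner_diff integrated_def integrated_op_inner)
    qed (use v \<rho> \<xi> \<epsilon> elems_closed[OF b'(1) \<rho> \<xi>] elems_closed[OF integrated_elems[OF f] \<rho> v] in auto)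
  qed
qed

lemma cmult_elems:
  assumes a: "a \<in> elems A" and b: "b \<in> elems A"
  shows "cmult A a b \<in> elems A"
proof (rule elems_limit)
  obtain c where c: "0 < c" "op_bounded b c" by (rule elems_bounded[OF b])
  show fam: "op_family (cmult A a b)"
    unfolding op_family_def
  proof (intro conjI ballI)
    fix \<rho> assume \<rho>: "\<rho> \<in> R"
    interpret covariant_rep act \<mu> \<rho> by (rule covariant_repI[OF \<rho>])
    note ab = op_familyD(1)[OF elems_family[OF a] \<rho>] op_familyD(1)[OF elems_family[OF b] \<rho>]
    note D = bounded_operatorD[OF ab(1)] bounded_operatorD[OF ab(2)]
    show "cmult A a b \<rho> \<in> extensional (vectors H)" using \<rho> by (simp add: crossed_product_simps)
    obtain d where d: "0 < d" "\<And>\<xi>. \<xi> \<in> vectors H \<Longrightarrow> vnorm H (a \<rho> \<xi>) \<le> d * vnorm H \<xi>"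
      using bounded_operator_bound[OF ab(1)] by blast
    have "vnorm H (a \<rho> (b \<rho> \<xi>)) \<le> d * c * vnorm H \<xi>" if "\<xi> \<in> vectors H" for \<xi>
    proof -
      have "d * vnorm H (b \<rho> \<xi>) \<le> d * (c * vnorm H \<xi>)"
        using c(2) d(1) \<rho> that by (intro mult_left_mono) (auto simp: op_bounded_def)
      then show ?thesis using d(2)[of "b \<rho> \<xi>"] D that by (simp add: mult.assoc)
    qed
    then show "bounded_operator H (cmult A a b \<rho>)"
      using \<rho> D by (intro bounded_operatorI[where c = "d * c"]) (simp_all add: crossed_product_simps)
  qed (simp add: crossed_product_simps)
  fix \<epsilon> :: real assume \<epsilon>: "0 < \<epsilon>"
  have e: "0 < \<epsilon> / 2 / c" "0 < \<epsilon> / 2" using \<epsilon> c by auto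
  obtain f where f: "f \<in> Cc_C0" "op_close a (integrated f) (\<epsilon> / 2 / c)" by (rule elems_approx[OF a e(1)])
  obtain b' where b': "b' \<in> elems A" "\<forall>\<rho>\<in>R. \<forall>\<xi>\<in>vectors (cspace \<rho>).
    vnorm (cspace \<rho>) (vdiff (cspace \<rho>) (integrated f \<rho> (b \<rho> \<xi>)) (b' \<rho> \<xi>)) \<le> \<epsilon> / 2 * vnorm (cspace \<rho>) \<xi>"
    using integrated_mult_approx[OF f(1) b e(2)] by (rule bexE)
  have "op_close (cmult A a b) b' \<epsilon>"
    unfolding op_close_def
  proof (intro ballI)
    fix \<rho> \<xi> assume \<rho>: "\<rho> \<in> R" and \<xi>: "\<xi> \<in> vectors (cspace \<rho>)"
    interpret covariant_rep act \<mu> \<rho> by (rule covariant_repI[OF \<rho>])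
    have v: "b \<rho> \<xi> \<in> vectors H" using b \<rho> \<xi> by auto
    have "vnorm H (vdiff H (a \<rho> (b \<rho> \<xi>)) (integrated f \<rho> (b \<rho> \<xi>))) \<le> \<epsilon> / 2 / c * vnorm H (b \<rho> \<xi>)"
      using f(2) \<rho> v by (simp add: op_close_def)
    also have "\<dots> \<le> \<epsilon> / 2 / c * (c * vnorm H \<xi>)"
      using c(2) e(1) \<rho> \<xi> by (intro mult_left_mono) (auto simp: op_bounded_def)
    finally have 1: "vnorm H (vdiff H (a \<rho> (b \<rho> \<xi>)) (integrated f \<rho> (b \<rho> \<xi>))) \<le> \<epsilon> / 2 * vnorm H \<xi>"
      using c(1) by simp
    have "vnorm H (vdiff H (a \<rho> (b \<rho> \<xi>)) (b' \<rho> \<xi>)) \<le> \<epsilon> / 2 * vnorm H \<xi> + \<epsilon> / 2 * vnorm H \<xi>"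
      by (rule norm_diff_triangle_le[OF _ _ _ 1 b'(2)[rule_format, OF \<rho> \<xi>]])
        (use elems_closed[OF b'(1) \<rho> \<xi>] elems_closed[OF integrated_elems[OF f(1)] \<rho> v] elems_closed[OF a \<rho> v] in auto)
    then show "vnorm H (vdiff H (cmult A a b \<rho> \<xi>) (b' \<rho> \<xi>)) \<le> \<epsilon> * vnorm H \<xi>"
      using \<rho> \<xi> by (simp add: crossed_product_simps)
  qed
  then show "\<exists>b'\<in>elems A. op_close (cmult A a b) b' \<epsilon>" using b'(1) by blast
qed

text \<open>\<open>bounded_operator_limit\<close> is applied at each pair with a common rate, so
  closeness stays uniform and the limit family is again approximable by elements of the
  algebra.\<close>

lemma elems_complete:
  assumes a: "\<And>n :: nat. a n \<in> elems A" and cl: "\<And>m n. m \<le> n \<Longrightarrow> op_close (a n) (a m) (e m)"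
    and e: "e \<longlonglongrightarrow> 0"
  shows "\<exists>b\<in>elems A. \<forall>m. op_close b (a m) (e m)"
proof -
  have "\<exists>S\<in>extensional (vectors (cspace \<rho>)). bounded_operator (cspace \<rho>) S \<and>
    (\<forall>\<xi>\<in>vectors (cspace \<rho>). \<forall>m. vnorm (cspace \<rho>) (vdiff (cspace \<rho>) (S \<xi>) (a m \<rho> \<xi>)) \<le> e m * vnorm (cspace \<rho>) \<xi>)"
    if \<rho>: "\<rho> \<in> R" for \<rho>
  proof -
    interpret covariant_rep act \<mu> \<rho> by (rule covariant_repI[OF \<rho>])
    show ?thesis
      using cl \<rho> op_familyD(1)[OF elems_family[OF a] \<rho>]
      by (intro bounded_operator_limit e) (auto simp: op_close_def)
  qed
  then obtain S where S: "\<And>\<rho>. \<rho> \<in> R \<Longrightarrow> S \<rho> \<in> extensional (vectors (cspace \<rho>))"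
    "\<And>\<rho>. \<rho> \<in> R \<Longrightarrow> bounded_operator (cspace \<rho>) (S \<rho>)"
    "\<And>\<rho> \<xi> m. \<rho> \<in> R \<Longrightarrow> \<xi> \<in> vectors (cspace \<rho>) \<Longrightarrow>
      vnorm (cspace \<rho>) (vdiff (cspace \<rho>) (S \<rho> \<xi>) (a m \<rho> \<xi>)) \<le> e m * vnorm (cspace \<rho>) \<xi>"
    by metis
  have close: "op_close (restrict S R) (a m) (e m)" for m using S(3) by (simp add: op_close_def)
  have "restrict S R \<in> elems A"
  proof (rule elems_limit)
    show "op_family (restrict S R)" using S(1,2) by (simp add: op_family_def)
    fix \<epsilon> :: real assume "0 < \<epsilon>"
    then have "eventually (\<lambda>m. e m < \<epsilon>) sequentially" by (rule order_tendstoD[OF e])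
    then obtain m where m: "e m < \<epsilon>" by (auto simp: eventually_sequentially)
    have "op_close (restrict S R) (a m) \<epsilon>"
      unfolding op_close_def
    proof (intro ballI)
      fix \<rho> \<xi> assume \<rho>: "\<rho> \<in> R" and \<xi>: "\<xi> \<in> vectors (cspace \<rho>)"
      interpret covariant_rep act \<mu> \<rho> by (rule covariant_repI[OF \<rho>])
      have "e m * vnorm H \<xi> \<le> \<epsilon> * vnorm H \<xi>" using m \<xi> by (intro mult_right_mono) auto
      then show "vnorm H (vdiff H (restrict S R \<rho> \<xi>) (a m \<rho> \<xi>)) \<le> \<epsilon> * vnorm H \<xi>"
        using close[of m] \<rho> \<xi> unfolding op_close_def by fastforce
    qed
    then show "\<exists>b\<in>elems A. op_close (restrict S R) b \<epsilon>" using a by blast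
  qed
  then show ?thesis using close by blast
qed

text \<open>This is the common kernel of the pairs in Q. That it is a two-sided ideal uses that A is
  closed under products, and closedness uses that a small distance in \<open>cnorm\<close> means a
  small distance at each pair. Such ideals provide the neighbourhoods with which convergence in the
  spectrum is tested.\<close>

lemma closed_ideal_annihilator:
  assumes Q: "Q \<subseteq> R"
  shows "closed_ideal A {a \<in> elems A. \<forall>\<rho>\<in>Q. \<forall>\<xi>\<in>vectors (cspace \<rho>). a \<rho> \<xi> = vzero (cspace \<rho>)}"
    (is "closed_ideal A ?I")
  unfolding closed_ideal_def
proof (intro conjI ballI allI impI)
  have hs: "hilbert_space (cspace \<rho>)" if "\<rho> \<in> R" for \<rho>
  proof -
    interpret covariant_rep act \<mu> \<rho> by (rule covariant_repI[OF that])
    show ?thesis by unfold_locales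
  qed
  have zero_map: "a \<rho> (vzero (cspace \<rho>)) = vzero (cspace \<rho>)" if "a \<in> elems A" "\<rho> \<in> R" for a \<rho>
  proof -
    interpret covariant_rep act \<mu> \<rho> by (rule covariant_repI[OF that(2)])
    have "a \<rho> (vscale H 0 (vzero H)) = vscale H 0 (a \<rho> (vzero H))"
      by (rule bounded_operatorD(3)[OF op_familyD(1)[OF elems_family[OF that(1)] that(2)]]) simp
    then show ?thesis using elems_closed[OF that(1,2), of "vzero H"] by (simp add: scale_zero)
  qed
  show "?I \<subseteq> elems A" by auto
  obtain b where b: "b \<in> elems A" "\<And>\<rho> \<xi>. \<rho> \<in> R \<Longrightarrow> \<xi> \<in> vectors (cspace \<rho>) \<Longrightarrow> b \<rho> \<xi> = vzero (cspace \<rho>)"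
    using sum_elems[of 0] by auto
  then have "b \<in> ?I" using Q by auto
  then show "?I \<noteq> {}" by blast
  show "cadd A a b \<in> ?I" if "a \<in> ?I" "b \<in> ?I" for a b
    using that cadd_elems[of a b] Q hs
    by (auto simp: crossed_product_simps(1) subset_iff hilbert_space.add_zero hilbert_space.zero_closed)
  show "cscale A c a \<in> ?I" if "a \<in> ?I" for a c
  proof -
    have "vscale (cspace \<rho>) c (vzero (cspace \<rho>)) = vzero (cspace \<rho>)" if "\<rho> \<in> R" for \<rho>
    proof -
      interpret covariant_rep act \<mu> \<rho> by (rule covariant_repI[OF that])
      show ?thesis by (rule vec_eqI) (simp_all add: inner_scale)
    qed
    then show ?thesis using that cscale_elems[of a c] Q by (auto simp: crossed_product_simps(2) subset_iff)
  qed
  show "cmult A a b \<in> ?I" "cmult A b a \<in> ?I" if "a \<in> elems A" "b \<in> ?I" for a b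
    using that cmult_elems[of a b] cmult_elems[of b a] Q zero_map elems_closed[of a]
    by (auto simp: crossed_product_simps(3) subset_iff)
  fix a assume a: "a \<in> elems A" and ap: "\<forall>\<epsilon>>0. \<exists>b\<in>?I. cnorm A (cadd A a (cscale A (- 1) b)) < \<epsilon>"
  have "a \<rho> \<xi> = vzero (cspace \<rho>)" if \<rho>: "\<rho> \<in> Q" and \<xi>: "\<xi> \<in> vectors (cspace \<rho>)" for \<rho> \<xi>
  proof -
    have \<rho>R: "\<rho> \<in> R" using Q \<rho> by blast
    interpret covariant_rep act \<mu> \<rho> by (rule covariant_repI[OF \<rho>R])
    show ?thesis
    proof (rule norm_diff_le_0)
      fix \<epsilon> :: real assume \<epsilon>: "0 < \<epsilon>"
      have p: "0 < vnorm H \<xi> + 1" using norm_nonneg[OF \<xi>] by linarith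
      define d where "d = \<epsilon> / (vnorm H \<xi> + 1)"
      have d: "0 < d" using \<epsilon> p by (simp add: d_def)
      have "\<exists>b\<in>?I. cnorm A (cadd A a (cscale A (- 1) b)) < d" using ap d by blast
      then obtain b where b: "b \<in> ?I" "cnorm A (cadd A a (cscale A (- 1) b)) < d" by (rule bexE)
      obtain k where k: "0 < k" "op_bounded a k" by (rule elems_bounded[OF a])
      obtain l where l: "0 < l" "op_bounded b l" using elems_bounded[of b] b(1) by blast
      have "op_close a b d"
        by (rule op_close_cnorm[OF elems_family[OF a] elems_family k(2) l(2) _ _ less_imp_le[OF b(2)]])
          (use b(1) k l in auto)
      then have "vnorm H (vdiff H (a \<rho> \<xi>) (b \<rho> \<xi>)) \<le> d * vnorm H \<xi>" using \<rho>R \<xi> by (simp add: op_close_def)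
      moreover have "b \<rho> \<xi> = vzero H" using b(1) \<rho> \<xi> by simp
      moreover have "d * vnorm H \<xi> \<le> d * (vnorm H \<xi> + 1)" using d by (intro mult_left_mono) auto
      moreover have "d * (vnorm H \<xi> + 1) = \<epsilon>" using p by (simp add: d_def)
      ultimately show "vnorm H (vdiff H (a \<rho> \<xi>) (vzero H)) \<le> \<epsilon>" by simp
    qed (use a \<rho>R \<xi> in auto)
  qed
  then show "a \<in> ?I" using a by blast
qed

end

section \<open>Points of the spectrum\<close>

lemma equivalent_reps_refl: "equivalent_reps A \<pi> \<pi>"
proof (cases \<pi>)
  case (Pair H p)
  have "unitary_map H H (\<lambda>\<xi>. \<xi>)"
    by (auto simp: unitary_map_def linear_map_def bij_betw_def)
  then show ?thesis
    unfolding equivalent_reps_def Pair by (auto intro!: exI[of _ "\<lambda>\<xi>. \<xi>"])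
qed

text \<open>Membership in the spectrum says only that the class equals that of some irreducible
  \<sigma>, which then lies in it by reflexivity. Properties of \<pi> are obtained from \<sigma> by
  transport along the equivalence.\<close>

lemma rep_class_in_spectrumE:
  assumes "rep_class A \<pi> \<in> spectrum A"
  obtains \<sigma> where "\<sigma> \<in> rep_class A \<pi>"
proof -
  obtain \<sigma> where \<sigma>: "irreducible_rep A \<sigma>" "rep_class A \<pi> = rep_class A \<sigma>"
    using assms by (auto simp: spectrum_def)
  then have "\<sigma> \<in> rep_class A \<pi>" by (auto simp: rep_class_def equivalent_reps_refl)
  then show thesis by (rule that)
qed

lemma rep_classD:
  assumes "\<sigma> \<in> rep_class A (H, p)"
  shows "\<exists>K r u. \<sigma> = (K, r) \<and> irreducible_rep A (K, r) \<and> unitary_map H K u \<and>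
    (\<forall>a\<in>elems A. \<forall>\<xi>\<in>vectors H. u (p a \<xi>) = r a (u \<xi>))"
  using assms by (cases \<sigma>) (auto simp: rep_class_def equivalent_reps_def)

lemma irreducible_hilbert: "irreducible_rep A (K, r) \<Longrightarrow> hilbert_space K"
  by (simp add: irreducible_rep_def star_representation_def)

lemma limitin_spectrumD:
  assumes "limitin (spectrum_topology A) c l F"
  shows "l \<in> spectrum A" "eventually (\<lambda>i. c i \<in> spectrum A) F"
    and "closed_ideal A I \<Longrightarrow> (\<And>\<pi>. \<pi> \<in> l \<Longrightarrow> \<not> I \<subseteq> rep_kernel A \<pi>) \<Longrightarrow>
      eventually (\<lambda>i. \<forall>\<pi>\<in>c i. \<not> I \<subseteq> rep_kernel A \<pi>) F"
proof -
  let ?S = "{{c \<in> spectrum A. \<forall>\<pi>\<in>c. \<not> I \<subseteq> rep_kernel A \<pi>} | I. closed_ideal A I}"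
  have top: "topspace (spectrum_topology A) = \<Union>?S" by (simp add: spectrum_topology_def)
  then have sub: "topspace (spectrum_topology A) \<subseteq> spectrum A" by auto
  have lt: "l \<in> topspace (spectrum_topology A)" using assms by (simp add: limitin_def)
  then show l: "l \<in> spectrum A" using sub by blast
  have "eventually (\<lambda>i. c i \<in> topspace (spectrum_topology A)) F"
    using assms lt openin_topspace unfolding limitin_def by blast
  then show "eventually (\<lambda>i. c i \<in> spectrum A) F" by eventually_elim (use sub in blast)
  assume I: "closed_ideal A I" "\<And>\<pi>. \<pi> \<in> l \<Longrightarrow> \<not> I \<subseteq> rep_kernel A \<pi>"
  let ?U = "{c \<in> spectrum A. \<forall>\<pi>\<in>c. \<not> I \<subseteq> rep_kernel A \<pi>}"
  have "openin (spectrum_topology A) ?U"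
    unfolding spectrum_topology_def by (rule topology_generated_by_Basis) (use I(1) in blast)
  moreover have "l \<in> ?U" using l I(2) by blast
  ultimately have "eventually (\<lambda>i. c i \<in> ?U) F" using assms unfolding limitin_def by blast
  then show "eventually (\<lambda>i. \<forall>\<pi>\<in>c i. \<not> I \<subseteq> rep_kernel A \<pi>) F" by eventually_elim simp
qed

context transformation_group
begin

text \<open>
  If \<open>\<rho>\<close> is not a covariant pair then evaluation at \<open>\<rho>\<close> is constant on the crossed product, so it
  cannot be equivalent to an irreducible representation.
\<close>

lemma covariant_of_spectrum:
  fixes \<rho> :: "('g, 'x, 'h) covariant_pair"
  defines "A \<equiv> (crossed_product act \<mu> :: (('g, 'x, 'h) covariant_pair \<Rightarrow> 'h \<Rightarrow> 'h) cstar)"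
  assumes "rep_class A (integrated_form \<rho>) \<in> spectrum A"
  shows "\<rho> \<in> covariant_reps act"
proof (rule ccontr)
  assume \<rho>: "\<rho> \<notin> covariant_reps act"
  have ext: "a \<in> extensional (covariant_reps act)" if "a \<in> elems A" for a
    using that by (auto simp: A_def crossed_product_def operator_product_def Let_def PiE_def)
  \<comment> \<open>Since a and 0 times a agree at \<rho>, the operator representing a equals 0
    times itself. That 0 times a belongs to the algebra needs its own argument when there are no
    covariant pairs at all, as \<open>cscale_elems\<close> presupposes one.\<close>
  have scale: "cscale A 0 a \<in> elems A" if a: "a \<in> elems A" for a
  proof (cases "covariant_reps act = ({} :: ('g, 'x, 'h) covariant_pair set)")
    case True
    then have "cscale A 0 a = a" using ext[OF a] by (auto simp: A_def crossed_product_simps extensional_def)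
    then show ?thesis using a by simp
  next
    case False
    then obtain \<rho>0 :: "('g, 'x, 'h) covariant_pair" where "\<rho>0 \<in> covariant_reps act" by blast
    then interpret nontrivial_transformation_group act \<mu> \<rho>0 by unfold_locales
    show ?thesis using a unfolding A_def by (rule cscale_elems)
  qed
  obtain \<sigma> where "\<sigma> \<in> rep_class A (integrated_form \<rho>)" by (rule rep_class_in_spectrumE[OF assms(2)])
  from rep_classD[OF this[unfolded integrated_form_def]]
  obtain K r u where \<sigma>0: "\<sigma> = (K, r)" "irreducible_rep A (K, r)" "unitary_map (cspace \<rho>) K u"
    "\<forall>a\<in>elems A. \<forall>\<xi>\<in>vectors (cspace \<rho>). u (a \<rho> \<xi>) = r a (u \<xi>)"
    by (elim exE conjE) (rule that)
  note \<sigma> = \<sigma>0(2,3) \<sigma>0(4)[rule_format]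
  have star: "star_representation A (K, r)" using \<sigma>(1) by (simp add: irreducible_rep_def)
  interpret hilbert_space K by (rule irreducible_hilbert[OF \<sigma>(1)])
  obtain a \<eta> where a: "a \<in> elems A" "\<eta> \<in> vectors K" "r a \<eta> \<noteq> vzero K"
    using \<sigma>(1) by (auto simp: irreducible_rep_def)
  have "u ` vectors (cspace \<rho>) = vectors K" using \<sigma>(2) by (simp add: unitary_map_def bij_betw_def)
  then obtain \<xi> where \<xi>: "\<xi> \<in> vectors (cspace \<rho>)" "u \<xi> = \<eta>" using a(2) by (metis imageE)
  have "a \<rho> = cscale A 0 a \<rho>"
    using ext[OF a(1)] ext[OF scale[OF a(1)]] \<rho> by (simp add: extensional_def)
  then have "r a \<eta> = r (cscale A 0 a) \<eta>" using \<sigma>(3)[OF a(1) \<xi>(1)] \<sigma>(3)[OF scale[OF a(1)] \<xi>(1)] \<xi>(2) by simp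
  also have "\<dots> = vscale K 0 (r a \<eta>)" using star a by (simp add: star_representation_def)
  also have "\<dots> = vzero K"
    using star a by (intro scale_zero bounded_operatorD(1)[of "r a"]) (auto simp: star_representation_def)
  finally show False using a(3) by simp
qed

end

context nontrivial_transformation_group
begin

lemma spectrum_nonzero:
  assumes sp: "rep_class A (integrated_form \<rho>) \<in> spectrum A" and \<rho>: "\<rho> \<in> R"
  shows "\<exists>a\<in>elems A. \<exists>\<xi>\<in>vectors (cspace \<rho>). a \<rho> \<xi> \<noteq> vzero (cspace \<rho>)"
proof -
  interpret covariant_rep act \<mu> \<rho> by (rule covariant_repI[OF \<rho>])
  obtain \<sigma> where "\<sigma> \<in> rep_class A (integrated_form \<rho>)" by (rule rep_class_in_spectrumE[OF sp])
  from rep_classD[OF this[unfolded integrated_form_def]]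
  obtain K r u where \<sigma>0: "\<sigma> = (K, r)" "irreducible_rep A (K, r)" "unitary_map H K u"
    "\<forall>a\<in>elems A. \<forall>\<xi>\<in>vectors H. u (a \<rho> \<xi>) = r a (u \<xi>)"
    by (elim exE conjE) (rule that)
  note \<sigma> = \<sigma>0(2,3) \<sigma>0(4)[rule_format]
  note uD = unitary_mapD[OF \<sigma>(2) hilbert_space_axioms]
    and uz = unitary_map_zero[OF \<sigma>(2) hilbert_space_axioms irreducible_hilbert[OF \<sigma>(1)]]
  obtain a \<eta> where a: "a \<in> elems A" "\<eta> \<in> vectors K" "r a \<eta> \<noteq> vzero K"
    using \<sigma>(1) by (auto simp: irreducible_rep_def)
  obtain \<xi> where \<xi>: "\<xi> \<in> vectors H" "u \<xi> = \<eta>" using uD(7)[OF a(2)] by (rule bexE)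
  have "a \<rho> \<xi> \<noteq> vzero H" using \<sigma>(3)[OF a(1) \<xi>(1)] \<xi>(2) a(3) uz by auto
  then show ?thesis using a(1) \<xi>(1) by (intro bexI)
qed

text \<open>The unitary onto an irreducible model carries V to a closed invariant subspace there and
  carries the dichotomy back.\<close>

lemma spectrum_irreducible:
  assumes sp: "rep_class A (integrated_form \<rho>) \<in> spectrum A" and \<rho>: "\<rho> \<in> R"
    and V: "closed_subspace (cspace \<rho>) V" and inv: "\<And>a \<xi>. a \<in> elems A \<Longrightarrow> \<xi> \<in> V \<Longrightarrow> a \<rho> \<xi> \<in> V"
  shows "V = {vzero (cspace \<rho>)} \<or> V = vectors (cspace \<rho>)"
proof -
  interpret covariant_rep act \<mu> \<rho> by (rule covariant_repI[OF \<rho>])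
  obtain \<sigma> where "\<sigma> \<in> rep_class A (integrated_form \<rho>)" by (rule rep_class_in_spectrumE[OF sp])
  from rep_classD[OF this[unfolded integrated_form_def]]
  obtain K r u where \<sigma>0: "\<sigma> = (K, r)" "irreducible_rep A (K, r)" "unitary_map H K u"
    "\<forall>a\<in>elems A. \<forall>\<xi>\<in>vectors H. u (a \<rho> \<xi>) = r a (u \<xi>)"
    by (elim exE conjE) (rule that)
  note \<sigma> = \<sigma>0(2,3) \<sigma>0(4)[rule_format]
  note uD = unitary_mapD[OF \<sigma>(2) hilbert_space_axioms]
    and uz = unitary_map_zero[OF \<sigma>(2) hilbert_space_axioms irreducible_hilbert[OF \<sigma>(1)]]
  have VH: "V \<subseteq> vectors H" using V by (simp add: closed_subspace_def)
  have "closed_subspace K (u ` V)"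
    unfolding closed_subspace_def
  proof (intro conjI ballI allI impI)
    show "u ` V \<subseteq> vectors K" using VH uD(1) by blast
    have "u (vzero H) \<in> u ` V" by (rule imageI) (use V in \<open>simp add: closed_subspace_def\<close>)
    then show "vzero K \<in> u ` V" by (simp only: uz)
    show "vadd K \<xi> \<eta> \<in> u ` V" if xe: "\<xi> \<in> u ` V" "\<eta> \<in> u ` V" for \<xi> \<eta>
    proof -
      obtain v where v: "\<xi> = u v" "v \<in> V" using xe(1) by (rule imageE)
      obtain w where w: "\<eta> = u w" "w \<in> V" using xe(2) by (rule imageE)
      have "vadd K \<xi> \<eta> = u (vadd H v w)"
        unfolding v(1) w(1) by (rule uD(2)[symmetric]; rule subsetD[OF VH]; fact)
      moreover have "vadd H v w \<in> V" using V v(2) w(2) by (simp add: closed_subspace_def)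
      ultimately show ?thesis by (rule image_eqI)
    qed
    show "vscale K c \<xi> \<in> u ` V" if xe: "\<xi> \<in> u ` V" for c \<xi>
    proof -
      obtain v where v: "\<xi> = u v" "v \<in> V" using xe by (rule imageE)
      have "vscale K c \<xi> = u (vscale H c v)"
        unfolding v(1) by (rule uD(3)[symmetric], rule subsetD[OF VH], fact)
      moreover have "vscale H c v \<in> V" using V v(2) by (simp add: closed_subspace_def)
      ultimately show ?thesis by (rule image_eqI)
    qed
    fix \<eta> assume \<eta>: "\<eta> \<in> vectors K" "\<forall>\<epsilon>>0. \<exists>\<zeta>\<in>u ` V. vnorm K (vdiff K \<eta> \<zeta>) < \<epsilon>"
    obtain \<xi> where \<xi>: "\<xi> \<in> vectors H" "u \<xi> = \<eta>" using uD(7)[OF \<eta>(1)] by (rule bexE)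
    have "\<exists>v\<in>V. vnorm H (vdiff H \<xi> v) < \<epsilon>" if "0 < \<epsilon>" for \<epsilon>
    proof -
      have "\<exists>\<zeta>\<in>u ` V. vnorm K (vdiff K \<eta> \<zeta>) < \<epsilon>" using \<eta>(2) that by simp
      then obtain v where v: "v \<in> V" "vnorm K (vdiff K \<eta> (u v)) < \<epsilon>" by auto
      have "vnorm K (vdiff K \<eta> (u v)) = vnorm H (vdiff H \<xi> v)"
        using uD(4)[OF \<xi>(1) subsetD[OF VH v(1)]] uD(5)[OF diff_closed[OF \<xi>(1) subsetD[OF VH v(1)]]] \<xi>(2)
        by simp
      then show ?thesis using v by auto
    qed
    then have "\<xi> \<in> V" using V \<xi>(1) unfolding closed_subspace_def by simp
    then show "\<eta> \<in> u ` V" using \<xi>(2) by auto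
  qed
  moreover have "\<forall>a\<in>elems A. r a ` (u ` V) \<subseteq> u ` V"
  proof (intro ballI subsetI)
    fix a \<zeta> assume a: "a \<in> elems A" and "\<zeta> \<in> r a ` u ` V"
    then obtain v where v: "v \<in> V" "\<zeta> = r a (u v)" by auto
    have "v \<in> vectors H" using v(1) VH by auto
    then have "\<zeta> = u (a \<rho> v)" using \<sigma>(3)[OF a] v(2) by simp
    then show "\<zeta> \<in> u ` V" using inv[OF a v(1)] by (rule image_eqI)
  qed
  ultimately have "u ` V = {vzero K} \<or> u ` V = vectors K"
    using \<sigma>(1) by (simp add: irreducible_rep_def)
  then show ?thesis
  proof
    assume eq: "u ` V = {vzero K}"
    have "v = vzero H" if "v \<in> V" for v
    proof -
      have "v \<in> vectors H" using that VH by auto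
      moreover have "u v = u (vzero H)" using eq that uz by auto
      ultimately show ?thesis using uD(8)[of v "vzero H"] by simp
    qed
    then have "V \<subseteq> {vzero H}" by blast
    moreover have "vzero H \<in> V" using V by (simp add: closed_subspace_def)
    ultimately show ?thesis by blast
  next
    assume eq: "u ` V = vectors K"
    have "\<xi> \<in> V" if \<xi>: "\<xi> \<in> vectors H" for \<xi>
    proof -
      have "u \<xi> \<in> u ` V" using uD(1)[OF \<xi>] eq by simp
      then obtain v where v: "u \<xi> = u v" "v \<in> V" by (rule imageE)
      then have "\<xi> = v" using uD(8)[OF \<xi> subsetD[OF VH]] by simp
      then show ?thesis using v(2) by simp
    qed
    then show ?thesis using VH by auto
  qed
qed

lemma rep_kernel_iff:
  assumes \<sigma>: "\<sigma> \<in> rep_class A (integrated_form \<rho>)" and \<rho>: "\<rho> \<in> R" and a: "a \<in> elems A"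
  shows "a \<in> rep_kernel A \<sigma> \<longleftrightarrow> (\<forall>\<xi>\<in>vectors (cspace \<rho>). a \<rho> \<xi> = vzero (cspace \<rho>))"
proof -
  interpret covariant_rep act \<mu> \<rho> by (rule covariant_repI[OF \<rho>])
  from rep_classD[OF \<sigma>[unfolded integrated_form_def]]
  obtain K r u where \<sigma>0: "\<sigma> = (K, r)" "irreducible_rep A (K, r)" "unitary_map H K u"
    "\<forall>a\<in>elems A. \<forall>\<xi>\<in>vectors H. u (a \<rho> \<xi>) = r a (u \<xi>)"
    by (elim exE conjE) (rule that)
  note \<sigma> = \<sigma>0(1-3) \<sigma>0(4)[rule_format]
  note uD = unitary_mapD[OF \<sigma>(3) hilbert_space_axioms]
    and uz = unitary_map_zero[OF \<sigma>(3) hilbert_space_axioms irreducible_hilbert[OF \<sigma>(2)]]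
  have "(\<forall>\<eta>\<in>vectors K. r a \<eta> = vzero K) \<longleftrightarrow> (\<forall>\<xi>\<in>vectors H. r a (u \<xi>) = vzero K)"
    using uD(1,7) by metis
  also have "\<dots> \<longleftrightarrow> (\<forall>\<xi>\<in>vectors H. a \<rho> \<xi> = vzero H)"
    using \<sigma>(4)[OF a] uD(8)[OF elems_closed[OF a \<rho>]] uz by (metis zero_closed)
  finally show ?thesis using a by (simp add: rep_kernel_def \<sigma>(1))
qed

text \<open>Otherwise the common annihilator of the pairs \<open>\<rho> (g i)\<close> is an ideal
  not contained in the kernel of the limit, so it defines a neighbourhood of the limit point that
  none of the classes along g can enter. Only exact vanishing is detected in this way, which
  dictates the effort spent on \<open>kill_subsequence\<close>.\<close>

lemma weak_containment:
  assumes lim: "limitin (spectrum_topology A) (\<lambda>n. rep_class A (integrated_form (\<rho> n)))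
      (rep_class A (integrated_form \<rho>z)) sequentially"
    and \<rho>: "\<rho>z \<in> R" "\<And>i. \<rho> (g i) \<in> R" and g: "strict_mono (g :: nat \<Rightarrow> nat)"
    and a: "a \<in> elems A" and z: "\<And>i \<xi>. \<xi> \<in> vectors (cspace (\<rho> (g i))) \<Longrightarrow> a (\<rho> (g i)) \<xi> = vzero (cspace (\<rho> (g i)))"
    and \<xi>: "\<xi> \<in> vectors (cspace \<rho>z)"
  shows "a \<rho>z \<xi> = vzero (cspace \<rho>z)"
proof (rule ccontr)
  assume nz: "a \<rho>z \<xi> \<noteq> vzero (cspace \<rho>z)"
  let ?Q = "range (\<lambda>i. \<rho> (g i))"
  let ?I = "{a \<in> elems A. \<forall>\<rho>\<in>?Q. \<forall>\<xi>\<in>vectors (cspace \<rho>). a \<rho> \<xi> = vzero (cspace \<rho>)}"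
  have I: "closed_ideal A ?I" by (rule closed_ideal_annihilator) (use \<rho>(2) in auto)
  have "eventually (\<lambda>n. \<forall>\<pi>\<in>rep_class A (integrated_form (\<rho> n)). \<not> ?I \<subseteq> rep_kernel A \<pi>) sequentially"
  proof (rule limitin_spectrumD(3)[OF lim I])
    fix \<pi> assume \<pi>: "\<pi> \<in> rep_class A (integrated_form \<rho>z)"
    have "a \<in> ?I" using a z by auto
    moreover have "a \<notin> rep_kernel A \<pi>" using rep_kernel_iff[OF \<pi> \<rho>(1) a] nz \<xi> by auto
    ultimately show "\<not> ?I \<subseteq> rep_kernel A \<pi>" by blast
  qed
  with limitin_spectrumD(2)[OF lim]
  have "eventually (\<lambda>n. rep_class A (integrated_form (\<rho> n)) \<in> spectrum A \<and>
     (\<forall>\<pi>\<in>rep_class A (integrated_form (\<rho> n)). \<not> ?I \<subseteq> rep_kernel A \<pi>)) sequentially"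
    by eventually_elim simp
  then obtain N where N: "\<And>n. n \<ge> N \<Longrightarrow> rep_class A (integrated_form (\<rho> n)) \<in> spectrum A"
    "\<And>n \<pi>. n \<ge> N \<Longrightarrow> \<pi> \<in> rep_class A (integrated_form (\<rho> n)) \<Longrightarrow> \<not> ?I \<subseteq> rep_kernel A \<pi>"
    by (auto simp: eventually_sequentially)
  have gN: "g N \<ge> N" using seq_suble[OF g] .
  obtain \<pi> where \<pi>: "\<pi> \<in> rep_class A (integrated_form (\<rho> (g N)))" by (rule rep_class_in_spectrumE[OF N(1)[OF gN]])
  have "?I \<subseteq> rep_kernel A \<pi>"
  proof
    fix b assume b: "b \<in> ?I"
    then show "b \<in> rep_kernel A \<pi>" using rep_kernel_iff[OF \<pi> \<rho>(2)] by auto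
  qed
  then show False using N(2)[OF gN \<pi>] by simp
qed

end

section \<open>Convergence of eigenvalues\<close>

abbreviation nmult :: "nat \<Rightarrow> 'g \<Rightarrow> 'g::comm_monoid_add" where
  "nmult j r \<equiv> (\<Sum>i<j. r)"

context covariant_rep
begin

definition shift_diff :: "'g \<Rightarrow> complex \<Rightarrow> 'h \<Rightarrow> 'h" where
  "shift_diff r c \<eta> = vdiff H (grep \<rho> r \<eta>) (vscale H c \<eta>)"

text \<open>The Cesaro mean of the powers of \<open>cnj c\<close> times
  \<open>grep \<rho> r\<close>. For c on the unit circle it fixes the c-eigenvectors of
  \<open>grep \<rho> r\<close> and is of order 1/N on vectors
  \<open>shift_diff r c \<eta>\<close>.\<close>

definition average :: "nat \<Rightarrow> complex \<Rightarrow> 'g \<Rightarrow> 'h \<Rightarrow> 'h" where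
  "average N c r \<eta> = vsum H (\<lambda>j. vscale H (cnj c ^ j / of_nat N) (grep \<rho> (nmult j r) \<eta>)) N"

lemma average_closed [simp]: "\<eta> \<in> vectors H \<Longrightarrow> average N c r \<eta> \<in> vectors H"
  unfolding average_def by (intro vsum_closed) simp

lemma shift_diff_closed [simp]: "\<eta> \<in> vectors H \<Longrightarrow> shift_diff r c \<eta> \<in> vectors H"
  unfolding shift_diff_def by simp

lemma inner_average:
  "\<eta> \<in> vectors H \<Longrightarrow> \<zeta> \<in> vectors H \<Longrightarrow> vinner H (average N c r \<eta>) \<zeta> =
    (\<Sum>j<N. cnj c ^ j / of_nat N * vinner H (grep \<rho> (nmult j r) \<eta>) \<zeta>)"
  unfolding average_def by (simp add: inner_vsum inner_scale)

text \<open>G is abelian, so all translations commute with one another.\<close>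

lemma shift_diff_average:
  assumes \<eta>: "\<eta> \<in> vectors H"
  shows "shift_diff s d (average N c r \<eta>) = average N c r (shift_diff s d \<eta>)"
proof (rule vec_eqI)
  fix \<zeta> assume \<zeta>: "\<zeta> \<in> vectors H"
  have swap: "vinner H (grep \<rho> (nmult j r) \<eta>) (grep \<rho> (- s) \<zeta>) = vinner H (grep \<rho> (nmult j r) (grep \<rho> s \<eta>)) \<zeta>" for j
    using grep_add[OF \<eta>, of s "nmult j r"] grep_add[OF \<eta>, of "nmult j r" s] \<eta> \<zeta>
    by (simp add: add.commute flip: grep_adjoint)
  have "vinner H (shift_diff s d (average N c r \<eta>)) \<zeta> =
      vinner H (average N c r \<eta>) (grep \<rho> (- s) \<zeta>) - d * vinner H (average N c r \<eta>) \<zeta>"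
    using \<eta> \<zeta> by (simp add: shift_diff_def inner_diff inner_scale grep_adjoint)
  also have "\<dots> = (\<Sum>j<N. cnj c ^ j / of_nat N * (vinner H (grep \<rho> (nmult j r) (grep \<rho> s \<eta>)) \<zeta>
      - d * vinner H (grep \<rho> (nmult j r) \<eta>) \<zeta>))"
    using \<eta> \<zeta> by (simp add: inner_average swap sum_distrib_left right_diff_distrib sum_subtractf algebra_simps)
  also have "\<dots> = vinner H (average N c r (shift_diff s d \<eta>)) \<zeta>"
    using \<eta> \<zeta> by (simp add: inner_average shift_diff_def grepD(3,4) inner_diff inner_scale)
  finally show "vinner H (shift_diff s d (average N c r \<eta>)) \<zeta> = vinner H (average N c r (shift_diff s d \<eta>)) \<zeta>" .
qed (use \<eta> in auto)

lemma average_shift_diff_norm: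
  assumes \<eta>: "\<eta> \<in> vectors H" and c: "cmod c = 1" and N: "0 < N"
  shows "vnorm H (average N c r (shift_diff r c \<eta>)) \<le> 2 / real N * vnorm H \<eta>"
proof (rule norm_leI)
  fix \<zeta> assume \<zeta>: "\<zeta> \<in> vectors H"
  have cc: "c * cnj c = 1" using c by (simp add: complex_norm_square[symmetric] flip: of_real_power)
  \<comment> \<open>Because c has modulus 1, \<open>c * cnj c ^ Suc j\<close> is
    \<open>cnj c ^ j\<close>, and the sum over j telescopes to its two end terms, each at most the
    product of the norms.\<close>
  define v where "v j = cnj c ^ j * vinner H (grep \<rho> (nmult j r) \<eta>) \<zeta>" for j
  have step: "cnj c ^ j / of_nat N * vinner H (grep \<rho> (nmult j r) (shift_diff r c \<eta>)) \<zeta> = c / of_nat N * (v (Suc j) - v j)" for j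
  proof -
    have "vinner H (grep \<rho> (nmult j r) (shift_diff r c \<eta>)) \<zeta>
       = vinner H (grep \<rho> (nmult (Suc j) r) \<eta>) \<zeta> - c * vinner H (grep \<rho> (nmult j r) \<eta>) \<zeta>"
      using \<eta> \<zeta> by (simp add: shift_diff_def grepD(3,4) inner_diff inner_scale grep_add)
    moreover have "c * cnj c ^ Suc j = cnj c ^ j" using cc by (simp add: mult.assoc[symmetric])
    ultimately show ?thesis unfolding v_def
      by (simp add: right_diff_distrib mult.assoc[symmetric] del: power_Suc sum.lessThan_Suc)
  qed
  have "vinner H (average N c r (shift_diff r c \<eta>)) \<zeta> = c / of_nat N * (v N - v 0)"
    by (simp only: inner_average[OF shift_diff_closed[OF \<eta>] \<zeta>] step sum_distrib_left[symmetric] sum_lessThan_telescope)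
  moreover have "cmod (v j) \<le> vnorm H \<eta> * vnorm H \<zeta>" for j
    using cauchy_schwarz[OF grep_closed[OF \<eta>] \<zeta>] \<eta> c by (simp add: v_def norm_mult norm_power grepD(5))
  then have "cmod (v N - v 0) \<le> 2 * (vnorm H \<eta> * vnorm H \<zeta>)"
    using norm_triangle_ineq4[of "v N" "v 0"] by (smt (verit))
  ultimately show "cmod (vinner H (average N c r (shift_diff r c \<eta>)) \<zeta>) \<le> 2 / real N * vnorm H \<eta> * vnorm H \<zeta>"
    using c N by (simp add: norm_mult norm_divide divide_right_mono)
qed (use \<eta> in auto)

lemma average_eigen:
  assumes \<eta>: "\<eta> \<in> vectors H" and c: "cmod c = 1" and N: "0 < N"
    and eig: "\<And>\<xi>. \<xi> \<in> vectors H \<Longrightarrow> grep \<rho> r \<xi> = vscale H c \<xi>"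
  shows "average N c r \<eta> = \<eta>"
proof (rule vec_eqI)
  fix \<zeta> assume \<zeta>: "\<zeta> \<in> vectors H"
  have "grep \<rho> (nmult j r) \<eta> = vscale H (c ^ j) \<eta>" for j
  proof (induction j)
    case (Suc j)
    have "grep \<rho> (nmult (Suc j) r) \<eta> = grep \<rho> (nmult j r) (grep \<rho> r \<eta>)"
      using grep_add[OF \<eta>, of "nmult j r" r] by simp
    then show ?case using Suc \<eta> by (simp add: eig grepD(3) scale_scale)
  qed (use \<eta> in \<open>simp add: grep_zero scale_one\<close>)
  moreover have "cnj c ^ j * c ^ j = 1" for j
    using c by (simp flip: power_mult_distrib) (simp add: mult.commute complex_norm_square[symmetric] flip: of_real_power)
  ultimately have "vinner H (average N c r \<eta>) \<zeta> = (\<Sum>j<N. vinner H \<eta> \<zeta> / of_nat N)"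
    using \<eta> \<zeta> by (simp add: inner_average inner_scale mult.assoc[symmetric])
  then show "vinner H (average N c r \<eta>) \<zeta> = vinner H \<eta> \<zeta>" using N by simp
qed (use \<eta> in auto)

lemma average_close:
  assumes \<eta>: "\<eta> \<in> vectors H" and N: "0 < N" and e: "0 \<le> e"
    and close: "\<And>j. j < N \<Longrightarrow> vnorm H (vdiff H (vscale H (cnj d ^ j) (grep \<rho> (nmult j s) \<eta>))
      (vscale H (cnj c ^ j) (grep \<rho> (nmult j r) \<eta>))) \<le> e"
  shows "vnorm H (vdiff H (average N d s \<eta>) (average N c r \<eta>)) \<le> e"
proof (rule norm_leI)
  fix \<zeta> assume \<zeta>: "\<zeta> \<in> vectors H"
  let ?v = "\<lambda>j. vdiff H (vscale H (cnj d ^ j) (grep \<rho> (nmult j s) \<eta>)) (vscale H (cnj c ^ j) (grep \<rho> (nmult j r) \<eta>))"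
  have "vinner H (vdiff H (average N d s \<eta>) (average N c r \<eta>)) \<zeta> = (\<Sum>j<N. vinner H (?v j) \<zeta> / of_nat N)"
    using \<eta> \<zeta> by (simp add: inner_diff inner_average inner_scale diff_divide_distrib sum_subtractf)
  also have "cmod \<dots> \<le> (\<Sum>j<N. e * vnorm H \<zeta> / real N)"
  proof (rule sum_norm_le)
    fix j assume "j \<in> {..<N}"
    then have "vnorm H (?v j) * vnorm H \<zeta> \<le> e * vnorm H \<zeta>" using close \<zeta> by (intro mult_right_mono) auto
    moreover have "cmod (vinner H (?v j) \<zeta>) \<le> vnorm H (?v j) * vnorm H \<zeta>" using \<eta> \<zeta> by (intro cauchy_schwarz) auto
    ultimately show "cmod (vinner H (?v j) \<zeta> / of_nat N) \<le> e * vnorm H \<zeta> / real N"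
      by (simp add: norm_divide divide_right_mono)
  qed
  also have "\<dots> = e * vnorm H \<zeta>" using N by simp
  finally show "cmod (vinner H (vdiff H (average N d s \<eta>) (average N c r \<eta>)) \<zeta>) \<le> e * vnorm H \<zeta>" .
qed (use \<eta> e in auto)

lemma shift_diff_vdiff:
  assumes "\<xi> \<in> vectors H" "\<eta> \<in> vectors H"
  shows "shift_diff r c (vdiff H \<xi> \<eta>) = vdiff H (shift_diff r c \<xi>) (shift_diff r c \<eta>)"
  by (rule vec_eqI) (use assms in \<open>simp_all add: shift_diff_def grepD(4) inner_diff inner_scale algebra_simps\<close>)

end

context nontrivial_transformation_group
begin

lemma lmult_eqI:
  assumes "a \<in> elems A" "\<And>\<rho> \<xi>. \<rho> \<in> R \<Longrightarrow> \<xi> \<in> vectors (cspace \<rho>) \<Longrightarrow> \<Phi> \<rho> (b \<rho> \<xi>) = a \<rho> \<xi>"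
  shows "lmult \<Phi> b = a"
proof (rule extensionalityI[of _ R])
  have fam: "op_family a" by (rule elems_family[OF assms(1)])
  show "lmult \<Phi> b \<in> extensional R" by (simp add: lmult_def)
  show "a \<in> extensional R" using fam by (simp add: op_family_def)
  fix \<rho> assume \<rho>: "\<rho> \<in> R"
  show "lmult \<Phi> b \<rho> = a \<rho>"
    by (rule extensionalityI[of _ "vectors (cspace \<rho>)"])
      (use fam \<rho> assms(2)[OF \<rho>] in \<open>auto simp: op_family_def lmult_def\<close>)
qed

abbreviation sdiff :: "'g \<Rightarrow> complex \<Rightarrow> (('g, 'x, 'h) covariant_pair \<Rightarrow> 'h \<Rightarrow> 'h) \<Rightarrow> ('g, 'x, 'h) covariant_pair \<Rightarrow> 'h \<Rightarrow> 'h" where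
  "sdiff r c \<equiv> lmult (\<lambda>\<rho>. covariant_rep.shift_diff \<rho> r c)"

lemma sdiff_elems:
  assumes b: "b \<in> elems A"
  shows "sdiff r c b \<in> elems A"
proof -
  let ?a = "cadd A (lmult (\<lambda>\<rho>. grep \<rho> r) b) (cscale A (- c) b)"
  have a: "?a \<in> elems A" by (intro cadd_elems lmult_grep cscale_elems b)
  have "sdiff r c b = ?a"
  proof (rule lmult_eqI[OF a])
    fix \<rho> \<xi> assume \<rho>: "\<rho> \<in> R" and \<xi>: "\<xi> \<in> vectors (cspace \<rho>)"
    interpret covariant_rep act \<mu> \<rho> by (rule covariant_repI[OF \<rho>])
    show "shift_diff r c (b \<rho> \<xi>) = ?a \<rho> \<xi>"
      using elems_closed[OF b \<rho> \<xi>] \<rho> \<xi>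
      by (simp add: shift_diff_def crossed_product_simps lmult_apply vdiff_def scale_scale)
  qed
  then show ?thesis using a by simp
qed

lemma average_elems:
  assumes b: "b \<in> elems A"
  shows "lmult (\<lambda>\<rho>. covariant_rep.average \<rho> N c r) b \<in> elems A"
proof -
  have "\<And>j. lmult (\<lambda>\<rho>. grep \<rho> (nmult j r)) b \<in> elems A" by (rule lmult_grep[OF b])
  then have "\<exists>a\<in>elems A. \<forall>\<rho>\<in>R. \<forall>\<xi>\<in>vectors (cspace \<rho>). a \<rho> \<xi> = vsum (cspace \<rho>)
     (\<lambda>j. vscale (cspace \<rho>) (cnj c ^ j / of_nat N) (lmult (\<lambda>\<rho>. grep \<rho> (nmult j r)) b \<rho> \<xi>)) N"
    by (rule sum_elems)
  then obtain a where a: "a \<in> elems A" "\<forall>\<rho>\<in>R. \<forall>\<xi>\<in>vectors (cspace \<rho>). a \<rho> \<xi> = vsum (cspace \<rho>)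
     (\<lambda>j. vscale (cspace \<rho>) (cnj c ^ j / of_nat N) (lmult (\<lambda>\<rho>. grep \<rho> (nmult j r)) b \<rho> \<xi>)) N"
    by (rule bexE)
  have "lmult (\<lambda>\<rho>. covariant_rep.average \<rho> N c r) b = a"
  proof (rule lmult_eqI[OF a(1)])
    fix \<rho> \<xi> assume \<rho>: "\<rho> \<in> R" and \<xi>: "\<xi> \<in> vectors (cspace \<rho>)"
    interpret covariant_rep act \<mu> \<rho> by (rule covariant_repI[OF \<rho>])
    show "average N c r (b \<rho> \<xi>) = a \<rho> \<xi>"
      using a(2) \<rho> \<xi> by (simp add: average_def lmult_apply)
  qed
  then show ?thesis using a(1) by simp
qed

definition kills :: "(('g, 'x, 'h) covariant_pair \<Rightarrow> 'h \<Rightarrow> 'h) \<Rightarrow> ('g, 'x, 'h) covariant_pair \<Rightarrow> bool" where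
  "kills a \<rho> \<longleftrightarrow> (\<forall>\<xi>\<in>vectors (cspace \<rho>). a \<rho> \<xi> = vzero (cspace \<rho>))"

lemma nmult_tendsto: "(r \<longlongrightarrow> r0) F \<Longrightarrow> ((\<lambda>i. nmult j (r i)) \<longlongrightarrow> nmult j (r0 :: 'g)) F"
  by (induction j) (auto intro!: tendsto_intros)

text \<open>The convergence is uniform over all pairs because the unitaries are applied to an
  element of the algebra. Each j has its own tail; only finitely many j are needed at a
  time.\<close>

lemma shifted_powers_eventually:
  assumes a: "a \<in> elems A" and e: "0 < e" and r: "r \<longlonglongrightarrow> r0" and lam: "\<omega> \<longlonglongrightarrow> c" "\<And>i. cmod (\<omega> i) = 1"
  shows "eventually (\<lambda>i. \<forall>\<rho>\<in>R. \<forall>\<xi>\<in>vectors (cspace \<rho>). vnorm (cspace \<rho>) (vdiff (cspace \<rho>)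
    (vscale (cspace \<rho>) (cnj (\<omega> i) ^ j) (grep \<rho> (nmult j (r i)) (a \<rho> \<xi>)))
    (vscale (cspace \<rho>) (cnj c ^ j) (grep \<rho> (nmult j r0) (a \<rho> \<xi>)))) \<le> e * vnorm (cspace \<rho>) \<xi>) sequentially"
proof -
  obtain C where C: "0 < C" "op_bounded a C" by (rule elems_bounded[OF a])
  have e2: "0 < e / 2" using e by simp
  have "(\<lambda>i. cnj (\<omega> i) ^ j) \<longlonglongrightarrow> cnj c ^ j" by (intro tendsto_intros lam)
  moreover have "0 < e / 2 / C" using e C by simp
  ultimately have ev1: "eventually (\<lambda>i. dist (cnj (\<omega> i) ^ j) (cnj c ^ j) < e / 2 / C) sequentially"
    by (rule tendstoD)
  from eventually_compose_filterlim[OF grep_eventually_uniform[OF a e2] nmult_tendsto[OF r, of j]] ev1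
  show ?thesis
  proof eventually_elim
    case (elim i)
    show ?case
    proof (intro ballI)
      fix \<rho> \<xi> assume \<rho>: "\<rho> \<in> R" and \<xi>: "\<xi> \<in> vectors (cspace \<rho>)"
      interpret covariant_rep act \<mu> \<rho> by (rule covariant_repI[OF \<rho>])
      let ?l = "cnj (\<omega> i) ^ j" and ?c = "cnj c ^ j"
      let ?u = "grep \<rho> (nmult j (r i)) (a \<rho> \<xi>)" and ?w = "grep \<rho> (nmult j r0) (a \<rho> \<xi>)"
      have v: "a \<rho> \<xi> \<in> vectors H" by (rule elems_closed[OF a \<rho> \<xi>])
      have 1: "vnorm H (vdiff H (vscale H ?l ?u) (vscale H ?l ?w)) \<le> e / 2 * vnorm H \<xi>"
        using elim(1) \<rho> \<xi> v lam(2)[of i] by (simp add: norm_diff_scale norm_power)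
      have "vdiff H (vscale H ?l ?w) (vscale H ?c ?w) = vscale H (?l - ?c) ?w"
        by (rule vec_eqI) (use v in \<open>simp_all add: inner_diff inner_scale algebra_simps\<close>)
      then have "vnorm H (vdiff H (vscale H ?l ?w) (vscale H ?c ?w)) = cmod (?l - ?c) * vnorm H (a \<rho> \<xi>)"
        using v by (simp add: norm_scale grepD(5))
      also have "\<dots> \<le> (e / 2 / C) * (C * vnorm H \<xi>)"
        using elim(2) C \<rho> \<xi> v e by (intro mult_mono) (auto simp: dist_norm op_bounded_def)
      finally have 2: "vnorm H (vdiff H (vscale H ?l ?w) (vscale H ?c ?w)) \<le> e / 2 * vnorm H \<xi>" using C(1) by simp
      have "vnorm H (vdiff H (vscale H ?l ?u) (vscale H ?c ?w)) \<le> e / 2 * vnorm H \<xi> + e / 2 * vnorm H \<xi>"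
        by (rule norm_diff_triangle_le[OF _ _ _ 1 2]) (use v in auto)
      then show "vnorm H (vdiff H (vscale H ?l ?u) (vscale H ?c ?w)) \<le> e * vnorm H \<xi>" by simp
    qed
  qed
qed

text \<open>
  Subtracting from \<open>b\<close> a long Cesaro mean of its translates, normalised by the eigenvalue at
  \<open>\<rho>s m\<close>, kills \<open>b\<close> at \<open>\<rho>s m\<close> but hardly changes \<open>\<delta>\<^sub>r b - c b\<close>, since the means of the latter telescope.
\<close>

lemma kill_one:
  assumes b: "b \<in> elems A" and e: "0 < e" and r: "r \<longlonglongrightarrow> r0"
    and lam: "\<omega> \<longlonglongrightarrow> c" "\<And>i. cmod (\<omega> i) = 1" "cmod c = 1"
    and \<rho>s: "\<And>i. \<rho>s i \<in> R"
    and eig: "\<And>i \<xi>. \<xi> \<in> vectors (cspace (\<rho>s i)) \<Longrightarrow> grep (\<rho>s i) (r i) \<xi> = vscale (cspace (\<rho>s i)) (\<omega> i) \<xi>"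
  shows "\<exists>m>M. \<exists>b'\<in>elems A. kills b' (\<rho>s m) \<and> (\<forall>\<sigma>\<in>R. kills b \<sigma> \<longrightarrow> kills b' \<sigma>) \<and>
    op_close (sdiff r0 c b') (sdiff r0 c b) e"
proof -
  obtain C where C: "0 < C" "op_bounded b C" by (rule elems_bounded[OF b])
  \<comment> \<open>N bounds the mean of \<open>sdiff r0 c b\<close>, formed with the limit data c
    and \<open>r0\<close>, by half of e. The other half of e pays for replacing the limit data by
    \<open>\<omega> m\<close> and \<open>r m\<close>.\<close>
  obtain N where N: "4 * C / e < real N" using reals_Archimedean2 by blast
  have N0: "0 < N"
  proof -
    have "0 < 4 * C / e" using C e by simp
    then show ?thesis using N by (cases N) auto
  qed
  have NC: "2 / real N * C \<le> e / 2" using N N0 e by (simp add: field_simps)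
  let ?a = "sdiff r0 c b"
  have a: "?a \<in> elems A" by (rule sdiff_elems[OF b])
  have e2: "0 < e / 2" using e by simp
  have "eventually (\<lambda>i. \<forall>j\<in>{..<N}. \<forall>\<rho>\<in>R. \<forall>\<xi>\<in>vectors (cspace \<rho>). vnorm (cspace \<rho>) (vdiff (cspace \<rho>)
    (vscale (cspace \<rho>) (cnj (\<omega> i) ^ j) (grep \<rho> (nmult j (r i)) (?a \<rho> \<xi>)))
    (vscale (cspace \<rho>) (cnj c ^ j) (grep \<rho> (nmult j r0) (?a \<rho> \<xi>)))) \<le> e / 2 * vnorm (cspace \<rho>) \<xi>) sequentially"
    by (rule eventually_ball_finite, simp, intro ballI, rule shifted_powers_eventually[OF a e2 r lam(1,2)])
  from eventually_conj[OF this eventually_gt_at_top[of M]] obtain m where m: "M < m"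
    and close: "\<forall>j\<in>{..<N}. \<forall>\<rho>\<in>R. \<forall>\<xi>\<in>vectors (cspace \<rho>). vnorm (cspace \<rho>) (vdiff (cspace \<rho>)
    (vscale (cspace \<rho>) (cnj (\<omega> m) ^ j) (grep \<rho> (nmult j (r m)) (?a \<rho> \<xi>)))
    (vscale (cspace \<rho>) (cnj c ^ j) (grep \<rho> (nmult j r0) (?a \<rho> \<xi>)))) \<le> e / 2 * vnorm (cspace \<rho>) \<xi>"
    by (auto simp: eventually_sequentially)
  define b' where "b' = cadd A b (cscale A (- 1) (lmult (\<lambda>\<rho>. covariant_rep.average \<rho> N (\<omega> m) (r m)) b))"
  have b': "b' \<in> elems A" unfolding b'_def by (intro cadd_elems cscale_elems average_elems b)
  have b'_eq: "b' \<rho> \<xi> = vdiff (cspace \<rho>) (b \<rho> \<xi>) (covariant_rep.average \<rho> N (\<omega> m) (r m) (b \<rho> \<xi>))"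
    if "\<rho> \<in> R" "\<xi> \<in> vectors (cspace \<rho>)" for \<rho> \<xi>
    using that by (simp add: b'_def crossed_product_simps lmult_apply vdiff_def)
  have k1: "kills b' (\<rho>s m)"
    unfolding kills_def
  proof
    fix \<xi> assume \<xi>: "\<xi> \<in> vectors (cspace (\<rho>s m))"
    interpret covariant_rep act \<mu> "\<rho>s m" by (rule covariant_repI[OF \<rho>s])
    have v: "b (\<rho>s m) \<xi> \<in> vectors H" by (rule elems_closed[OF b \<rho>s \<xi>])
    show "b' (\<rho>s m) \<xi> = vzero H"
      using v by (simp add: b'_eq[OF \<rho>s \<xi>] average_eigen[OF v lam(2) N0 eig])
  qed
  have k2: "kills b' \<sigma>" if \<sigma>: "\<sigma> \<in> R" and k: "kills b \<sigma>" for \<sigma>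
    unfolding kills_def
  proof
    fix \<xi> assume \<xi>: "\<xi> \<in> vectors (cspace \<sigma>)"
    interpret covariant_rep act \<mu> \<sigma> by (rule covariant_repI[OF \<sigma>])
    have z: "b \<sigma> \<xi> = vzero H" using k \<xi> by (simp add: kills_def)
    have "average N (\<omega> m) (r m) (vzero H) = vzero H"
      by (rule vec_eqI) (simp_all add: inner_average grep_adjoint)
    then show "b' \<sigma> \<xi> = vzero H" by (simp add: b'_eq[OF \<sigma> \<xi>] z)
  qed
  have "op_close (sdiff r0 c b') (sdiff r0 c b) e"
    unfolding op_close_def
  proof (intro ballI)
    fix \<rho> \<xi> assume \<rho>: "\<rho> \<in> R" and \<xi>: "\<xi> \<in> vectors (cspace \<rho>)"
    interpret covariant_rep act \<mu> \<rho> by (rule covariant_repI[OF \<rho>])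
    let ?\<eta> = "b \<rho> \<xi>"
    have v: "?\<eta> \<in> vectors H" by (rule elems_closed[OF b \<rho> \<xi>])
    have a_eq: "?a \<rho> \<xi> = shift_diff r0 c ?\<eta>" using \<rho> \<xi> by (simp add: lmult_apply)
    have av: "shift_diff r0 c (average N (\<omega> m) (r m) ?\<eta>) = average N (\<omega> m) (r m) (shift_diff r0 c ?\<eta>)"
      by (rule shift_diff_average[OF v])
    have 1: "vnorm H (vdiff H (average N (\<omega> m) (r m) (shift_diff r0 c ?\<eta>)) (average N c r0 (shift_diff r0 c ?\<eta>)))
      \<le> e / 2 * vnorm H \<xi>"
    proof (rule average_close)
      fix j assume "j < N"
      then show "vnorm H (vdiff H (vscale H (cnj (\<omega> m) ^ j) (grep \<rho> (nmult j (r m)) (shift_diff r0 c ?\<eta>)))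
        (vscale H (cnj c ^ j) (grep \<rho> (nmult j r0) (shift_diff r0 c ?\<eta>)))) \<le> e / 2 * vnorm H \<xi>"
        using bspec[OF bspec[OF bspec[OF close] \<rho>] \<xi>, of j] by (simp only: a_eq lessThan_iff)
    qed (use v N0 e \<xi> in auto)
    have "vnorm H (average N c r0 (shift_diff r0 c ?\<eta>)) \<le> 2 / real N * vnorm H ?\<eta>"
      by (rule average_shift_diff_norm[OF v lam(3) N0])
    also have "\<dots> \<le> 2 / real N * (C * vnorm H \<xi>)"
      using C(2) \<rho> \<xi> by (intro mult_left_mono) (auto simp: op_bounded_def)
    also have "\<dots> \<le> e / 2 * vnorm H \<xi>" using mult_right_mono[OF NC norm_nonneg[OF \<xi>]] by (simp add: mult.assoc)
    finally have 2: "vnorm H (average N c r0 (shift_diff r0 c ?\<eta>)) \<le> e / 2 * vnorm H \<xi>" .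
    have "vdiff H (sdiff r0 c b' \<rho> \<xi>) (sdiff r0 c b \<rho> \<xi>)
      = vdiff H (vdiff H (shift_diff r0 c ?\<eta>) (average N (\<omega> m) (r m) (shift_diff r0 c ?\<eta>))) (shift_diff r0 c ?\<eta>)"
      using \<rho> \<xi> v by (simp add: lmult_apply b'_eq shift_diff_vdiff av)
    also have "\<dots> = vscale H (- 1) (average N (\<omega> m) (r m) (shift_diff r0 c ?\<eta>))"
      by (rule vec_eqI) (use v in \<open>simp_all add: inner_diff inner_scale\<close>)
    also have "vnorm H \<dots> = vnorm H (average N (\<omega> m) (r m) (shift_diff r0 c ?\<eta>))"
      using v by (simp add: norm_scale)
    also have "\<dots> \<le> e / 2 * vnorm H \<xi> + e / 2 * vnorm H \<xi>"
      using norm_le_diff[of "average N (\<omega> m) (r m) (shift_diff r0 c ?\<eta>)" "average N c r0 (shift_diff r0 c ?\<eta>)"]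
        1 2 v by simp
    finally show "vnorm H (vdiff H (sdiff r0 c b' \<rho> \<xi>) (sdiff r0 c b \<rho> \<xi>)) \<le> e * vnorm H \<xi>" by simp
  qed
  then show ?thesis using m b' k1 k2 by blast
qed

lemma kills_sdiff: "b \<in> elems A \<Longrightarrow> \<sigma> \<in> R \<Longrightarrow> kills b \<sigma> \<Longrightarrow> kills (sdiff r c b) \<sigma>"
  unfolding kills_def
proof
  fix \<xi> assume \<sigma>: "\<sigma> \<in> R" and \<xi>: "\<xi> \<in> vectors (cspace \<sigma>)" and k: "\<forall>\<xi>\<in>vectors (cspace \<sigma>). b \<sigma> \<xi> = vzero (cspace \<sigma>)"
  interpret covariant_rep act \<mu> \<sigma> by (rule covariant_repI[OF \<sigma>])
  have "shift_diff r c (vzero H) = vzero H"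
    by (rule vec_eqI) (simp_all add: shift_diff_def inner_diff inner_scale grep_adjoint)
  then show "sdiff r c b \<sigma> \<xi> = vzero H" using \<sigma> \<xi> k by (simp add: lmult_apply)
qed

lemma op_close_mono: "op_close a b \<epsilon> \<Longrightarrow> \<epsilon> \<le> \<delta> \<Longrightarrow> op_close a b \<delta>"
  unfolding op_close_def
proof (intro ballI)
  fix \<rho> \<xi> assume cl: "\<forall>\<rho>\<in>R. \<forall>\<xi>\<in>vectors (cspace \<rho>).
      vnorm (cspace \<rho>) (vdiff (cspace \<rho>) (a \<rho> \<xi>) (b \<rho> \<xi>)) \<le> \<epsilon> * vnorm (cspace \<rho>) \<xi>"
    and le: "\<epsilon> \<le> \<delta>" and \<rho>: "\<rho> \<in> R" and \<xi>: "\<xi> \<in> vectors (cspace \<rho>)"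
  interpret covariant_rep act \<mu> \<rho> by (rule covariant_repI[OF \<rho>])
  have "\<epsilon> * vnorm H \<xi> \<le> \<delta> * vnorm H \<xi>" using le \<xi> by (intro mult_right_mono) auto
  moreover have "vnorm H (vdiff H (a \<rho> \<xi>) (b \<rho> \<xi>)) \<le> \<epsilon> * vnorm H \<xi>" using cl \<rho> \<xi> by simp
  ultimately show "vnorm H (vdiff H (a \<rho> \<xi>) (b \<rho> \<xi>)) \<le> \<delta> * vnorm H \<xi>" by linarith
qed

text \<open>\<open>kill_one\<close> is iterated with errors \<delta>/2^n. Each step treats a larger
  index and keeps everything that already vanished. Nothing controls the elements themselves, but
  their images under \<open>sdiff r0 c\<close> are Cauchy; it is the limit of these images that
  vanishes at every chosen index and is close to \<open>sdiff r0 c b0\<close>.\<close>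

lemma kill_subsequence:
  assumes b0: "b0 \<in> elems A" and \<delta>: "0 < \<delta>" and r: "r \<longlonglongrightarrow> r0"
    and lam: "\<omega> \<longlonglongrightarrow> c" "\<And>i. cmod (\<omega> i) = 1" "cmod c = 1"
    and \<rho>s: "\<And>i. \<rho>s i \<in> R"
    and eig: "\<And>i \<xi>. \<xi> \<in> vectors (cspace (\<rho>s i)) \<Longrightarrow> grep (\<rho>s i) (r i) \<xi> = vscale (cspace (\<rho>s i)) (\<omega> i) \<xi>"
  shows "\<exists>m a. strict_mono (m :: nat \<Rightarrow> nat) \<and> a \<in> elems A \<and> (\<forall>i. kills a (\<rho>s (m i))) \<and> op_close a (sdiff r0 c b0) (2 * \<delta>)"
proof -
  let ?D = "sdiff r0 c"
  \<comment> \<open>The recursion runs over pairs of an element and the index treated last; the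
    initial index 0 only serves as a lower bound.\<close>
  let ?Q = "\<lambda>i p q. snd p < snd q \<and> kills (fst q) (\<rho>s (snd q)) \<and> (\<forall>\<sigma>\<in>R. kills (fst p) \<sigma> \<longrightarrow> kills (fst q) \<sigma>) \<and>
      op_close (?D (fst q)) (?D (fst p)) (\<delta> / 2 ^ i)"
  have "\<exists>f. \<forall>n. (fst (f n) \<in> elems A \<and> (n = 0 \<longrightarrow> fst (f n) = b0)) \<and> ?Q n (f n) (f (Suc n))"
  proof (rule dependent_nat_choice)
    show "\<exists>p :: (('g, 'x, 'h) covariant_pair \<Rightarrow> 'h \<Rightarrow> 'h) \<times> nat. fst p \<in> elems A \<and> ((0 :: nat) = 0 \<longrightarrow> fst p = b0)" using b0 by (intro exI[of _ "(b0, 0)"]) auto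
    fix p :: "(('g, 'x, 'h) covariant_pair \<Rightarrow> 'h \<Rightarrow> 'h) \<times> nat" and n :: nat
    assume p: "fst p \<in> elems A \<and> (n = 0 \<longrightarrow> fst p = b0)"
    have "0 < \<delta> / 2 ^ n" using \<delta> by simp
    from kill_one[OF conjunct1[OF p] this r lam \<rho>s eig, of "snd p"]
    obtain m b' where "snd p < m" "b' \<in> elems A" "kills b' (\<rho>s m)" "\<forall>\<sigma>\<in>R. kills (fst p) \<sigma> \<longrightarrow> kills b' \<sigma>"
      "op_close (?D b') (?D (fst p)) (\<delta> / 2 ^ n)" by blast
    then show "\<exists>q. (fst q \<in> elems A \<and> (Suc n = 0 \<longrightarrow> fst q = b0)) \<and> ?Q n p q"
      by (intro exI[of _ "(b', m)"]) auto
  qed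
  then obtain f where f: "\<And>n. fst (f n) \<in> elems A" "fst (f 0) = b0" "\<And>n. snd (f n) < snd (f (Suc n))"
    "\<And>n. kills (fst (f (Suc n))) (\<rho>s (snd (f (Suc n))))"
    "\<And>n \<sigma>. \<sigma> \<in> R \<Longrightarrow> kills (fst (f n)) \<sigma> \<Longrightarrow> kills (fst (f (Suc n))) \<sigma>"
    "\<And>n. op_close (?D (fst (f (Suc n)))) (?D (fst (f n))) (\<delta> / 2 ^ n)" by metis
  define a where "a n = ?D (fst (f n))" for n
  define m where "m i = snd (f (Suc i))" for i
  \<comment> \<open>The tail of the geometric series from term k on, so that
    \<open>e k - e n\<close> is exactly the sum of the errors between k and n.\<close>
  define e where "e k = 2 * \<delta> / 2 ^ k" for k :: nat
  have mono: "strict_mono m" unfolding m_def by (rule strict_monoI_Suc) (rule f(3))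
  have aA: "a n \<in> elems A" for n unfolding a_def by (rule sdiff_elems[OF f(1)])
  have cl': "op_close (a n) (a k) (e k - e n)" if "k \<le> n" for k n
    using that
  proof (induction n rule: dec_induct)
    case base
    then show ?case using op_close_refl[OF elems_family[OF aA], of 0 k] by simp
  next
    case (step n)
    have "op_close (a (Suc n)) (a k) (\<delta> / 2 ^ n + (e k - e n))"
      by (rule op_close_trans[OF elems_family[OF aA] elems_family[OF aA] elems_family[OF aA] _ step.IH])
        (simp add: a_def f(6))
    moreover have "\<delta> / 2 ^ n + (e k - e n) = e k - e (Suc n)" by (simp add: e_def)
    ultimately show ?case by simp
  qed
  have cl: "op_close (a n) (a k) (e k)" if "k \<le> n" for k n
    by (rule op_close_mono[OF cl'[OF that]]) (use \<delta> in \<open>simp add: e_def\<close>)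
  have "(\<lambda>k. 2 * \<delta> * (1 / 2) ^ k) \<longlonglongrightarrow> 2 * \<delta> * 0" by (intro tendsto_intros LIMSEQ_realpow_zero) auto
  then have e0: "e \<longlonglongrightarrow> 0" unfolding e_def by (simp add: power_divide)
  have "\<exists>b\<in>elems A. \<forall>m. op_close b (a m) (e m)" by (rule elems_complete[OF aA cl e0])
  then obtain b where b: "b \<in> elems A" "\<forall>m. op_close b (a m) (e m)" by (rule bexE)
  have kf: "kills (fst (f n)) (\<rho>s (m i))" if "Suc i \<le> n" for n i
    using that
  proof (induction n rule: dec_induct)
    case base
    show ?case unfolding m_def by (rule f(4))
  next
    case (step n)
    show ?case by (rule f(5)[OF \<rho>s step.IH])
  qed
  have "kills b (\<rho>s (m i))" for i
    unfolding kills_def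
  proof
    fix \<xi> assume \<xi>: "\<xi> \<in> vectors (cspace (\<rho>s (m i)))"
    interpret covariant_rep act \<mu> "\<rho>s (m i)" by (rule covariant_repI[OF \<rho>s])
    have "vnorm H (b (\<rho>s (m i)) \<xi>) \<le> e n * vnorm H \<xi>" if "Suc i \<le> n" for n
    proof -
      have "kills (a n) (\<rho>s (m i))" unfolding a_def by (rule kills_sdiff[OF f(1) \<rho>s kf[OF that]])
      then have "a n (\<rho>s (m i)) \<xi> = vzero H" using \<xi> by (simp add: kills_def)
      moreover have "vnorm H (vdiff H (b (\<rho>s (m i)) \<xi>) (a n (\<rho>s (m i)) \<xi>)) \<le> e n * vnorm H \<xi>"
        using b(2) \<rho>s \<xi> unfolding op_close_def by simp
      ultimately show ?thesis using elems_closed[OF b(1) \<rho>s \<xi>] by simp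
    qed
    moreover have "(\<lambda>n. e n * vnorm H \<xi>) \<longlonglongrightarrow> 0" by (rule tendsto_mult_left_zero[OF e0])
    ultimately have "vnorm H (b (\<rho>s (m i)) \<xi>) \<le> 0"
      by (intro LIMSEQ_le_const[of "\<lambda>n. e n * vnorm H \<xi>"]) auto
    moreover have bv: "b (\<rho>s (m i)) \<xi> \<in> vectors H" by (rule elems_closed[OF b(1) \<rho>s \<xi>])
    ultimately have "vnorm H (b (\<rho>s (m i)) \<xi>) = 0" using norm_nonneg[OF bv] by linarith
    then show "b (\<rho>s (m i)) \<xi> = vzero H" using norm_eq_0_iff[OF bv] by simp
  qed
  moreover have "op_close b (sdiff r0 c b0) (2 * \<delta>)"
    using b(2)[rule_format, of 0] by (simp add: a_def e_def f(2))
  ultimately show ?thesis using mono b(1) by blast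
qed

text \<open>At \<rho>z the operator \<open>shift_diff r0 c\<close> is multiplication by \<kappa> -
  c. If this were nonzero, \<open>sdiff r0 c b\<close> would have a nonzero value at some vector,
  while \<open>kill_subsequence\<close> approximates it by elements that vanish along a subsequence
  and hence, by \<open>weak_containment\<close>, at \<rho>z.\<close>

lemma eigenvalue_convergence:
  assumes lim: "limitin (spectrum_topology A) (\<lambda>n. rep_class A (integrated_form (\<rho> n)))
      (rep_class A (integrated_form \<rho>z)) sequentially"
    and \<rho>: "\<rho>z \<in> R" "\<And>i. \<rho> (g i) \<in> R" and g: "strict_mono (g :: nat \<Rightarrow> nat)" and r: "r \<longlonglongrightarrow> r0"
    and lam: "\<omega> \<longlonglongrightarrow> c" "\<And>i. cmod (\<omega> i) = 1"
    and eig: "\<And>i \<xi>. \<xi> \<in> vectors (cspace (\<rho> (g i))) \<Longrightarrow> grep (\<rho> (g i)) (r i) \<xi> = vscale (cspace (\<rho> (g i))) (\<omega> i) \<xi>"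
    and eigz: "\<And>\<xi>. \<xi> \<in> vectors (cspace \<rho>z) \<Longrightarrow> grep \<rho>z r0 \<xi> = vscale (cspace \<rho>z) \<kappa> \<xi>"
  shows "\<kappa> = c"
proof (rule ccontr)
  assume ne: "\<kappa> \<noteq> c"
  have "(\<lambda>i. cmod (\<omega> i)) \<longlonglongrightarrow> cmod c" by (intro tendsto_intros lam)
  then have c1: "cmod c = 1" using LIMSEQ_unique[of "\<lambda>i. 1" 1 "cmod c"] lam(2) by simp
  interpret z: covariant_rep act \<mu> \<rho>z by (rule covariant_repI[OF \<rho>(1)])
  obtain b \<xi> where b: "b \<in> elems A" and \<xi>: "\<xi> \<in> vectors (cspace \<rho>z)" and nz: "b \<rho>z \<xi> \<noteq> vzero (cspace \<rho>z)"
    using spectrum_nonzero[OF limitin_spectrumD(1)[OF lim] \<rho>(1)] by (elim bexE)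
  let ?H = "cspace \<rho>z"
  have v: "b \<rho>z \<xi> \<in> vectors ?H" by (rule elems_closed[OF b \<rho>(1) \<xi>])
  define t where "t = cmod (\<kappa> - c) * vnorm ?H (b \<rho>z \<xi>)"
  have "vnorm ?H (b \<rho>z \<xi>) \<noteq> 0" using nz z.norm_eq_0_iff[OF v] by simp
  then have t: "0 < t" using ne z.norm_nonneg[OF v] by (simp add: t_def)
  have n0: "0 \<le> vnorm ?H \<xi>" using \<xi> by simp
  \<comment> \<open>Here t is the size of the value to be contradicted; with this choice the error
    \<open>2 * \<delta>\<close> at \<xi> is at most half of t.\<close>
  define \<delta> where "\<delta> = t / 4 / (vnorm ?H \<xi> + 1)"
  have \<delta>: "0 < \<delta>" using t n0 by (simp add: \<delta>_def add_nonneg_pos)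
  have \<delta>2: "2 * \<delta> * vnorm ?H \<xi> < t"
  proof -
    have "2 * \<delta> * vnorm ?H \<xi> \<le> 2 * \<delta> * (vnorm ?H \<xi> + 1)" using \<delta> by (intro mult_left_mono) auto
    also have "\<dots> = t / 2" using n0 by (simp add: \<delta>_def field_simps)
    finally show ?thesis using t by linarith
  qed
  have "\<exists>m a. strict_mono (m :: nat \<Rightarrow> nat) \<and> a \<in> elems A \<and> (\<forall>i. kills a (\<rho> (g (m i)))) \<and> op_close a (sdiff r0 c b) (2 * \<delta>)"
    by (rule kill_subsequence[where \<rho>s = "\<lambda>i. \<rho> (g i)", OF b \<delta> r lam c1 \<rho>(2)]) (rule eig)
  then obtain m a where m: "strict_mono (m :: nat \<Rightarrow> nat)" and a: "a \<in> elems A" "\<forall>i. kills a (\<rho> (g (m i)))"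
    "op_close a (sdiff r0 c b) (2 * \<delta>)"
    by (elim exE conjE) (rule that)
  have gm: "strict_mono (\<lambda>i. g (m i))" using g m by (simp add: strict_mono_def)
  have "a \<rho>z \<xi> = vzero ?H"
    by (rule weak_containment[OF lim \<rho>(1) \<rho>(2) gm a(1) _ \<xi>]) (use a(2) in \<open>simp add: kills_def\<close>)
  then have "vnorm ?H (vdiff ?H (vzero ?H) (sdiff r0 c b \<rho>z \<xi>)) \<le> 2 * \<delta> * vnorm ?H \<xi>"
    using a(3) \<rho>(1) \<xi> unfolding op_close_def by metis
  moreover have "vdiff ?H (vzero ?H) (sdiff r0 c b \<rho>z \<xi>) = vscale ?H (c - \<kappa>) (b \<rho>z \<xi>)"
    by (rule z.vec_eqI)
      (use v \<rho>(1) \<xi> in \<open>simp_all add: lmult_apply z.shift_diff_def eigz z.inner_diff z.inner_scale algebra_simps\<close>)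
  ultimately have "t \<le> 2 * \<delta> * vnorm ?H \<xi>" using v by (simp add: t_def z.norm_scale norm_minus_commute)
  then show False using \<delta>2 by simp
qed

end

section \<open>Haar measures of subgroups and the Fell topology\<close>

text \<open>Regarded as Borel measures on G concentrated on the respective subgroup, the Haar
  measures of different subgroups can be compared and passed to a limit.\<close>

definition extend_measure :: "'a::topological_space measure \<Rightarrow> 'a measure" where
  "extend_measure m = distr m borel (\<lambda>x. x)"

lemma
  fixes m :: "'g::{topological_ab_group_add, t2_space} measure"
  assumes m: "haar_measure (top_of_set H) (+) H m" and H: "H \<in> closed_subgroups"
  shows haar_extend_measure: "haar_measure euclidean (+) H (extend_measure m)"
    and AE_extend_measure: "AE r in extend_measure m. r \<in> H"
    and integral_extend_measure: "f \<in> borel_measurable borel \<Longrightarrow>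
      (LINT r|extend_measure m. f r) = (LINT r|m. (f r :: 'b::{banach, second_countable_topology}))"
proof -
  have closed: "closed H" using H by (simp add: closed_subgroups_def)
  have space: "space m = H" and sets: "sets m = sigma_sets H {U. openin (top_of_set H) U}"
    using m by (simp_all add: haar_measure_def)
  have meas: "(\<lambda>x. x) \<in> borel_measurable m"
  proof (rule borel_measurableI)
    fix S :: "'g set" assume "open S"
    then have "openin (top_of_set H) (H \<inter> S)" by blast
    then show "(\<lambda>x. x) -` S \<inter> space m \<in> sets m" unfolding sets space by (auto simp: Int_commute)
  qed
  have em: "emeasure (extend_measure m) A = emeasure m (A \<inter> H)" if "A \<in> sets borel" for A
    using that meas by (simp add: extend_measure_def emeasure_distr space)
  have sg: "s + t \<in> H" "- s \<in> H" if "s \<in> H" "t \<in> H" for s t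
    using H that by (simp_all add: closed_subgroups_def)
  show "haar_measure euclidean (+) H (extend_measure m)"
    unfolding haar_measure_def
  proof (intro conjI allI impI ballI)
    show "space (extend_measure m) = topspace euclidean" by (simp add: extend_measure_def)
    show "sets (extend_measure m) = sigma_sets (topspace euclidean) {U. openin euclidean U}"
      by (simp add: extend_measure_def borel_def)
    show "emeasure (extend_measure m) (topspace euclidean) \<noteq> 0"
      using m by (simp add: em haar_measure_def)
    fix K :: "'g set" assume "compactin euclidean K"
    then have "compact K" by simp
    moreover have "compactin (top_of_set H) (K \<inter> H)"
      using \<open>compact K\<close> closed by (simp add: compactin_subtopology compact_Int_closed)
    then have "emeasure m (K \<inter> H) < \<infinity>" using m by (simp add: haar_measure_def)
    ultimately show "emeasure (extend_measure m) K < \<infinity>" by (simp add: em borel_compact)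
  next
    fix s A assume s: "s \<in> H" and "A \<in> sets (extend_measure m)"
    then have A: "A \<in> sets borel" by (simp add: extend_measure_def)
    have im: "(+) s ` B = (\<lambda>r. r - s) -` B" for B :: "'g set"
      by (auto intro!: image_eqI[of _ _ "_ - s"])
    have sm: "(\<lambda>r. r - s) \<in> borel_measurable borel"
      by (rule borel_measurable_continuous_onI) (intro continuous_intros)
    have "(+) s ` A \<in> sets borel" unfolding im using measurable_sets[OF sm A] by simp
    moreover have "((+) s ` A) \<inter> H = (+) s ` (A \<inter> H)"
    proof -
      have "s + a \<in> H \<longleftrightarrow> a \<in> H" for a
      proof
        assume "s + a \<in> H"
        from sg(1)[OF this sg(2)[OF s s]] show "a \<in> H" by simp
      qed (rule sg(1)[OF s])
      then show ?thesis by auto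
    qed
    moreover have "emeasure m ((+) s ` (A \<inter> H)) = emeasure m (A \<inter> H)"
    proof -
      have "A \<inter> H \<in> sets m" using measurable_sets[OF meas A] by (simp add: space)
      then show ?thesis using m s by (simp add: haar_measure_def)
    qed
    ultimately show "emeasure (extend_measure m) ((+) s ` A) = emeasure (extend_measure m) A"
      using A by (simp add: em)
  qed
  have "- H \<in> sets borel" using closed by (simp add: borel_closed)
  then have "emeasure (extend_measure m) (- H) = 0" by (simp add: em)
  moreover have "- H \<in> sets (extend_measure m)" using \<open>- H \<in> sets borel\<close> by (simp add: extend_measure_def)
  ultimately show "AE r in extend_measure m. r \<in> H"
    by (intro AE_I[of _ _ "- H"]) auto
  show "(LINT r|extend_measure m. f r) = (LINT r|m. f r)" if "f \<in> borel_measurable borel" for f :: "'g \<Rightarrow> 'b"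
    unfolding extend_measure_def by (rule integral_distr[OF meas that])
qed

text \<open>Points violating the estimate lie in a compact set formed from the support and a null
  sequence of translations, so a subsequence converges and continuity gives the
  contradiction.\<close>

lemma Cc_uniformly_continuous:
  fixes f :: "'g::{topological_ab_group_add, first_countable_topology, t2_space} \<Rightarrow> 'b::real_normed_vector"
  assumes f: "f \<in> Cc" and \<epsilon>: "0 < \<epsilon>"
  shows "eventually (\<lambda>u. \<forall>s. norm (f (s + u) - f s) \<le> \<epsilon>) (nhds 0)"
  unfolding eventually_nhds_iff_sequentially
proof (intro allI impI, rule ccontr)
  fix u :: "nat \<Rightarrow> 'g" assume u: "u \<longlonglongrightarrow> 0"
    and "\<not> eventually (\<lambda>n. \<forall>s. norm (f (s + u n) - f s) \<le> \<epsilon>) sequentially"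
  then have "\<exists>\<^sub>F n in sequentially. \<exists>s. \<epsilon> < norm (f (s + u n) - f s)"
    by (simp add: frequently_def not_less)
  then have "infinite {n. \<exists>s. \<epsilon> < norm (f (s + u n) - f s)}"
    by (simp add: frequently_cofinite flip: cofinite_eq_sequentially)
  then obtain q :: "nat \<Rightarrow> nat" where q: "strict_mono q" "\<And>n. \<exists>s. \<epsilon> < norm (f (s + u (q n)) - f s)"
    using infinite_enumerate by blast
  then obtain s where s: "\<And>n. \<epsilon> < norm (f (s n + u (q n)) - f (s n))" by metis
  have uq: "(\<lambda>n. u (q n)) \<longlonglongrightarrow> 0" using LIMSEQ_subseq_LIMSEQ[OF u q(1)] by (simp add: o_def)
  obtain K B where K: "compact K" "\<And>s. s \<notin> K \<Longrightarrow> f s = 0" using Cc_bounded[OF f] by metis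
  let ?L = "K + uminus ` (insert 0 (range (\<lambda>n. u (q n))))"
  have L: "compact ?L" by (intro compact_plus K(1) compact_uminus convergent_seq_compact uq)
  have "s n \<in> ?L" for n
  proof -
    have "s n + u (q n) \<in> K \<or> s n \<in> K"
      using s[of n] K(2)[of "s n + u (q n)"] K(2)[of "s n"] \<epsilon> by (cases "s n + u (q n) \<in> K"; cases "s n \<in> K") auto
    then show ?thesis
    proof
      assume "s n + u (q n) \<in> K"
      then have "(s n + u (q n)) + - u (q n) \<in> ?L" by (intro set_plus_intro) auto
      then show ?thesis by simp
    next
      assume "s n \<in> K"
      then have "s n + - 0 \<in> ?L" by (intro set_plus_intro imageI) auto
      then show ?thesis by simp
    qed
  qed
  then obtain s0 v where v: "strict_mono (v :: nat \<Rightarrow> nat)" "(s \<circ> v) \<longlonglongrightarrow> s0"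
    using seq_compactE[OF compact_imp_seq_compact[OF L], of s] by metis
  have sv: "(\<lambda>n. s (v n)) \<longlonglongrightarrow> s0" using v(2) by (simp add: o_def)
  have uv: "(\<lambda>n. u (q (v n))) \<longlonglongrightarrow> 0" using LIMSEQ_subseq_LIMSEQ[OF uq v(1)] by (simp add: o_def)
  have cont: "(\<lambda>n. f (w n)) \<longlonglongrightarrow> f w0" if "w \<longlonglongrightarrow> w0" for w w0
    using continuous_on_tendsto_compose[OF Cc_continuous[OF f] that] by simp
  have "(\<lambda>n. f (s (v n) + u (q (v n))) - f (s (v n))) \<longlonglongrightarrow> f (s0 + 0) - f s0"
    by (intro tendsto_diff cont tendsto_add sv uv)
  then have "(\<lambda>n. norm (f (s (v n) + u (q (v n))) - f (s (v n)))) \<longlonglongrightarrow> 0"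
    by (simp add: tendsto_norm_zero_iff)
  then have "0 \<ge> \<epsilon>" using s by (intro LIMSEQ_le_const) (auto intro!: less_imp_le)
  then show False using \<epsilon> by simp
qed

section \<open>Normalised Haar measures of closed subgroups: uniform bounds and
  periodization\<close>

locale lc_group =
  fixes f0 :: "'g::{topological_ab_group_add, second_countable_topology, t2_space} \<Rightarrow> real"
  assumes lcG: "locally_compact_space (euclidean :: 'g topology)"
    and f0: "f0 \<in> Cc" "f0 0 = 1" "\<And>s. 0 \<le> f0 s" "\<And>s. f0 s \<le> 1"
begin

definition sub_haar :: "'g set \<Rightarrow> 'g measure \<Rightarrow> bool" where
  "sub_haar H \<beta> \<longleftrightarrow> H \<in> closed_subgroups \<and> haar_measure euclidean (+) H \<beta> \<and> (AE r in \<beta>. r \<in> H) \<and>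
     (LINT s|\<beta>. f0 s) = 1"

lemma sub_haarD:
  assumes "sub_haar H \<beta>"
  shows "haar_measure euclidean (+) H \<beta>" "AE r in \<beta>. r \<in> H" "(LINT s|\<beta>. f0 s) = 1"
    "sets \<beta> = sets borel" "space \<beta> = UNIV" "compact K \<Longrightarrow> emeasure \<beta> K < \<infinity>"
    "0 \<in> H" "s \<in> H \<Longrightarrow> t \<in> H \<Longrightarrow> s + t \<in> H" "s \<in> H \<Longrightarrow> - s \<in> H"
proof -
  have H: "H \<in> closed_subgroups" and m: "haar_measure euclidean (+) H \<beta>"
    using assms by (simp_all add: sub_haar_def)
  show "haar_measure euclidean (+) H \<beta>" "sets \<beta> = sets borel" "space \<beta> = UNIV"
    using m haar_measure_sets[OF m] by simp_all
  show "AE r in \<beta>. r \<in> H" "(LINT s|\<beta>. f0 s) = 1" using assms by (simp_all add: sub_haar_def)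
  show "compact K \<Longrightarrow> emeasure \<beta> K < \<infinity>" using m by (simp add: haar_measure_def)
  show "0 \<in> H" "s \<in> H \<Longrightarrow> t \<in> H \<Longrightarrow> s + t \<in> H" "s \<in> H \<Longrightarrow> - s \<in> H"
    using H by (simp_all add: closed_subgroups_def)
qed

lemma sigma_finite:
  assumes "sub_haar H \<beta>"
  shows "sigma_finite_measure \<beta>"
proof
  obtain K where K: "\<And>n :: nat. compact (K n :: 'g set)" "(\<Union>n. K n) = UNIV" using sigma_compact_space[OF lcG] by metis
  show "\<exists>A. countable A \<and> A \<subseteq> sets \<beta> \<and> \<Union>A = space \<beta> \<and> (\<forall>a\<in>A. emeasure \<beta> a \<noteq> \<infinity>)"
    using K sub_haarD(4-6)[OF assms] by (intro exI[of _ "range K"]) (auto simp: borel_compact less_top)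
qed

text \<open>The normalisation bounds the mass of U = {f0 > 1/2} by 2 for every subgroup. Let V be an
  open neighbourhood of 0 with V - V inside U: a translate of V that meets H lies in the translate
  of U by a point of H, so it has mass at most 2, and a translate that misses H has mass 0. The
  number of translates of V needed to cover K does not depend on H.\<close>

lemma uniform_measure_bound:
  assumes K: "compact (K :: 'g set)"
  shows "\<exists>C\<ge>0. \<forall>H \<beta>. sub_haar H \<beta> \<longrightarrow> measure \<beta> K \<le> C"
proof -
  define U where "U = {s. 1 / 2 < f0 s}"
  have Uo: "open U" unfolding U_def
    by (intro open_Collect_less continuous_intros Cc_continuous f0)
  have "0 \<in> U" by (simp add: U_def f0)
  have "continuous_on UNIV (\<lambda>p :: 'g \<times> 'g. fst p - snd p)" by (intro continuous_intros)
  then have "open ((\<lambda>p :: 'g \<times> 'g. fst p - snd p) -` U)" using Uo by (simp add: continuous_on_open_vimage)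
  moreover have "(0, 0) \<in> (\<lambda>p :: 'g \<times> 'g. fst p - snd p) -` U" using \<open>0 \<in> U\<close> by simp
  ultimately obtain V1 V2 where V12: "open V1" "open V2" "(0, 0) \<in> V1 \<times> V2"
    "V1 \<times> V2 \<subseteq> (\<lambda>p :: 'g \<times> 'g. fst p - snd p) -` U" by (rule open_prod_elim)
  define V where "V = V1 \<inter> V2"
  have V: "open V" "0 \<in> V" "\<And>a b. a \<in> V \<Longrightarrow> b \<in> V \<Longrightarrow> a - b \<in> U"
    using V12 by (auto simp: V_def subset_iff)
  have sh: "(+) k ` B = (\<lambda>r. r - k) -` B" for k and B :: "'g set"
    by (auto intro!: image_eqI[of _ _ "_ - k"])
  have oV: "open ((+) k ` V)" for k
    unfolding sh by (intro open_vimage V(1) continuous_intros)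
  have mem: "k \<in> (+) k ` V" for k using V(2) by (auto intro!: image_eqI[of _ _ 0])
  have cov: "K \<subseteq> (\<Union>k\<in>K. (+) k ` V)"
  proof
    fix k assume "k \<in> K"
    then show "k \<in> (\<Union>k\<in>K. (+) k ` V)" by (rule UN_I) (rule mem)
  qed
  obtain C where C: "C \<subseteq> K" "finite C" "K \<subseteq> (\<Union>k\<in>C. (+) k ` V)"
    using compactE_image[where f = "\<lambda>k. (+) k ` V", OF K oV cov] by metis
  have "measure \<beta> K \<le> 2 * real (card C)" if \<beta>: "sub_haar H \<beta>" for H \<beta>
  proof -
    note D = sub_haarD[OF \<beta>]
    have Us: "U \<in> sets \<beta>" using Uo by (simp add: D(4))
    obtain K0 where K0: "compact K0" "\<And>s. s \<notin> K0 \<Longrightarrow> f0 s = 0" using Cc_bounded[OF f0(1)] by metis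
    have fin: "emeasure \<beta> U < \<infinity>"
    proof -
      have "U \<subseteq> K0" using K0(2) by (force simp: U_def)
      then have "emeasure \<beta> U \<le> emeasure \<beta> K0" using K0(1) by (intro emeasure_mono) (auto simp: D(4) borel_compact)
      then show ?thesis using D(6)[OF K0(1)] by simp
    qed
    have i0: "integrable \<beta> f0"
      by (rule integrable_compact_support(1)[OF D(4) K0(1) D(6)[OF K0(1)] continuous_borel[OF Cc_continuous[OF f0(1)]] K0(2), of 1])
        (use f0 in auto)
    have "measure \<beta> U / 2 = (LINT s|\<beta>. indicat_real U s / 2)" using Us fin by (simp add: measure_def)
    also have "\<dots> \<le> (LINT s|\<beta>. f0 s)"
    proof (rule integral_mono[OF _ i0])
      show "integrable \<beta> (\<lambda>s. indicat_real U s / 2)" using Us fin by (intro integrable_divide) auto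
      show "indicat_real U s / 2 \<le> f0 s" for s using f0(3)[of s] by (auto simp: indicator_def U_def)
    qed
    finally have U2: "measure \<beta> U \<le> 2" using D(3) by simp
    have eU: "emeasure \<beta> U = ennreal (measure \<beta> U)" using fin by (simp add: emeasure_eq_ennreal_measure less_top)
    have kV: "emeasure \<beta> ((+) k ` V) \<le> ennreal 2" for k
    proof (cases "(+) k ` V \<inter> H = {}")
      case True
      then have "AE r in \<beta>. r \<notin> (+) k ` V" using D(2) by (auto elim!: eventually_mono)
      then have "emeasure \<beta> ((+) k ` V) = 0"
        using oV[of k] by (subst AE_iff_measurable[where P = "\<lambda>r. r \<notin> (+) k ` V", symmetric]) (auto simp: D(4,5))
      then show ?thesis by simp
    next
      case False
      then obtain h where h: "h \<in> H" "h \<in> (+) k ` V" by blast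
      have "(+) k ` V \<subseteq> (+) h ` U"
      proof
        fix y assume "y \<in> (+) k ` V"
        then obtain v where v: "v \<in> V" "y = k + v" by blast
        obtain v' where v': "v' \<in> V" "h = k + v'" using h(2) by blast
        have "y = h + (v - v')" using v v' by (simp add: algebra_simps)
        then show "y \<in> (+) h ` U" using V(3)[OF v(1) v'(1)] by blast
      qed
      moreover have "(+) h ` U \<in> sets \<beta>"
        unfolding sh D(4) by (intro borel_open open_vimage Uo continuous_intros)
      ultimately have "emeasure \<beta> ((+) k ` V) \<le> emeasure \<beta> ((+) h ` U)" by (rule emeasure_mono)
      also have "\<dots> = emeasure \<beta> U" using D(1) h(1) Us by (simp add: haar_measure_def)
      also have "\<dots> \<le> ennreal 2" unfolding eU using U2 by (rule ennreal_leI)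
      finally show ?thesis .
    qed
    have Vs: "(+) k ` V \<in> sets \<beta>" for k using oV[of k] by (simp add: D(4))
    have "emeasure \<beta> K \<le> emeasure \<beta> (\<Union>k\<in>C. (+) k ` V)"
      using Vs C(2,3) by (intro emeasure_mono) auto
    also have "\<dots> \<le> (\<Sum>k\<in>C. emeasure \<beta> ((+) k ` V))"
      using Vs C(2) by (intro emeasure_subadditive_finite) auto
    also have "\<dots> \<le> (\<Sum>k\<in>C. ennreal 2)" by (intro sum_mono kV)
    also have "\<dots> = ennreal (2 * real (card C))"
      by (simp add: ennreal_of_nat_eq_real_of_nat mult.commute ennreal_mult')
    finally have "enn2real (emeasure \<beta> K) \<le> enn2real (ennreal (2 * real (card C)))"
      by (intro enn2real_mono) auto
    then show ?thesis by (simp add: measure_def)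
  qed
  then show ?thesis by (intro exI[of _ "2 * real (card C)"]) auto
qed

text \<open>The measure lives on H, so inserting the indicator of H does not change the integral,
  and a pointwise bound on H is enough. This matters because the characters and the vanishing
  arguments below give control only at points of the subgroup.\<close>

lemma Cc_integral_bound:
  fixes f :: "'g \<Rightarrow> complex"
  assumes f: "f \<in> borel_measurable borel" and K: "compact K" "\<And>s. s \<notin> K \<Longrightarrow> f s = 0"
    and \<beta>: "sub_haar H \<beta>" and C: "measure \<beta> K \<le> C" and e: "0 \<le> e" "\<And>s. s \<in> H \<Longrightarrow> cmod (f s) \<le> e"
  shows "cmod (LINT s|\<beta>. f s) \<le> e * C"
proof -
  note D = sub_haarD[OF \<beta>]
  have Hb: "H \<in> sets borel" using \<beta> by (simp add: sub_haar_def closed_subgroups_def borel_closed)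
  define f' where "f' s = indicat_real H s *\<^sub>R f s" for s
  have f': "f' \<in> borel_measurable borel" unfolding f'_def using f Hb by measurable
  have "(LINT s|\<beta>. f s) = (LINT s|\<beta>. f' s)"
  proof (rule integral_cong_AE)
    show "f \<in> borel_measurable \<beta>" "f' \<in> borel_measurable \<beta>"
      using f f' measurable_cong_sets[OF D(4) refl] by blast+
    show "AE s in \<beta>. f s = f' s" using D(2) by eventually_elim (simp add: f'_def)
  qed
  also have "cmod \<dots> \<le> e * measure \<beta> K"
    by (rule integrable_compact_support(2)[OF D(4) K(1) D(6)[OF K(1)] f'])
      (use K(2) e in \<open>auto simp: f'_def indicator_def\<close>)
  also have "\<dots> \<le> e * C" using C e(1) by (rule mult_left_mono)
  finally show ?thesis .
qed

lemma Cc_integrable: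
  fixes f :: "'g \<Rightarrow> complex"
  assumes f: "f \<in> Cc" and \<beta>: "sub_haar H \<beta>"
  shows "integrable \<beta> f"
proof -
  obtain K B where K: "compact K" "\<And>s. s \<notin> K \<Longrightarrow> f s = 0" "\<And>s. norm (f s) \<le> B" using Cc_bounded[OF f] by metis
  show ?thesis
    by (rule integrable_compact_support(1)[OF sub_haarD(4)[OF \<beta>] K(1) sub_haarD(6)[OF \<beta> K(1)]
        continuous_borel[OF Cc_continuous[OF f]] K(2,3)])
qed

definition per :: "'g measure \<Rightarrow> ('g \<Rightarrow> complex) \<Rightarrow> 'g \<Rightarrow> complex" where
  "per \<beta> h s = (LINT t|\<beta>. h (s + t))"

lemma per_continuous:
  assumes h: "h \<in> Cc" and \<beta>: "sub_haar H \<beta>"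
  shows "continuous_on UNIV (per \<beta> h)"
proof (rule sequential_continuity)
  fix u :: "nat \<Rightarrow> 'g" and l assume u: "u \<longlonglongrightarrow> l"
  obtain K B where K: "compact K" "\<And>s. s \<notin> K \<Longrightarrow> h s = 0" "\<And>s. norm (h s) \<le> B" using Cc_bounded[OF h] by metis
  let ?L = "K + uminus ` (insert l (range u))"
  have L: "compact ?L" by (intro compact_plus K(1) compact_uminus convergent_seq_compact u)
  have hc: "(\<lambda>t. h (s + t)) \<in> borel_measurable borel" for s
    by (rule continuous_borel, rule continuous_on_compose2[OF Cc_continuous[OF h]]) (auto intro!: continuous_intros)
  show "(\<lambda>n. per \<beta> h (u n)) \<longlonglongrightarrow> per \<beta> h l"
    unfolding per_def
  proof (rule tendsto_integral_compact_support[OF sub_haarD(4)[OF \<beta>] L sub_haarD(6)[OF \<beta> L] hc hc])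
    show "h (u n + t) = 0" if "t \<notin> ?L" for n t
    proof (rule K(2), rule notI)
      assume "u n + t \<in> K"
      then have "(u n + t) + - u n \<in> ?L" by (intro set_plus_intro) auto
      then show False using that by simp
    qed
    show "AE t in \<beta>. (\<lambda>n. h (u n + t)) \<longlonglongrightarrow> h (l + t)"
    proof (rule AE_I2)
      fix t
      have "(\<lambda>n. u n + t) \<longlonglongrightarrow> l + t" by (intro tendsto_intros u)
      from continuous_on_tendsto_compose[OF Cc_continuous[OF h] this]
      show "(\<lambda>n. h (u n + t)) \<longlonglongrightarrow> h (l + t)" by simp
    qed
  qed (rule K(3))
qed

lemma per_invariant:
  assumes h: "h \<in> borel_measurable borel" and \<beta>: "sub_haar H \<beta>" and s: "s \<in> H"
  shows "per \<beta> h (r + s) = per \<beta> h r"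
proof -
  have "(\<lambda>t. r + t) \<in> borel_measurable borel"
    by (rule borel_measurable_continuous_onI) (intro continuous_intros)
  then have hb: "(\<lambda>t. h (r + t)) \<in> borel_measurable borel"
    using measurable_compose[OF _ h] by blast
  have "(LINT t|\<beta>. h (r + (t - - s))) = (LINT t|\<beta>. h (r + t))"
    by (rule haar_integral_translate[OF sub_haarD(1)[OF \<beta>] sub_haarD(9)[OF \<beta> s] hb])
  then show ?thesis unfolding per_def by (simp add: add.assoc add.commute add.left_commute)
qed

lemma Fubini_Cc:
  fixes f :: "'g \<Rightarrow> 'g \<Rightarrow> complex"
  assumes \<beta>: "sub_haar H \<beta>" "sub_haar H' \<beta>'" and f: "continuous_on UNIV (\<lambda>p. f (fst p) (snd p))"
    and K: "compact K" "compact L" "\<And>s t. s \<notin> K \<or> t \<notin> L \<Longrightarrow> f s t = 0" and B: "\<And>s t. cmod (f s t) \<le> B"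
  shows "(LINT s|\<beta>. LINT t|\<beta>'. f s t) = (LINT t|\<beta>'. LINT s|\<beta>. f s t)"
proof -
  interpret b: sigma_finite_measure \<beta> by (rule sigma_finite[OF \<beta>(1)])
  interpret b': sigma_finite_measure \<beta>' by (rule sigma_finite[OF \<beta>(2)])
  interpret pair_sigma_finite \<beta> \<beta>' ..
  note D = sub_haarD[OF \<beta>(1)] and D' = sub_haarD[OF \<beta>(2)]
  have sp: "sets (\<beta> \<Otimes>\<^sub>M \<beta>') = sets (borel :: ('g \<times> 'g) measure)"
    unfolding borel_prod[symmetric] by (rule sets_pair_measure_cong[OF D(4) D'(4)])
  have fm: "case_prod f \<in> borel_measurable (\<beta> \<Otimes>\<^sub>M \<beta>')"
    unfolding measurable_cong_sets[OF sp refl] case_prod_unfold by (rule continuous_borel[OF f])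
  have KL: "K \<in> sets \<beta>" "L \<in> sets \<beta>'" using K by (simp_all add: D(4) D'(4) borel_compact)
  have "emeasure (\<beta> \<Otimes>\<^sub>M \<beta>') (K \<times> L) = emeasure \<beta> K * emeasure \<beta>' L" by (rule b'.emeasure_pair_measure_Times[OF KL])
  also have "\<dots> < \<infinity>" using D(6)[OF K(1)] D'(6)[OF K(2)] by (simp add: ennreal_mult_less_top)
  finally have fin: "emeasure (\<beta> \<Otimes>\<^sub>M \<beta>') (K \<times> L) < \<infinity>" .
  have "integrable (\<beta> \<Otimes>\<^sub>M \<beta>') (\<lambda>p. B * indicat_real (K \<times> L) p)"
    using KL fin by (intro integrable_mult_right integrable_real_indicator) auto
  then have int: "integrable (\<beta> \<Otimes>\<^sub>M \<beta>') (case_prod f)"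
  proof (rule Bochner_Integration.integrable_bound[OF _ fm])
    have "norm (case_prod f p) \<le> norm (B * indicat_real (K \<times> L) p)" for p
      using B[of "fst p" "snd p"] K(3)[of "fst p" "snd p"] by (cases p) (auto simp: indicator_def)
    then show "AE p in \<beta> \<Otimes>\<^sub>M \<beta>'. norm (case_prod f p) \<le> norm (B * indicat_real (K \<times> L) p)" by simp
  qed
  show ?thesis using Fubini_integral[OF int] by simp
qed

lemma parameter_integral_continuous:
  fixes f :: "'g \<Rightarrow> 'g \<Rightarrow> complex"
  assumes \<beta>: "sub_haar H \<beta>" and f: "continuous_on UNIV (\<lambda>p. f (fst p) (snd p))"
    and K: "compact K" "\<And>s t. s \<notin> K \<Longrightarrow> f s t = 0" and B: "\<And>s t. cmod (f s t) \<le> B"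
  shows "continuous_on UNIV (\<lambda>t. LINT s|\<beta>. f s t)"
proof (rule sequential_continuity)
  fix u :: "nat \<Rightarrow> 'g" and l assume u: "u \<longlonglongrightarrow> l"
  have m: "(\<lambda>s. f s t) \<in> borel_measurable borel" for t
  proof (rule continuous_borel)
    show "continuous_on UNIV (\<lambda>s. f s t)"
      using continuous_on_compose2[OF f, of UNIV "\<lambda>s. (s, t)"]
        continuous_on_Pair[OF continuous_on_id continuous_on_const, of UNIV t] by simp
  qed
  show "(\<lambda>n. LINT s|\<beta>. f s (u n)) \<longlonglongrightarrow> (LINT s|\<beta>. f s l)"
  proof (rule tendsto_integral_compact_support[OF sub_haarD(4)[OF \<beta>] K(1) sub_haarD(6)[OF \<beta> K(1)] m m K(2) B], simp)
    show "AE s in \<beta>. (\<lambda>n. f s (u n)) \<longlonglongrightarrow> f s l"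
    proof (rule AE_I2)
      fix s :: 'g
      have "(\<lambda>n. (s, u n)) \<longlonglongrightarrow> (s, l)" by (intro tendsto_intros u)
      from continuous_on_tendsto_compose[OF f this] show "(\<lambda>n. f s (u n)) \<longlonglongrightarrow> f s l" by simp
    qed
  qed
qed

end

section \<open>Fell convergence of subgroups implies convergence of their Haar measures\<close>

lemma
  assumes lim: "limitin fell_topology Hn H sequentially"
  shows fell_limit_lower: "open U \<Longrightarrow> H \<inter> U \<noteq> {} \<Longrightarrow> eventually (\<lambda>n. Hn n \<inter> U \<noteq> {}) sequentially"
    and fell_limit_upper: "compact C \<Longrightarrow> C \<inter> H = {} \<Longrightarrow> eventually (\<lambda>n. C \<inter> Hn n = {}) sequentially"
proof -
  let ?S = "{{H \<in> closed_subgroups. C \<inter> H = {} \<and> (\<forall>A\<in>F. H \<inter> A \<noteq> {})} | C F.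
        compact C \<and> finite F \<and> (\<forall>A\<in>F. open A \<and> A \<noteq> {})} :: 'a set set set"
  have "H \<in> topspace fell_topology" using lim by (simp add: limitin_def)
  also have "topspace fell_topology = \<Union>?S" by (simp add: fell_topology_def)
  finally have H: "H \<in> closed_subgroups" by auto
  have ev: "eventually (\<lambda>n. C \<inter> Hn n = {} \<and> (\<forall>A\<in>F. Hn n \<inter> A \<noteq> {})) sequentially"
    if "compact C" "finite F" "\<forall>A\<in>F. open A" "C \<inter> H = {}" "\<forall>A\<in>F. H \<inter> A \<noteq> {}" for C F
  proof -
    let ?U = "{H \<in> closed_subgroups. C \<inter> H = {} \<and> (\<forall>A\<in>F. H \<inter> A \<noteq> {})}"
    have "\<forall>A\<in>F. open A \<and> A \<noteq> {}" using that(3,5) by auto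
    then have "?U \<in> ?S" using that(1,2) by blast
    then have "openin fell_topology ?U" unfolding fell_topology_def by (rule topology_generated_by_Basis)
    moreover have "H \<in> ?U" using H that(4,5) by blast
    ultimately have "eventually (\<lambda>n. Hn n \<in> ?U) sequentially" using lim unfolding limitin_def by blast
    then show ?thesis by eventually_elim simp
  qed
  show "eventually (\<lambda>n. Hn n \<inter> U \<noteq> {}) sequentially" if "open U" "H \<inter> U \<noteq> {}"
    using ev[of "{}" "{U}"] that by simp
  show "eventually (\<lambda>n. C \<inter> Hn n = {}) sequentially" if "compact C" "C \<inter> H = {}"
    using ev[of C "{}"] that by simp
qed

context lc_group
begin

text \<open>The part of K where the modulus of f is at least d is compact and misses H, so by Fell
  convergence it eventually misses \<open>Hn n\<close>. At the points of \<open>Hn n\<close> f is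
  then at most d, and the mass of K is uniformly bounded.\<close>

lemma integral_vanishing:
  fixes f :: "'g \<Rightarrow> complex"
  assumes lim: "limitin fell_topology Hn H sequentially" and \<beta>: "\<And>n. sub_haar (Hn n) (\<beta> n)"
    and f: "f \<in> Cc" and z: "\<And>s. s \<in> H \<Longrightarrow> f s = 0"
  shows "(\<lambda>n. LINT s|\<beta> n. f s) \<longlonglongrightarrow> 0"
proof (rule tendstoI)
  fix e :: real assume e: "0 < e"
  obtain K B where K: "compact K" "\<And>s. s \<notin> K \<Longrightarrow> f s = 0" using Cc_bounded[OF f] by metis
  obtain C where C: "0 \<le> C" "\<And>H \<beta>. sub_haar H \<beta> \<Longrightarrow> measure \<beta> K \<le> C" using uniform_measure_bound[OF K(1)] by metis
  define d where "d = e / (C + 1)"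
  have d: "0 < d" using e C(1) by (simp add: d_def)
  have dC: "d * C < e"
  proof -
    have "d * C < d * (C + 1)" using d by (intro mult_strict_left_mono) auto
    also have "\<dots> = e" using C(1) by (simp add: d_def)
    finally show ?thesis .
  qed
  have "closed {s. d \<le> cmod (f s)}"
    by (rule closed_Collect_le[OF continuous_on_const continuous_on_norm[OF Cc_continuous[OF f]]])
  then have "compact (K \<inter> {s. d \<le> cmod (f s)})" by (rule compact_Int_closed[OF K(1)])
  moreover have "(K \<inter> {s. d \<le> cmod (f s)}) \<inter> H = {}" using z d by auto
  ultimately have "eventually (\<lambda>n. (K \<inter> {s. d \<le> cmod (f s)}) \<inter> Hn n = {}) sequentially"
    by (rule fell_limit_upper[OF lim])
  then show "eventually (\<lambda>n. dist (LINT s|\<beta> n. f s) 0 < e) sequentially"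
  proof eventually_elim
    case (elim n)
    have "cmod (LINT s|\<beta> n. f s) \<le> d * C"
    proof (rule Cc_integral_bound[OF continuous_borel[OF Cc_continuous[OF f]] K \<beta> C(2)[OF \<beta>] less_imp_le[OF d]])
      fix s assume s: "s \<in> Hn n"
      show "cmod (f s) \<le> d"
      proof (cases "s \<in> K")
        case True
        then show ?thesis using elim s by force
      qed (use K(2) d in simp)
    qed
    then show ?case using dC by simp
  qed
qed

lemma f0_complex: "(\<lambda>s. complex_of_real (f0 s)) \<in> Cc"
proof -
  obtain K B where K: "compact K" "\<And>s. s \<notin> K \<Longrightarrow> f0 s = 0" using Cc_bounded[OF f0(1)] by metis
  show ?thesis by (rule CcI[OF _ K(1)]) (auto intro!: continuous_intros Cc_continuous f0(1) simp: K(2))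
qed

lemma Cc_compose_shift:
  fixes f :: "'g \<Rightarrow> complex"
  assumes f: "f \<in> Cc"
  shows "(\<lambda>s. f (s + t)) \<in> Cc" "(\<lambda>s. f (- s)) \<in> Cc"
proof -
  obtain K B where K: "compact K" "\<And>s. s \<notin> K \<Longrightarrow> f s = 0" using Cc_bounded[OF f] by metis
  show "(\<lambda>s. f (s + t)) \<in> Cc"
  proof (rule CcI)
    show "continuous_on UNIV (\<lambda>s. f (s + t))"
      by (rule continuous_on_compose2[OF Cc_continuous[OF f]]) (auto intro!: continuous_intros)
    show "compact ((\<lambda>s. s - t) ` K)" by (intro compact_continuous_image continuous_intros K(1))
    show "f (s + t) = 0" if "s \<notin> (\<lambda>s. s - t) ` K" for s
      using that K(2)[of "s + t"] by (metis add_diff_cancel_right' image_eqI)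
  qed
  show "(\<lambda>s. f (- s)) \<in> Cc"
  proof (rule CcI)
    show "continuous_on UNIV (\<lambda>s. f (- s))"
      by (rule continuous_on_compose2[OF Cc_continuous[OF f]]) (auto intro!: continuous_intros)
    show "compact (uminus ` K)" by (rule compact_uminus[OF K(1)])
    show "f (- s) = 0" if "s \<notin> uminus ` K" for s
      using that K(2)[of "- s"] by (metis add.inverse_inverse image_eqI)
  qed
qed

lemma Cc_mult:
  fixes f g :: "'g \<Rightarrow> complex"
  assumes f: "f \<in> Cc" and g: "continuous_on UNIV g"
  shows "(\<lambda>s. f s * g s) \<in> Cc"
proof -
  obtain K B where K: "compact K" "\<And>s. s \<notin> K \<Longrightarrow> f s = 0" using Cc_bounded[OF f] by metis
  show ?thesis
    by (rule CcI[OF continuous_on_mult[OF Cc_continuous[OF f] g] K(1)]) (simp add: K(2))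
qed

text \<open>
  Both lemmas evaluate the double integral of \<open>F(s) f\<^sub>0(s + t)\<close> over \<open>H\<^sub>n \<times> H\<close>, which is how one
  proves uniqueness of Haar measure on an abelian group.
\<close>

lemma shifted_product_limit:
  fixes F :: "'g \<Rightarrow> complex"
  assumes lim: "limitin fell_topology Hn H sequentially" and \<beta>: "\<And>n. sub_haar (Hn n) (\<beta> n)"
    and F: "F \<in> Cc" and t: "t \<in> H"
  shows "(\<lambda>n. (LINT s|\<beta> n. F s * f0 (s + t)) - (LINT s|\<beta> n. F (s - t) * f0 s)) \<longlonglongrightarrow> 0"
proof (rule tendstoI)
  fix e :: real assume e: "0 < e"
  define \<Phi> where "\<Phi> s = F (s - t) * f0 s" for s
  have Fs: "(\<lambda>s. F (s - t)) \<in> Cc" using Cc_compose_shift(1)[OF F, of "- t"] by simp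
  have \<Phi>: "\<Phi> \<in> Cc" unfolding \<Phi>_def by (rule Cc_mult[OF Fs Cc_continuous[OF f0_complex]])
  obtain K where K: "compact K" "\<And>s. s \<notin> K \<Longrightarrow> \<Phi> s = 0" using Cc_bounded[OF \<Phi>] by metis
  obtain U0 C0 where U0: "open U0" "compact C0" "(0 :: 'g) \<in> U0" "U0 \<subseteq> C0"
    using locally_compactE[OF lcG, of 0] by metis
  define L where "L = K \<union> (K + uminus ` C0)"
  have L: "compact L" unfolding L_def by (intro compact_Un compact_plus compact_uminus K(1) U0(2))
  obtain C where C: "0 \<le> C" "\<And>H \<beta>. sub_haar H \<beta> \<Longrightarrow> measure \<beta> L \<le> C" using uniform_measure_bound[OF L] by metis
  define d where "d = e / (C + 1)"
  have d: "0 < d" using e C(1) by (simp add: d_def)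
  have dC: "d * C < e"
  proof -
    have "d * C < d * (C + 1)" using d by (intro mult_strict_left_mono) auto
    also have "\<dots> = e" using C(1) by (simp add: d_def)
    finally show ?thesis .
  qed
  have "eventually (\<lambda>u. u \<in> U0) (nhds 0)" using U0 by (simp add: eventually_nhds_in_open)
  with Cc_uniformly_continuous[OF \<Phi> d]
  have "eventually (\<lambda>u. (\<forall>s. cmod (\<Phi> (s + u) - \<Phi> s) \<le> d) \<and> u \<in> U0) (nhds 0)" by (rule eventually_conj)
  then obtain U where U: "open U" "0 \<in> U" "\<And>u. u \<in> U \<Longrightarrow> (\<forall>s. cmod (\<Phi> (s + u) - \<Phi> s) \<le> d) \<and> u \<in> U0"
    by (auto simp: eventually_nhds)
  have "open ((\<lambda>r. t - r) -` U)" by (intro open_vimage U(1) continuous_intros)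
  moreover have "H \<inter> (\<lambda>r. t - r) -` U \<noteq> {}" using t U(2) by auto
  ultimately have "eventually (\<lambda>n. Hn n \<inter> (\<lambda>r. t - r) -` U \<noteq> {}) sequentially" by (rule fell_limit_lower[OF lim])
  then show "eventually (\<lambda>n. dist ((LINT s|\<beta> n. F s * f0 (s + t)) - (LINT s|\<beta> n. F (s - t) * f0 s)) 0 < e) sequentially"
  proof eventually_elim
    case (elim n)
    \<comment> \<open>The point t of H need not be in \<open>Hn n\<close>, but Fell convergence
      supplies r in \<open>Hn n\<close> close to it. Invariance of \<open>\<beta> n\<close> removes
      r, and uniform continuity handles the remaining shift by t - r.\<close>
    then obtain r where r: "r \<in> Hn n" "t - r \<in> U" by auto
    have \<Phi>c: "(\<lambda>s. \<Phi> (s + u)) \<in> Cc" for u by (rule Cc_compose_shift(1)[OF \<Phi>])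
    have "(LINT s|\<beta> n. F s * f0 (s + t)) = (LINT s|\<beta> n. \<Phi> (s + t))" by (simp add: \<Phi>_def)
    also have "\<dots> = (LINT s|\<beta> n. \<Phi> (s - r + t))"
      by (rule haar_integral_translate[OF sub_haarD(1)[OF \<beta>] r(1) continuous_borel[OF Cc_continuous[OF \<Phi>c]], symmetric])
    also have "\<dots> = (LINT s|\<beta> n. \<Phi> (s + (t - r)))" by (simp add: algebra_simps)
    finally have "(LINT s|\<beta> n. F s * f0 (s + t)) - (LINT s|\<beta> n. F (s - t) * f0 s)
        = (LINT s|\<beta> n. \<Phi> (s + (t - r))) - (LINT s|\<beta> n. \<Phi> s)" by (simp add: \<Phi>_def)
    also have "\<dots> = (LINT s|\<beta> n. \<Phi> (s + (t - r)) - \<Phi> s)"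
      by (rule Bochner_Integration.integral_diff[symmetric, OF Cc_integrable[OF \<Phi>c \<beta>] Cc_integrable[OF \<Phi> \<beta>]])
    also have "cmod \<dots> \<le> d * C"
    proof (rule Cc_integral_bound[OF _ L _ \<beta> C(2)[OF \<beta>] less_imp_le[OF d]])
      show "(\<lambda>s. \<Phi> (s + (t - r)) - \<Phi> s) \<in> borel_measurable borel"
        by (intro borel_measurable_diff continuous_borel Cc_continuous \<Phi> \<Phi>c)
      fix s assume s: "s \<notin> L"
      have "s + (t - r) \<notin> K"
      proof
        assume "s + (t - r) \<in> K"
        moreover have "- (t - r) \<in> uminus ` C0" using U(3)[OF r(2)] U0(4) by (intro imageI) blast
        ultimately have "(s + (t - r)) + - (t - r) \<in> K + uminus ` C0" by (rule set_plus_intro)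
        then show False using s by (simp add: L_def)
      qed
      moreover have "s \<notin> K" using s by (simp add: L_def)
      ultimately show "\<Phi> (s + (t - r)) - \<Phi> s = 0" by (simp add: K(2))
    next
      show "cmod (\<Phi> (s + (t - r)) - \<Phi> s) \<le> d" for s using U(3)[OF r(2)] by blast
    qed
    finally show ?case using dC by simp
  qed
qed

lemma haar_convergence_reflected:
  fixes F :: "'g \<Rightarrow> complex"
  assumes lim: "limitin fell_topology Hn H sequentially" and \<beta>: "\<And>n. sub_haar (Hn n) (\<beta> n)"
    and \<beta>0: "sub_haar H \<beta>0" and F: "F \<in> Cc"
  shows "(\<lambda>n. LINT s|\<beta> n. F s) \<longlonglongrightarrow> (LINT s|\<beta>0. F (- s))"
proof -
  let ?g = "\<lambda>s. complex_of_real (f0 s)"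
  note g = f0_complex
  note contF = Cc_continuous[OF F] and contg = Cc_continuous[OF g]
  obtain K BF where K: "compact K" "\<And>s. s \<notin> K \<Longrightarrow> F s = 0" and BF: "0 \<le> BF" "\<And>s. cmod (F s) \<le> BF"
    using Cc_bounded[OF F] by metis
  obtain Kg where Kg: "compact Kg" "\<And>s. s \<notin> Kg \<Longrightarrow> f0 s = 0" using Cc_bounded[OF f0(1)] by metis
  define L where "L = Kg + uminus ` K"
  have L: "compact L" unfolding L_def by (intro compact_plus compact_uminus K(1) Kg(1))
  have inL: "t \<in> L" if "s + t \<in> Kg" "s \<in> K" for s t
  proof -
    have "(s + t) + - s \<in> L" unfolding L_def using that by (intro set_plus_intro) auto
    then show ?thesis by simp
  qed
  have Bg: "cmod (?g s) \<le> 1" for s using f0(3,4)[of s] by simp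
  have BFg: "cmod (F s * ?g s') \<le> BF" for s s'
    using mult_mono[OF BF(2)[of s] Bg[of s'] BF(1)] by (simp add: norm_mult)
  define P where "P s t = F s * ?g (s + t)" for s t
  define Q where "Q s t = F (s - t) * ?g s" for s t
  have contP: "continuous_on UNIV (\<lambda>p. P (fst p) (snd p))" unfolding P_def
    by (intro continuous_on_mult continuous_on_compose2[OF contF] continuous_on_compose2[OF contg] continuous_intros) auto
  have contQ: "continuous_on UNIV (\<lambda>p. Q (fst p) (snd p))" unfolding Q_def
    by (intro continuous_on_mult continuous_on_compose2[OF contF] continuous_on_compose2[OF contg] continuous_intros) auto
  have P0: "P s t = 0" if "s \<notin> K \<or> t \<notin> L" for s t
    using that inL[of s t] K(2)[of s] Kg(2)[of "s + t"] by (auto simp: P_def)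
  have Q0: "Q s t = 0" if "s \<notin> Kg \<or> t \<notin> L" for s t
    using that inL[of "s - t" t] K(2)[of "s - t"] Kg(2)[of s] by (auto simp: Q_def)
  have BP: "cmod (P s t) \<le> BF" and BQ: "cmod (Q s t) \<le> BF" for s t unfolding P_def Q_def by (rule BFg)+
  define J where "J n t = (LINT s|\<beta> n. P s t)" for n t
  define J' where "J' n t = (LINT s|\<beta> n. Q s t)" for n t
  \<comment> \<open>The inner integrals over H of P and Q give \<open>F s * c s\<close> and
    \<open>?g s * d s\<close>. On H the function c is 1, by the normalisation, and d is the constant
    \<open>d0\<close>, so \<open>integral_vanishing\<close> allows both replacements under the
    integral over \<open>Hn n\<close>.\<close>
  define c where "c = per \<beta>0 ?g"
  define F' where "F' u = F (- u)" for u
  have F': "F' \<in> Cc" unfolding F'_def by (rule Cc_compose_shift(2)[OF F])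
  define d where "d s = per \<beta>0 F' (- s)" for s
  define d0 where "d0 = (LINT s|\<beta>0. F (- s))"
  have contc: "continuous_on UNIV c" unfolding c_def by (rule per_continuous[OF g \<beta>0])
  have contd: "continuous_on UNIV d" unfolding d_def
    by (rule continuous_on_compose2[OF per_continuous[OF F' \<beta>0]]) (auto intro!: continuous_intros)
  have c1: "c s = 1" if "s \<in> H" for s
  proof -
    have "c s = per \<beta>0 ?g 0" unfolding c_def using per_invariant[OF continuous_borel[OF contg] \<beta>0 that, of 0] by simp
    then show ?thesis using sub_haarD(3)[OF \<beta>0] by (simp add: per_def)
  qed
  have d1: "d s = d0" if "s \<in> H" for s
    unfolding d_def d0_def
    using per_invariant[OF continuous_borel[OF Cc_continuous[OF F']] \<beta>0 sub_haarD(9)[OF \<beta>0 that], of 0]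
    by (simp add: per_def F'_def)
  have "(\<lambda>n. LINT s|\<beta> n. F s * (1 - c s)) \<longlonglongrightarrow> 0"
    by (rule integral_vanishing[OF lim \<beta> Cc_mult[OF F]]) (auto intro!: continuous_intros contc simp: c1)
  moreover have "(LINT s|\<beta> n. F s * (1 - c s)) = (LINT s|\<beta> n. F s) - (LINT t|\<beta>0. J n t)" for n
  proof -
    have "(LINT s|\<beta> n. F s * c s) = (LINT s|\<beta> n. LINT t|\<beta>0. P s t)" by (simp add: c_def per_def P_def)
    also have "\<dots> = (LINT t|\<beta>0. J n t)"
      unfolding J_def by (rule Fubini_Cc[OF \<beta> \<beta>0 contP K(1) L P0 BP])
    finally show ?thesis
      using Cc_integrable[OF F \<beta>] Cc_integrable[OF Cc_mult[OF F contc] \<beta>] by (simp add: algebra_simps)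
  qed
  ultimately have l1: "(\<lambda>n. (LINT s|\<beta> n. F s) - (LINT t|\<beta>0. J n t)) \<longlonglongrightarrow> 0" by simp
  have "(\<lambda>n. LINT s|\<beta> n. ?g s * (d s - d0)) \<longlonglongrightarrow> 0"
    by (rule integral_vanishing[OF lim \<beta> Cc_mult[OF g]]) (auto intro!: continuous_intros contd simp: d1)
  moreover have "(LINT s|\<beta> n. ?g s * (d s - d0)) = (LINT t|\<beta>0. J' n t) - d0" for n
  proof -
    have "(LINT s|\<beta> n. ?g s * d s) = (LINT s|\<beta> n. LINT t|\<beta>0. Q s t)"
      by (simp add: d_def per_def Q_def F'_def mult.commute algebra_simps)
    also have "\<dots> = (LINT t|\<beta>0. J' n t)"
      unfolding J'_def by (rule Fubini_Cc[OF \<beta> \<beta>0 contQ Kg(1) L Q0 BQ])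
    finally have "(LINT s|\<beta> n. ?g s * d s) = (LINT t|\<beta>0. J' n t)" .
    moreover have "(LINT s|\<beta> n. ?g s * d0) = d0" using sub_haarD(3)[OF \<beta>, of n] by simp
    ultimately show ?thesis
      using Cc_integrable[OF Cc_mult[OF g contd] \<beta>, of n] Cc_integrable[OF Cc_mult[OF g continuous_on_const] \<beta>, of n d0]
      by (simp add: right_diff_distrib)
  qed
  ultimately have l2: "(\<lambda>n. (LINT t|\<beta>0. J' n t) - d0) \<longlonglongrightarrow> 0" by simp
  obtain C where C: "0 \<le> C" "\<And>H \<beta>. sub_haar H \<beta> \<Longrightarrow> measure \<beta> (K \<union> Kg) \<le> C"
    using uniform_measure_bound[OF compact_Un[OF K(1) Kg(1)]] by metis
  have cJ: "continuous_on UNIV (J n)" for n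
    unfolding J_def by (rule parameter_integral_continuous[OF \<beta> contP K(1) P0 BP]) simp
  have cJ': "continuous_on UNIV (J' n)" for n
    unfolding J'_def by (rule parameter_integral_continuous[OF \<beta> contQ Kg(1) Q0 BQ]) simp
  have mP: "(\<lambda>s. P s t) \<in> borel_measurable borel" and mQ: "(\<lambda>s. Q s t) \<in> borel_measurable borel" for t
    unfolding P_def Q_def
    by (intro continuous_borel continuous_on_mult continuous_on_compose2[OF contF] continuous_on_compose2[OF contg] continuous_intros; simp)+
  have BJ: "cmod (J n t) \<le> BF * C" for n t
    unfolding J_def
    by (rule Cc_integral_bound[OF mP compact_Un[OF K(1) Kg(1)] _ \<beta> C(2)[OF \<beta>] BF(1) BP]) (simp add: P0)
  have BJ': "cmod (J' n t) \<le> BF * C" for n t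
    unfolding J'_def
    by (rule Cc_integral_bound[OF mQ compact_Un[OF K(1) Kg(1)] _ \<beta> C(2)[OF \<beta>] BF(1) BQ]) (simp add: Q0)
  have J0: "J n t = 0" "J' n t = 0" if "t \<notin> L" for n t using that by (simp_all add: J_def J'_def P0 Q0)
  \<comment> \<open>With the integral over H outermost, P and Q are compared for fixed t in H by
    \<open>shifted_product_limit\<close>. The bound for dominated convergence is uniform in n
    because of \<open>uniform_measure_bound\<close>.\<close>
  have "(\<lambda>n. LINT t|\<beta>0. J n t - J' n t) \<longlonglongrightarrow> (LINT t|\<beta>0. 0)"
  proof (rule tendsto_integral_compact_support[OF sub_haarD(4)[OF \<beta>0] L sub_haarD(6)[OF \<beta>0 L]])
    show "(\<lambda>t. J n t - J' n t) \<in> borel_measurable borel" for n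
      by (intro continuous_borel continuous_intros cJ cJ')
    show "cmod (J n t - J' n t) \<le> BF * C + BF * C" for n t
      using norm_triangle_ineq4[of "J n t" "J' n t"] BJ[of n t] BJ'[of n t] by linarith
    show "AE t in \<beta>0. (\<lambda>n. J n t - J' n t) \<longlonglongrightarrow> 0"
      using sub_haarD(2)[OF \<beta>0]
    proof eventually_elim
      case (elim t)
      show ?case using shifted_product_limit[OF lim \<beta> F elim] by (simp add: J_def J'_def P_def Q_def)
    qed
  qed (simp_all add: J0)
  moreover have "(LINT t|\<beta>0. J n t - J' n t) = (LINT t|\<beta>0. J n t) - (LINT t|\<beta>0. J' n t)" for n
  proof (rule Bochner_Integration.integral_diff)
    show "integrable \<beta>0 (J n)"
      by (rule integrable_compact_support(1)[OF sub_haarD(4)[OF \<beta>0] L sub_haarD(6)[OF \<beta>0 L] continuous_borel[OF cJ] J0(1) BJ])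
    show "integrable \<beta>0 (J' n)"
      by (rule integrable_compact_support(1)[OF sub_haarD(4)[OF \<beta>0] L sub_haarD(6)[OF \<beta>0 L] continuous_borel[OF cJ'] J0(2) BJ'])
  qed
  ultimately have l3: "(\<lambda>n. (LINT t|\<beta>0. J n t) - (LINT t|\<beta>0. J' n t)) \<longlonglongrightarrow> 0" by simp
  have "(\<lambda>n. (LINT s|\<beta> n. F s) - d0) \<longlonglongrightarrow> 0"
    using tendsto_add[OF tendsto_add[OF l1 l3] l2] by simp
  then show ?thesis unfolding d0_def by (rule LIM_zero_cancel)
qed

text \<open>For the constant sequence H the reflected version says that \<beta>0 is invariant under
  inversion, which removes the reflection.\<close>

lemma haar_convergence:
  fixes F :: "'g \<Rightarrow> complex"
  assumes lim: "limitin fell_topology Hn H sequentially" and \<beta>: "\<And>n. sub_haar (Hn n) (\<beta> n)"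
    and \<beta>0: "sub_haar H \<beta>0" and F: "F \<in> Cc"
  shows "(\<lambda>n. LINT s|\<beta> n. F s) \<longlonglongrightarrow> (LINT s|\<beta>0. F s)"
proof -
  have "H \<in> topspace fell_topology" using lim by (simp add: limitin_def)
  then have "limitin fell_topology (\<lambda>n. H) H sequentially" by simp
  from haar_convergence_reflected[OF this \<beta>0 \<beta>0 F] have "(LINT s|\<beta>0. F s) = (LINT s|\<beta>0. F (- s))"
    by (simp add: LIMSEQ_const_iff)
  then show ?thesis using haar_convergence_reflected[OF lim \<beta> \<beta>0 F] by simp
qed

text \<open>\<open>haar_convergence\<close> for the fixed function F times \<tau> gives the limit.
  The characters are close to \<tau> only at points of \<open>Hn n\<close> in compact sets, which is
  all that \<open>Cc_integral_bound\<close> asks.\<close>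

lemma character_haar_convergence:
  fixes F :: "'g \<Rightarrow> complex"
  assumes lim: "limitin fell_topology Hn H sequentially" and \<beta>: "\<And>n. sub_haar (Hn n) (\<beta> n)"
    and \<beta>0: "sub_haar H \<beta>0" and F: "F \<in> Cc"
    and \<tau>: "\<And>n. continuous_on UNIV (\<tau>s n)" "continuous_on UNIV \<tau>"
    and conv: "\<And>K \<epsilon>. compact K \<Longrightarrow> 0 < \<epsilon> \<Longrightarrow> eventually (\<lambda>n. \<forall>r\<in>Hn n \<inter> K. cmod (\<tau>s n r - \<tau> r) \<le> \<epsilon>) sequentially"
  shows "(\<lambda>n. LINT s|\<beta> n. F s * \<tau>s n s) \<longlonglongrightarrow> (LINT s|\<beta>0. F s * \<tau> s)"
proof -
  obtain K B where K: "compact K" "\<And>s. s \<notin> K \<Longrightarrow> F s = 0" and B: "0 \<le> B" "\<And>s. cmod (F s) \<le> B"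
    using Cc_bounded[OF F] by metis
  obtain C where C: "0 \<le> C" "\<And>H \<beta>. sub_haar H \<beta> \<Longrightarrow> measure \<beta> K \<le> C" using uniform_measure_bound[OF K(1)] by metis
  have "(\<lambda>n. LINT s|\<beta> n. F s * (\<tau>s n s - \<tau> s)) \<longlonglongrightarrow> 0"
  proof (rule tendstoI)
    fix e :: real assume e: "0 < e"
    define d where "d = e / (B * C + 1)"
    have p: "0 < B * C + 1" using B(1) C(1) by (simp add: add_nonneg_pos)
    have d: "0 < d" using e p by (simp add: d_def)
    have dC: "B * d * C < e"
    proof -
      have "d * (B * C) < d * (B * C + 1)" using d by (intro mult_strict_left_mono) auto
      also have "\<dots> = e" using p by (simp add: d_def)
      finally show ?thesis by (simp add: mult.commute mult.left_commute)
    qed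
    from conv[OF K(1) d]
    show "eventually (\<lambda>n. dist (LINT s|\<beta> n. F s * (\<tau>s n s - \<tau> s)) 0 < e) sequentially"
    proof eventually_elim
      case (elim n)
      have "cmod (LINT s|\<beta> n. F s * (\<tau>s n s - \<tau> s)) \<le> (B * d) * C"
      proof (rule Cc_integral_bound[OF _ K(1) _ \<beta> C(2)[OF \<beta>]])
        show "(\<lambda>s. F s * (\<tau>s n s - \<tau> s)) \<in> borel_measurable borel"
          by (intro continuous_borel continuous_intros Cc_continuous F \<tau>)
        fix s assume s: "s \<in> Hn n"
        show "cmod (F s * (\<tau>s n s - \<tau> s)) \<le> B * d"
        proof (cases "s \<in> K")
          case True
          then have "cmod (\<tau>s n s - \<tau> s) \<le> d" using elim s by blast
          then show ?thesis unfolding norm_mult using B by (intro mult_mono) auto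
        qed (use K(2) B(1) d in simp)
      qed (use K(2) B(1) d in simp_all)
      then show ?case using dC by simp
    qed
  qed
  moreover have "(LINT s|\<beta> n. F s * (\<tau>s n s - \<tau> s)) = (LINT s|\<beta> n. F s * \<tau>s n s) - (LINT s|\<beta> n. F s * \<tau> s)" for n
    using Cc_integrable[OF Cc_mult[OF F \<tau>(1)] \<beta>] Cc_integrable[OF Cc_mult[OF F \<tau>(2)] \<beta>]
    by (simp add: right_diff_distrib)
  moreover have "(\<lambda>n. LINT s|\<beta> n. F s * \<tau> s) \<longlonglongrightarrow> (LINT s|\<beta>0. F s * \<tau> s)"
    by (rule haar_convergence[OF lim \<beta> \<beta>0 Cc_mult[OF F \<tau>(2)]])
  ultimately show ?thesis by (auto dest: tendsto_add)
qed

end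

section \<open>Square-integrable functions\<close>

lemma l2_class_eq:
  assumes "AE x in M. f x = g x"
  shows "l2_class M f = l2_class M g"
proof -
  have "(AE x in M. h x = f x) \<longleftrightarrow> (AE x in M. h x = g x)" for h
    using assms by (intro iffI; elim AE_mp; auto)
  then show ?thesis by (simp add: l2_class_def)
qed

lemma l2_class_self: "f \<in> square_integrable M \<Longrightarrow> f \<in> l2_class M f"
  by (simp add: l2_class_def)

lemma l2_rep_class:
  assumes "f \<in> square_integrable M"
  shows "l2_rep (l2_class M f) \<in> square_integrable M" "AE x in M. l2_rep (l2_class M f) x = f x"
proof -
  have "l2_rep (l2_class M f) \<in> l2_class M f"
    unfolding l2_rep_def by (rule someI[of "\<lambda>g. g \<in> l2_class M f", OF l2_class_self[OF assms]])
  then show "l2_rep (l2_class M f) \<in> square_integrable M" "AE x in M. l2_rep (l2_class M f) x = f x"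
    by (simp_all add: l2_class_def)
qed

lemma L2_simps:
  "vectors (L2 M) = l2_class M ` square_integrable M"
  "vzero (L2 M) = l2_class M (\<lambda>_. 0)"
  by (simp_all add: L2_def)

lemma L2_inner:
  assumes f: "f \<in> square_integrable M" and g: "g \<in> square_integrable M"
  shows "vinner (L2 M) (l2_class M f) (l2_class M g) = (LINT x|M. f x * cnj (g x))"
proof -
  note F = l2_rep_class[OF f] and G = l2_rep_class[OF g]
  have m: "f \<in> borel_measurable M" "g \<in> borel_measurable M"
    "l2_rep (l2_class M f) \<in> borel_measurable M" "l2_rep (l2_class M g) \<in> borel_measurable M"
    using f g F(1) G(1) by (simp_all add: square_integrable_def)
  have "(LINT x|M. l2_rep (l2_class M f) x * cnj (l2_rep (l2_class M g) x)) = (LINT x|M. f x * cnj (g x))"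
  proof (rule integral_cong_AE)
    show "AE x in M. l2_rep (l2_class M f) x * cnj (l2_rep (l2_class M g) x) = f x * cnj (g x)"
      using F(2) G(2) by eventually_elim simp
    have mc: "(\<lambda>x. cnj (h x)) \<in> borel_measurable M" if "h \<in> borel_measurable M" for h
      by (rule measurable_compose[OF that]) (intro borel_measurable_continuous_onI continuous_intros)
    show "(\<lambda>x. l2_rep (l2_class M f) x * cnj (l2_rep (l2_class M g) x)) \<in> borel_measurable M"
      "(\<lambda>x. f x * cnj (g x)) \<in> borel_measurable M"
      by (intro borel_measurable_times mc m)+
  qed
  then show ?thesis by (simp add: L2_def)
qed

lemma L2_add:
  assumes f: "f \<in> square_integrable M" and g: "g \<in> square_integrable M"
  shows "vadd (L2 M) (l2_class M f) (l2_class M g) = l2_class M (\<lambda>x. f x + g x)"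
proof -
  have "AE x in M. l2_rep (l2_class M f) x + l2_rep (l2_class M g) x = f x + g x"
    using l2_rep_class(2)[OF f] l2_rep_class(2)[OF g] by eventually_elim simp
  from l2_class_eq[OF this] show ?thesis by (simp add: L2_def)
qed

lemma L2_scale:
  assumes f: "f \<in> square_integrable M"
  shows "vscale (L2 M) c (l2_class M f) = l2_class M (\<lambda>x. c * f x)"
proof -
  have "AE x in M. c * l2_rep (l2_class M f) x = c * f x"
    using l2_rep_class(2)[OF f] by eventually_elim simp
  from l2_class_eq[OF this] show ?thesis by (simp add: L2_def)
qed

section \<open>Cosets\<close>

lemma topspace_coset_topology: "topspace (coset_topology H) = cosets H"
proof
  show "topspace (coset_topology H) \<subseteq> cosets H"
    using openin_topspace[of "coset_topology H"] unfolding openin_coset_topology by simp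
  have "openin (coset_topology H) (cosets H)" unfolding openin_coset_topology by (simp add: cosets_def)
  then show "cosets H \<subseteq> topspace (coset_topology H)" by (rule openin_subset)
qed

lemma elt_set_plus_assoc: "a +o (b +o H) = (a + b) +o (H :: 'a::semigroup_add set)"
  by (auto simp: elt_set_plus_def add.assoc)

lemma closed_subgroup_add_iff:
  assumes "H \<in> closed_subgroups"
  shows "s +o H = t +o H \<longleftrightarrow> s - t \<in> H"
proof
  have H: "0 \<in> H" "\<And>s t. s \<in> H \<Longrightarrow> t \<in> H \<Longrightarrow> s + t \<in> H" "\<And>s. s \<in> H \<Longrightarrow> - s \<in> H"
    using assms by (auto simp: closed_subgroups_def)
  assume "s +o H = t +o H"
  moreover have "s \<in> s +o H" using H(1) by (force simp: elt_set_plus_def)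
  ultimately obtain h where "h \<in> H" "s = t + h" by (auto simp: elt_set_plus_def)
  then show "s - t \<in> H" by simp
next
  have H: "\<And>s t. s \<in> H \<Longrightarrow> t \<in> H \<Longrightarrow> s + t \<in> H" "\<And>s. s \<in> H \<Longrightarrow> - s \<in> H"
    using assms by (auto simp: closed_subgroups_def)
  have sub: "s +o H \<subseteq> t +o H" if d: "s - t \<in> H" for s t
  proof
    fix y assume "y \<in> s +o H"
    then obtain h where h: "h \<in> H" "y = s + h" by (auto simp: elt_set_plus_def)
    then have "y = t + ((s - t) + h)" by (simp add: algebra_simps)
    then show "y \<in> t +o H" using H(1)[OF d h(1)] unfolding elt_set_plus_def by blast
  qed
  assume d: "s - t \<in> H"
  have "t - s \<in> H" using H(2)[OF d] by simp
  then show "s +o H = t +o H" using sub[OF d] sub[of t s] by blast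
qed

lemma coset_some:
  assumes "H \<in> closed_subgroups"
  shows "(SOME r. r \<in> s +o H) - s \<in> H"
proof -
  have "s + 0 \<in> s +o H" using assms by (auto simp: elt_set_plus_def closed_subgroups_def intro!: bexI[of _ 0])
  then have "(SOME r. r \<in> s +o H) \<in> s +o H" by (rule someI)
  then show ?thesis by (auto simp: elt_set_plus_def)
qed

section \<open>Induced representations\<close>

locale induced_system = transformation_group act \<mu> + lc_group f0
  for act :: "'g::{topological_ab_group_add, second_countable_topology, t2_space} \<Rightarrow>
      'x::{second_countable_topology, t2_space} \<Rightarrow> 'x" and \<mu> :: "'g measure" and f0 :: "'g \<Rightarrow> real" +
  fixes \<alpha> :: "'g set \<Rightarrow> 'g measure" and \<nu> :: "'g set \<Rightarrow> 'g set measure"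
  assumes alpha: "\<And>H. H \<in> closed_subgroups \<Longrightarrow>
          haar_measure (top_of_set H) (+) H (\<alpha> H) \<and> (LINT s|\<alpha> H. f0 s) = 1"
    and nu: "\<And>H. H \<in> closed_subgroups \<Longrightarrow>
          haar_measure (coset_topology H) (+o) UNIV (\<nu> H) \<and> weil_formula \<mu> (\<alpha> H) (\<nu> H)"
begin

abbreviation \<beta> :: "'g set \<Rightarrow> 'g measure" where "\<beta> H \<equiv> extend_measure (\<alpha> H)"

lemma sub_haar_beta: "H \<in> closed_subgroups \<Longrightarrow> sub_haar H (\<beta> H)"
  using alpha[of H] haar_extend_measure[of H "\<alpha> H"] AE_extend_measure[of H "\<alpha> H"]
    integral_extend_measure[of H "\<alpha> H" f0] continuous_borel[OF Cc_continuous[OF f0(1)]]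
  by (simp add: sub_haar_def)

text \<open>The representative of the coset is the one chosen in \<open>weil_formula\<close>, so
  that Weil's formula applies verbatim; for h in \<open>Cc\<close> the value does not depend on
  it.\<close>

definition P :: "'g set \<Rightarrow> ('g \<Rightarrow> complex) \<Rightarrow> 'g set \<Rightarrow> complex" where
  "P H h c = per (\<beta> H) h (SOME s. s \<in> c)"

lemma P_coset:
  assumes H: "H \<in> closed_subgroups" and h: "h \<in> Cc"
  shows "P H h (s +o H) = per (\<beta> H) h s"
  using per_invariant[OF continuous_borel[OF Cc_continuous[OF h]] sub_haar_beta[OF H] coset_some[OF H, of s], of s]
  by (simp add: P_def)

lemma weil:
  assumes H: "H \<in> closed_subgroups" and h: "h \<in> Cc"
  shows "(LINT s|\<mu>. h s) = (LINT c|\<nu> H. P H h c)"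
proof -
  have "(LINT t|\<alpha> H. h (s + t)) = per (\<beta> H) h s" for s
  proof -
    have "(\<lambda>t. h (s + t)) \<in> borel_measurable borel"
      using Cc_compose_shift(1)[OF h, of s] by (intro continuous_borel Cc_continuous) (simp add: add.commute)
    then show ?thesis
      using integral_extend_measure[of H "\<alpha> H" "\<lambda>t. h (s + t)"] alpha[OF H] H by (simp add: per_def)
  qed
  then show ?thesis using nu[OF H] h by (simp add: weil_formula_def P_def)
qed

lemma
  assumes H: "H \<in> closed_subgroups"
  shows space_nu: "space (\<nu> H) = cosets H"
    and sets_nu: "sets (\<nu> H) = sigma_sets (cosets H) {U. openin (coset_topology H) U}"
  using nu[OF H] by (simp_all add: haar_measure_def topspace_coset_topology)

lemma coset_rep: "H \<in> closed_subgroups \<Longrightarrow> c \<in> space (\<nu> H) \<Longrightarrow> \<exists>s. c = s +o H"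
  by (auto simp: space_nu cosets_def)

lemma openin_sets_nu: "H \<in> closed_subgroups \<Longrightarrow> openin (coset_topology H) U \<Longrightarrow> U \<in> sets (\<nu> H)"
  by (simp add: sets_nu sigma_sets.Basic)

text \<open>The preimage in G of the image of K is K + H, which is closed, so the image is a closed
  set of cosets; being compact it has finite measure.\<close>

lemma coset_image_measure:
  assumes H: "H \<in> closed_subgroups" and K: "compact K"
  shows "(\<lambda>s. s +o H) ` K \<in> sets (\<nu> H)" "emeasure (\<nu> H) ((\<lambda>s. s +o H) ` K) < \<infinity>"
proof -
  let ?q = "\<lambda>s. s +o H"
  have "closed (K + H)" using K H by (intro closed_plus_compact) (auto simp: closed_subgroups_def)
  moreover have eq: "?q s \<in> ?q ` K \<longleftrightarrow> s \<in> K + H" for s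
  proof
    assume "?q s \<in> ?q ` K"
    then obtain k where k: "k \<in> K" "s - k \<in> H" using closed_subgroup_add_iff[OF H] by auto
    then have "k + (s - k) \<in> K + H" by (rule set_plus_intro)
    then show "s \<in> K + H" by simp
  next
    assume "s \<in> K + H"
    then obtain k h where "k \<in> K" "h \<in> H" "s = k + h" by (auto simp: set_plus_def)
    then show "?q s \<in> ?q ` K" using closed_subgroup_add_iff[OF H, of s k] by auto
  qed
  ultimately have "openin (coset_topology H) (cosets H - ?q ` K)"
    unfolding openin_coset_topology by (auto simp: cosets_def eq open_Compl Compl_eq[symmetric])
  then have "cosets H - ?q ` K \<in> sets (\<nu> H)" by (rule openin_sets_nu[OF H])
  then have "space (\<nu> H) - (cosets H - ?q ` K) \<in> sets (\<nu> H)" by (rule sets.compl_sets)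
  moreover have "space (\<nu> H) - (cosets H - ?q ` K) = ?q ` K" by (auto simp: space_nu[OF H] cosets_def)
  ultimately show "?q ` K \<in> sets (\<nu> H)" by simp
  have "continuous_map euclidean (coset_topology H) ?q"
    unfolding continuous_map_def by (auto simp: topspace_coset_topology cosets_def openin_coset_topology)
  then have "compactin (coset_topology H) (?q ` K)" by (rule image_compactin[rotated]) (simp add: K)
  then show "emeasure (\<nu> H) (?q ` K) < \<infinity>" using nu[OF H] by (simp add: haar_measure_def)
qed

lemma P_measurable:
  assumes H: "H \<in> closed_subgroups" and h: "h \<in> Cc"
  shows "P H h \<in> borel_measurable (\<nu> H)"
proof (rule borel_measurableI)
  fix S :: "complex set" assume S: "open S"
  have "openin (coset_topology H) (P H h -` S \<inter> cosets H)"
    unfolding openin_coset_topology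
  proof
    have "{s. s +o H \<in> P H h -` S \<inter> cosets H} = per (\<beta> H) h -` S"
      by (auto simp: P_coset[OF H h] cosets_def)
    then show "open {s. s +o H \<in> P H h -` S \<inter> cosets H}"
      using S per_continuous[OF h sub_haar_beta[OF H]] by (simp add: open_vimage)
  qed simp
  then show "P H h -` S \<inter> space (\<nu> H) \<in> sets (\<nu> H)" using openin_sets_nu[OF H] by (simp add: space_nu[OF H])
qed

lemma per_zero:
  assumes H: "H \<in> closed_subgroups" and h: "h \<in> Cc" and K: "\<And>s. s \<notin> K \<Longrightarrow> h s = 0"
    and s: "\<And>k. k \<in> K \<Longrightarrow> s - k \<notin> H"
  shows "per (\<beta> H) h s = 0"
proof -
  note D = sub_haarD[OF sub_haar_beta[OF H]]
  have "AE t in \<beta> H. h (s + t) = 0"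
    using D(2)
  proof eventually_elim
    case (elim t)
    have "s + t \<notin> K"
    proof
      assume "s + t \<in> K"
      then have "s - (s + t) \<notin> H" by (rule s)
      then show False using D(9)[OF elim] by simp
    qed
    then show ?case by (rule K)
  qed
  then have "(LINT t|\<beta> H. h (s + t)) = (LINT t|\<beta> H. 0)"
  proof (rule integral_cong_AE[rotated 2])
    have "(\<lambda>t. h (s + t)) \<in> borel_measurable borel"
      using Cc_compose_shift(1)[OF h, of s] by (intro continuous_borel Cc_continuous) (simp add: add.commute)
    then show "(\<lambda>t. h (s + t)) \<in> borel_measurable (\<beta> H)" using measurable_cong_sets[OF D(4) refl] by blast
  qed simp
  then show ?thesis by (simp add: per_def)
qed

text \<open>The periodization is bounded on the image of the compact support and vanishes off it,
  and this image has finite measure.\<close>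

lemma P_square_integrable:
  assumes H: "H \<in> closed_subgroups" and h: "h \<in> Cc"
  shows "P H h \<in> square_integrable (\<nu> H)"
proof -
  obtain K B where K: "compact K" "\<And>s. s \<notin> K \<Longrightarrow> h s = 0" using Cc_bounded[OF h] by metis
  let ?q = "\<lambda>s. s +o H"
  have "bounded (per (\<beta> H) h ` K)"
    using per_continuous[OF h sub_haar_beta[OF H]] K(1)
    by (meson compact_continuous_image compact_imp_bounded continuous_on_subset subset_UNIV)
  then obtain b where b: "\<And>s. s \<in> K \<Longrightarrow> cmod (per (\<beta> H) h s) \<le> b" by (auto simp: bounded_iff)
  have le: "(cmod (P H h c))\<^sup>2 \<le> b\<^sup>2 * indicat_real (?q ` K) c" if c: "c \<in> space (\<nu> H)" for c
  proof (cases "c \<in> ?q ` K")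
    case True
    then obtain k where k: "k \<in> K" "c = k +o H" by auto
    then have "cmod (P H h c) \<le> b" using b[OF k(1)] by (simp add: P_coset[OF H h])
    then show ?thesis using True by (simp add: power_mono)
  next
    case False
    obtain s where s: "c = s +o H" using c by (auto simp: space_nu[OF H] cosets_def)
    have "per (\<beta> H) h s = 0"
    proof (rule per_zero[OF H h K(2)])
      fix k assume "k \<in> K"
      then show "s - k \<notin> H" using False closed_subgroup_add_iff[OF H, of s k] s by auto
    qed
    then show ?thesis using False by (simp add: s P_coset[OF H h])
  qed
  have "integrable (\<nu> H) (\<lambda>c. b\<^sup>2 * indicat_real (?q ` K) c)"
    using coset_image_measure[OF H K(1)] by (intro integrable_mult_right integrable_real_indicator) auto
  then have "integrable (\<nu> H) (\<lambda>c. (cmod (P H h c))\<^sup>2)"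
  proof (rule Bochner_Integration.integrable_bound)
    show "(\<lambda>c. (cmod (P H h c))\<^sup>2) \<in> borel_measurable (\<nu> H)"
      using P_measurable[OF H h] by measurable
    show "AE c in \<nu> H. norm ((cmod (P H h c))\<^sup>2) \<le> norm (b\<^sup>2 * indicat_real (?q ` K) c)"
    proof (rule AE_I2)
      fix c assume "c \<in> space (\<nu> H)"
      from le[OF this] show "norm ((cmod (P H h c))\<^sup>2) \<le> norm (b\<^sup>2 * indicat_real (?q ` K) c)"
        by (simp add: indicator_def)
    qed
  qed
  then show ?thesis using P_measurable[OF H h] by (simp add: square_integrable_def)
qed

definition cls :: "'g set \<Rightarrow> ('g \<Rightarrow> complex) \<Rightarrow> ('g set \<Rightarrow> complex) set" where
  "cls H h = l2_class (\<nu> H) (P H h)"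

lemma cls_vectors: "H \<in> closed_subgroups \<Longrightarrow> h \<in> Cc \<Longrightarrow> cls H h \<in> vectors (L2 (\<nu> H))"
  by (simp add: cls_def L2_simps P_square_integrable)

lemma per_multiplicative:
  assumes H: "H \<in> closed_subgroups" and inv: "\<And>s t. t \<in> H \<Longrightarrow> u (s + t) = u s"
    and u: "continuous_on UNIV u" and h: "h \<in> Cc"
  shows "per (\<beta> H) (\<lambda>s. u s * h s) s = u s * per (\<beta> H) h s"
proof -
  note D = sub_haarD[OF sub_haar_beta[OF H]]
  have mh: "(\<lambda>t. h (s + t)) \<in> borel_measurable (\<beta> H)" if "h \<in> Cc" for h :: "'g \<Rightarrow> complex"
    using Cc_compose_shift(1)[OF that, of s] continuous_borel[OF Cc_continuous, of "\<lambda>t. h (t + s)"]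
    unfolding measurable_cong_sets[OF D(4) refl] by (simp add: add.commute)
  have uh: "(\<lambda>s. u s * h s) \<in> Cc" using Cc_mult[OF h u] by (simp add: mult.commute)
  have "(LINT t|\<beta> H. u (s + t) * h (s + t)) = (LINT t|\<beta> H. u s * h (s + t))"
  proof (rule integral_cong_AE)
    show "AE t in \<beta> H. u (s + t) * h (s + t) = u s * h (s + t)"
      using D(2) by eventually_elim (simp add: inv)
    show "(\<lambda>t. u (s + t) * h (s + t)) \<in> borel_measurable (\<beta> H)" by (rule mh[OF uh])
    show "(\<lambda>t. u s * h (s + t)) \<in> borel_measurable (\<beta> H)" using mh[OF h] by measurable
  qed
  then show ?thesis by (simp add: per_def)
qed

text \<open>Unfolding: \<open>per (\<beta> H) h\<close> is constant on cosets, so the product of one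
  periodization with the conjugate of the other is the periodization of
  \<open>per (\<beta> H) h\<close> times the conjugate of g. Weil's formula then turns the integral
  over G/H into one over G.\<close>

lemma cls_inner:
  assumes H: "H \<in> closed_subgroups" and h: "h \<in> Cc" and g: "g \<in> Cc"
  shows "vinner (L2 (\<nu> H)) (cls H h) (cls H g) = (LINT s|\<mu>. per (\<beta> H) h s * cnj (g s))"
proof -
  note sh = sub_haar_beta[OF H]
  have cg: "(\<lambda>s. cnj (g s)) \<in> Cc"
  proof -
    obtain K B where K: "compact K" "\<And>s. s \<notin> K \<Longrightarrow> g s = 0" using Cc_bounded[OF g] by metis
    have "continuous_on UNIV (\<lambda>s. cnj (g s))" using Cc_continuous[OF g] by (intro continuous_intros)
    then show ?thesis by (rule CcI[OF _ K(1)]) (simp add: K(2))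
  qed
  let ?\<phi> = "\<lambda>s. per (\<beta> H) h s * cnj (g s)"
  have \<phi>: "?\<phi> \<in> Cc" using Cc_mult[OF cg per_continuous[OF h sh]] by (simp add: mult.commute)
  have P\<phi>: "P H ?\<phi> c = P H h c * cnj (P H g c)" if c: "c \<in> space (\<nu> H)" for c
  proof -
    obtain s where s: "c = s +o H" using coset_rep[OF H c] by (rule exE)
    have "per (\<beta> H) ?\<phi> s = per (\<beta> H) h s * per (\<beta> H) (\<lambda>s. cnj (g s)) s"
      by (rule per_multiplicative[OF H per_invariant[OF continuous_borel[OF Cc_continuous[OF h]] sh] per_continuous[OF h sh] cg])
    also have "per (\<beta> H) (\<lambda>s. cnj (g s)) s = cnj (per (\<beta> H) g s)" by (simp add: per_def)
    finally show ?thesis by (simp add: s P_coset[OF H] h g \<phi>)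
  qed
  have "vinner (L2 (\<nu> H)) (cls H h) (cls H g) = (LINT c|\<nu> H. P H h c * cnj (P H g c))"
    unfolding cls_def by (rule L2_inner[OF P_square_integrable[OF H h] P_square_integrable[OF H g]])
  also have "\<dots> = (LINT c|\<nu> H. P H ?\<phi> c)" by (rule Bochner_Integration.integral_cong) (simp_all add: P\<phi>)
  also have "\<dots> = (LINT s|\<mu>. ?\<phi> s)" by (rule weil[OF H \<phi>, symmetric])
  finally show ?thesis .
qed

lemma cls_add:
  assumes H: "H \<in> closed_subgroups" and h: "h \<in> Cc" and g: "g \<in> Cc"
  shows "vadd (L2 (\<nu> H)) (cls H h) (cls H g) = cls H (\<lambda>s. h s + g s)"
proof -
  have "P H h c + P H g c = P H (\<lambda>s. h s + g s) c" for c
    unfolding P_def per_def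
    using Cc_integrable[OF Cc_compose_shift(1)[OF h] sub_haar_beta[OF H], of "SOME s. s \<in> c"]
      Cc_integrable[OF Cc_compose_shift(1)[OF g] sub_haar_beta[OF H], of "SOME s. s \<in> c"]
    by (simp add: add.commute[of "SOME s. s \<in> c"])
  then show ?thesis
    unfolding cls_def L2_add[OF P_square_integrable[OF H h] P_square_integrable[OF H g]] by simp
qed

lemma cls_scale:
  assumes H: "H \<in> closed_subgroups" and h: "h \<in> Cc"
  shows "vscale (L2 (\<nu> H)) c (cls H h) = cls H (\<lambda>s. c * h s)"
  unfolding cls_def L2_scale[OF P_square_integrable[OF H h]]
  by (rule l2_class_eq) (simp add: P_def per_def)

lemma cls_zero: "vzero (L2 (\<nu> H)) = cls H (\<lambda>s. 0)"
  unfolding cls_def L2_simps by (rule l2_class_eq) (simp add: P_def per_def)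

lemma stabilizer_closed_subgroup: "stabilizer act x \<in> closed_subgroups"
proof -
  have "closed (stabilizer act x)"
    unfolding stabilizer_def by (intro closed_Collect_eq continuous_act continuous_on_const)
  moreover have "act (- s) x = x" if "act s x = x" for s using act_minus(2)[of s x] that by simp
  ultimately show ?thesis by (auto simp: closed_subgroups_def stabilizer_def act_add)
qed

lemma cls_frep:
  fixes x :: 'x
  assumes h: "h \<in> Cc" and f: "f \<in> C0"
  defines "H \<equiv> stabilizer act x"
  shows "frep (induced_pair act (\<nu> H) x \<tau>) f (cls H h) = cls H (\<lambda>s. f (act s x) * h s)"
proof -
  have H: "H \<in> closed_subgroups" unfolding H_def by (rule stabilizer_closed_subgroup)
  have uc: "continuous_on UNIV (\<lambda>s. f (act s x))"
    by (rule continuous_on_compose2[OF C0_continuous[OF f] continuous_act(2)]) simp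
  have inv: "f (act (s + t) x) = f (act s x)" if "t \<in> H" for s t
    using that by (simp add: H_def stabilizer_def act_add)
  have fh: "(\<lambda>s. f (act s x) * h s) \<in> Cc" using Cc_mult[OF h uc] by (simp add: mult.commute)
  have "AE c in \<nu> H. f (act (SOME s. s \<in> c) x) * l2_rep (cls H h) c = P H (\<lambda>s. f (act s x) * h s) c"
    using l2_rep_class(2)[OF P_square_integrable[OF H h]] AE_space
  proof eventually_elim
    case (elim c)
    obtain s where s: "c = s +o H" using elim(2) by (auto simp: space_nu[OF H] cosets_def)
    have "f (act (SOME r. r \<in> c) x) = f (act s x)" using inv[OF coset_some[OF H, of s], of s] by (simp add: s)
    then show ?case using elim(1) per_multiplicative[OF H inv uc h, of s]
      by (simp add: s cls_def P_coset[OF H h] P_coset[OF H fh])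
  qed
  from l2_class_eq[OF this] show ?thesis by (simp add: induced_pair_def cls_def)
qed

lemma cls_grep:
  fixes x :: 'x
  assumes h: "h \<in> Cc"
  defines "H \<equiv> stabilizer act x"
  shows "grep (induced_pair act (\<nu> H) x \<tau>) t (cls H h) = cls H (\<lambda>s. \<tau> t * h (s - t))"
proof -
  have H: "H \<in> closed_subgroups" unfolding H_def by (rule stabilizer_closed_subgroup)
  have ht: "(\<lambda>s. h (s - t)) \<in> Cc" using Cc_compose_shift(1)[OF h, of "- t"] by simp
  have tht: "(\<lambda>s. \<tau> t * h (s - t)) \<in> Cc" using Cc_mult[OF ht continuous_on_const, of "\<tau> t"] by (simp add: mult.commute)
  note sq = P_square_integrable[OF H h]
  define L where "L c = (- t) +o c" for c
  have Lc: "L c \<in> cosets H" if "c \<in> cosets H" for c using that by (auto simp: L_def cosets_def elt_set_plus_assoc)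
  have Lm: "L \<in> measurable (\<nu> H) (\<nu> H)"
  proof (rule measurable_sigma_sets[OF sets_nu[OF H]])
    show "{U. openin (coset_topology H) U} \<subseteq> Pow (cosets H)" by (auto simp: openin_coset_topology)
    show "L \<in> space (\<nu> H) \<rightarrow> cosets H" using Lc by (auto simp: space_nu[OF H])
    fix U assume "U \<in> {U. openin (coset_topology H) U}"
    then have U: "openin (coset_topology H) U" by simp
    have "openin (coset_topology H) (L -` U \<inter> cosets H)"
      unfolding openin_coset_topology
    proof
      have "{s. s +o H \<in> L -` U \<inter> cosets H} = (\<lambda>s. - t + s) -` {s. s +o H \<in> U}"
        by (auto simp: L_def cosets_def elt_set_plus_assoc)
      moreover have "open ((\<lambda>s. - t + s) -` {s. s +o H \<in> U})"
        using U unfolding openin_coset_topology by (intro open_vimage continuous_intros) simp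
      ultimately show "open {s. s +o H \<in> L -` U \<inter> cosets H}" by simp
    qed simp
    then show "L -` U \<inter> space (\<nu> H) \<in> sets (\<nu> H)" using openin_sets_nu[OF H] by (simp add: space_nu[OF H])
  qed
  \<comment> \<open>\<open>grep\<close> translates an arbitrary representative of the class, which
    agrees with \<open>P H h\<close> only off this null set. Its preimage under the translation L is
    again a translate of it, hence null by invariance of \<open>\<nu> H\<close>.\<close>
  let ?N = "{c \<in> space (\<nu> H). l2_rep (cls H h) c \<noteq> P H h c}"
  have rm: "l2_rep (cls H h) \<in> borel_measurable (\<nu> H)" "P H h \<in> borel_measurable (\<nu> H)"
    using l2_rep_class(1)[OF sq] P_measurable[OF H h] by (simp_all add: cls_def square_integrable_def)
  have Ns: "?N \<in> sets (\<nu> H)" using rm by measurable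
  have "AE c in \<nu> H. l2_rep (cls H h) c = P H h c" using l2_rep_class(2)[OF sq] by (simp add: cls_def)
  then have N0: "emeasure (\<nu> H) ?N = 0" using Ns by (subst (asm) AE_iff_measurable[where N = ?N]) auto
  have LN: "L -` ?N \<inter> space (\<nu> H) = (+o) t ` ?N"
  proof
    show "L -` ?N \<inter> space (\<nu> H) \<subseteq> (+o) t ` ?N"
    proof
      fix c assume c: "c \<in> L -` ?N \<inter> space (\<nu> H)"
      have "c = t +o L c" by (simp add: L_def elt_set_plus_assoc)
      then show "c \<in> (+o) t ` ?N" using c by auto
    qed
    show "(+o) t ` ?N \<subseteq> L -` ?N \<inter> space (\<nu> H)"
    proof
      fix c assume "c \<in> (+o) t ` ?N"
      then obtain d where d: "d \<in> ?N" "c = t +o d" by auto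
      have "L c = d" using d by (simp add: L_def elt_set_plus_assoc)
      moreover have "c \<in> cosets H" using d by (auto simp: space_nu[OF H] cosets_def elt_set_plus_assoc)
      ultimately show "c \<in> L -` ?N \<inter> space (\<nu> H)" using d(1) by (simp add: space_nu[OF H])
    qed
  qed
  have "emeasure (\<nu> H) (L -` ?N \<inter> space (\<nu> H)) = 0"
    unfolding LN using nu[OF H] Ns N0 by (simp add: haar_measure_def)
  moreover have "L -` ?N \<inter> space (\<nu> H) \<in> sets (\<nu> H)" by (rule measurable_sets[OF Lm Ns])
  ultimately have "AE c in \<nu> H. l2_rep (cls H h) (L c) = P H h (L c)"
    using measurable_space[OF Lm] by (intro AE_I[where N = "L -` ?N \<inter> space (\<nu> H)"]) auto
  then have "AE c in \<nu> H. \<tau> t * l2_rep (cls H h) ((- t) +o c) = P H (\<lambda>s. \<tau> t * h (s - t)) c"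
    using AE_space
  proof eventually_elim
    case (elim c)
    obtain s where s: "c = s +o H" using elim(2) by (auto simp: space_nu[OF H] cosets_def)
    have "P H h (L c) = per (\<beta> H) h (s - t)"
      using P_coset[OF H h, of "- t + s"] by (simp add: L_def s elt_set_plus_assoc)
    moreover have "P H (\<lambda>s. \<tau> t * h (s - t)) c = \<tau> t * per (\<beta> H) h (s - t)"
      unfolding s P_coset[OF H tht] by (simp add: per_def algebra_simps)
    ultimately show ?case using elim(1) by (simp add: L_def)
  qed
  from l2_class_eq[OF this] show ?thesis by (simp add: induced_pair_def cls_def)
qed

end

context nontrivial_transformation_group
begin

lemma cnorm_bound:
  assumes a: "a \<in> elems A" and \<rho>: "\<rho> \<in> R" and \<eta>: "\<eta> \<in> vectors (cspace \<rho>)"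
  shows "cmod (vinner (cspace \<rho>) (a \<rho> \<eta>) \<eta>) \<le> (vnorm (cspace \<rho>) \<eta>)\<^sup>2 * cnorm A a"
proof -
  interpret covariant_rep act \<mu> \<rho> by (rule covariant_repI[OF \<rho>])
  obtain c where c: "0 < c" "op_bounded a c" by (rule elems_bounded[OF a])
  have "op_norm H (a \<rho>) \<le> cnorm A a"
    unfolding crossed_product_simps(4)
    by (rule cSUP_upper[OF \<rho>]) (use op_norm_le_bounded[OF c(2)] c(1) in \<open>auto intro!: bdd_aboveI2\<close>)
  moreover have "vnorm H (a \<rho> \<eta>) \<le> op_norm H (a \<rho>) * vnorm H \<eta>"
    by (rule op_norm_bound[OF op_familyD(1)[OF elems_family[OF a] \<rho>] \<eta>])
  ultimately have "vnorm H (a \<rho> \<eta>) \<le> cnorm A a * vnorm H \<eta>"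
    using mult_right_mono[of "op_norm H (a \<rho>)" "cnorm A a" "vnorm H \<eta>"] \<eta> by simp
  then have "vnorm H (a \<rho> \<eta>) * vnorm H \<eta> \<le> cnorm A a * vnorm H \<eta> * vnorm H \<eta>"
    using \<eta> by (intro mult_right_mono) auto
  moreover have "cmod (vinner H (a \<rho> \<eta>) \<eta>) \<le> vnorm H (a \<rho> \<eta>) * vnorm H \<eta>"
    by (rule cauchy_schwarz[OF elems_closed[OF a \<rho> \<eta>] \<eta>])
  ultimately show ?thesis by (simp add: power2_eq_square algebra_simps)
qed

lemma vector_functional_linear:
  assumes \<rho>: "\<rho> \<in> R" and \<eta>: "\<eta> \<in> vectors (cspace \<rho>)" and a: "a \<in> elems A"
  shows "b \<in> elems A \<Longrightarrow> vinner (cspace \<rho>) (cadd A a b \<rho> \<eta>) \<eta> =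
      vinner (cspace \<rho>) (a \<rho> \<eta>) \<eta> + vinner (cspace \<rho>) (b \<rho> \<eta>) \<eta>"
    and "vinner (cspace \<rho>) (cscale A c a \<rho> \<eta>) \<eta> = c * vinner (cspace \<rho>) (a \<rho> \<eta>) \<eta>"
proof -
  interpret covariant_rep act \<mu> \<rho> by (rule covariant_repI[OF \<rho>])
  show "vinner H (cadd A a b \<rho> \<eta>) \<eta> = vinner H (a \<rho> \<eta>) \<eta> + vinner H (b \<rho> \<eta>) \<eta>" if "b \<in> elems A"
    using elems_closed[OF a \<rho> \<eta>] elems_closed[OF that \<rho> \<eta>] \<rho> \<eta> by (simp add: crossed_product_simps inner_add)
  show "vinner H (cscale A c a \<rho> \<eta>) \<eta> = c * vinner H (a \<rho> \<eta>) \<eta>"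
    using elems_closed[OF a \<rho> \<eta>] \<rho> \<eta> by (simp add: crossed_product_simps inner_scale)
qed

lemma difference_dual:
  assumes \<rho>: "\<rho> \<in> R" "\<eta> \<in> vectors (cspace \<rho>)" and \<sigma>: "\<sigma> \<in> R" "\<xi> \<in> vectors (cspace \<sigma>)"
    and \<psi>: "\<And>a. a \<in> elems A \<Longrightarrow> \<psi> a = vinner (cspace \<rho>) (a \<rho> \<eta>) \<eta> - vinner (cspace \<sigma>) (a \<sigma> \<xi>) \<xi>"
  shows "\<psi> \<in> dual A"
proof -
  have "cmod (\<psi> a) \<le> ((vnorm (cspace \<rho>) \<eta>)\<^sup>2 + (vnorm (cspace \<sigma>) \<xi>)\<^sup>2) * cnorm A a" if a: "a \<in> elems A" for a
    using norm_triangle_ineq4[of "vinner (cspace \<rho>) (a \<rho> \<eta>) \<eta>" "vinner (cspace \<sigma>) (a \<sigma> \<xi>) \<xi>"]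
      cnorm_bound[OF a \<rho>] cnorm_bound[OF a \<sigma>] by (simp add: \<psi>[OF a] distrib_right)
  moreover have "linear_functional A \<psi>"
    unfolding linear_functional_def
    using vector_functional_linear[OF \<rho>] vector_functional_linear[OF \<sigma>] cadd_elems cscale_elems
    by (simp add: \<psi> algebra_simps)
  ultimately show ?thesis unfolding dual_def by blast
qed

end

lemma characterD:
  assumes "\<tau> \<in> characters"
  shows "continuous_on UNIV \<tau>" "cmod (\<tau> s) = 1" "\<tau> (s + t) = \<tau> s * \<tau> t"
    "\<tau> s * cnj (\<tau> s) = 1" "cnj (\<tau> s) * \<tau> s = 1"
proof -
  show "continuous_on UNIV \<tau>" "\<tau> (s + t) = \<tau> s * \<tau> t" using assms by (simp_all add: characters_def)
  show 1: "cmod (\<tau> s) = 1" using assms by (simp add: characters_def)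
  show "\<tau> s * cnj (\<tau> s) = 1" using 1 by (simp flip: complex_norm_square)
  then show "cnj (\<tau> s) * \<tau> s = 1" by (simp add: mult.commute)
qed

section \<open>Twisted periodizations and their matrix coefficients\<close>

context induced_system
begin

text \<open>The same h is twisted for every subgroup and character. The factor
  \<open>\<tau> s\<close> cancels in matrix coefficients, so that after periodization \<tau>
  survives only on H, inside \<open>twper\<close>.\<close>

definition twist :: "('g \<Rightarrow> complex) \<Rightarrow> ('g \<Rightarrow> complex) \<Rightarrow> 'g \<Rightarrow> 'g \<Rightarrow> complex" where
  "twist \<tau> h a = (\<lambda>s. \<tau> s * h (s - a))"

definition twper :: "'g set \<Rightarrow> ('g \<Rightarrow> complex) \<Rightarrow> ('g \<Rightarrow> complex) \<Rightarrow> 'g \<Rightarrow> complex" where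
  "twper H \<tau> h u = (LINT r|\<beta> H. h (u + r) * \<tau> r)"

lemma twist_Cc:
  assumes "\<tau> \<in> characters" "h \<in> Cc"
  shows "twist \<tau> h a \<in> Cc"
  using Cc_mult[OF Cc_compose_shift(1)[OF assms(2), of "- a"] characterD(1)[OF assms(1)]]
  by (simp add: twist_def mult.commute)

lemma per_twist:
  assumes \<tau>: "\<tau> \<in> characters"
  shows "per (\<beta> H) (twist \<tau> h a) s = \<tau> s * twper H \<tau> h (s - a)"
proof -
  have "per (\<beta> H) (twist \<tau> h a) s = (LINT t|\<beta> H. \<tau> s * (h (s - a + t) * \<tau> t))"
    unfolding per_def twist_def characterD(3)[OF \<tau>]
    by (intro Bochner_Integration.integral_cong refl) (simp add: algebra_simps)
  then show ?thesis by (simp add: twper_def)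
qed

lemma twper_continuous:
  assumes H: "H \<in> closed_subgroups" and \<tau>: "\<tau> \<in> characters" and h: "h \<in> Cc"
  shows "continuous_on UNIV (twper H \<tau> h)"
proof -
  have "twper H \<tau> h = (\<lambda>s. cnj (\<tau> s) * per (\<beta> H) (twist \<tau> h 0) s)"
    using characterD(5)[OF \<tau>] by (simp add: per_twist[OF \<tau>] mult.assoc[symmetric])
  moreover have "continuous_on UNIV (\<lambda>s. cnj (\<tau> s) * per (\<beta> H) (twist \<tau> h 0) s)"
    by (intro continuous_on_mult continuous_on_cnj characterD(1)[OF \<tau>] per_continuous[OF twist_Cc[OF \<tau> h] sub_haar_beta[OF H]])
  ultimately show ?thesis by simp
qed

text \<open>Unfolding removes the factor \<open>\<tau> s\<close>, and invariance of \<mu> removes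
  one shift. What remains is b - a, which \<open>escape\<close> will control.\<close>

lemma cls_twist_inner:
  assumes H: "H \<in> closed_subgroups" and \<tau>: "\<tau> \<in> characters" and h: "h \<in> Cc"
  shows "vinner (L2 (\<nu> H)) (cls H (twist \<tau> h a)) (cls H (twist \<tau> h b)) =
    (LINT s|\<mu>. twper H \<tau> h (s + b - a) * cnj (h s))"
proof -
  let ?f = "\<lambda>s. twper H \<tau> h (s + b - a) * cnj (h s)"
  have "vinner (L2 (\<nu> H)) (cls H (twist \<tau> h a)) (cls H (twist \<tau> h b)) =
    (LINT s|\<mu>. \<tau> s * twper H \<tau> h (s - a) * cnj (\<tau> s * h (s - b)))"
    by (simp add: cls_inner[OF H twist_Cc[OF \<tau> h] twist_Cc[OF \<tau> h]] per_twist[OF \<tau>]) (simp add: twist_def)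
  also have "\<dots> = (LINT s|\<mu>. ?f (s - b))"
  proof (intro Bochner_Integration.integral_cong refl)
    fix s
    have "\<tau> s * twper H \<tau> h (s - a) * cnj (\<tau> s * h (s - b)) = (\<tau> s * cnj (\<tau> s)) * (twper H \<tau> h (s - a) * cnj (h (s - b)))"
      by simp
    then show "\<tau> s * twper H \<tau> h (s - a) * cnj (\<tau> s * h (s - b)) = ?f (s - b)"
      using characterD(4)[OF \<tau>, of s] by simp
  qed
  also have "\<dots> = (LINT s|\<mu>. ?f s)"
  proof (rule haar_integral_translate[OF haar UNIV_I])
    have "continuous_on UNIV (\<lambda>s. twper H \<tau> h (s + b - a))"
      by (rule continuous_on_compose2[OF twper_continuous[OF H \<tau> h]]) (auto intro!: continuous_intros)
    then show "?f \<in> borel_measurable borel"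
      by (intro continuous_borel continuous_on_mult continuous_on_cnj Cc_continuous[OF h])
  qed
  finally show ?thesis .
qed

abbreviation ip :: "'x \<Rightarrow> ('g \<Rightarrow> complex) \<Rightarrow> ('g, 'x, ('g set \<Rightarrow> complex) set) covariant_pair" where
  "ip x \<tau> \<equiv> induced_pair act (\<nu> (stabilizer act x)) x \<tau>"

lemma cspace_ip [simp]: "cspace (ip x \<tau>) = L2 (\<nu> (stabilizer act x))"
  by (simp add: induced_pair_def)

lemma cls_action:
  assumes h: "h \<in> Cc" and f: "f \<in> Cc_C0"
  shows "frep (ip x \<tau>) (f t) (grep (ip x \<tau>) t (cls (stabilizer act x) h))
      = cls (stabilizer act x) (\<lambda>s. f t (act s x) * (\<tau> t * h (s - t)))"
    and "(\<lambda>s. f t (act s x) * (\<tau> t * h (s - t))) \<in> Cc"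
proof -
  have ht: "(\<lambda>s. \<tau> t * h (s - t)) \<in> Cc"
    using Cc_mult[OF Cc_compose_shift(1)[OF h, of "- t"] continuous_on_const, of "\<tau> t"] by (simp add: mult.commute)
  show "frep (ip x \<tau>) (f t) (grep (ip x \<tau>) t (cls (stabilizer act x) h))
      = cls (stabilizer act x) (\<lambda>s. f t (act s x) * (\<tau> t * h (s - t)))"
    unfolding cls_grep[OF h] by (rule cls_frep[OF ht Cc_C0_C0[OF f]])
  have "continuous_on UNIV (\<lambda>s. f t (act s x))"
    by (rule continuous_on_compose2[OF C0_continuous[OF Cc_C0_C0[OF f]] continuous_act(2)]) simp
  from Cc_mult[OF ht this] show "(\<lambda>s. f t (act s x) * (\<tau> t * h (s - t))) \<in> Cc" by (simp add: mult.commute)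
qed

text \<open>After unfolding, \<open>\<tau> s * cnj (\<tau> s)\<close> is 1, and shifting s by a
  replaces the base point x by \<open>act a x\<close>. So a sequence of shifts enters only through
  the translated points, which will converge, and not through the shifts themselves, which may leave
  every compact set.\<close>

lemma cls_twist_action_inner:
  fixes x a
  assumes \<tau>: "\<tau> \<in> characters" and h: "h \<in> Cc" and f: "f \<in> Cc_C0"
  defines "H \<equiv> stabilizer act x" and "\<eta> \<equiv> cls (stabilizer act x) (twist \<tau> h a)"
  shows "vinner (L2 (\<nu> H)) (frep (ip x \<tau>) (f t) (grep (ip x \<tau>) t \<eta>)) \<eta> =
    (LINT s|\<mu>. f t (act s (act a x)) * twper H \<tau> h (s - t) * cnj (h s))"
proof -
  have H: "H \<in> closed_subgroups" unfolding H_def by (rule stabilizer_closed_subgroup)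
  let ?f = "\<lambda>s. f t (act s (act a x)) * twper H \<tau> h (s - t) * cnj (h s)"
  let ?g = "\<lambda>s. f t (act s x) * (\<tau> t * twist \<tau> h a (s - t))"
  have uc: "continuous_on UNIV (\<lambda>s. f t (act s x))" for x
    by (rule continuous_on_compose2[OF C0_continuous[OF Cc_C0_C0[OF f]] continuous_act(2)]) simp
  have inv: "f t (act (s + r) x) = f t (act s x)" if "r \<in> H" for s r
    using that by (simp add: H_def stabilizer_def act_add)
  have g_eq: "?g = (\<lambda>s. f t (act s x) * twist \<tau> h (t + a) s)"
  proof
    fix s
    have "\<tau> t * \<tau> (s - t) = \<tau> s" using characterD(3)[OF \<tau>, of t "s - t"] by simp
    moreover have "?g s = f t (act s x) * ((\<tau> t * \<tau> (s - t)) * h (s - (t + a)))"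
      by (simp only: twist_def diff_diff_add mult.assoc)
    ultimately show "?g s = f t (act s x) * twist \<tau> h (t + a) s" by (simp only: twist_def)
  qed
  have per_g: "per (\<beta> H) ?g s = f t (act s x) * (\<tau> s * twper H \<tau> h (s - t - a))" for s
  proof -
    have "per (\<beta> H) (\<lambda>s. f t (act s x) * twist \<tau> h (t + a) s) s = f t (act s x) * per (\<beta> H) (twist \<tau> h (t + a)) s"
      by (rule per_multiplicative[OF H _ uc twist_Cc[OF \<tau> h]]) (rule inv)
    then show ?thesis unfolding g_eq per_twist[OF \<tau>] by (simp only: diff_diff_add)
  qed
  have "vinner (L2 (\<nu> H)) (frep (ip x \<tau>) (f t) (grep (ip x \<tau>) t \<eta>)) \<eta>
     = vinner (L2 (\<nu> H)) (cls H ?g) (cls H (twist \<tau> h a))"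
    unfolding \<eta>_def H_def by (simp only: cls_action(1)[OF twist_Cc[OF \<tau> h] f])
  also have "\<dots> = (LINT s|\<mu>. per (\<beta> H) ?g s * cnj (twist \<tau> h a s))"
    by (rule cls_inner[OF H cls_action(2)[OF twist_Cc[OF \<tau> h] f] twist_Cc[OF \<tau> h]])
  also have "\<dots> = (LINT s|\<mu>. ?f (s - a))"
  proof (intro Bochner_Integration.integral_cong refl)
    fix s
    have "act (s - a) (act a x) = act s x" by (simp flip: act_add)
    moreover have "per (\<beta> H) ?g s * cnj (twist \<tau> h a s) =
        (\<tau> s * cnj (\<tau> s)) * (f t (act s x) * twper H \<tau> h (s - t - a) * cnj (h (s - a)))"
      unfolding per_g by (simp add: twist_def)
    ultimately show "per (\<beta> H) ?g s * cnj (twist \<tau> h a s) = ?f (s - a)"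
      using characterD(4)[OF \<tau>, of s] by (simp add: algebra_simps)
  qed
  also have "\<dots> = (LINT s|\<mu>. ?f s)"
  proof (rule haar_integral_translate[OF haar UNIV_I])
    have "continuous_on UNIV (\<lambda>s. twper H \<tau> h (s - t))"
      by (rule continuous_on_compose2[OF twper_continuous[OF H \<tau> h]]) (auto intro!: continuous_intros)
    then show "?f \<in> borel_measurable borel"
      by (intro continuous_borel continuous_on_mult continuous_on_cnj Cc_continuous[OF h] uc)
  qed
  finally show ?thesis .
qed

text \<open>Translation by an element of the stabilizer fixes every coset, so only the scalar is
  left.\<close>

lemma eigen_stabilizer:
  assumes r: "r \<in> stabilizer act x" and \<xi>: "\<xi> \<in> vectors (L2 (\<nu> (stabilizer act x)))"
  shows "grep (ip x \<tau>) r \<xi> = vscale (L2 (\<nu> (stabilizer act x))) (\<tau> r) \<xi>"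
proof -
  let ?H = "stabilizer act x"
  have H: "?H \<in> closed_subgroups" by (rule stabilizer_closed_subgroup)
  have "(- r) +o c = c" if "c \<in> space (\<nu> ?H)" for c
  proof -
    obtain s where s: "c = s +o ?H" using coset_rep[OF H \<open>c \<in> space (\<nu> ?H)\<close>] by (rule exE)
    have "- r + s - s \<in> ?H" using H r by (simp add: closed_subgroups_def)
    then show ?thesis using closed_subgroup_add_iff[OF H, of "- r + s" s] by (simp add: s elt_set_plus_assoc)
  qed
  then have "AE c in \<nu> ?H. \<tau> r * l2_rep \<xi> ((- r) +o c) = \<tau> r * l2_rep \<xi> c" by (intro AE_I2) simp
  from l2_class_eq[OF this] show ?thesis by (simp add: induced_pair_def L2_def)
qed

text \<open>The domination needed for limits over varying subgroups and characters: characters have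
  modulus 1, and for u in D the integrands are supported in one compact set, whose mass
  \<open>uniform_measure_bound\<close> controls.\<close>

lemma twper_bound:
  assumes h: "h \<in> Cc" and D: "compact D"
  shows "\<exists>M\<ge>0. \<forall>H \<tau> u. H \<in> closed_subgroups \<longrightarrow> \<tau> \<in> characters \<longrightarrow> u \<in> D \<longrightarrow> cmod (twper H \<tau> h u) \<le> M"
proof -
  obtain K B where K: "compact K" "\<And>s. s \<notin> K \<Longrightarrow> h s = 0" and B: "0 \<le> B" "\<And>s. cmod (h s) \<le> B"
    using Cc_bounded[OF h] by metis
  let ?L = "K + uminus ` D"
  have L: "compact ?L" by (intro compact_plus compact_uminus K(1) D)
  obtain C where C: "0 \<le> C" "\<And>H \<beta>. sub_haar H \<beta> \<Longrightarrow> measure \<beta> ?L \<le> C" using uniform_measure_bound[OF L] by metis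
  have "cmod (twper H \<tau> h u) \<le> B * C" if H: "H \<in> closed_subgroups" and \<tau>: "\<tau> \<in> characters" and u: "u \<in> D" for H \<tau> u
    unfolding twper_def
  proof (rule Cc_integral_bound[OF _ L _ sub_haar_beta[OF H] C(2)[OF sub_haar_beta[OF H]] B(1)])
    have "continuous_on UNIV (\<lambda>r. h (u + r))"
      by (rule continuous_on_compose2[OF Cc_continuous[OF h]]) (auto intro!: continuous_intros)
    then show "(\<lambda>r. h (u + r) * \<tau> r) \<in> borel_measurable borel"
      by (intro continuous_borel continuous_on_mult characterD(1)[OF \<tau>])
    show "h (u + r) * \<tau> r = 0" if "r \<notin> ?L" for r
    proof -
      have "u + r \<notin> K"
      proof
        assume "u + r \<in> K"
        then have "(u + r) + - u \<in> ?L" using u by (intro set_plus_intro imageI)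
        then show False using that by simp
      qed
      then show ?thesis by (simp add: K(2))
    qed
    show "cmod (h (u + r) * \<tau> r) \<le> B" for r using B(2)[of "u + r"] by (simp add: norm_mult characterD(2)[OF \<tau>])
  qed
  then show ?thesis using B(1) C(1) by (intro exI[of _ "B * C"]) auto
qed

text \<open>Stated for arbitrary \<theta> because it is applied twice: with a fixed
  \<open>twper\<close> and varying t, for continuity in t, and with fixed t and varying
  \<open>twper\<close>, for the limit in n.\<close>

lemma matrix_coefficient_tendsto:
  fixes \<theta> :: "nat \<Rightarrow> 'g \<Rightarrow> complex"
  assumes h: "h \<in> Cc" and K: "\<And>s. s \<notin> K \<Longrightarrow> h s = 0" "compact K"
    and f: "f \<in> Cc_C0" and Kf: "\<And>s. s \<notin> Kf \<Longrightarrow> f s = (\<lambda>x. 0)"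
    and \<theta>: "\<And>n. continuous_on UNIV (\<theta> n)" "continuous_on UNIV \<theta>0"
    and M: "0 \<le> M" "\<And>n u. u \<in> K + uminus ` Kf \<Longrightarrow> cmod (\<theta> n u) \<le> M"
    and t: "t \<longlonglongrightarrow> t0" and y: "y \<longlonglongrightarrow> y0"
    and lim: "\<And>s. (\<lambda>n. \<theta> n (s - t n)) \<longlonglongrightarrow> \<theta>0 (s - t0)"
  shows "(\<lambda>n. LINT s|\<mu>. f (t n) (act s (y n)) * \<theta> n (s - t n) * cnj (h s)) \<longlonglongrightarrow>
     (LINT s|\<mu>. f t0 (act s y0) * \<theta>0 (s - t0) * cnj (h s))"
proof -
  obtain Bf where Bf: "0 < Bf" "\<And>s x. cmod (f s x) \<le> Bf" using Cc_C0_bounded[OF f] by metis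
  obtain K' Bh where Bh: "0 \<le> Bh" "\<And>s. cmod (h s) \<le> Bh" using Cc_bounded[OF h] by metis
  have meas: "(\<lambda>s. f t (act s y) * \<theta> (s - t) * cnj (h s)) \<in> borel_measurable borel"
    if \<theta>: "continuous_on UNIV \<theta>" for \<theta> :: "'g \<Rightarrow> complex" and t y
  proof (rule continuous_borel)
    have "continuous_on UNIV (\<lambda>s. f t (act s y))"
      by (rule continuous_on_compose2[OF C0_continuous[OF Cc_C0_C0[OF f]] continuous_act(2)]) simp
    moreover have "continuous_on UNIV (\<lambda>s. \<theta> (s - t))"
      by (rule continuous_on_compose2[OF \<theta>]) (auto intro!: continuous_intros)
    ultimately show "continuous_on UNIV (\<lambda>s. f t (act s y) * \<theta> (s - t) * cnj (h s))"
      by (intro continuous_on_mult continuous_on_cnj Cc_continuous[OF h])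
  qed
  show ?thesis
  proof (rule tendsto_integral_compact_support[OF sets_mu(1) K(2) mu_compact[OF K(2)] meas[OF \<theta>(1)] meas[OF \<theta>(2)]])
    show "f (t n) (act s (y n)) * \<theta> n (s - t n) * cnj (h s) = 0" if "s \<notin> K" for n s using K(1)[OF that] by simp
    \<comment> \<open>If s is outside K or \<open>t n\<close> is outside \<open>Kf\<close> the
      integrand vanishes, so \<theta> has to be bounded only on the set of differences of points of
      K and \<open>Kf\<close>.\<close>
    show "cmod (f (t n) (act s (y n)) * \<theta> n (s - t n) * cnj (h s)) \<le> Bf * M * Bh" for n s
    proof (cases "s \<in> K \<and> t n \<in> Kf")
      case True
      then have "s + - t n \<in> K + uminus ` Kf" by (intro set_plus_intro imageI) auto
      then have "cmod (\<theta> n (s - t n)) \<le> M" using M(2) by simp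
      then show ?thesis unfolding norm_mult complex_mod_cnj
        using Bf M(1) Bh by (intro mult_mono mult_nonneg_nonneg) (auto intro: less_imp_le)
    next
      case False
      then have z: "f (t n) (act s (y n)) * \<theta> n (s - t n) * cnj (h s) = 0" using K(1)[of s] Kf[of "t n"] by auto
      show ?thesis unfolding z using Bf(1) M(1) Bh(1) by simp
    qed
    show "AE s in \<mu>. (\<lambda>n. f (t n) (act s (y n)) * \<theta> n (s - t n) * cnj (h s)) \<longlonglongrightarrow> f t0 (act s y0) * \<theta>0 (s - t0) * cnj (h s)"
    proof (rule AE_I2)
      fix s
      show "(\<lambda>n. f (t n) (act s (y n)) * \<theta> n (s - t n) * cnj (h s)) \<longlonglongrightarrow> f t0 (act s y0) * \<theta>0 (s - t0) * cnj (h s)"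
        by (intro tendsto_mult tendsto_const Cc_C0_tendsto[OF f t] act_tendsto y lim)
    qed
  qed
qed

text \<open>Dominated convergence twice, in s for fixed t and then in t. Continuity of the inner
  integral in t is proved in order to have a measurable integrand outside.\<close>

lemma state_tendsto:
  assumes h: "h \<in> Cc" and f: "f \<in> Cc_C0" and y: "y \<longlonglongrightarrow> z"
    and H: "\<And>n. Hn n \<in> closed_subgroups" "H \<in> closed_subgroups"
    and \<tau>: "\<And>n. \<tau>s n \<in> characters" "\<tau> \<in> characters"
    and lim: "\<And>u. (\<lambda>n. twper (Hn n) (\<tau>s n) h u) \<longlonglongrightarrow> twper H \<tau> h u"
  shows "(\<lambda>n. LINT t|\<mu>. LINT s|\<mu>. f t (act s (y n)) * twper (Hn n) (\<tau>s n) h (s - t) * cnj (h s)) \<longlonglongrightarrow>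
     (LINT t|\<mu>. LINT s|\<mu>. f t (act s z) * twper H \<tau> h (s - t) * cnj (h s))"
proof -
  obtain K Bh where K: "compact K" "\<And>s. s \<notin> K \<Longrightarrow> h s = 0" and Bh: "0 \<le> Bh" "\<And>s. cmod (h s) \<le> Bh"
    using Cc_bounded[OF h] by metis
  obtain Kf where Kf: "compact Kf" "\<And>s. s \<notin> Kf \<Longrightarrow> f s = (\<lambda>x. 0)" using Cc_C0_support[OF f] by metis
  obtain Bf where Bf: "0 < Bf" "\<And>s x. cmod (f s x) \<le> Bf" using Cc_C0_bounded[OF f] by metis
  have D: "compact (K + uminus ` Kf)" by (intro compact_plus compact_uminus K(1) Kf(1))
  obtain M where M: "0 \<le> M" "\<And>H \<tau> u. H \<in> closed_subgroups \<Longrightarrow> \<tau> \<in> characters \<Longrightarrow> u \<in> K + uminus ` Kf \<Longrightarrow> cmod (twper H \<tau> h u) \<le> M"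
    using twper_bound[OF h D] by metis
  define \<Phi> where "\<Phi> H \<tau> y t = (LINT s|\<mu>. f t (act s y) * twper H \<tau> h (s - t) * cnj (h s))" for H \<tau> y t
  have cont: "continuous_on UNIV (\<Phi> H \<tau> y)" if H: "H \<in> closed_subgroups" and \<tau>: "\<tau> \<in> characters" for H \<tau> y
  proof (rule sequential_continuity)
    fix u l assume u: "u \<longlonglongrightarrow> (l :: 'g)"
    note tc = twper_continuous[OF H \<tau> h]
    show "(\<lambda>n. \<Phi> H \<tau> y (u n)) \<longlonglongrightarrow> \<Phi> H \<tau> y l"
      unfolding \<Phi>_def
    proof (rule matrix_coefficient_tendsto[OF h K(2,1) f Kf(2) tc tc M(1) M(2)[OF H \<tau>] u tendsto_const])
      fix s
      have "(\<lambda>n. s - u n) \<longlonglongrightarrow> s - l" by (intro tendsto_intros u)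
      from continuous_on_tendsto_compose[OF tc this]
      show "(\<lambda>n. twper H \<tau> h (s - u n)) \<longlonglongrightarrow> twper H \<tau> h (s - l)" by simp
    qed
  qed
  have bound: "cmod (\<Phi> H \<tau> y t) \<le> Bf * M * Bh * measure \<mu> K" if H: "H \<in> closed_subgroups" and \<tau>: "\<tau> \<in> characters" for H \<tau> y t
    unfolding \<Phi>_def
  proof (rule integrable_compact_support(2)[OF sets_mu(1) K(1) mu_compact[OF K(1)]])
    have "continuous_on UNIV (\<lambda>s. f t (act s y))"
      by (rule continuous_on_compose2[OF C0_continuous[OF Cc_C0_C0[OF f]] continuous_act(2)]) simp
    moreover have "continuous_on UNIV (\<lambda>s. twper H \<tau> h (s - t))"
      by (rule continuous_on_compose2[OF twper_continuous[OF H \<tau> h]]) (auto intro!: continuous_intros)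
    ultimately show "(\<lambda>s. f t (act s y) * twper H \<tau> h (s - t) * cnj (h s)) \<in> borel_measurable borel"
      by (intro continuous_borel continuous_on_mult continuous_on_cnj Cc_continuous[OF h])
    show "cmod (f t (act s y) * twper H \<tau> h (s - t) * cnj (h s)) \<le> Bf * M * Bh" for s
    proof (cases "s \<in> K \<and> t \<in> Kf")
      case True
      then have "s + - t \<in> K + uminus ` Kf" by (intro set_plus_intro imageI) auto
      then have "cmod (twper H \<tau> h (s - t)) \<le> M" using M(2)[OF H \<tau>] by simp
      then show ?thesis unfolding norm_mult complex_mod_cnj
        using Bf M(1) Bh by (intro mult_mono mult_nonneg_nonneg) (auto intro: less_imp_le)
    next
      case False
      then have z: "f t (act s y) * twper H \<tau> h (s - t) * cnj (h s) = 0" using K(2)[of s] Kf(2)[of t] by auto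
      show ?thesis unfolding z using Bf(1) M(1) Bh(1) by simp
    qed
  qed (simp add: K(2))
  have "(\<lambda>n. LINT t|\<mu>. \<Phi> (Hn n) (\<tau>s n) (y n) t) \<longlonglongrightarrow> (LINT t|\<mu>. \<Phi> H \<tau> z t)"
  proof (rule tendsto_integral_compact_support[OF sets_mu(1) Kf(1) mu_compact[OF Kf(1)]
        continuous_borel[OF cont[OF H(1) \<tau>(1)]] continuous_borel[OF cont[OF H(2) \<tau>(2)]] _ bound[OF H(1) \<tau>(1)]])
    show "\<Phi> (Hn n) (\<tau>s n) (y n) t = 0" if "t \<notin> Kf" for n t using Kf(2)[OF that] by (simp add: \<Phi>_def)
    show "AE t in \<mu>. (\<lambda>n. \<Phi> (Hn n) (\<tau>s n) (y n) t) \<longlonglongrightarrow> \<Phi> H \<tau> z t"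
      unfolding \<Phi>_def
      by (intro AE_I2 matrix_coefficient_tendsto[OF h K(2,1) f Kf(2) twper_continuous[OF H(1) \<tau>(1) h]
          twper_continuous[OF H(2) \<tau>(2) h] M(1) M(2)[OF H(1) \<tau>(1)] tendsto_const y lim])
  qed
  then show ?thesis by (simp add: \<Phi>_def)
qed

lemma norm_tendsto:
  assumes h: "h \<in> Cc"
    and H: "\<And>n. Hn n \<in> closed_subgroups" "H \<in> closed_subgroups"
    and \<tau>: "\<And>n. \<tau>s n \<in> characters" "\<tau> \<in> characters"
    and lim: "\<And>u. (\<lambda>n. twper (Hn n) (\<tau>s n) h u) \<longlonglongrightarrow> twper H \<tau> h u"
  shows "(\<lambda>n. LINT s|\<mu>. twper (Hn n) (\<tau>s n) h s * cnj (h s)) \<longlonglongrightarrow> (LINT s|\<mu>. twper H \<tau> h s * cnj (h s))"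
proof -
  obtain K B where K: "compact K" "\<And>s. s \<notin> K \<Longrightarrow> h s = 0" and B: "0 \<le> B" "\<And>s. cmod (h s) \<le> B"
    using Cc_bounded[OF h] by metis
  obtain M where M: "0 \<le> M" "\<And>H \<tau> u. H \<in> closed_subgroups \<Longrightarrow> \<tau> \<in> characters \<Longrightarrow> u \<in> K \<Longrightarrow> cmod (twper H \<tau> h u) \<le> M"
    using twper_bound[OF h K(1)] by metis
  have meas: "(\<lambda>s. twper H \<tau> h s * cnj (h s)) \<in> borel_measurable borel" if "H \<in> closed_subgroups" "\<tau> \<in> characters" for H \<tau>
    by (intro continuous_borel continuous_on_mult continuous_on_cnj Cc_continuous[OF h] twper_continuous that h)
  show ?thesis
  proof (rule tendsto_integral_compact_support[OF sets_mu(1) K(1) mu_compact[OF K(1)] meas[OF H(1) \<tau>(1)] meas[OF H(2) \<tau>(2)]])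
    show "cmod (twper (Hn n) (\<tau>s n) h s * cnj (h s)) \<le> M * B" for n s
    proof (cases "s \<in> K")
      case True
      then show ?thesis unfolding norm_mult complex_mod_cnj
        using M(2)[OF H(1) \<tau>(1)] B M(1) by (intro mult_mono) auto
    qed (use K(2) M(1) B(1) in simp)
    show "AE s in \<mu>. (\<lambda>n. twper (Hn n) (\<tau>s n) h s * cnj (h s)) \<longlonglongrightarrow> twper H \<tau> h s * cnj (h s)"
      by (intro AE_I2 tendsto_mult tendsto_const lim)
  qed (simp add: K(2))
qed

text \<open>Were it zero, Weil's formula would make the integral of f0 vanish, so the open set where
  f0 is positive would be null; countably many of its translates cover G, and \<mu> would be 0. This
  rules out the zero subspace in \<open>cls_dense\<close>.\<close>

lemma cls_f0_nonzero:
  assumes H: "H \<in> closed_subgroups"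
  shows "cls H (\<lambda>s. complex_of_real (f0 s)) \<noteq> vzero (L2 (\<nu> H))"
proof
  let ?g = "\<lambda>s. complex_of_real (f0 s)"
  assume "cls H ?g = vzero (L2 (\<nu> H))"
  then have "P H ?g \<in> l2_class (\<nu> H) (\<lambda>_. 0)"
    using l2_class_self[OF P_square_integrable[OF H f0_complex]] by (simp add: cls_def L2_simps)
  then have ae: "AE c in \<nu> H. P H ?g c = 0" by (simp add: l2_class_def)
  have "(LINT c|\<nu> H. P H ?g c) = (LINT c|\<nu> H. 0)"
    by (rule integral_cong_AE[OF P_measurable[OF H f0_complex] _ ae]) simp
  then have "complex_of_real (LINT s|\<mu>. f0 s) = 0"
    using weil[OF H f0_complex] by simp
  then have i0: "(LINT s|\<mu>. f0 s) = 0" by simp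
  obtain K where K: "compact K" "\<And>s. s \<notin> K \<Longrightarrow> f0 s = 0" using Cc_bounded[OF f0(1)] by metis
  have "integrable \<mu> f0"
    by (rule integrable_compact_support(1)[OF sets_mu(1) K(1) mu_compact[OF K(1)] continuous_borel[OF Cc_continuous[OF f0(1)]] K(2), of 1])
      (use f0 in auto)
  then have ae0: "AE s in \<mu>. f0 s = 0" using integral_nonneg_eq_0_iff_AE[of \<mu> f0] f0(3) i0 by auto
  define U where "U = {s. 0 < f0 s}"
  have U: "open U" unfolding U_def by (intro open_Collect_less continuous_intros Cc_continuous f0)
  have "AE s in \<mu>. s \<notin> U" using ae0 by eventually_elim (simp add: U_def)
  then have U0: "emeasure \<mu> U = 0"
    using U by (subst (asm) AE_iff_measurable[where N = U]) (auto simp: sets_mu)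
  have sh: "(+) k ` U = (\<lambda>r. r - k) -` U" for k :: 'g
    by (auto intro!: image_eqI[of _ _ "_ - k"])
  have oU: "open ((+) k ` U)" for k unfolding sh by (intro open_vimage U continuous_intros)
  have kU: "emeasure \<mu> ((+) k ` U) = 0" for k using haar U U0 by (simp add: haar_measure_def sets_mu)
  obtain \<F>' where F': "\<F>' \<subseteq> range (\<lambda>k. (+) k ` U)" "countable \<F>'" "\<Union>\<F>' = \<Union>(range (\<lambda>k. (+) k ` U))"
    using Lindelof[of "range (\<lambda>k. (+) k ` U)"] oU by blast
  have "k \<in> (+) k ` U" for k by (auto intro!: image_eqI[of _ _ 0] simp: U_def f0(2))
  then have "\<Union>\<F>' = UNIV" using F'(3) by blast
  moreover have "(\<Union>V\<in>\<F>'. V) \<in> null_sets \<mu>"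
  proof (rule null_sets_UN'[OF F'(2)])
    fix V assume "V \<in> \<F>'"
    then obtain k where "V = (+) k ` U" using F'(1) by blast
    then show "V \<in> null_sets \<mu>" using kU oU by (simp add: null_sets_def sets_mu)
  qed
  ultimately have "emeasure \<mu> UNIV = 0" by (simp add: null_sets_def)
  then show False using haar by (simp add: haar_measure_def)
qed

end

section \<open>Convergence of vector states\<close>

locale induced_rep = induced_system act \<mu> f0 \<alpha> \<nu>
  for act :: "'g::{topological_ab_group_add, second_countable_topology, t2_space} \<Rightarrow>
      'x::{second_countable_topology, t2_space} \<Rightarrow> 'x" and \<mu> :: "'g measure" and f0 :: "'g \<Rightarrow> real"
    and \<alpha> :: "'g set \<Rightarrow> 'g measure" and \<nu> :: "'g set \<Rightarrow> 'g set measure" +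
  fixes z :: 'x and \<tau> :: "'g \<Rightarrow> complex"
  assumes \<tau>: "\<tau> \<in> characters"
    and \<rho>z: "induced_pair act (\<nu> (stabilizer act z)) z \<tau> \<in> covariant_reps act"
begin

sublocale nontrivial_transformation_group act \<mu> "ip z \<tau>"
  by unfold_locales (rule \<rho>z)

abbreviation S where "S \<equiv> stabilizer act z"

text \<open>Keeps Riemann sums inside the space of classes \<open>cls H h\<close> during the density
  argument.\<close>

lemma vsum_cls:
  assumes H: "H \<in> closed_subgroups"
  shows "(\<And>i. i < n \<Longrightarrow> g i \<in> Cc) \<Longrightarrow> \<exists>h\<in>Cc. vsum (L2 (\<nu> H)) (\<lambda>i. vscale (L2 (\<nu> H)) (c i) (cls H (g i))) n = cls H h"
proof (induction n)
  case 0
  have "(\<lambda>s. 0) \<in> (Cc :: ('g \<Rightarrow> complex) set)" by (rule CcI[of _ "{}"]) auto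
  then show ?case by (auto simp: cls_zero)
next
  case (Suc n)
  obtain h where h: "h \<in> Cc" "vsum (L2 (\<nu> H)) (\<lambda>i. vscale (L2 (\<nu> H)) (c i) (cls H (g i))) n = cls H h"
    using Suc by (meson less_SucI)
  have gn: "g n \<in> Cc" by (rule Suc.prems) simp
  have cg: "(\<lambda>s. c n * g n s) \<in> Cc" using Cc_mult[OF gn continuous_on_const, of "c n"] by (simp add: mult.commute)
  have sum: "(\<lambda>s. h s + c n * g n s) \<in> Cc"
  proof -
    obtain K where K: "compact K" "\<And>s. s \<notin> K \<Longrightarrow> h s = 0" using Cc_bounded[OF h(1)] by metis
    obtain L where L: "compact L" "\<And>s. s \<notin> L \<Longrightarrow> c n * g n s = 0" using Cc_bounded[OF cg] by metis
    have "continuous_on UNIV (\<lambda>s. h s + c n * g n s)"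
      by (rule continuous_on_add[OF Cc_continuous[OF h(1)] Cc_continuous[OF cg]])
    then show ?thesis by (rule CcI[OF _ compact_Un[OF K(1) L(1)]]) (use K(2) L(2) in auto)
  qed
  have "vsum (L2 (\<nu> H)) (\<lambda>i. vscale (L2 (\<nu> H)) (c i) (cls H (g i))) (Suc n) = cls H (\<lambda>s. h s + c n * g n s)"
    by (simp add: h(2) cls_scale[OF H gn] cls_add[OF H h(1) cg])
  then show ?case using sum by blast
qed

text \<open>By irreducibility: the closure of the classes \<open>cls S h\<close> is a nonzero invariant subspace.\<close>

lemma cls_dense:
  assumes sp: "rep_class A (integrated_form (ip z \<tau>)) \<in> spectrum A"
    and \<xi>: "\<xi> \<in> vectors (L2 (\<nu> S))" and \<epsilon>: "0 < \<epsilon>"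
  shows "\<exists>h\<in>Cc. vnorm (L2 (\<nu> S)) (vdiff (L2 (\<nu> S)) \<xi> (cls S h)) < \<epsilon>"
proof -
  interpret z: covariant_rep act \<mu> "ip z \<tau>" by (rule covariant_repI[OF \<rho>z])
  let ?H = "L2 (\<nu> S)"
  have hs: "hilbert_space ?H" using z.hilbert_space_axioms by simp
  interpret hilbert_space ?H by (rule hs)
  have S: "S \<in> closed_subgroups" by (rule stabilizer_closed_subgroup)
  note cv = cls_vectors[OF S]
  define V where "V = {\<xi> \<in> vectors ?H. \<forall>\<epsilon>>0. \<exists>h\<in>Cc. vnorm ?H (vdiff ?H \<xi> (cls S h)) < \<epsilon>}"
  have VH: "\<xi> \<in> vectors ?H" if "\<xi> \<in> V" for \<xi> using that by (simp add: V_def)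
  have Vap: "\<exists>h\<in>Cc. vnorm ?H (vdiff ?H \<xi> (cls S h)) < \<epsilon>" if "\<xi> \<in> V" "0 < \<epsilon>" for \<xi> \<epsilon>
    using that by (simp add: V_def)
  have Vcls: "cls S h \<in> V" if "h \<in> Cc" for h
    unfolding V_def using that cv[OF that] by (auto intro!: bexI[of _ h])
  \<comment> \<open>V is closed, so it suffices below to approximate by members of V; the closure
    properties and the invariance of V are all obtained through this.\<close>
  have Vlim: "\<xi> \<in> V" if \<xi>: "\<xi> \<in> vectors ?H" and ap: "\<And>\<epsilon>. 0 < \<epsilon> \<Longrightarrow> \<exists>\<eta>\<in>V. vnorm ?H (vdiff ?H \<xi> \<eta>) < \<epsilon>" for \<xi>
    unfolding V_def
  proof (intro CollectI conjI allI impI \<xi>)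
    fix \<epsilon> :: real assume "0 < \<epsilon>"
    then have e: "0 < \<epsilon> / 2" by simp
    have "\<exists>\<eta>\<in>V. vnorm ?H (vdiff ?H \<xi> \<eta>) < \<epsilon> / 2" by (rule ap[OF e])
    then obtain \<eta> where \<eta>: "\<eta> \<in> V" "vnorm ?H (vdiff ?H \<xi> \<eta>) < \<epsilon> / 2" by (rule bexE)
    obtain h where h: "h \<in> Cc" "vnorm ?H (vdiff ?H \<eta> (cls S h)) < \<epsilon> / 2" using Vap[OF \<eta>(1) e] by (rule bexE)
    have "vnorm ?H (vdiff ?H \<xi> (cls S h)) < \<epsilon>"
      using norm_diff_triangle[OF \<xi> VH[OF \<eta>(1)] cv[OF h(1)]] \<eta>(2) h(2) by linarith
    then show "\<exists>h\<in>Cc. vnorm ?H (vdiff ?H \<xi> (cls S h)) < \<epsilon>" using h(1) by (rule bexI)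
  qed
  have csub: "closed_subspace ?H V"
    unfolding closed_subspace_def
  proof (intro conjI ballI allI impI)
    show "V \<subseteq> vectors ?H" using VH by blast
    have "(\<lambda>s. 0) \<in> (Cc :: ('g \<Rightarrow> complex) set)" by (rule CcI[of _ "{}"]) auto
    then show "vzero ?H \<in> V" using Vcls by (simp add: cls_zero)
    show "vadd ?H \<xi> \<eta> \<in> V" if "\<xi> \<in> V" "\<eta> \<in> V" for \<xi> \<eta>
    proof (rule Vlim)
      note v = VH[OF \<open>\<xi> \<in> V\<close>] VH[OF \<open>\<eta> \<in> V\<close>]
      show "vadd ?H \<xi> \<eta> \<in> vectors ?H" using v by simp
      fix \<epsilon> :: real assume "0 < \<epsilon>"
      then have e: "0 < \<epsilon> / 2" by simp
      obtain h where h: "h \<in> Cc" "vnorm ?H (vdiff ?H \<xi> (cls S h)) < \<epsilon> / 2" using Vap[OF \<open>\<xi> \<in> V\<close> e] by (rule bexE)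
      obtain g where g: "g \<in> Cc" "vnorm ?H (vdiff ?H \<eta> (cls S g)) < \<epsilon> / 2" using Vap[OF \<open>\<eta> \<in> V\<close> e] by (rule bexE)
      have "\<exists>k\<in>Cc. vsum ?H (\<lambda>i. vscale ?H 1 (cls S (if i = 0 then h else g))) 2 = cls S k"
        by (rule vsum_cls[OF S]) (use h(1) g(1) in auto)
      then obtain k where k: "k \<in> Cc" "vadd ?H (cls S h) (cls S g) = cls S k"
        using cv[OF h(1)] cv[OF g(1)] add_commute[OF zero_closed] add_zero
        by (auto simp: numeral_2_eq_2 scale_one)
      have "vnorm ?H (vdiff ?H (vadd ?H \<xi> \<eta>) (cls S k)) < \<epsilon>"
        using norm_diff_add_le[OF v cv[OF h(1)] cv[OF g(1)]] h(2) g(2) k(2) by simp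
      then show "\<exists>\<zeta>\<in>V. vnorm ?H (vdiff ?H (vadd ?H \<xi> \<eta>) \<zeta>) < \<epsilon>" using Vcls[OF k(1)] by (rule bexI)
    qed
    show "vscale ?H c \<xi> \<in> V" if "\<xi> \<in> V" for c \<xi>
    proof (rule Vlim)
      note v = VH[OF \<open>\<xi> \<in> V\<close>]
      show "vscale ?H c \<xi> \<in> vectors ?H" using v by simp
      fix \<epsilon> :: real assume \<epsilon>: "0 < \<epsilon>"
      have p: "0 < cmod c + 1" by (simp add: add_nonneg_pos)
      have e: "0 < \<epsilon> / (cmod c + 1)" using \<epsilon> p by simp
      obtain h where h: "h \<in> Cc" "vnorm ?H (vdiff ?H \<xi> (cls S h)) < \<epsilon> / (cmod c + 1)"
        using Vap[OF \<open>\<xi> \<in> V\<close> e] by (rule bexE)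
      have ch: "(\<lambda>s. c * h s) \<in> Cc" using Cc_mult[OF h(1) continuous_on_const, of c] by (simp add: mult.commute)
      have "vnorm ?H (vdiff ?H (vscale ?H c \<xi>) (cls S (\<lambda>s. c * h s))) = cmod c * vnorm ?H (vdiff ?H \<xi> (cls S h))"
        using norm_diff_scale[OF v cv[OF h(1)], of c] by (simp add: cls_scale[OF S h(1)])
      also have "\<dots> \<le> (cmod c + 1) * vnorm ?H (vdiff ?H \<xi> (cls S h))"
        using v cv[OF h(1)] by (intro mult_right_mono) auto
      also have "\<dots> < (cmod c + 1) * (\<epsilon> / (cmod c + 1))" by (rule mult_strict_left_mono[OF h(2) p])
      finally have "vnorm ?H (vdiff ?H (vscale ?H c \<xi>) (cls S (\<lambda>s. c * h s))) < \<epsilon>" using p by simp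
      then show "\<exists>\<zeta>\<in>V. vnorm ?H (vdiff ?H (vscale ?H c \<xi>) \<zeta>) < \<epsilon>" using Vcls[OF ch] by (rule bexI)
    qed
    show "\<xi> \<in> V" if "\<xi> \<in> vectors ?H" "\<forall>\<epsilon>>0. \<exists>\<eta>\<in>V. vnorm ?H (vdiff ?H \<xi> \<eta>) < \<epsilon>" for \<xi>
      by (rule Vlim[OF that(1)]) (use that(2) in simp)
  qed
  \<comment> \<open>The Riemann sums of the weak integral that defines the integrated form are again
    classes, by \<open>cls_action\<close> and \<open>vsum_cls\<close>.\<close>
  have f_inv: "integrated f (ip z \<tau>) (cls S h) \<in> V" if f: "f \<in> Cc_C0" and h: "h \<in> Cc" for f h
  proof (rule Vlim)
    have hv: "cls S h \<in> vectors ?H" by (rule cv[OF h])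
    let ?F = "\<lambda>t. frep (ip z \<tau>) (f t) (grep (ip z \<tau>) t (cls S h))"
    have int: "integrated f (ip z \<tau>) (cls S h) = integrated_op \<mu> (ip z \<tau>) f (cls S h)" using \<rho>z by (simp add: integrated_def)
    show iv: "integrated f (ip z \<tau>) (cls S h) \<in> vectors ?H"
      using z.integrated_op_closed[OF f] hv by (simp add: int)
    obtain K where K: "compact K" "\<And>s. s \<notin> K \<Longrightarrow> f s = (\<lambda>x. 0)" using Cc_C0_support[OF f] by metis
    fix \<epsilon> :: real assume "0 < \<epsilon>"
    then have e: "0 < \<epsilon> / 2" by simp
    have Fv: "?F t \<in> vectors ?H" for t
      using z.frep_closed[OF Cc_C0_C0[OF f] z.grep_closed] hv by simp
    have F0: "?F t = vzero ?H" if "t \<notin> K" for t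
      using z.frep_zero[OF z.grep_closed] hv K(2)[OF that] by simp
    have Fc: "eventually (\<lambda>s'. vnorm ?H (vdiff ?H (?F s') (?F s)) \<le> \<epsilon>) (nhds s)" if "0 < \<epsilon>" for s \<epsilon>
      using z.frep_grep_eventually[OF f _ that] hv by simp
    have "\<exists>n p (c :: nat \<Rightarrow> real). (\<forall>i<n. p i \<in> K) \<and> (\<forall>\<eta>\<in>vectors ?H. cmod ((LINT s|\<mu>. vinner ?H (?F s) \<eta>) -
       vinner ?H (vsum ?H (\<lambda>i. vscale ?H (c i) (?F (p i))) n) \<eta>) \<le> \<epsilon> / 2 * vnorm ?H \<eta>)"
      by (rule weak_integral_approx[OF sets_mu(1) K(1) mu_compact[OF K(1)] Fv F0 Fc e])
    then obtain n p and c :: "nat \<Rightarrow> real" where ap: "\<forall>\<eta>\<in>vectors ?H. cmod ((LINT s|\<mu>. vinner ?H (?F s) \<eta>) -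
       vinner ?H (vsum ?H (\<lambda>i. vscale ?H (c i) (?F (p i))) n) \<eta>) \<le> \<epsilon> / 2 * vnorm ?H \<eta>" by auto
    let ?g = "\<lambda>i s. f (p i) (act s z) * (\<tau> (p i) * h (s - p i))"
    have "\<exists>k\<in>Cc. vsum ?H (\<lambda>i. vscale ?H (complex_of_real (c i)) (cls S (?g i))) n = cls S k"
      by (rule vsum_cls[OF S]) (rule cls_action(2)[OF h f])
    then obtain k where k: "k \<in> Cc" "vsum ?H (\<lambda>i. vscale ?H (complex_of_real (c i)) (cls S (?g i))) n = cls S k"
      by (rule bexE)
    have k2: "vsum ?H (\<lambda>i. vscale ?H (complex_of_real (c i)) (?F (p i))) n = cls S k"
      unfolding k(2)[symmetric] by (simp only: cls_action(1)[OF h f])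
    have "vnorm ?H (vdiff ?H (integrated f (ip z \<tau>) (cls S h)) (cls S k)) \<le> \<epsilon> / 2"
    proof (rule norm_leI)
      fix \<eta> assume \<eta>: "\<eta> \<in> vectors ?H"
      have "vinner ?H (integrated f (ip z \<tau>) (cls S h)) \<eta> = (LINT s|\<mu>. vinner ?H (?F s) \<eta>)"
        using z.integrated_op_inner[OF f] hv \<eta> by (simp add: int)
      then show "cmod (vinner ?H (vdiff ?H (integrated f (ip z \<tau>) (cls S h)) (cls S k)) \<eta>) \<le> \<epsilon> / 2 * vnorm ?H \<eta>"
        using bspec[OF ap \<eta>] by (simp add: inner_diff[OF iv cv[OF k(1)] \<eta>] k2)
    qed (use iv cv[OF k(1)] e in auto)
    then have "vnorm ?H (vdiff ?H (integrated f (ip z \<tau>) (cls S h)) (cls S k)) < \<epsilon>" using \<open>0 < \<epsilon>\<close> by linarith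
    then show "\<exists>\<eta>\<in>V. vnorm ?H (vdiff ?H (integrated f (ip z \<tau>) (cls S h)) \<eta>) < \<epsilon>" using Vcls[OF k(1)] by (rule bexI)
  qed
  have inv: "a (ip z \<tau>) \<xi> \<in> V" if a: "a \<in> elems A" and \<xi>: "\<xi> \<in> V" for a \<xi>
  proof (rule Vlim)
    have v: "\<xi> \<in> vectors ?H" by (rule VH[OF \<xi>])
    have av: "a (ip z \<tau>) \<eta> \<in> vectors ?H" if "\<eta> \<in> vectors ?H" for \<eta>
      using elems_closed[OF a \<rho>z] that by simp
    show "a (ip z \<tau>) \<xi> \<in> vectors ?H" by (rule av[OF v])
    obtain c where c: "0 < c" "op_bounded a c" by (rule elems_bounded[OF a])
    fix \<epsilon> :: real assume \<epsilon>: "0 < \<epsilon>"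
    have e: "0 < \<epsilon> / 2 / c" using \<epsilon> c by simp
    obtain h where h: "h \<in> Cc" "vnorm ?H (vdiff ?H \<xi> (cls S h)) < \<epsilon> / 2 / c" using Vap[OF \<xi> e] by (rule bexE)
    note hv = cv[OF h(1)]
    \<comment> \<open>The accuracy of f is chosen after h, since its error is multiplied by the norm
      of \<open>cls S h\<close>.\<close>
    define d where "d = \<epsilon> / 2 / (vnorm ?H (cls S h) + 1)"
    have p: "0 < vnorm ?H (cls S h) + 1" using norm_nonneg[OF hv] by linarith
    have d: "0 < d" using \<epsilon> p by (simp add: d_def)
    obtain f where f: "f \<in> Cc_C0" "op_close a (integrated f) d" by (rule elems_approx[OF a d])
    have bd: "op_bounded a c \<Longrightarrow> \<eta> \<in> vectors ?H \<Longrightarrow> vnorm ?H (a (ip z \<tau>) \<eta>) \<le> c * vnorm ?H \<eta>" for \<eta>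
      using \<rho>z unfolding op_bounded_def by force
    have "vdiff ?H (a (ip z \<tau>) \<xi>) (a (ip z \<tau>) (cls S h)) = a (ip z \<tau>) (vdiff ?H \<xi> (cls S h))"
      using bounded_operatorD(4)[of "a (ip z \<tau>)" \<xi> "cls S h"] op_familyD(1)[OF elems_family[OF a] \<rho>z] v hv by simp
    then have "vnorm ?H (vdiff ?H (a (ip z \<tau>) \<xi>) (a (ip z \<tau>) (cls S h))) \<le> c * vnorm ?H (vdiff ?H \<xi> (cls S h))"
      using bd[OF c(2) diff_closed[OF v hv]] by simp
    also have "\<dots> < c * (\<epsilon> / 2 / c)" by (rule mult_strict_left_mono[OF h(2) c(1)])
    finally have 1: "vnorm ?H (vdiff ?H (a (ip z \<tau>) \<xi>) (a (ip z \<tau>) (cls S h))) < \<epsilon> / 2" using c(1) by simp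
    have "vnorm ?H (vdiff ?H (a (ip z \<tau>) (cls S h)) (integrated f (ip z \<tau>) (cls S h))) \<le> d * vnorm ?H (cls S h)"
      using f(2) \<rho>z hv unfolding op_close_def by force
    also have "\<dots> \<le> d * (vnorm ?H (cls S h) + 1)" using d by (intro mult_left_mono) auto
    also have "\<dots> = \<epsilon> / 2" using p by (simp add: d_def field_simps)
    finally have 2: "vnorm ?H (vdiff ?H (a (ip z \<tau>) (cls S h)) (integrated f (ip z \<tau>) (cls S h))) \<le> \<epsilon> / 2" .
    have "vnorm ?H (vdiff ?H (a (ip z \<tau>) \<xi>) (integrated f (ip z \<tau>) (cls S h))) < \<epsilon>"
      using norm_diff_triangle[OF av[OF v] av[OF hv] VH[OF f_inv[OF f(1) h(1)]]] 1 2 by linarith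
    then show "\<exists>\<eta>\<in>V. vnorm ?H (vdiff ?H (a (ip z \<tau>) \<xi>) \<eta>) < \<epsilon>" using f_inv[OF f(1) h(1)] by (rule bexI)
  qed
  have "closed_subspace (cspace (ip z \<tau>)) V" using csub by simp
  then have "V = {vzero (cspace (ip z \<tau>))} \<or> V = vectors (cspace (ip z \<tau>))"
    by (rule spectrum_irreducible[OF sp \<rho>z]) (rule inv)
  then have "V = {vzero ?H} \<or> V = vectors ?H" by simp
  moreover have "V \<noteq> {vzero ?H}" using Vcls[OF f0_complex] cls_f0_nonzero[OF S] by auto
  ultimately have "\<xi> \<in> V" using \<xi> by blast
  then show ?thesis using Vap \<epsilon> by blast
qed

end

text \<open>Turns the failure of a statement that should hold eventually and uniformly on K into a
  convergent sequence of counterexamples along a subsequence.\<close>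

lemma subsequence_compact:
  fixes K :: "'a::first_countable_topology set"
  assumes K: "compact K" and P: "frequently (\<lambda>n. \<exists>r\<in>K. P n r) sequentially"
  shows "\<exists>g r r0. strict_mono (g :: nat \<Rightarrow> nat) \<and> (\<forall>i. r i \<in> K \<and> P (g i) (r i)) \<and> r0 \<in> K \<and> r \<longlonglongrightarrow> r0"
proof -
  have "infinite {n. \<exists>r\<in>K. P n r}" using P by (simp add: cofinite_eq_sequentially[symmetric] frequently_cofinite)
  then obtain g :: "nat \<Rightarrow> nat" where g: "strict_mono g" "\<And>i. g i \<in> {n. \<exists>r\<in>K. P n r}"
    using infinite_enumerate by blast
  then have "\<forall>i. \<exists>r\<in>K. P (g i) r" by simp
  then obtain r where r: "\<And>i. r i \<in> K" "\<And>i. P (g i) (r i)" by metis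
  obtain r0 h where h: "r0 \<in> K" "strict_mono h" "(r \<circ> h) \<longlonglongrightarrow> r0"
    using compact_imp_seq_compact[OF K] r(1) unfolding seq_compact_def by metis
  show ?thesis
    using strict_mono_o[OF g(1) h(2)] r h by (intro exI[of _ "g \<circ> h"] exI[of _ "r \<circ> h"] exI[of _ r0]) auto
qed

text \<open>The pairs at \<open>x n\<close> are known to be covariant only from some n on:
  convergence in the spectrum says nothing about finitely many terms.\<close>

locale induced_sequence = induced_rep act \<mu> f0 \<alpha> \<nu> z \<tau>
  for act :: "'g::{topological_ab_group_add, second_countable_topology, t2_space} \<Rightarrow>
      'x::{second_countable_topology, t2_space} \<Rightarrow> 'x" and \<mu> :: "'g measure" and f0 :: "'g \<Rightarrow> real"
    and \<alpha> :: "'g set \<Rightarrow> 'g measure" and \<nu> :: "'g set \<Rightarrow> 'g set measure"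
    and z :: 'x and \<tau> :: "'g \<Rightarrow> complex" +
  fixes x :: "nat \<Rightarrow> 'x" and \<tau>s :: "nat \<Rightarrow> 'g \<Rightarrow> complex"
  assumes fell: "limitin fell_topology (\<lambda>n. stabilizer act (x n)) (stabilizer act z) sequentially"
    and \<tau>s: "\<And>n. \<tau>s n \<in> characters"
    and spec: "limitin (spectrum_topology A) (\<lambda>n. rep_class A (integrated_form (ip (x n) (\<tau>s n))))
          (rep_class A (integrated_form (ip z \<tau>))) sequentially"
    and \<rho>s: "eventually (\<lambda>n. ip (x n) (\<tau>s n) \<in> R) sequentially"
begin

abbreviation "Sn n \<equiv> stabilizer act (x n)"

lemmas subgroups = stabilizer_closed_subgroup[of z] stabilizer_closed_subgroup[of "x _"]

text \<open>G is abelian, so \<open>r i\<close> fixes every point of the orbit of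
  \<open>x (g i)\<close>, in particular the translated points that converge to z; the equation
  passes to the limit.\<close>

lemma stabilizer_limit:
  assumes y: "(\<lambda>n. act (t n) (x n)) \<longlonglongrightarrow> z" and g: "strict_mono (g :: nat \<Rightarrow> nat)"
    and r: "\<And>i. r i \<in> Sn (g i)" "r \<longlonglongrightarrow> r0"
  shows "r0 \<in> S"
proof -
  have yg: "(\<lambda>i. act (t (g i)) (x (g i))) \<longlonglongrightarrow> z" using LIMSEQ_subseq_LIMSEQ[OF y g] by (simp add: o_def)
  have "act (r i) (act (t (g i)) (x (g i))) = act (t (g i)) (x (g i))" for i
  proof -
    have "act (r i) (act (t (g i)) (x (g i))) = act (t (g i)) (act (r i) (x (g i)))"
      by (simp flip: act_add add: add.commute)
    then show ?thesis using r(1)[of i] by (simp add: stabilizer_def)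
  qed
  then have "(\<lambda>i. act (t (g i)) (x (g i))) \<longlonglongrightarrow> act r0 z" using act_tendsto[OF r(2) yg] by simp
  then have "act r0 z = z" using LIMSEQ_unique yg by blast
  then show ?thesis by (simp add: stabilizer_def)
qed

text \<open>A failure yields points \<open>r i\<close> of the stabilizers in K and values
  \<open>\<tau>s (g i) (r i)\<close> on the unit circle that converge along a subsequence. These
  values are the scalars by which \<open>r i\<close> acts, so \<open>eigenvalue_convergence\<close>
  identifies their limit with the value of \<tau> at the limit point, contradicting the gap
  \<epsilon>.\<close>

lemma character_convergence:
  assumes y: "(\<lambda>n. act (t n) (x n)) \<longlonglongrightarrow> z" and K: "compact K" and \<epsilon>: "0 < \<epsilon>"
  shows "eventually (\<lambda>n. \<forall>r\<in>Sn n \<inter> K. cmod (\<tau>s n r - \<tau> r) \<le> \<epsilon>) sequentially"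
proof (rule ccontr)
  let ?P = "\<lambda>n p. fst p \<in> Sn n \<and> snd p = \<tau>s n (fst p) \<and> \<epsilon> < cmod (\<tau>s n (fst p) - \<tau> (fst p)) \<and> ip (x n) (\<tau>s n) \<in> R"
  \<comment> \<open>Points and eigenvalues are kept as pairs in one compact set, so that a single
    subsequence makes both converge.\<close>
  let ?K = "K \<times> sphere (0 :: complex) 1"
  assume "\<not> eventually (\<lambda>n. \<forall>r\<in>Sn n \<inter> K. cmod (\<tau>s n r - \<tau> r) \<le> \<epsilon>) sequentially"
  then have "frequently (\<lambda>n. \<exists>r\<in>Sn n \<inter> K. \<epsilon> < cmod (\<tau>s n r - \<tau> r)) sequentially"
    by (simp add: frequently_def not_less)
  then have "frequently (\<lambda>n. (\<exists>r\<in>Sn n \<inter> K. \<epsilon> < cmod (\<tau>s n r - \<tau> r)) \<and> ip (x n) (\<tau>s n) \<in> R) sequentially"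
    using frequently_eventually_conj[OF _ \<rho>s] by (subst conj_commute)
  then have fr: "frequently (\<lambda>n. \<exists>p\<in>?K. ?P n p) sequentially"
  proof (rule frequently_elim1)
    fix n assume "(\<exists>r\<in>Sn n \<inter> K. \<epsilon> < cmod (\<tau>s n r - \<tau> r)) \<and> ip (x n) (\<tau>s n) \<in> R"
    then obtain r where "r \<in> Sn n" "r \<in> K" "\<epsilon> < cmod (\<tau>s n r - \<tau> r)" "ip (x n) (\<tau>s n) \<in> R" by auto
    then show "\<exists>p\<in>?K. ?P n p" using characterD(2)[OF \<tau>s] by (intro bexI[of _ "(r, \<tau>s n r)"]) auto
  qed
  have cK: "compact ?K" by (intro compact_Times K) simp
  have "\<exists>g p p0. strict_mono (g :: nat \<Rightarrow> nat) \<and> (\<forall>i. p i \<in> ?K \<and> ?P (g i) (p i)) \<and> p0 \<in> ?K \<and> p \<longlonglongrightarrow> p0"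
    by (rule subsequence_compact[OF cK fr])
  then obtain g p p0 where g: "strict_mono (g :: nat \<Rightarrow> nat)" and p: "\<forall>i. p i \<in> ?K \<and> ?P (g i) (p i)"
    and p0: "p \<longlonglongrightarrow> p0" by (elim exE conjE) (rule that)
  define r where "r i = fst (p i)" for i
  define \<omega> where "\<omega> i = snd (p i)" for i
  have r: "r i \<in> Sn (g i)" "\<omega> i = \<tau>s (g i) (r i)" "\<epsilon> < cmod (\<tau>s (g i) (r i) - \<tau> (r i))"
    "ip (x (g i)) (\<tau>s (g i)) \<in> R" for i
    using p by (simp_all add: r_def \<omega>_def)
  have lim: "r \<longlonglongrightarrow> fst p0" "\<omega> \<longlonglongrightarrow> snd p0" unfolding r_def \<omega>_def by (intro tendsto_intros p0)+
  have r0: "fst p0 \<in> S" by (rule stabilizer_limit[OF y g r(1) lim(1)])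
  have "\<tau> (fst p0) = snd p0"
  proof (rule eigenvalue_convergence[where \<rho> = "\<lambda>n. ip (x n) (\<tau>s n)" and g = g, OF spec \<rho>z r(4) g lim])
    show "cmod (\<omega> i) = 1" for i using characterD(2)[OF \<tau>s] by (simp add: r(2))
    show "grep (ip (x (g i)) (\<tau>s (g i))) (r i) \<xi> = vscale (cspace (ip (x (g i)) (\<tau>s (g i)))) (\<omega> i) \<xi>"
      if "\<xi> \<in> vectors (cspace (ip (x (g i)) (\<tau>s (g i))))" for i \<xi>
      unfolding cspace_ip r(2) by (rule eigen_stabilizer[OF r(1)]) (use that in simp)
    show "grep (ip z \<tau>) (fst p0) \<xi> = vscale (cspace (ip z \<tau>)) (\<tau> (fst p0)) \<xi>"
      if "\<xi> \<in> vectors (cspace (ip z \<tau>))" for \<xi>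
      unfolding cspace_ip by (rule eigen_stabilizer[OF r0]) (use that in simp)
  qed
  moreover have "(\<lambda>i. \<tau> (r i)) \<longlonglongrightarrow> \<tau> (fst p0)"
    by (rule continuous_on_tendsto_compose[OF characterD(1)[OF \<tau>] lim(1)]) auto
  ultimately have "(\<lambda>i. cmod (\<omega> i - \<tau> (r i))) \<longlonglongrightarrow> cmod (snd p0 - snd p0)"
    by (intro tendsto_intros lim) simp
  moreover have "\<epsilon> \<le> cmod (\<omega> i - \<tau> (r i))" for i using r(3)[of i] by (simp add: r(2))
  ultimately have "\<epsilon> \<le> cmod (snd p0 - snd p0)" by (intro LIMSEQ_le_const) auto
  then show False using \<epsilon> by simp
qed

lemma twper_tendsto:
  assumes y: "(\<lambda>n. act (t n) (x n)) \<longlonglongrightarrow> z" and h: "h \<in> Cc"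
  shows "(\<lambda>n. twper (Sn n) (\<tau>s n) h u) \<longlonglongrightarrow> twper S \<tau> h u"
proof -
  have F: "(\<lambda>r. h (u + r)) \<in> Cc" using Cc_compose_shift(1)[OF h, of u] by (simp add: add.commute)
  show ?thesis
    unfolding twper_def
    by (rule character_haar_convergence[OF fell sub_haar_beta[OF subgroups(2)] sub_haar_beta[OF subgroups(1)] F
        characterD(1)[OF \<tau>s] characterD(1)[OF \<tau>] character_convergence[OF y]])
qed

text \<open>If \<open>b n - a n + s\<close> kept returning to K, a subsequence would converge to
  some \<open>r0\<close>. This maps the limit of \<open>act (a n) (x n)\<close> to the limit of
  \<open>act (b n) (x n)\<close>, so it fixes z, and by Fell convergence it is close to elements of
  the nearby stabilizers. Then \<open>r i + a (g i)\<close>, which equals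
  \<open>b (g i) + s i\<close>, lies in both of the sets assumed disjoint.\<close>

lemma escape:
  assumes K: "compact K" and W: "0 \<in> interior W"
    and y: "(\<lambda>n. act (a n) (x n)) \<longlonglongrightarrow> z" "(\<lambda>n. act (b n) (x n)) \<longlonglongrightarrow> z"
    and disj: "eventually (\<lambda>n. (W + {a n} + Sn n) \<inter> (W + {b n} + Sn n) = {}) sequentially"
  shows "eventually (\<lambda>n. \<forall>s\<in>Sn n. b n - a n + s \<notin> K) sequentially"
proof (rule ccontr)
  let ?P = "\<lambda>n r. (r - (b n - a n)) \<in> Sn n \<and> (W + {a n} + Sn n) \<inter> (W + {b n} + Sn n) = {}"
  assume "\<not> eventually (\<lambda>n. \<forall>s\<in>Sn n. b n - a n + s \<notin> K) sequentially"
  then have "frequently (\<lambda>n. \<exists>s\<in>Sn n. b n - a n + s \<in> K) sequentially" by (simp add: frequently_def)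
  then have "frequently (\<lambda>n. (\<exists>s\<in>Sn n. b n - a n + s \<in> K) \<and> (W + {a n} + Sn n) \<inter> (W + {b n} + Sn n) = {}) sequentially"
    using frequently_eventually_conj[OF _ disj] by (subst conj_commute)
  then have "frequently (\<lambda>n. \<exists>r\<in>K. ?P n r) sequentially"
    by (rule frequently_elim1) (auto intro!: bexI[of _ "b _ - a _ + _"])
  from subsequence_compact[OF K this]
  obtain g r r0 where g: "strict_mono (g :: nat \<Rightarrow> nat)" and r: "\<forall>i. r i \<in> K \<and> ?P (g i) (r i)" and lim: "r \<longlonglongrightarrow> r0"
    by (elim exE conjE) (rule that)
  define s where "s i = r i - (b (g i) - a (g i))" for i
  have sS: "s i \<in> Sn (g i)" and dis: "(W + {a (g i)} + Sn (g i)) \<inter> (W + {b (g i)} + Sn (g i)) = {}" for i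
    using r by (simp_all add: s_def)
  have req: "r i + a (g i) = b (g i) + s i" for i by (simp add: s_def algebra_simps)
  have yg: "(\<lambda>i. act (a (g i)) (x (g i))) \<longlonglongrightarrow> z" "(\<lambda>i. act (b (g i)) (x (g i))) \<longlonglongrightarrow> z"
    using LIMSEQ_subseq_LIMSEQ[OF y(1) g] LIMSEQ_subseq_LIMSEQ[OF y(2) g] by (simp_all add: o_def)
  have "act (r i) (act (a (g i)) (x (g i))) = act (b (g i)) (x (g i))" for i
    using sS[of i] unfolding act_add[symmetric] req by (simp add: act_add stabilizer_def)
  then have "(\<lambda>i. act (b (g i)) (x (g i))) \<longlonglongrightarrow> act r0 z" using act_tendsto[OF lim yg(1)] by simp
  then have "act r0 z = z" using LIMSEQ_unique yg(2) by blast
  then have r0: "r0 \<in> S" by (simp add: stabilizer_def)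
  \<comment> \<open>Two neighbourhoods of \<open>r0\<close> whose differences lie in the interior of
    W: one will contain \<open>r i\<close>, the other an element of the stabilizer of
    \<open>x (g i)\<close>.\<close>
  have "continuous_on UNIV (\<lambda>p :: 'g \<times> 'g. fst p - snd p)" by (intro continuous_intros)
  then have "open ((\<lambda>p :: 'g \<times> 'g. fst p - snd p) -` interior W)" by (simp add: continuous_on_open_vimage)
  moreover have "(r0, r0) \<in> (\<lambda>p :: 'g \<times> 'g. fst p - snd p) -` interior W" using W by simp
  ultimately obtain U1 U2 where U: "open U1" "open U2" "(r0, r0) \<in> U1 \<times> U2"
    "U1 \<times> U2 \<subseteq> (\<lambda>p :: 'g \<times> 'g. fst p - snd p) -` interior W" by (rule open_prod_elim)
  have "eventually (\<lambda>n. Sn n \<inter> U2 \<noteq> {}) sequentially" by (rule fell_limit_lower[OF fell U(2)]) (use r0 U(3) in auto)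
  then have "eventually (\<lambda>i. Sn (g i) \<inter> U2 \<noteq> {}) sequentially" by (rule eventually_subseq[OF g])
  moreover have "eventually (\<lambda>i. r i \<in> U1) sequentially" by (rule topological_tendstoD[OF lim U(1)]) (use U(3) in auto)
  ultimately have "eventually (\<lambda>i. Sn (g i) \<inter> U2 \<noteq> {} \<and> r i \<in> U1) sequentially" by (rule eventually_conj)
  then obtain i where i: "Sn (g i) \<inter> U2 \<noteq> {}" "r i \<in> U1" using eventually_happens'[OF sequentially_bot] by blast
  then obtain s' where s': "s' \<in> Sn (g i)" "s' \<in> U2" by blast
  have "r i - s' \<in> W" using i(2) s'(2) U(4) interior_subset by fastforce
  then have "(r i - s') + a (g i) + s' \<in> W + {a (g i)} + Sn (g i)" using s'(1) by (intro set_plus_intro) auto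
  moreover have "0 + b (g i) + s i \<in> W + {b (g i)} + Sn (g i)"
    using W interior_subset sS by (intro set_plus_intro) auto
  moreover have "(r i - s') + a (g i) + s' = 0 + b (g i) + s i" using req[of i] by (simp add: algebra_simps)
  ultimately show False using dis[of i] by auto
qed

end

context hilbert_space
begin

lemma norm_limit:
  assumes \<xi>: "\<xi> \<in> vectors H" "\<And>m. \<xi>s m \<in> vectors H"
    and lim: "(\<lambda>m. vnorm H (vdiff H \<xi> (\<xi>s m))) \<longlonglongrightarrow> 0"
  shows "(\<lambda>m. vnorm H (\<xi>s m)) \<longlonglongrightarrow> vnorm H \<xi>"
proof -
  have "\<bar>vnorm H (\<xi>s m) - vnorm H \<xi>\<bar> \<le> vnorm H (vdiff H \<xi> (\<xi>s m))" for m
    using norm_le_diff[OF \<xi>(1) \<xi>(2)[of m]] norm_le_diff[OF \<xi>(2)[of m] \<xi>(1)] norm_diff_commute[OF \<xi>(1) \<xi>(2)[of m]]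
    by linarith
  then have "(\<lambda>m. vnorm H (\<xi>s m) - vnorm H \<xi>) \<longlonglongrightarrow> 0"
    by (intro Lim_null_comparison[OF _ lim] always_eventually) simp
  then show ?thesis by (rule LIM_zero_cancel)
qed

end

context nontrivial_transformation_group
begin

lemma op_close_inner:
  assumes ab: "op_close a b \<epsilon>" "a \<in> elems A" "b \<in> elems A" and \<rho>: "\<rho> \<in> R" and \<eta>: "\<eta> \<in> vectors (cspace \<rho>)"
  shows "cmod (vinner (cspace \<rho>) (a \<rho> \<eta>) \<eta> - vinner (cspace \<rho>) (b \<rho> \<eta>) \<eta>) \<le> \<epsilon> * (vnorm (cspace \<rho>) \<eta>)\<^sup>2"
proof -
  interpret covariant_rep act \<mu> \<rho> by (rule covariant_repI[OF \<rho>])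
  note v = elems_closed[OF ab(2) \<rho> \<eta>] elems_closed[OF ab(3) \<rho> \<eta>]
  have "vnorm H (vdiff H (a \<rho> \<eta>) (b \<rho> \<eta>)) \<le> \<epsilon> * vnorm H \<eta>" using ab(1) \<rho> \<eta> by (simp add: op_close_def)
  then have "vnorm H (vdiff H (a \<rho> \<eta>) (b \<rho> \<eta>)) * vnorm H \<eta> \<le> \<epsilon> * vnorm H \<eta> * vnorm H \<eta>"
    using \<eta> by (intro mult_right_mono) auto
  moreover have "cmod (vinner H (vdiff H (a \<rho> \<eta>) (b \<rho> \<eta>)) \<eta>) \<le> vnorm H (vdiff H (a \<rho> \<eta>) (b \<rho> \<eta>)) * vnorm H \<eta>"
    by (rule cauchy_schwarz) (use v \<eta> in auto)
  ultimately show ?thesis using v \<eta> by (simp add: inner_diff power2_eq_square mult.assoc)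
qed

lemma vector_state_tendsto:
  assumes a: "a \<in> elems A" and \<rho>: "\<rho> \<in> R" and \<xi>: "\<xi> \<in> vectors (cspace \<rho>)" "\<And>m. \<xi>s m \<in> vectors (cspace \<rho>)"
    and lim: "(\<lambda>m. vnorm (cspace \<rho>) (vdiff (cspace \<rho>) \<xi> (\<xi>s m))) \<longlonglongrightarrow> 0"
  shows "(\<lambda>m. vinner (cspace \<rho>) (a \<rho> (\<xi>s m)) (\<xi>s m)) \<longlonglongrightarrow> vinner (cspace \<rho>) (a \<rho> \<xi>) \<xi>"
proof -
  interpret covariant_rep act \<mu> \<rho> by (rule covariant_repI[OF \<rho>])
  let ?d = "\<lambda>m. vnorm H (vdiff H \<xi> (\<xi>s m))"
  note nl = norm_limit[OF \<xi> lim]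
  obtain c where c: "0 < c" "op_bounded a c" by (rule elems_bounded[OF a])
  have cb: "vnorm H (a \<rho> \<eta>) \<le> c * vnorm H \<eta>" if "\<eta> \<in> vectors H" for \<eta>
    using c(2) \<rho> that by (simp add: op_bounded_def)
  have le: "cmod (vinner H (a \<rho> \<xi>) \<xi> - vinner H (a \<rho> (\<xi>s m)) (\<xi>s m)) \<le> c * ?d m * (vnorm H \<xi> + vnorm H (\<xi>s m))" for m
  proof -
    note v = \<xi>(1) \<xi>(2)[of m]
    note av = elems_closed[OF a \<rho> v(1)] elems_closed[OF a \<rho> v(2)]
    have dv: "vdiff H \<xi> (\<xi>s m) \<in> vectors H" using v by simp
    have ad: "a \<rho> (vdiff H \<xi> (\<xi>s m)) = vdiff H (a \<rho> \<xi>) (a \<rho> (\<xi>s m))"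
      by (rule bounded_operatorD(4)[OF op_familyD(1)[OF elems_family[OF a] \<rho>] v])
    have "vinner H (a \<rho> \<xi>) \<xi> - vinner H (a \<rho> (\<xi>s m)) (\<xi>s m) =
        vinner H (a \<rho> (vdiff H \<xi> (\<xi>s m))) \<xi> + vinner H (a \<rho> (\<xi>s m)) (vdiff H \<xi> (\<xi>s m))"
      using v av by (simp add: ad inner_diff inner_diff_right)
    also have "cmod \<dots> \<le> vnorm H (a \<rho> (vdiff H \<xi> (\<xi>s m))) * vnorm H \<xi> + vnorm H (a \<rho> (\<xi>s m)) * ?d m"
      by (intro order_trans[OF norm_triangle_ineq] add_mono cauchy_schwarz elems_closed[OF a \<rho>] dv v)
    also have "\<dots> \<le> c * ?d m * vnorm H \<xi> + c * vnorm H (\<xi>s m) * ?d m"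
      by (intro add_mono mult_right_mono cb dv v norm_nonneg)
    finally show ?thesis by (simp add: algebra_simps)
  qed
  have "(\<lambda>m. c * ?d m * (vnorm H \<xi> + vnorm H (\<xi>s m))) \<longlonglongrightarrow> c * 0 * (vnorm H \<xi> + vnorm H \<xi>)"
    by (intro tendsto_intros lim nl)
  then have "(\<lambda>m. c * ?d m * (vnorm H \<xi> + vnorm H (\<xi>s m))) \<longlonglongrightarrow> 0" by simp
  from Lim_null_comparison[OF always_eventually[OF allI[OF le]] this]
  have "(\<lambda>m. vinner H (a \<rho> \<xi>) \<xi> - vinner H (a \<rho> (\<xi>s m)) (\<xi>s m)) \<longlonglongrightarrow> 0" .
  from tendsto_diff[OF tendsto_const[of "vinner H (a \<rho> \<xi>) \<xi>"] this]
  show "(\<lambda>m. vinner H (a \<rho> (\<xi>s m)) (\<xi>s m)) \<longlonglongrightarrow> vinner H (a \<rho> \<xi>) \<xi>" by simp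
qed

end

section \<open>Limits of vector states along the sequence\<close>

context induced_rep
begin

lemma integrated_twist_inner:
  fixes a
  assumes \<theta>: "\<theta> \<in> characters" and h: "h \<in> Cc" and f: "f \<in> Cc_C0" and \<rho>: "ip y \<theta> \<in> R"
  defines "\<eta> \<equiv> cls (stabilizer act y) (twist \<theta> h a)"
  shows "vinner (L2 (\<nu> (stabilizer act y))) (integrated f (ip y \<theta>) \<eta>) \<eta> =
    (LINT t|\<mu>. LINT s|\<mu>. f t (act s (act a y)) * twper (stabilizer act y) \<theta> h (s - t) * cnj (h s))"
proof -
  interpret r: covariant_rep act \<mu> "ip y \<theta>" by (rule covariant_repI[OF \<rho>])
  have \<eta>v: "\<eta> \<in> vectors (cspace (ip y \<theta>))"
    unfolding \<eta>_def cspace_ip by (intro cls_vectors stabilizer_closed_subgroup twist_Cc \<theta> h)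
  have "vinner (cspace (ip y \<theta>)) (integrated f (ip y \<theta>) \<eta>) \<eta> =
      (LINT t|\<mu>. vinner (cspace (ip y \<theta>)) (frep (ip y \<theta>) (f t) (grep (ip y \<theta>) t \<eta>)) \<eta>)"
    using r.integrated_op_inner[OF f \<eta>v \<eta>v] \<rho> by (simp add: integrated_def)
  then show ?thesis unfolding cspace_ip \<eta>_def cls_twist_action_inner[OF \<theta> h f] .
qed

end

context induced_sequence
begin

lemma approximant_norm_tendsto:
  assumes y: "(\<lambda>n. act (a n) (x n)) \<longlonglongrightarrow> z" and h: "h \<in> Cc"
  shows "(\<lambda>n. vinner (L2 (\<nu> (Sn n))) (cls (Sn n) (twist (\<tau>s n) h (a n))) (cls (Sn n) (twist (\<tau>s n) h (a n))))
    \<longlonglongrightarrow> vinner (L2 (\<nu> S)) (cls S (twist \<tau> h 0)) (cls S (twist \<tau> h 0))"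
  using norm_tendsto[OF h subgroups(2) subgroups(1) \<tau>s \<tau> twper_tendsto[OF y h]]
  by (simp add: cls_twist_inner[OF subgroups(2) \<tau>s h] cls_twist_inner[OF subgroups(1) \<tau> h])

text \<open>The double integral depends on n only through the translated point and
  \<open>twper\<close>, and both converge. The limit vector has shift 0 because the translated
  points converge to z itself.\<close>

lemma approximant_state_tendsto_integrated:
  assumes y: "(\<lambda>n. act (a n) (x n)) \<longlonglongrightarrow> z" and h: "h \<in> Cc" and f: "f \<in> Cc_C0"
  defines "\<eta> \<equiv> \<lambda>n. cls (Sn n) (twist (\<tau>s n) h (a n))"
  shows "(\<lambda>n. vinner (L2 (\<nu> (Sn n))) (integrated f (ip (x n) (\<tau>s n)) (\<eta> n)) (\<eta> n))
    \<longlonglongrightarrow> vinner (L2 (\<nu> S)) (integrated f (ip z \<tau>) (cls S (twist \<tau> h 0))) (cls S (twist \<tau> h 0))"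
    (is "?u \<longlonglongrightarrow> _")
proof -
  let ?v = "\<lambda>n. LINT t|\<mu>. LINT s|\<mu>. f t (act s (act (a n) (x n))) * twper (Sn n) (\<tau>s n) h (s - t) * cnj (h s)"
  \<comment> \<open>The double integral is defined for every n, but it is identified with the inner
    product only where the pair is covariant.\<close>
  have ev: "eventually (\<lambda>n. ?v n = ?u n) sequentially"
    using \<rho>s by (rule eventually_mono) (simp add: \<eta>_def integrated_twist_inner[OF \<tau>s h f])
  have "?v \<longlonglongrightarrow> (LINT t|\<mu>. LINT s|\<mu>. f t (act s z) * twper S \<tau> h (s - t) * cnj (h s))"
    by (rule state_tendsto[OF h f y subgroups(2) subgroups(1) \<tau>s \<tau> twper_tendsto[OF y h]])
  then have "?v \<longlonglongrightarrow> vinner (L2 (\<nu> S)) (integrated f (ip z \<tau>) (cls S (twist \<tau> h 0))) (cls S (twist \<tau> h 0))"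
    by (simp add: integrated_twist_inner[OF \<tau> h f \<rho>z])
  then show ?thesis by (rule Lim_transform_eventually[OF _ ev])
qed

text \<open>The accuracy d of an approximating integrated form holds at all pairs at once, up to the
  squared norm of the vector, and these norms converge. Three errors of a third of e result.\<close>

lemma approximant_state_tendsto:
  assumes y: "(\<lambda>n. act (a n) (x n)) \<longlonglongrightarrow> z" and h: "h \<in> Cc" and b: "b \<in> elems A"
  defines "\<eta> \<equiv> \<lambda>n. cls (Sn n) (twist (\<tau>s n) h (a n))"
  shows "(\<lambda>n. vinner (L2 (\<nu> (Sn n))) (b (ip (x n) (\<tau>s n)) (\<eta> n)) (\<eta> n))
    \<longlonglongrightarrow> vinner (L2 (\<nu> S)) (b (ip z \<tau>) (cls S (twist \<tau> h 0))) (cls S (twist \<tau> h 0))"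
    (is "?u \<longlonglongrightarrow> ?l")
proof (rule tendstoI)
  let ?\<xi> = "cls S (twist \<tau> h 0)"
  interpret r: covariant_rep act \<mu> "ip z \<tau>" by (rule covariant_repI[OF \<rho>z])
  have \<xi>: "?\<xi> \<in> vectors (cspace (ip z \<tau>))" unfolding cspace_ip by (intro cls_vectors subgroups twist_Cc \<tau> h)
  have \<eta>: "\<eta> n \<in> vectors (cspace (ip (x n) (\<tau>s n)))" for n
    unfolding \<eta>_def cspace_ip by (intro cls_vectors subgroups twist_Cc \<tau>s h)
  \<comment> \<open>Exceeds the limit of the squared norms, so it bounds them eventually.\<close>
  define B where "B = (vnorm (L2 (\<nu> S)) ?\<xi>)\<^sup>2 + 1"
  have B: "0 < B" by (simp add: B_def add_nonneg_pos)
  fix e :: real assume e: "0 < e"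
  define d where "d = e / 3 / B"
  have d: "0 < d" "d * B = e / 3" using e B by (simp_all add: d_def)
  obtain f where f: "f \<in> Cc_C0" "op_close b (integrated f) d" by (rule elems_approx[OF b d(1)])
  note cl = op_close_inner[OF f(2) b integrated_elems[OF f(1)]]
  have "(\<lambda>n. Re (vinner (L2 (\<nu> (Sn n))) (\<eta> n) (\<eta> n))) \<longlonglongrightarrow> Re (vinner (L2 (\<nu> S)) ?\<xi> ?\<xi>)"
    unfolding \<eta>_def by (intro tendsto_Re approximant_norm_tendsto[OF y h])
  moreover have "Re (vinner (L2 (\<nu> S)) ?\<xi> ?\<xi>) < B" using r.inner_self_real[OF \<xi>] by (simp add: B_def)
  ultimately have nev: "eventually (\<lambda>n. Re (vinner (L2 (\<nu> (Sn n))) (\<eta> n) (\<eta> n)) < B) sequentially"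
    by (rule order_tendstoD(2))
  have "eventually (\<lambda>n. dist (vinner (L2 (\<nu> (Sn n))) (integrated f (ip (x n) (\<tau>s n)) (\<eta> n)) (\<eta> n))
      (vinner (L2 (\<nu> S)) (integrated f (ip z \<tau>) ?\<xi>) ?\<xi>) < e / 3) sequentially"
    unfolding \<eta>_def by (rule tendstoD[OF approximant_state_tendsto_integrated[OF y h f(1)]]) (use e in simp)
  with nev \<rho>s show "eventually (\<lambda>n. dist (?u n) ?l < e) sequentially"
  proof eventually_elim
    case (elim n)
    interpret q: covariant_rep act \<mu> "ip (x n) (\<tau>s n)" by (rule covariant_repI[OF elim(2)])
    have "(vnorm (L2 (\<nu> (Sn n))) (\<eta> n))\<^sup>2 < B" using elim(1) q.inner_self_real[OF \<eta>] by simp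
    then have "d * (vnorm (L2 (\<nu> (Sn n))) (\<eta> n))\<^sup>2 \<le> d * B" using d(1) by (intro mult_left_mono) auto
    then have 1: "cmod (?u n - vinner (L2 (\<nu> (Sn n))) (integrated f (ip (x n) (\<tau>s n)) (\<eta> n)) (\<eta> n)) \<le> e / 3"
      using cl[OF elim(2) \<eta>[of n]] d(2) by simp
    have "d * (vnorm (L2 (\<nu> S)) ?\<xi>)\<^sup>2 \<le> d * B" using d(1) by (intro mult_left_mono) (auto simp: B_def)
    then have 2: "cmod (?l - vinner (L2 (\<nu> S)) (integrated f (ip z \<tau>) ?\<xi>) ?\<xi>) \<le> e / 3"
      using cl[OF \<rho>z \<xi>] d(2) by simp
    let ?p = "vinner (L2 (\<nu> (Sn n))) (integrated f (ip (x n) (\<tau>s n)) (\<eta> n)) (\<eta> n)"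
    let ?q = "vinner (L2 (\<nu> S)) (integrated f (ip z \<tau>) ?\<xi>) ?\<xi>"
    have "dist (?u n) ?l \<le> dist (?u n) ?p + (dist ?p ?q + dist ?q ?l)"
      by (rule order_trans[OF dist_triangle add_left_mono[OF dist_triangle]])
    moreover have "dist (?u n) ?p \<le> e / 3" using 1 by (simp only: dist_norm)
    moreover have "dist ?q ?l \<le> e / 3" using 2 by (simp only: dist_norm norm_minus_commute)
    ultimately show ?case using elim(3) by linarith
  qed
qed

text \<open>A nonzero contribution needs both s and \<open>s + b n - a n + r\<close> in the support
  of h for some r in the stabilizer, so \<open>b n - a n + r\<close> would be a difference of two
  points of a compact set; \<open>escape\<close> excludes this for large n.\<close>

lemma approximants_orthogonal:
  assumes h: "h \<in> Cc" and W: "0 \<in> interior W"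
    and y: "(\<lambda>n. act (a n) (x n)) \<longlonglongrightarrow> z" "(\<lambda>n. act (b n) (x n)) \<longlonglongrightarrow> z"
    and disj: "eventually (\<lambda>n. (W + {a n} + Sn n) \<inter> (W + {b n} + Sn n) = {}) sequentially"
  shows "eventually (\<lambda>n. vinner (L2 (\<nu> (Sn n))) (cls (Sn n) (twist (\<tau>s n) h (a n))) (cls (Sn n) (twist (\<tau>s n) h (b n))) = 0)
    sequentially"
proof -
  obtain K B where K: "compact K" "\<And>s. s \<notin> K \<Longrightarrow> h s = 0" using Cc_bounded[OF h] by metis
  have "eventually (\<lambda>n. \<forall>s\<in>Sn n. b n - a n + s \<notin> K + uminus ` K) sequentially"
    by (rule escape[OF compact_plus[OF K(1) compact_uminus[OF K(1)]] W y disj])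
  then show ?thesis
  proof eventually_elim
    case (elim n)
    have z: "twper (Sn n) (\<tau>s n) h (s + b n - a n) * cnj (h s) = 0" for s
    proof (cases "s \<in> K")
      case True
      have "AE r in \<beta> (Sn n). h (s + b n - a n + r) * \<tau>s n r = 0"
        using sub_haarD(2)[OF sub_haar_beta[OF subgroups(2)]]
      proof eventually_elim
        case (elim r)
        have "s + b n - a n + r \<notin> K"
        proof
          assume "s + b n - a n + r \<in> K"
          then have "(s + b n - a n + r) + - s \<in> K + uminus ` K" using True by (intro set_plus_intro imageI)
          moreover have "(s + b n - a n + r) + - s = b n - a n + r" by (simp add: algebra_simps)
          ultimately show False using \<open>\<forall>s\<in>Sn n. b n - a n + s \<notin> K + uminus ` K\<close> elim by simp
        qed
        then show ?case by (simp add: K(2))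
      qed
      then show ?thesis unfolding twper_def by (simp add: integral_eq_zero_AE)
    qed (simp add: K(2))
    then show ?case unfolding cls_twist_inner[OF subgroups(2) \<tau>s h] z by simp
  qed
qed

end

context hilbert_space
begin

text \<open>Allows limits to be taken with unnormalised vectors, the normalisation being done only
  at the end.\<close>

lemma normalized_quotient:
  assumes "\<eta> \<in> vectors H" "vnorm H \<eta> \<noteq> 0" "\<zeta> \<in> vectors H"
  shows "vinner H (vscale H (1 / of_real (vnorm H \<eta>)) \<zeta>) (vscale H (1 / of_real (vnorm H \<eta>)) \<eta>) = vinner H \<zeta> \<eta> / vinner H \<eta> \<eta>"
  using assms by (simp add: inner_scale inner_scale_right inner_self_real power2_eq_square field_simps)

lemma normalize_orthogonal:
  assumes J: "finite J" and \<eta>: "\<And>j. j \<in> J \<Longrightarrow> \<eta> j \<in> vectors H" "\<And>j. j \<in> J \<Longrightarrow> vnorm H (\<eta> j) \<noteq> 0"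
    and orth: "\<And>i j. i \<in> J \<Longrightarrow> j \<in> J \<Longrightarrow> i \<noteq> j \<Longrightarrow> vinner H (\<eta> i) (\<eta> j) = 0"
  defines "e \<equiv> \<lambda>j. vscale H (1 / of_real (vnorm H (\<eta> j))) (\<eta> j)"
  shows "orthonormal H (e ` J)" "card (e ` J) = card J"
proof -
  have ij: "vinner H (e i) (e j) = (if i = j then 1 else 0)" if "i \<in> J" "j \<in> J" for i j
  proof (cases "i = j")
    case True
    have "vinner H (\<eta> i) (\<eta> i) \<noteq> 0" using \<eta>[OF \<open>i \<in> J\<close>] by (simp add: inner_self_real)
    then show ?thesis using True normalized_quotient[OF \<eta>[OF \<open>i \<in> J\<close>] \<eta>(1)[OF \<open>i \<in> J\<close>]] by (simp add: e_def)
  next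
    case False
    then show ?thesis using orth[OF that False] \<eta>(1) that by (simp add: e_def inner_scale inner_scale_right)
  qed
  have inj: "inj_on e J"
  proof (rule inj_onI)
    fix i j assume "i \<in> J" "j \<in> J" "e i = e j"
    then show "i = j" using ij[of i j] ij[of i i] by (cases "i = j") auto
  qed
  then show "card (e ` J) = card J" by (rule card_image)
  show "orthonormal H (e ` J)"
    unfolding orthonormal_def
  proof (intro conjI ballI)
    show "e ` J \<subseteq> vectors H" using \<eta>(1) by (auto simp: e_def)
    fix \<xi> \<zeta> assume "\<xi> \<in> e ` J" "\<zeta> \<in> e ` J"
    then obtain i j where "i \<in> J" "j \<in> J" "\<xi> = e i" "\<zeta> = e j" by (elim imageE) (rule that)
    then show "vinner H \<xi> \<zeta> = (if \<xi> = \<zeta> then 1 else 0)" using ij inj by (simp add: inj_on_eq_iff)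
  qed
qed

end

context induced_rep
begin

text \<open>The state is written as a quotient since the approximating vectors are not normalised;
  their norms tend to 1.\<close>

lemma vector_state_approx:
  assumes sp: "rep_class A (integrated_form (ip z \<tau>)) \<in> spectrum A"
    and \<xi>: "\<xi> \<in> vectors (L2 (\<nu> S))" "vnorm (L2 (\<nu> S)) \<xi> = 1"
    and F: "finite F" "F \<subseteq> elems A" and \<epsilon>: "0 < \<epsilon>"
  shows "\<exists>h\<in>Cc. let \<zeta> = cls S (twist \<tau> h 0) in vnorm (L2 (\<nu> S)) \<zeta> \<noteq> 0 \<and>
    (\<forall>a\<in>F. dist (vinner (L2 (\<nu> S)) (a (ip z \<tau>) \<zeta>) \<zeta> / vinner (L2 (\<nu> S)) \<zeta> \<zeta>) (vinner (L2 (\<nu> S)) (a (ip z \<tau>) \<xi>) \<xi>) < \<epsilon>)"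
proof -
  interpret r: covariant_rep act \<mu> "ip z \<tau>" by (rule covariant_repI[OF \<rho>z])
  let ?H = "L2 (\<nu> S)"
  have SH: "S \<in> closed_subgroups" by (rule stabilizer_closed_subgroup)
  have "\<forall>m. \<exists>h\<in>Cc. vnorm ?H (vdiff ?H \<xi> (cls S h)) < inverse (real (Suc m))"
    by (intro allI cls_dense[OF sp \<xi>(1)]) simp
  then obtain g where g: "\<And>m. g m \<in> Cc" "\<And>m. vnorm ?H (vdiff ?H \<xi> (cls S (g m))) < inverse (real (Suc m))" by metis
  \<comment> \<open>Multiplying by the conjugate of \<tau> makes \<open>g m\<close> itself the
    untranslated twist of \<open>h m\<close>, so density of the classes gives density of the twisted
    ones.\<close>
  define h where "h m = (\<lambda>s. g m s * cnj (\<tau> s))" for m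
  have h: "h m \<in> Cc" for m
    unfolding h_def by (rule Cc_mult[OF g(1)]) (intro continuous_on_cnj characterD(1)[OF \<tau>])
  have th: "twist \<tau> (h m) 0 = g m" for m
  proof
    fix s show "twist \<tau> (h m) 0 s = g m s" using characterD(4)[OF \<tau>, of s] by (simp add: twist_def h_def)
  qed
  have v: "cls S (g m) \<in> vectors (cspace (ip z \<tau>))" for m unfolding cspace_ip by (rule cls_vectors[OF SH g(1)])
  have \<xi>v: "\<xi> \<in> vectors (cspace (ip z \<tau>))" using \<xi> by simp
  have nn: "0 \<le> vnorm ?H (vdiff ?H \<xi> (cls S (g m)))" for m using r.norm_nonneg[OF r.diff_closed[OF \<xi>v v]] by simp
  have le: "norm (vnorm ?H (vdiff ?H \<xi> (cls S (g m)))) \<le> inverse (real (Suc m))" for m using nn[of m] g(2)[of m] by simp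
  have lim: "(\<lambda>m. vnorm (cspace (ip z \<tau>)) (vdiff (cspace (ip z \<tau>)) \<xi> (cls S (g m)))) \<longlonglongrightarrow> 0"
    unfolding cspace_ip by (rule Lim_null_comparison[OF always_eventually[OF allI[OF le]] LIMSEQ_inverse_real_of_nat])
  have nl: "(\<lambda>m. vnorm ?H (cls S (g m))) \<longlonglongrightarrow> 1"
    using r.norm_limit[OF \<xi>v v lim] \<xi>(2) by simp
  have self: "vinner ?H (cls S (g m)) (cls S (g m)) = (of_real (vnorm ?H (cls S (g m))))\<^sup>2" for m
    using r.inner_self_real[OF v] by simp
  have "eventually (\<lambda>m. dist (vinner ?H (a (ip z \<tau>) (cls S (g m))) (cls S (g m)) / vinner ?H (cls S (g m)) (cls S (g m)))
      (vinner ?H (a (ip z \<tau>) \<xi>) \<xi>) < \<epsilon>) sequentially" if a: "a \<in> F" for a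
  proof (rule tendstoD[OF _ \<epsilon>])
    have aA: "a \<in> elems A" using F(2) a by blast
    have "(\<lambda>m. vinner (cspace (ip z \<tau>)) (a (ip z \<tau>) (cls S (g m))) (cls S (g m))) \<longlonglongrightarrow> vinner (cspace (ip z \<tau>)) (a (ip z \<tau>) \<xi>) \<xi>"
      by (rule vector_state_tendsto[OF aA \<rho>z \<xi>v v lim])
    then have "(\<lambda>m. vinner ?H (a (ip z \<tau>) (cls S (g m))) (cls S (g m))) \<longlonglongrightarrow> vinner ?H (a (ip z \<tau>) \<xi>) \<xi>" by simp
    then have "(\<lambda>m. vinner ?H (a (ip z \<tau>) (cls S (g m))) (cls S (g m)) / (of_real (vnorm ?H (cls S (g m))))\<^sup>2)
        \<longlonglongrightarrow> vinner ?H (a (ip z \<tau>) \<xi>) \<xi> / (of_real 1)\<^sup>2"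
      by (intro tendsto_intros nl) simp_all
    then show "(\<lambda>m. vinner ?H (a (ip z \<tau>) (cls S (g m))) (cls S (g m)) / vinner ?H (cls S (g m)) (cls S (g m)))
        \<longlonglongrightarrow> vinner ?H (a (ip z \<tau>) \<xi>) \<xi>" by (simp add: self)
  qed
  then have "eventually (\<lambda>m. \<forall>a\<in>F. dist (vinner ?H (a (ip z \<tau>) (cls S (g m))) (cls S (g m)) / vinner ?H (cls S (g m)) (cls S (g m)))
      (vinner ?H (a (ip z \<tau>) \<xi>) \<xi>) < \<epsilon>) sequentially"
    by (intro eventually_ball_finite F) auto
  moreover have "eventually (\<lambda>m. 0 < vnorm ?H (cls S (g m))) sequentially" by (rule order_tendstoD(1)[OF nl]) simp
  ultimately have "eventually (\<lambda>m. (\<forall>a\<in>F. dist (vinner ?H (a (ip z \<tau>) (cls S (g m))) (cls S (g m)) / vinner ?H (cls S (g m)) (cls S (g m)))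
      (vinner ?H (a (ip z \<tau>) \<xi>) \<xi>) < \<epsilon>) \<and> 0 < vnorm ?H (cls S (g m))) sequentially" by (rule eventually_conj)
  then obtain m where m: "\<forall>a\<in>F. dist (vinner ?H (a (ip z \<tau>) (cls S (g m))) (cls S (g m)) / vinner ?H (cls S (g m)) (cls S (g m)))
      (vinner ?H (a (ip z \<tau>) \<xi>) \<xi>) < \<epsilon>" "0 < vnorm ?H (cls S (g m))"
    using eventually_happens'[OF sequentially_bot] by blast
  show ?thesis by (rule bexI[OF _ h[of m]]) (use m in \<open>simp add: th Let_def\<close>)
qed

end

context induced_sequence
begin

text \<open>One function h is fixed for the vector state of \<xi>, at the cost of half of
  \<epsilon>. For large n its twists shifted by \<open>t j n\<close> have states close to that of
  the limit vector, have nonzero norm and, by disjointness, are orthogonal; normalising them gives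
  E.\<close>

lemma vector_states_in_sequence:
  assumes J: "finite J" and W: "0 \<in> interior W"
    and y: "\<And>j. j \<in> J \<Longrightarrow> (\<lambda>n. act (t j n) (x n)) \<longlonglongrightarrow> z"
    and disj: "\<And>i j. i \<in> J \<Longrightarrow> j \<in> J \<Longrightarrow> i \<noteq> j \<Longrightarrow>
      eventually (\<lambda>n. (W + {t i n} + Sn n) \<inter> (W + {t j n} + Sn n) = {}) sequentially"
    and \<xi>: "\<xi> \<in> vectors (L2 (\<nu> S))" "vnorm (L2 (\<nu> S)) \<xi> = 1"
    and F: "finite F" "F \<subseteq> elems A" and \<epsilon>: "0 < \<epsilon>"
  shows "eventually (\<lambda>n. \<exists>E. finite E \<and> card E = card J \<and> orthonormal (L2 (\<nu> (Sn n))) E \<and>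
    (\<forall>\<eta>\<in>E. \<forall>a\<in>F. dist (vinner (L2 (\<nu> (Sn n))) (a (ip (x n) (\<tau>s n)) \<eta>) \<eta>) (vinner (L2 (\<nu> S)) (a (ip z \<tau>) \<xi>) \<xi>) < \<epsilon>)) sequentially"
proof -
  let ?H = "\<lambda>n. L2 (\<nu> (Sn n))"
  have e2: "0 < \<epsilon> / 2" using \<epsilon> by simp
  obtain h where h: "h \<in> Cc" and h': "let \<zeta> = cls S (twist \<tau> h 0) in vnorm (L2 (\<nu> S)) \<zeta> \<noteq> 0 \<and>
    (\<forall>a\<in>F. dist (vinner (L2 (\<nu> S)) (a (ip z \<tau>) \<zeta>) \<zeta> / vinner (L2 (\<nu> S)) \<zeta> \<zeta>) (vinner (L2 (\<nu> S)) (a (ip z \<tau>) \<xi>) \<xi>) < \<epsilon> / 2)"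
    using vector_state_approx[OF limitin_spectrumD(1)[OF spec] \<xi> F e2] by (rule bexE)
  define \<zeta> where "\<zeta> = cls S (twist \<tau> h 0)"
  define \<eta> where "\<eta> n j = cls (Sn n) (twist (\<tau>s n) h (t j n))" for n j
  have \<zeta>: "vnorm (L2 (\<nu> S)) \<zeta> \<noteq> 0" "\<And>a. a \<in> F \<Longrightarrow>
    dist (vinner (L2 (\<nu> S)) (a (ip z \<tau>) \<zeta>) \<zeta> / vinner (L2 (\<nu> S)) \<zeta> \<zeta>) (vinner (L2 (\<nu> S)) (a (ip z \<tau>) \<xi>) \<xi>) < \<epsilon> / 2"
    using h' by (simp_all add: Let_def \<zeta>_def)
  interpret r: covariant_rep act \<mu> "ip z \<tau>" by (rule covariant_repI[OF \<rho>z])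
  have \<zeta>v: "\<zeta> \<in> vectors (cspace (ip z \<tau>))" unfolding \<zeta>_def cspace_ip by (intro cls_vectors subgroups twist_Cc \<tau> h)
  have nz: "vinner (L2 (\<nu> S)) \<zeta> \<zeta> \<noteq> 0" using \<zeta>(1) r.inner_self_real[OF \<zeta>v] by simp
  have nl: "(\<lambda>n. vinner (?H n) (\<eta> n j) (\<eta> n j)) \<longlonglongrightarrow> vinner (L2 (\<nu> S)) \<zeta> \<zeta>" if "j \<in> J" for j
    unfolding \<eta>_def \<zeta>_def by (rule approximant_norm_tendsto[OF y[OF that] h])
  have "eventually (\<lambda>n. vinner (?H n) (\<eta> n j) (\<eta> n j) \<noteq> 0) sequentially" if "j \<in> J" for j
    by (rule tendsto_imp_eventually_ne[OF nl[OF that] nz])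
  then have 1: "eventually (\<lambda>n. \<forall>j\<in>J. vinner (?H n) (\<eta> n j) (\<eta> n j) \<noteq> 0) sequentially"
    by (intro eventually_ball_finite J) auto
  have "eventually (\<lambda>n. i \<noteq> j \<longrightarrow> vinner (?H n) (\<eta> n i) (\<eta> n j) = 0) sequentially" if "i \<in> J" "j \<in> J" for i j
  proof (cases "i = j")
    case False
    show ?thesis
      unfolding \<eta>_def
      by (rule eventually_mono[OF approximants_orthogonal[OF h W y[OF that(1)] y[OF that(2)] disj[OF that False]]]) simp
  qed simp
  then have 2: "eventually (\<lambda>n. \<forall>i\<in>J. \<forall>j\<in>J. i \<noteq> j \<longrightarrow> vinner (?H n) (\<eta> n i) (\<eta> n j) = 0) sequentially"
    by (intro eventually_ball_finite ballI J)
  have "eventually (\<lambda>n. dist (vinner (?H n) (a (ip (x n) (\<tau>s n)) (\<eta> n j)) (\<eta> n j) / vinner (?H n) (\<eta> n j) (\<eta> n j))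
      (vinner (L2 (\<nu> S)) (a (ip z \<tau>) \<zeta>) \<zeta> / vinner (L2 (\<nu> S)) \<zeta> \<zeta>) < \<epsilon> / 2) sequentially" if "j \<in> J" "a \<in> F" for j a
  proof (rule tendstoD[OF _ e2])
    have aA: "a \<in> elems A" using F(2) that(2) by blast
    have "(\<lambda>n. vinner (?H n) (a (ip (x n) (\<tau>s n)) (\<eta> n j)) (\<eta> n j)) \<longlonglongrightarrow> vinner (L2 (\<nu> S)) (a (ip z \<tau>) \<zeta>) \<zeta>"
      unfolding \<eta>_def \<zeta>_def by (rule approximant_state_tendsto[OF y[OF that(1)] h aA])
    then show "(\<lambda>n. vinner (?H n) (a (ip (x n) (\<tau>s n)) (\<eta> n j)) (\<eta> n j) / vinner (?H n) (\<eta> n j) (\<eta> n j))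
        \<longlonglongrightarrow> vinner (L2 (\<nu> S)) (a (ip z \<tau>) \<zeta>) \<zeta> / vinner (L2 (\<nu> S)) \<zeta> \<zeta>"
      by (rule tendsto_divide[OF _ nl[OF that(1)] nz])
  qed
  then have 3: "eventually (\<lambda>n. \<forall>j\<in>J. \<forall>a\<in>F.
      dist (vinner (?H n) (a (ip (x n) (\<tau>s n)) (\<eta> n j)) (\<eta> n j) / vinner (?H n) (\<eta> n j) (\<eta> n j))
      (vinner (L2 (\<nu> S)) (a (ip z \<tau>) \<zeta>) \<zeta> / vinner (L2 (\<nu> S)) \<zeta> \<zeta>) < \<epsilon> / 2) sequentially"
    by (intro eventually_ball_finite ballI J F(1))
  from \<rho>s 1 2 3 show ?thesis
  proof eventually_elim
    case (elim n)
    let ?\<rho> = "ip (x n) (\<tau>s n)"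
    interpret q: covariant_rep act \<mu> ?\<rho> by (rule covariant_repI[OF elim(1)])
    define e where "e j = vscale (?H n) (1 / of_real (vnorm (?H n) (\<eta> n j))) (\<eta> n j)" for j
    have v: "\<eta> n j \<in> vectors (cspace ?\<rho>)" for j unfolding \<eta>_def cspace_ip by (intro cls_vectors subgroups twist_Cc \<tau>s h)
    have n0: "vnorm (?H n) (\<eta> n j) \<noteq> 0" if "j \<in> J" for j
      using bspec[OF elim(2) that] q.inner_self_real[OF v, of j] by auto
    have "orthonormal (cspace ?\<rho>) ((\<lambda>j. vscale (cspace ?\<rho>) (1 / of_real (vnorm (cspace ?\<rho>) (\<eta> n j))) (\<eta> n j)) ` J)"
      "card ((\<lambda>j. vscale (cspace ?\<rho>) (1 / of_real (vnorm (cspace ?\<rho>) (\<eta> n j))) (\<eta> n j)) ` J) = card J"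
      by (rule q.normalize_orthogonal[OF J v]; use n0 elim(3) in simp)+
    then have o: "orthonormal (?H n) (e ` J)" "card (e ` J) = card J" by (simp_all add: e_def)
    have "dist (vinner (?H n) (a ?\<rho> (e j)) (e j)) (vinner (L2 (\<nu> S)) (a (ip z \<tau>) \<xi>) \<xi>) < \<epsilon>" if "j \<in> J" "a \<in> F" for j a
    proof -
      have aA: "a \<in> elems A" using F(2) that(2) by blast
      have "a ?\<rho> (e j) = vscale (?H n) (1 / of_real (vnorm (?H n) (\<eta> n j))) (a ?\<rho> (\<eta> n j))"
        using q.bounded_operatorD(3)[OF op_familyD(1)[OF elems_family[OF aA] elim(1)] v] by (simp add: e_def)
      then have "vinner (?H n) (a ?\<rho> (e j)) (e j) = vinner (?H n) (a ?\<rho> (\<eta> n j)) (\<eta> n j) / vinner (?H n) (\<eta> n j) (\<eta> n j)"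
        using q.normalized_quotient[OF v _ elems_closed[OF aA elim(1) v]] n0[OF that(1)] by (simp add: e_def)
      moreover have "dist (vinner (?H n) (a ?\<rho> (\<eta> n j)) (\<eta> n j) / vinner (?H n) (\<eta> n j) (\<eta> n j))
          (vinner (L2 (\<nu> S)) (a (ip z \<tau>) \<zeta>) \<zeta> / vinner (L2 (\<nu> S)) \<zeta> \<zeta>) < \<epsilon> / 2"
        using elim(4) that by blast
      ultimately show ?thesis using dist_triangle_half_l[OF _ \<zeta>(2)[OF that(2), unfolded dist_commute[of "_ / _"]]] by simp
    qed
    then show ?case using o J by (intro exI[of _ "e ` J"]) auto
  qed
qed

text \<open>A weak-star neighbourhood tests finitely many elements of the algebra up to some
  \<epsilon>, and an associated pure state is the vector state of a unit vector, so
  \<open>vector_states_in_sequence\<close> applies. \<open>difference_dual\<close> supplies the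
  remaining requirement that the differences of states belong to \<open>dual A\<close>.\<close>

lemma lower_multiplicity_ge:
  assumes J: "finite J" and W: "0 \<in> interior W"
    and y: "\<And>j. j \<in> J \<Longrightarrow> (\<lambda>n. act (t j n) (x n)) \<longlonglongrightarrow> z"
    and disj: "\<And>i j. i \<in> J \<Longrightarrow> j \<in> J \<Longrightarrow> i \<noteq> j \<Longrightarrow>
      eventually (\<lambda>n. (W + {t i n} + Sn n) \<inter> (W + {t j n} + Sn n) = {}) sequentially"
  shows "enat (card J) \<le> lower_multiplicity A (integrated_form (ip z \<tau>))
    (\<lambda>n. integrated_form (ip (x n) (\<tau>s n))) sequentially"
  unfolding lower_multiplicity_def
proof (intro INF_greatest Liminf_bounded)
  fix \<phi> N assume "\<phi> \<in> {\<phi>. associated_pure_state A (integrated_form (ip z \<tau>)) \<phi>}" and "N \<in> weak_star_nbhds A"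
  then obtain \<xi> F \<epsilon> where \<xi>: "\<xi> \<in> vectors (L2 (\<nu> S))" "vnorm (L2 (\<nu> S)) \<xi> = 1"
    and \<phi>: "\<And>a. a \<in> elems A \<Longrightarrow> \<phi> a = vinner (L2 (\<nu> S)) (a (ip z \<tau>) \<xi>) \<xi>"
    and F: "finite F" "F \<subseteq> elems A" and \<epsilon>: "0 < (\<epsilon> :: real)"
    and N: "N = {\<psi>\<in>dual A. \<forall>a\<in>F. cmod (\<psi> a) < \<epsilon>}"
    by (auto simp: associated_pure_state_def integrated_form_def vector_functional_def weak_star_nbhds_def)
  have \<xi>v: "\<xi> \<in> vectors (cspace (ip z \<tau>))" using \<xi> by simp
  have "eventually (\<lambda>n. \<exists>E. finite E \<and> card E = card J \<and> orthonormal (L2 (\<nu> (Sn n))) E \<and>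
    (\<forall>\<eta>\<in>E. \<forall>a\<in>F. dist (vinner (L2 (\<nu> (Sn n))) (a (ip (x n) (\<tau>s n)) \<eta>) \<eta>) (vinner (L2 (\<nu> S)) (a (ip z \<tau>) \<xi>) \<xi>) < \<epsilon>)) sequentially"
    by (rule vector_states_in_sequence[OF J W y disj \<xi> F \<epsilon>])
  with \<rho>s show "eventually (\<lambda>n. enat (card J) \<le> orthonormal_count (integrated_form (ip (x n) (\<tau>s n))) \<phi> N) sequentially"
  proof eventually_elim
    case (elim n)
    let ?\<rho> = "ip (x n) (\<tau>s n)" and ?H = "L2 (\<nu> (Sn n))"
    obtain E where E: "finite E" "card E = card J" "orthonormal ?H E"
      and d: "\<forall>\<eta>\<in>E. \<forall>a\<in>F. dist (vinner ?H (a ?\<rho> \<eta>) \<eta>) (vinner (L2 (\<nu> S)) (a (ip z \<tau>) \<xi>) \<xi>) < \<epsilon>"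
      using elim(2) by (elim exE conjE) (rule that)
    have "vnorm ?H \<eta> = 1 \<and> vector_functional (integrated_form ?\<rho>) \<eta> \<in> {\<lambda>a. \<phi> a + \<psi> a | \<psi>. \<psi> \<in> N}" if \<eta>: "\<eta> \<in> E" for \<eta>
    proof
      show "vnorm ?H \<eta> = 1" using E(3) \<eta> by (simp add: orthonormal_def vnorm_def)
      have v: "\<eta> \<in> vectors (cspace ?\<rho>)" using E(3) \<eta> by (auto simp: orthonormal_def)
      let ?\<psi> = "\<lambda>a. vector_functional (integrated_form ?\<rho>) \<eta> a - \<phi> a"
      have \<psi>: "?\<psi> a = vinner (cspace ?\<rho>) (a ?\<rho> \<eta>) \<eta> - vinner (cspace (ip z \<tau>)) (a (ip z \<tau>) \<xi>) \<xi>" if "a \<in> elems A" for a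
        using \<phi>[OF that] by (simp add: vector_functional_def integrated_form_def)
      have "?\<psi> \<in> dual A" by (rule difference_dual[OF elim(1) v \<rho>z \<xi>v \<psi>])
      moreover have "cmod (?\<psi> a) < \<epsilon>" if a: "a \<in> F" for a
        using bspec[OF bspec[OF d \<eta>] a] \<psi>[OF subsetD[OF F(2) a]] by (simp only: cspace_ip dist_norm)
      ultimately have "?\<psi> \<in> N" by (simp add: N)
      then show "vector_functional (integrated_form ?\<rho>) \<eta> \<in> {\<lambda>a. \<phi> a + \<psi> a | \<psi>. \<psi> \<in> N}"
        by (intro CollectI exI[of _ ?\<psi>]) auto
    qed
    then show ?case
      unfolding orthonormal_count_def
      using E(1,3) by (intro SUP_upper2[where i = E]) (simp_all add: E(2) integrated_form_def)
  qed
qed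

end

theorem theorem4p4:
  fixes act :: "'g::{topological_ab_group_add, second_countable_topology, t2_space} \<Rightarrow>
      'x::{second_countable_topology, t2_space} \<Rightarrow> 'x"
    and \<mu> :: "'g measure"
    and f0 :: "'g \<Rightarrow> real"
    and \<alpha> :: "'g set \<Rightarrow> 'g measure"
    and \<nu> :: "'g set \<Rightarrow> 'g set measure"
    and k :: nat
    and z :: 'x
    and x :: "nat \<Rightarrow> 'x"
    and W :: "'g set"
    and t :: "nat \<Rightarrow> nat \<Rightarrow> 'g"
    and \<tau>s :: "nat \<Rightarrow> 'g \<Rightarrow> complex"
    and \<tau> :: "'g \<Rightarrow> complex"
  assumes "locally_compact_space (euclidean :: 'g topology)"
    and "locally_compact_space (euclidean :: 'x topology)"
    and "continuous_action act"
    and "haar_measure euclidean (+) UNIV \<mu>"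
    and "f0 \<in> Cc" and "f0 0 = 1" and "\<And>s. 0 \<le> f0 s \<and> f0 s \<le> 1"
    and "\<And>H. H \<in> closed_subgroups \<Longrightarrow>
          haar_measure (top_of_set H) (+) H (\<alpha> H) \<and> (LINT s|\<alpha> H. f0 s) = 1"
    and "\<And>H. H \<in> closed_subgroups \<Longrightarrow>
          haar_measure (coset_topology H) (+o) UNIV (\<nu> H) \<and> weil_formula \<mu> (\<alpha> H) (\<nu> H)"
    and "0 < k"
    and "limitin fell_topology (\<lambda>n. stabilizer act (x n)) (stabilizer act z) sequentially"
    and "compact W" and "uminus ` W = W" and "0 \<in> interior W"
    and "\<And>j. 1 \<le> j \<and> j \<le> k \<Longrightarrow> (\<lambda>n. act (t j n) (x n)) \<longlonglongrightarrow> z"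
    and "\<exists>N. \<forall>n\<ge>N. \<forall>i j. 1 \<le> i \<and> i < j \<and> j \<le> k \<longrightarrow>
          (W + {t j n} + stabilizer act (x n)) \<inter> (W + {t i n} + stabilizer act (x n)) = {}"
    and "emeasure \<mu> ((W + stabilizer act z) - (interior W + stabilizer act z)) = 0"
    and "\<And>n. \<tau>s n \<in> characters" and "\<tau> \<in> characters"
    and "limitin (spectrum_topology (crossed_product act \<mu>))
          (\<lambda>n. rep_class (crossed_product act \<mu>) (Ind act \<nu> (x n) (\<tau>s n)))
          (rep_class (crossed_product act \<mu>) (Ind act \<nu> z \<tau>)) sequentially"
  shows "enat k \<le> lower_multiplicity (crossed_product act \<mu>) (Ind act \<nu> z \<tau>)
           (\<lambda>n. Ind act \<nu> (x n) (\<tau>s n)) sequentially"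
proof -
  let ?A = "crossed_product act \<mu> :: (('g, 'x, ('g set \<Rightarrow> complex) set) covariant_pair \<Rightarrow>
      ('g set \<Rightarrow> complex) set \<Rightarrow> ('g set \<Rightarrow> complex) set) cstar"
  let ?ip = "\<lambda>x \<tau>. induced_pair act (\<nu> (stabilizer act x)) x \<tau>"
  interpret transformation_group act \<mu> by unfold_locales (rule assms)+
  interpret induced_system act \<mu> f0 \<alpha> \<nu> by unfold_locales (use assms in blast)+
  have lim: "limitin (spectrum_topology ?A) (\<lambda>n. rep_class ?A (integrated_form (?ip (x n) (\<tau>s n))))
      (rep_class ?A (integrated_form (?ip z \<tau>))) sequentially"
    using assms(20) unfolding Ind_def .
  note D = limitin_spectrumD(1,2)[OF lim]
  \<comment> \<open>Convergence puts the classes into the spectrum from some n on, and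
    \<open>covariant_of_spectrum\<close> then makes the corresponding pairs covariant.\<close>
  have \<rho>s: "eventually (\<lambda>n. ?ip (x n) (\<tau>s n) \<in> covariant_reps act) sequentially"
    using D(2) by (rule eventually_mono) (rule covariant_of_spectrum)
  interpret induced_rep act \<mu> f0 \<alpha> \<nu> z \<tau>
    by unfold_locales (rule assms(19), rule covariant_of_spectrum[OF D(1)])
  interpret induced_sequence act \<mu> f0 \<alpha> \<nu> z \<tau> x \<tau>s
    by unfold_locales (rule assms(11), rule assms(18), rule lim, rule \<rho>s)
  obtain N where N: "\<And>n i j. N \<le> n \<Longrightarrow> 1 \<le> i \<Longrightarrow> i < j \<Longrightarrow> j \<le> k \<Longrightarrow>
      (W + {t j n} + stabilizer act (x n)) \<inter> (W + {t i n} + stabilizer act (x n)) = {}"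
    using assms(16) by metis
  have disj: "eventually (\<lambda>n. (W + {t i n} + stabilizer act (x n)) \<inter> (W + {t j n} + stabilizer act (x n)) = {}) sequentially"
    if "i \<in> {1..k}" "j \<in> {1..k}" "i \<noteq> j" for i j
    using eventually_ge_at_top[of N]
  proof eventually_elim
    case (elim n)
    show ?case
    proof (cases "i < j")
      case True
      then show ?thesis using N[OF elim, of i j] that by (subst Int_commute) simp
    next
      case False
      then show ?thesis using N[OF elim, of j i] that by simp
    qed
  qed
  have "enat (card {1..k}) \<le> lower_multiplicity ?A (integrated_form (?ip z \<tau>))
      (\<lambda>n. integrated_form (?ip (x n) (\<tau>s n))) sequentially"
    by (rule lower_multiplicity_ge[OF _ assms(14) _ disj]) (use assms(15) in auto)
  then show ?thesis by (simp add: Ind_def)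
qed

end
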